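(* In the setting described in the context, suppose that $$h\le \frac{\cos^2(\frac{3\pi}{8})}{2c_1}\,\epsilon,\qquad \tau\le\frac{\cos^2(\frac{3\pi}{8})}{2c_2}\,\epsilon .$$ Then there exist $\gamma_1>0$ and $0<\tau_1\le\tau_0$ such that $$\max_{m=1,\ldots,M}\frac{2}{\epsilon\pi}\int_\Omega (u_h^m)^2\rho^m|\nabla\phi^m| + \sum_{m=1}^M\tau_m\frac{2}{\epsilon\pi}\int_\Omega|\nabla u_h^m|^2\rho^m|\nabla\phi^m| \le C\Big(\int_{\Gamma(0)}(u_0)^2+\sum_{m=1}^M\tau_m\int_{\Gamma(t_m)}(f^m)^2\Big),$$ provided that $\gamma\ge\gamma_1$ and $\tau\le\min(\tau_1,\epsilon^2)$. Here $C$ is a constant independent of $\epsilon$, $h$, the time partition, $u_0$ and $f$.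
   Context: Surfaces. Let $n\in\{1,2\}$, $T>0$. For $t\in[0,T]$ let $\Gamma(t)\subset\mathbb{R}^{n+1}$ be a connected, compact, orientable hypersurface without boundary, and $S_T=\bigcup_{t\in(0,T)}(\Gamma(t)\times\{t\})$. A velocity field $v:\overline{S_T}\to\mathbb{R}^{n+1}$ is prescribed, $v=V\nu+v_\tau$ with $(v_\tau,\nu)=0$, where $\nu$ is a unit normal and $V$ the corresponding normal velocity of $\Gamma(t)$. There is a smooth map $\Phi:\Gamma(0)\times[0,T]\to\mathbb{R}^{n+1}$ with $\Phi(\cdot,t)$ a diffeomorphism from $\Gamma(0)$ onto $\Gamma(t)$ for every $t$, $\partial_t\Phi(P,t)=v(\Phi(P,t),t)$ and $\Phi(P,0)=P$. The material derivative is $\partial_t^\bullet\eta(\Phi(P,t),t)=\frac{d}{dt}[\eta(\Phi(P,t),t)]$; $\nabla_\Gamma$ is the tangential gradient and $\Delta_\Gamma$ the Laplace–Beltrami operator on $\Gamma(t)$. Level set function. $\Omega\subset\mathbb{R}^{n+1}$ is a bounded polyhedral domain with $\Gamma(t)\subset\Omega$ for all $t$, and $\phi:\Omega\times[0,T]\to\mathbb{R}$ is smooth with $\Gamma(t)=\{x\in\Omega:\phi(x,t)=0\}$ and $\nabla\phi(x,t)\ne0$ on $\Gamma(t)$. For $r>0$ put $U_r(t)=\{x\in\Omega:|\phi(x,t)|<r\}$, $\mathcal U_{r,T}=\bigcup_{t\in[0,T]}(U_r(t)\times\{t\})$. Constants $\delta_0>0$, $0<c_0\le c_1$, $c_2>0$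 are fixed with $\overline{U_{\delta_0}(t)}\subset\Omega$ for all $t$ and $c_0\le|\nabla\phi|\le c_1$, $|D^2\phi|,|\phi_t|,|\phi_{tt}|\le c_2$ on $\mathcal U_{\delta_0,T}$. Extension. For $P\in\Gamma(0)$, $t\in[0,T]$ let $\gamma_{P,t}$ solve $\gamma_{P,t}'(s)=\nabla\phi(\gamma_{P,t}(s),t)/|\nabla\phi(\gamma_{P,t}(s),t)|^2$, $\gamma_{P,t}(0)=\Phi(P,t)$. A number $0<\delta<\delta_0$ is fixed such that $\gamma_{P,t}$ exists uniquely on $(-\delta,\delta)$ for all $P,t$ and $F_t(P,s):=\gamma_{P,t}(s)$ is, for every $t$, a diffeomorphism of $\Gamma(0)\times(-\delta,\delta)$ onto $U_\delta(t)$; its inverse is $F_t^{-1}(x)=(p(x,t),\phi(x,t))$. Put $\tilde p(x,t)=\Phi(p(x,t),t)\in\Gamma(t)$, and extend $z:\overline{S_T}\to\mathbb{R}$ by $z^e(x,t)=z(\tilde p(x,t),t)$, $(x,t)\in\mathcal U_{\delta,T}$ (componentwise for vector fields). On $\mathcal U_{\delta,T}$ set $\nu=\nabla\phi/|\nabla\phi|$, $V=-\phi_t/|\nabla\phi|$ (orientation chosen so that these extend the unit normal and normal velocity), and extend the velocity by $v=V\nu+(I-\nu\otimes\nu)v_\tau^e$. Phase field functions. $g(r)=\cos^2 r$ for $|r|\le\pi/2$, $g(r)=0$ for $|r|>\pi/2$; $\rho(x,t)=g(\phi(x,t)/\epsilon)$, $\tilde\rho(x,t)=g(\phi(x,t)/(2\epsilon))$,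 where $0<\epsilon<\delta/\pi$. Discretization. $0=t_0<\dots<t_M=T$, $\tau_m=t_m-t_{m-1}$, $\tau=\max_m\tau_m$; $f^m(x)=f(x,t_m)$ for any function $f(x,t)$. $(\mathcal T_h)_{0<h\le h_0}$ is a family of triangulations of $\Omega$, $h=\max_{T\in\mathcal T_h}h_T$, $h_T=\mathrm{diam}(T)$, regular: there is $\sigma>0$ with $r_T\ge\sigma h_T$ for all $T\in\mathcal T_h$, $0<h\le h_0$, $r_T$ being the radius of the largest ball contained in $T$. $\mathcal N_h$ is the set of vertices. For $0\le m\le M$: $\mathcal T_h^m=\{T\in\mathcal T_h:\tilde\rho^m(x)>0\text{ for some }x\in T\cap\mathcal N_h\}$, $D_h^m=\bigcup_{T\in\mathcal T_h^m}T$, $V_h^m=\{v_h\in C^0(D_h^m): v_h|_T\text{ is a linear polynomial on each }T\in\mathcal T_h^m\}$, and $I_h^m:C^0(D_h^m)\to V_h^m$ is Lagrange interpolation at the vertices. Scheme. $f$ and $u_0$ are the given data of the surface PDE $\partial_t^\bullet u+u\nabla_\Gamma\cdot v-\Delta_\Gamma u=f$ on $S_T$, $u(\cdot,0)=u_0$ on $\Gamma(0)$. With $u_0^e(x)=u_0(\tilde p(x,0))$ and $f^{e,m}(x)=f(\tilde p(x,t_m),t_m)$, $u_h^0\in V_h^0$ is defined by $\int_{D_h^0}u_h^0v_h=\int_{D_h^0}u_0^ev_h$ for all $v_h\in V_h^0$, and for $m=1,\dots,M$, $u_h^m\in V_h^m$ satisfies for all $v_h\in V_h^m$ $$\int_\Omega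 u_h^mv_h\rho^m|\nabla\phi^m|-\int_\Omega u_h^{m-1}v_h\rho^{m-1}|\nabla\phi^{m-1}|+\tau_m\int_\Omega(\nabla u_h^m,\nabla v_h)\rho^m|\nabla\phi^m|-\tau_m\int_\Omega u_h^m(v^m,\nabla v_h)\rho^m|\nabla\phi^m|+\gamma\tau_m^2\int_\Omega I_h^m\tilde\rho^m(\nabla u_h^m,\nabla v_h)=\tau_m\int_\Omega f^{e,m}v_h\rho^m|\nabla\phi^m|,$$ where $\gamma>0$ is a parameter (the integrals are in effect taken only over $D_h^m$). The constant $\tau_0>0$ is the one from the existence result for the scheme: for sufficiently small $h$, the scheme has a unique solution whenever $0<\tau\le\tau_0$. *)

theory Defs
  imports "HOL-Analysis.Analysis"
begin

section \<open>Differential calculus and smooth maps\<close>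

definition grad :: "('a::euclidean_space \<Rightarrow> real) \<Rightarrow> 'a \<Rightarrow> 'a" where
  "grad f x = (\<Sum>b\<in>Basis. frechet_derivative f (at x) b *\<^sub>R b)"

definition hessian :: "('a::euclidean_space \<Rightarrow> real) \<Rightarrow> 'a \<Rightarrow> 'a \<Rightarrow> 'a" where
  "hessian f x = frechet_derivative (grad f) (at x)"

text \<open>Time derivative on the closed interval \<open>[0,T]\<close>, one-sided at the end points.\<close>

definition time_deriv :: "real \<Rightarrow> ('a \<Rightarrow> real \<Rightarrow> real) \<Rightarrow> 'a \<Rightarrow> real \<Rightarrow> real" where
  "time_deriv T f x t = vector_derivative (\<lambda>s. f x s) (at t within {0..T})"

text \<open>\<open>k\<close> times continuously differentiable on an open set.\<close>

primrec Ck_on ::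
    "nat \<Rightarrow> 'a::real_normed_vector set \<Rightarrow> ('a \<Rightarrow> 'b::real_normed_vector) \<Rightarrow> bool" where
  "Ck_on 0 U f \<longleftrightarrow> continuous_on U f"
| "Ck_on (Suc k) U f \<longleftrightarrow> (\<forall>x\<in>U. f differentiable (at x)) \<and>
     (\<forall>w. Ck_on k U (\<lambda>x. frechet_derivative f (at x) w))"

text \<open>On an arbitrary subset of a Euclidean space (a hypersurface, a space-time cylinder including
  its end times, ...) smooth means: locally the restriction of a \<open>C\<^sup>\<infinity>\<close> map on an open set.\<close>

definition smooth_on ::
    "'a::real_normed_vector set \<Rightarrow> ('a \<Rightarrow> 'b::real_normed_vector) \<Rightarrow> bool" where
  "smooth_on S f \<longleftrightarrow> (\<forall>x\<in>S. \<exists>U g. open U \<and> x \<in> U \<and> (\<forall>k. Ck_on k U g) \<and> (\<forall>y\<in>S \<inter> U. g y = f y))"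

definition diffeomorphism_between ::
    "'a::real_normed_vector set \<Rightarrow> 'b::real_normed_vector set \<Rightarrow> ('a \<Rightarrow> 'b) \<Rightarrow> bool" where
  "diffeomorphism_between A B f \<longleftrightarrow>
     bij_betw f A B \<and> smooth_on A f \<and> smooth_on B (inv_into A f)"

section \<open>Hypersurfaces and surface measure\<close>

text \<open>A smooth embedded hypersurface without boundary: locally a regular level set.\<close>

definition smooth_hypersurface :: "'a::euclidean_space set \<Rightarrow> bool" where
  "smooth_hypersurface S \<longleftrightarrow> (\<forall>x\<in>S. \<exists>U \<psi>. open U \<and> x \<in> U \<and> smooth_on U (\<psi> :: 'a \<Rightarrow> real) \<and>
     (\<forall>y\<in>U. grad \<psi> y \<noteq> 0) \<and> S \<inter> U = {y \<in> U. \<psi> y = 0})"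

definition tangent_space :: "'a::real_normed_vector set \<Rightarrow> 'a \<Rightarrow> 'a set" where
  "tangent_space S x = {w. \<exists>c e. 0 < e \<and> c (0::real) = x \<and> (\<forall>s\<in>{-e<..<e}. c s \<in> S) \<and>
     (c has_vector_derivative w) (at 0)}"

definition orientable_hypersurface :: "'a::euclidean_space set \<Rightarrow> bool" where
  "orientable_hypersurface S \<longleftrightarrow>
     (\<exists>N. continuous_on S N \<and> (\<forall>x\<in>S. norm (N x) = 1 \<and> (\<forall>w\<in>tangent_space S x. N x \<bullet> w = 0)))"

text \<open>The \<open>n\<close>-dimensional Hausdorff measure (for \<open>n \<ge> 1\<close>), normalised so that it is the usual
  surface measure on \<open>n\<close>-dimensional hypersurfaces.  The covering sets have to be required
  bounded, because \<^const>\<open>diameter\<close> is unspecified on unbounded sets.\<close>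

definition hausdorff_outer :: "nat \<Rightarrow> 'a::metric_space set \<Rightarrow> ennreal" where
  "hausdorff_outer n A = (SUP d\<in>{0<..}.
     INF C\<in>{C :: nat \<Rightarrow> 'a set. A \<subseteq> (\<Union>i. C i) \<and> (\<forall>i. bounded (C i) \<and> diameter (C i) \<le> d)}.
       (\<Sum>i. ennreal (unit_ball_vol (real n) * (diameter (C i) / 2) ^ n)))"

definition hausdorff_measure :: "nat \<Rightarrow> 'a::metric_space measure" where
  "hausdorff_measure n = measure_of UNIV (sets borel) (hausdorff_outer n)"

definition square_integrable_on :: "'a measure \<Rightarrow> 'a set \<Rightarrow> ('a \<Rightarrow> real) \<Rightarrow> bool" where
  "square_integrable_on M A f \<longleftrightarrow> set_borel_measurable M A f \<and> set_integrable M A (\<lambda>x. (f x)\<^sup>2)"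

section \<open>The moving surface and its level set description\<close>

definition polyhedral_domain :: "'a::euclidean_space set \<Rightarrow> bool" where
  "polyhedral_domain \<Omega> \<longleftrightarrow> \<Omega> \<noteq> {} \<and> open \<Omega> \<and> bounded \<Omega> \<and> connected \<Omega> \<and> interior (closure \<Omega>) = \<Omega> \<and>
     (\<exists>\<P>. finite \<P> \<and> (\<forall>P\<in>\<P>. polytope P) \<and> closure \<Omega> = \<Union>\<P>)"

text \<open>\<open>U\<^sub>r(t)\<close>\<close>

definition strip :: "'a set \<Rightarrow> ('a \<Rightarrow> real \<Rightarrow> real) \<Rightarrow> real \<Rightarrow> real \<Rightarrow> 'a set" where
  "strip \<Omega> \<phi> r t = {x\<in>\<Omega>. \<bar>\<phi> x t\<bar> < r}"

definition unit_normal :: "('a::euclidean_space \<Rightarrow> real \<Rightarrow> real) \<Rightarrow> 'a \<Rightarrow> real \<Rightarrow> 'a" where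
  "unit_normal \<phi> x t = grad (\<lambda>y. \<phi> y t) x /\<^sub>R norm (grad (\<lambda>y. \<phi> y t) x)"

definition normal_velocity :: "real \<Rightarrow> ('a::euclidean_space \<Rightarrow> real \<Rightarrow> real) \<Rightarrow> 'a \<Rightarrow> real \<Rightarrow> real" where
  "normal_velocity T \<phi> x t = - time_deriv T \<phi> x t / norm (grad (\<lambda>y. \<phi> y t) x)"

text \<open>\<open>y\<close> solves \<open>y' = \<nabla>\<phi>(y,t) / |\<nabla>\<phi>(y,t)|\<^sup>2\<close>, \<open>y(0) = x\<^sub>0\<close> on \<open>(-\<delta>,\<delta>)\<close>; the right-hand side has
  to be defined along \<open>y\<close>.\<close>

definition gradient_curve ::
    "'a::euclidean_space set \<Rightarrow> ('a \<Rightarrow> real \<Rightarrow> real) \<Rightarrow> real \<Rightarrow> real \<Rightarrow> 'a \<Rightarrow> (real \<Rightarrow> 'a) \<Rightarrow> bool" where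
  "gradient_curve \<Omega> \<phi> \<delta> t x0 y \<longleftrightarrow> y 0 = x0 \<and>
     (\<forall>s\<in>{-\<delta><..<\<delta>}. y s \<in> \<Omega> \<and> grad (\<lambda>z. \<phi> z t) (y s) \<noteq> 0 \<and>
        (y has_vector_derivative
           grad (\<lambda>z. \<phi> z t) (y s) /\<^sub>R (norm (grad (\<lambda>z. \<phi> z t) (y s)))\<^sup>2) (at s))"

text \<open>\<open>flow P t s\<close> is \<open>\<gamma>\<^sub>P\<^sub>,\<^sub>t(s)\<close>; the velocity \<open>v\<close> only matters at points of \<open>\<Gamma>(t)\<close>, \<open>0 \<le> t \<le> T\<close>.\<close>

locale moving_surface =
  fixes n :: nat and T :: real
    and \<Gamma> :: "real \<Rightarrow> 'a::euclidean_space set"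
    and v :: "'a \<Rightarrow> real \<Rightarrow> 'a"
    and \<Phi> :: "'a \<Rightarrow> real \<Rightarrow> 'a"
    and \<Omega> :: "'a set"
    and \<phi> :: "'a \<Rightarrow> real \<Rightarrow> real"
    and \<delta>0 c0 c1 c2 \<delta> :: real
    and flow :: "'a \<Rightarrow> real \<Rightarrow> real \<Rightarrow> 'a"
  assumes dim: "n \<in> {1, 2}" "DIM('a) = n + 1"
    and T_pos: "0 < T"
    and surface: "\<And>t. t \<in> {0..T} \<Longrightarrow> \<Gamma> t \<noteq> {} \<and> connected (\<Gamma> t) \<and> compact (\<Gamma> t) \<and>
          smooth_hypersurface (\<Gamma> t) \<and> orientable_hypersurface (\<Gamma> t)"
    and Phi_smooth: "smooth_on (\<Gamma> 0 \<times> {0..T}) (\<lambda>(P, t). \<Phi> P t)"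
    and Phi_diffeo: "\<And>t. t \<in> {0..T} \<Longrightarrow> diffeomorphism_between (\<Gamma> 0) (\<Gamma> t) (\<lambda>P. \<Phi> P t)"
    and Phi_deriv: "\<And>P t. P \<in> \<Gamma> 0 \<Longrightarrow> t \<in> {0..T} \<Longrightarrow>
          ((\<lambda>s. \<Phi> P s) has_vector_derivative v (\<Phi> P t) t) (at t within {0..T})"
    and Phi_0: "\<And>P. P \<in> \<Gamma> 0 \<Longrightarrow> \<Phi> P 0 = P"
    and domain: "polyhedral_domain \<Omega>"
    and surface_sub: "\<And>t. t \<in> {0..T} \<Longrightarrow> \<Gamma> t \<subseteq> \<Omega>"
    and phi_smooth: "smooth_on (\<Omega> \<times> {0..T}) (\<lambda>(x, t). \<phi> x t)"
    and surface_eq: "\<And>t. t \<in> {0..T} \<Longrightarrow> \<Gamma> t = {x\<in>\<Omega>. \<phi> x t = 0}"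
    and phi_regular: "\<And>x t. t \<in> {0..T} \<Longrightarrow> x \<in> \<Gamma> t \<Longrightarrow> grad (\<lambda>y. \<phi> y t) x \<noteq> 0"
    and constants: "0 < \<delta>0" "0 < c0" "c0 \<le> c1" "0 < c2"
    and strip_sub: "\<And>t. t \<in> {0..T} \<Longrightarrow> closure (strip \<Omega> \<phi> \<delta>0 t) \<subseteq> \<Omega>"
    and phi_bounds: "\<And>x t. t \<in> {0..T} \<Longrightarrow> x \<in> strip \<Omega> \<phi> \<delta>0 t \<Longrightarrow>
          c0 \<le> norm (grad (\<lambda>y. \<phi> y t) x) \<and> norm (grad (\<lambda>y. \<phi> y t) x) \<le> c1 \<and>
          onorm (hessian (\<lambda>y. \<phi> y t) x) \<le> c2 \<and>
          \<bar>time_deriv T \<phi> x t\<bar> \<le> c2 \<and> \<bar>time_deriv T (time_deriv T \<phi>) x t\<bar> \<le> c2"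
    and delta: "0 < \<delta>" "\<delta> < \<delta>0"
    and flow: "\<And>P t. P \<in> \<Gamma> 0 \<Longrightarrow> t \<in> {0..T} \<Longrightarrow> gradient_curve \<Omega> \<phi> \<delta> t (\<Phi> P t) (flow P t)"
    and flow_unique: "\<And>P t y s. P \<in> \<Gamma> 0 \<Longrightarrow> t \<in> {0..T} \<Longrightarrow>
          gradient_curve \<Omega> \<phi> \<delta> t (\<Phi> P t) y \<Longrightarrow> s \<in> {-\<delta><..<\<delta>} \<Longrightarrow> y s = flow P t s"
    and flow_diffeo: "\<And>t. t \<in> {0..T} \<Longrightarrow>
          diffeomorphism_between (\<Gamma> 0 \<times> {-\<delta><..<\<delta>}) (strip \<Omega> \<phi> \<delta> t) (\<lambda>(P, s). flow P t s)"

text \<open>\<open>p(x,t)\<close>, the first component of \<open>F\<^sub>t\<close> inverted, for \<open>x \<in> U\<^sub>\<delta>(t)\<close>.\<close>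

definition base_point ::
    "'a set \<Rightarrow> real \<Rightarrow> ('a \<Rightarrow> real \<Rightarrow> real \<Rightarrow> 'a) \<Rightarrow> 'a \<Rightarrow> real \<Rightarrow> 'a" where
  "base_point \<Gamma>0 \<delta> flow x t = fst (inv_into (\<Gamma>0 \<times> {-\<delta><..<\<delta>}) (\<lambda>(P, s). flow P t s) x)"

text \<open>The extension \<open>z\<^sup>e(x,t) = z(\<Phi>(p(x,t),t),t)\<close> on \<open>U\<^sub>\<delta>(t)\<close>, continued by zero.\<close>

definition extend ::
    "(real \<Rightarrow> 'a set) \<Rightarrow> ('a \<Rightarrow> real \<Rightarrow> 'a) \<Rightarrow> 'a set \<Rightarrow> ('a \<Rightarrow> real \<Rightarrow> real) \<Rightarrow> real \<Rightarrow>
     ('a \<Rightarrow> real \<Rightarrow> real \<Rightarrow> 'a) \<Rightarrow> ('a \<Rightarrow> real \<Rightarrow> 'b::zero) \<Rightarrow> 'a \<Rightarrow> real \<Rightarrow> 'b" where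
  "extend \<Gamma> \<Phi> \<Omega> \<phi> \<delta> flow z x t =
     (if x \<in> strip \<Omega> \<phi> \<delta> t then z (\<Phi> (base_point (\<Gamma> 0) \<delta> flow x t) t) t else 0)"

definition tangential_velocity ::
    "('a::euclidean_space \<Rightarrow> real \<Rightarrow> real) \<Rightarrow> ('a \<Rightarrow> real \<Rightarrow> 'a) \<Rightarrow> 'a \<Rightarrow> real \<Rightarrow> 'a" where
  "tangential_velocity \<phi> v x t = v x t - (v x t \<bullet> unit_normal \<phi> x t) *\<^sub>R unit_normal \<phi> x t"

text \<open>\<open>V \<nu> + (I - \<nu> \<otimes> \<nu>) v\<^sub>\<tau>\<^sup>e\<close>\<close>

definition extended_velocity ::
    "real \<Rightarrow> (real \<Rightarrow> 'a::euclidean_space set) \<Rightarrow> ('a \<Rightarrow> real \<Rightarrow> 'a) \<Rightarrow> 'a set \<Rightarrow>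
     ('a \<Rightarrow> real \<Rightarrow> real) \<Rightarrow> real \<Rightarrow> ('a \<Rightarrow> real \<Rightarrow> real \<Rightarrow> 'a) \<Rightarrow> ('a \<Rightarrow> real \<Rightarrow> 'a) \<Rightarrow> 'a \<Rightarrow> real \<Rightarrow> 'a" where
  "extended_velocity T \<Gamma> \<Phi> \<Omega> \<phi> \<delta> flow v x t =
     (let \<nu> = unit_normal \<phi> x t;
          w = extend \<Gamma> \<Phi> \<Omega> \<phi> \<delta> flow (tangential_velocity \<phi> v) x t
      in normal_velocity T \<phi> x t *\<^sub>R \<nu> + (w - (\<nu> \<bullet> w) *\<^sub>R \<nu>))"

section \<open>Phase field functions\<close>

definition profile :: "real \<Rightarrow> real" where
  "profile r = (if \<bar>r\<bar> \<le> pi / 2 then (cos r)\<^sup>2 else 0)"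

text \<open>\<open>\<phi>\<close> is given on \<open>\<Omega>\<close> only, while mesh vertices may lie on the boundary of \<open>\<Omega>\<close>.  There the phase
  field functions are zero, their continuous continuation when \<open>\<epsilon> < \<delta> / \<pi>\<close>.\<close>

definition rho :: "'a set \<Rightarrow> ('a \<Rightarrow> real \<Rightarrow> real) \<Rightarrow> real \<Rightarrow> 'a \<Rightarrow> real \<Rightarrow> real" where
  "rho \<Omega> \<phi> \<epsilon> x t = (if x \<in> \<Omega> then profile (\<phi> x t / \<epsilon>) else 0)"

definition rho_tilde :: "'a set \<Rightarrow> ('a \<Rightarrow> real \<Rightarrow> real) \<Rightarrow> real \<Rightarrow> 'a \<Rightarrow> real \<Rightarrow> real" where
  "rho_tilde \<Omega> \<phi> \<epsilon> x t = (if x \<in> \<Omega> then profile (\<phi> x t / (2 * \<epsilon>)) else 0)"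

text \<open>\<open>\<integral>\<^sub>\<Omega> g \<rho>(\<cdot>,t) |\<nabla>\<phi>(\<cdot>,t)|\<close>\<close>

definition diffuse_integral ::
    "'a::euclidean_space set \<Rightarrow> ('a \<Rightarrow> real \<Rightarrow> real) \<Rightarrow> real \<Rightarrow> real \<Rightarrow> ('a \<Rightarrow> real) \<Rightarrow> real" where
  "diffuse_integral \<Omega> \<phi> \<epsilon> t g =
     (LINT x:\<Omega>|lebesgue. g x * rho \<Omega> \<phi> \<epsilon> x t * norm (grad (\<lambda>y. \<phi> y t) x))"

section \<open>Triangulations and finite elements\<close>

definition inradius :: "'a::metric_space set \<Rightarrow> real" where
  "inradius K = Sup {r. 0 < r \<and> (\<exists>x. ball x r \<subseteq> K)}"

definition vertices :: "'a::real_vector set set \<Rightarrow> 'a set" where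
  "vertices \<T> = {x. \<exists>K\<in>\<T>. x extreme_point_of K}"

text \<open>The family is indexed by its mesh size; \<open>H\<close> is the set of mesh sizes that occur.\<close>

definition regular_triangulations ::
    "'a::euclidean_space set \<Rightarrow> real \<Rightarrow> real set \<Rightarrow> (real \<Rightarrow> 'a set set) \<Rightarrow> bool" where
  "regular_triangulations \<Omega> h0 H \<T> \<longleftrightarrow> 0 < h0 \<and> H \<subseteq> {0<..h0} \<and>
     (\<forall>h\<in>H. triangulation (\<T> h) \<and> (\<forall>K\<in>\<T> h. int DIM('a) simplex K) \<and> \<Union>(\<T> h) = closure \<Omega> \<and>
        Max (diameter ` \<T> h) = h) \<and>
     (\<exists>\<sigma>>0. \<forall>h\<in>H. \<forall>K\<in>\<T> h. \<sigma> * diameter K \<le> inradius K)"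

text \<open>\<open>\<T>\<^sub>h\<^sup>m\<close>, \<open>D\<^sub>h\<^sup>m\<close>, \<open>V\<^sub>h\<^sup>m\<close>, \<open>I\<^sub>h\<^sup>m\<close>, with \<open>t = t\<^sub>m\<close>.  Finite element functions are total functions
  with arbitrary values outside \<open>D\<^sub>h\<^sup>m\<close>; interpolants are zero there.\<close>

definition strip_mesh ::
    "'a::euclidean_space set \<Rightarrow> ('a \<Rightarrow> real \<Rightarrow> real) \<Rightarrow> 'a set set \<Rightarrow> real \<Rightarrow> real \<Rightarrow> 'a set set" where
  "strip_mesh \<Omega> \<phi> \<T> \<epsilon> t = {K\<in>\<T>. \<exists>x\<in>K \<inter> vertices \<T>. 0 < rho_tilde \<Omega> \<phi> \<epsilon> x t}"

definition strip_domain ::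
    "'a::euclidean_space set \<Rightarrow> ('a \<Rightarrow> real \<Rightarrow> real) \<Rightarrow> 'a set set \<Rightarrow> real \<Rightarrow> real \<Rightarrow> 'a set" where
  "strip_domain \<Omega> \<phi> \<T> \<epsilon> t = \<Union>(strip_mesh \<Omega> \<phi> \<T> \<epsilon> t)"

definition fe_space ::
    "'a::euclidean_space set \<Rightarrow> ('a \<Rightarrow> real \<Rightarrow> real) \<Rightarrow> 'a set set \<Rightarrow> real \<Rightarrow> real \<Rightarrow> ('a \<Rightarrow> real) set" where
  "fe_space \<Omega> \<phi> \<T> \<epsilon> t = {w. continuous_on (strip_domain \<Omega> \<phi> \<T> \<epsilon> t) w \<and>
     (\<forall>K\<in>strip_mesh \<Omega> \<phi> \<T> \<epsilon> t. \<exists>a b. \<forall>x\<in>K. w x = a + b \<bullet> x)}"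

definition lagrange_interp ::
    "'a::euclidean_space set \<Rightarrow> ('a \<Rightarrow> real \<Rightarrow> real) \<Rightarrow> 'a set set \<Rightarrow> real \<Rightarrow> real \<Rightarrow>
     ('a \<Rightarrow> real) \<Rightarrow> 'a \<Rightarrow> real" where
  "lagrange_interp \<Omega> \<phi> \<T> \<epsilon> t g = (THE w. w \<in> fe_space \<Omega> \<phi> \<T> \<epsilon> t \<and>
     (\<forall>x\<in>strip_domain \<Omega> \<phi> \<T> \<epsilon> t \<inter> vertices \<T>. w x = g x) \<and>
     (\<forall>x. x \<notin> strip_domain \<Omega> \<phi> \<T> \<epsilon> t \<longrightarrow> w x = 0))"

section \<open>The scheme\<close>

definition time_partition :: "real \<Rightarrow> nat \<Rightarrow> (nat \<Rightarrow> real) \<Rightarrow> bool" where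
  "time_partition T M t \<longleftrightarrow> t 0 = 0 \<and> t M = T \<and> (\<forall>m<M. t m < t (Suc m))"

definition time_step :: "(nat \<Rightarrow> real) \<Rightarrow> nat \<Rightarrow> real" where
  "time_step t m = t m - t (m - 1)"

definition max_time_step :: "nat \<Rightarrow> (nat \<Rightarrow> real) \<Rightarrow> real" where
  "max_time_step M t = Max (time_step t ` {1..M})"

text \<open>\<open>ve\<close>, \<open>u0e\<close>, \<open>fe\<close> are the extended velocity, initial datum and right-hand side.  The gradient
  of a finite element function is taken pointwise; it exists in the interior of every mesh element
  and its values on the null set of element boundaries do not affect Lebesgue integrals.\<close>

definition scheme_solution ::
    "'a::euclidean_space set \<Rightarrow> ('a \<Rightarrow> real \<Rightarrow> real) \<Rightarrow> ('a \<Rightarrow> real \<Rightarrow> 'a) \<Rightarrow> ('a \<Rightarrow> real) \<Rightarrow>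
     ('a \<Rightarrow> real \<Rightarrow> real) \<Rightarrow> 'a set set \<Rightarrow> real \<Rightarrow> real \<Rightarrow> nat \<Rightarrow> (nat \<Rightarrow> real) \<Rightarrow>
     (nat \<Rightarrow> 'a \<Rightarrow> real) \<Rightarrow> bool" where
  "scheme_solution \<Omega> \<phi> ve u0e fe \<T> \<epsilon> \<gamma> M t u \<longleftrightarrow>
     (\<forall>m\<le>M. u m \<in> fe_space \<Omega> \<phi> \<T> \<epsilon> (t m)) \<and>
     (\<forall>w\<in>fe_space \<Omega> \<phi> \<T> \<epsilon> (t 0).
        (LINT x:strip_domain \<Omega> \<phi> \<T> \<epsilon> (t 0)|lebesgue. u 0 x * w x) =
        (LINT x:strip_domain \<Omega> \<phi> \<T> \<epsilon> (t 0)|lebesgue. u0e x * w x)) \<and>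
     (\<forall>m\<in>{1..M}. \<forall>w\<in>fe_space \<Omega> \<phi> \<T> \<epsilon> (t m).
        diffuse_integral \<Omega> \<phi> \<epsilon> (t m) (\<lambda>x. u m x * w x)
        - diffuse_integral \<Omega> \<phi> \<epsilon> (t (m - 1)) (\<lambda>x. u (m - 1) x * w x)
        + time_step t m * diffuse_integral \<Omega> \<phi> \<epsilon> (t m) (\<lambda>x. grad (u m) x \<bullet> grad w x)
        - time_step t m * diffuse_integral \<Omega> \<phi> \<epsilon> (t m) (\<lambda>x. u m x * (ve x (t m) \<bullet> grad w x))
        + \<gamma> * (time_step t m)\<^sup>2 *
            (LINT x:\<Omega>|lebesgue.
               lagrange_interp \<Omega> \<phi> \<T> \<epsilon> (t m) (\<lambda>y. rho_tilde \<Omega> \<phi> \<epsilon> y (t m)) x *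
               (grad (u m) x \<bullet> grad w x))
        = time_step t m * diffuse_integral \<Omega> \<phi> \<epsilon> (t m) (\<lambda>x. fe x (t m) * w x))"

end

theory Submission
  imports Defs
begin

text \<open>The estimate is an energy estimate: each step of the scheme is tested with its own solution
  \<open>u\<^sup>m\<close>.  The diffusion term gives the dissipation, the velocity term is bounded by Young's inequality
  and the boundedness of the extended velocity, and a discrete Gronwall argument sums the steps
  (\<open>energy_step\<close>, \<open>discrete_gronwall\<close>).

  One term needs work.  Young's inequality turns the contribution of the previous step into
  \<open>\<integral> (u\<^sup>m)\<^sup>2 \<rho>\<^sup>m\<^sup>-\<^sup>1 |\<nabla>\<phi>\<^sup>m\<^sup>-\<^sup>1|\<close>, the new solution with the old weight, which has to be compared with the
  same integral for the new weight (\<open>weight_shift_inequality\<close>).  Since \<open>\<rho> = g(\<phi>/\<epsilon>)\<close>, the weights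
  differ to first order in \<open>\<tau>\<close> by a multiple of \<open>g'(\<phi>/\<epsilon>) \<tau>/\<epsilon>\<close>, which is not \<open>O(\<tau>)\<close> times
  the weight: \<open>1/\<epsilon>\<close> is not bounded, and \<open>g'\<close> is not bounded by \<open>g\<close>.  But \<open>g'(\<phi>/\<epsilon>)/\<epsilon>\<close> is a
  derivative of \<open>g(\<phi>/\<epsilon>)\<close> in the normal direction, so an
  integration by parts (\<open>strip_integration_by_parts\<close>) replaces it by \<open>g(\<phi>/\<epsilon>)\<close> times
  \<open>\<tau> (|u| |\<nabla>u| + u\<^sup>2)\<close>, which the dissipation and the Gronwall argument take care of.  The second order
  remainder is of size \<open>\<tau>\<^sup>2/\<epsilon>\<^sup>2 u\<^sup>2\<close> on a strip slightly wider than the support of \<open>\<rho>\<^sup>m\<close>, so that it is not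
  controlled by the weight.  Integrating by parts against a steep bump function of \<open>\<phi>/\<epsilon>\<close> gives the
  Poincare inequality \<open>strip_poincare_inequality\<close>, which bounds \<open>\<integral> u\<^sup>2\<close> on the wider strip by the
  weighted integral plus \<open>\<epsilon>\<^sup>2 \<integral> |\<nabla>u|\<^sup>2\<close>.  With \<open>\<tau> \<le> \<epsilon>\<^sup>2\<close> the first part becomes \<open>O(\<tau>)\<close> times the weighted
  integral; the second becomes \<open>\<tau>\<^sup>2 \<integral> |\<nabla>u|\<^sup>2\<close> over a strip on which the interpolated \<open>\<rho>\<close>-tilde is
  bounded below, because \<open>h\<close> is small compared with \<open>\<epsilon>\<close>, and it is absorbed by the stabilisation term
  \<open>\<gamma> \<tau>\<^sup>2\<close> when \<open>\<gamma>\<close> is large (\<open>stabilisation_coercive\<close>).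

  The right-hand side consists of integrals over the strip of functions that are constant along the
  normal flow.  An upper bound for them by integrals over the surface suffices, so the coarea formula
  is replaced by a covering argument: the set of points of the strip \<open>U\<^sub>r\<close> whose foot point lies in a
  set of diameter \<open>d\<close> is covered by about \<open>r/d\<close> balls of radius comparable to \<open>d\<close>, and thus has volume
  \<open>O(r d\<^sup>n)\<close> (\<open>tube_volume\<close>, \<open>foot_point_measure_le\<close>, \<open>extension_square_integral_le\<close>).  The factor \<open>r\<close>, which is
  \<open>O(\<epsilon>)\<close>, cancels the \<open>1/\<epsilon>\<close> in the estimate.\<close>

section \<open>Derivatives, Lipschitz maps and curves\<close>

text \<open>Used for pointwise gradients, which are limits of measurable difference quotients only almost
  everywhere.\<close>

lemma borel_measurable_lebesgue_AE_eq:
  fixes f g :: "'a::euclidean_space \<Rightarrow> 'b::topological_space"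
  assumes f: "f \<in> borel_measurable lebesgue" and eq: "AE x in lebesgue. f x = g x"
  shows "g \<in> borel_measurable lebesgue"
proof (rule measurableI)
  fix A :: "'b set" assume A: "A \<in> sets borel"
  have 1: "f -` A \<in> sets lebesgue" using measurable_sets[OF f A] by simp
  have 2: "AE x in lebesgue. x \<in> f -` A \<longleftrightarrow> x \<in> g -` A" using eq by eventually_elim simp
  have "g -` A \<inter> space lebesgue \<in> sets lebesgue"
    using completion.in_sets_AE[OF 2 1] by simp
  then show "g -` A \<inter> space lebesgue \<in> sets lebesgue" .
qed simp

text \<open>Distances under inversion in the unit sphere. The formula makes the field \<open>\<nabla>\<phi> /
  |\<nabla>\<phi>|\<^sup>2\<close> Lipschitz wherever \<open>\<nabla>\<phi>\<close> is Lipschitz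
  and bounded away from zero.\<close>

lemma norm_inversion_diff:
  fixes a b :: "'a::real_inner"
  assumes "a \<noteq> 0" "b \<noteq> 0"
  shows "norm (a /\<^sub>R (norm a)\<^sup>2 - b /\<^sub>R (norm b)\<^sup>2) = norm (a - b) / (norm a * norm b)"
proof -
  have p: "norm a > 0" "norm b > 0" using assms by auto
  define \<alpha> \<beta> where "\<alpha> = inverse ((norm a)\<^sup>2)" and "\<beta> = inverse ((norm b)\<^sup>2)"
  have ab: "\<alpha> * (a \<bullet> a) = 1" "\<beta> * (b \<bullet> b) = 1"
    using assms by (auto simp: \<alpha>_def \<beta>_def power2_norm_eq_inner)
  have "(norm (\<alpha> *\<^sub>R a - \<beta> *\<^sub>R b))\<^sup>2
      = \<alpha> * (\<alpha> * (a \<bullet> a)) - 2 * \<alpha> * \<beta> * (a \<bullet> b) + \<beta> * (\<beta> * (b \<bullet> b))"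
    unfolding power2_norm_eq_inner
    by (simp add: inner_diff_left inner_diff_right inner_commute[of b a] algebra_simps)
  also have "\<dots> = \<alpha> * (\<beta> * (b \<bullet> b)) - 2 * \<alpha> * \<beta> * (a \<bullet> b) + \<beta> * (\<alpha> * (a \<bullet> a))"
    unfolding ab by simp
  also have "\<dots> = \<alpha> * \<beta> * (norm (a - b))\<^sup>2"
    unfolding power2_norm_eq_inner
    by (simp add: inner_diff_left inner_diff_right inner_commute[of b a] algebra_simps)
  also have "\<dots> = (norm (a - b) / (norm a * norm b))\<^sup>2"
    by (simp add: \<alpha>_def \<beta>_def power_divide power_mult_distrib divide_inverse power_inverse)
  finally have "(norm (\<alpha> *\<^sub>R a - \<beta> *\<^sub>R b))\<^sup>2 = (norm (a - b) / (norm a * norm b))\<^sup>2" .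
  then show ?thesis using p unfolding \<alpha>_def \<beta>_def by (simp add: power2_eq_iff_nonneg)
qed

lemma norm_normalize_diff:
  fixes a b :: "'a::real_normed_vector"
  assumes "a \<noteq> 0" "b \<noteq> 0"
  shows "norm (a /\<^sub>R norm a - b /\<^sub>R norm b) \<le> 2 * norm (a - b) / norm a"
proof -
  have p: "norm a > 0" "norm b > 0" using assms by auto
  have e: "a /\<^sub>R norm a - b /\<^sub>R norm b = (a - b) /\<^sub>R norm a + (1 / norm a - 1 / norm b) *\<^sub>R b"
    by (simp add: algebra_simps inverse_eq_divide)
  have "norm (a /\<^sub>R norm a - b /\<^sub>R norm b)
      \<le> norm ((a - b) /\<^sub>R norm a) + norm ((1 / norm a - 1 / norm b) *\<^sub>R b)"
    unfolding e by (rule norm_triangle_ineq)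
  also have "norm ((a - b) /\<^sub>R norm a) = norm (a - b) / norm a" by (simp add: divide_inverse)
  also have "norm ((1 / norm a - 1 / norm b) *\<^sub>R b) = \<bar>norm b - norm a\<bar> / norm a"
  proof -
    have "1 / norm a - 1 / norm b = (norm b - norm a) / (norm a * norm b)"
      using p by (simp add: field_simps)
    then show ?thesis using p by (simp add: abs_mult)
  qed
  also have "\<bar>norm b - norm a\<bar> / norm a \<le> norm (a - b) / norm a"
    using p norm_triangle_ineq3[of b a] by (simp add: divide_right_mono norm_minus_commute)
  finally show ?thesis by simp
qed

text \<open>The divergence theorem in its simplest form, for functions that are only Lipschitz and almost
  everywhere differentiable. By translation invariance all difference quotients in the direction
  \<open>b\<close> have integral zero; the Lipschitz bound and the bounded support dominate them,
  and they converge almost everywhere to the derivative.\<close>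

lemma integral_frechet_derivative_eq_0:
  fixes F :: "'a::euclidean_space \<Rightarrow> real"
  assumes r: "0 < r" and L0: "0 \<le> L"
    and lip: "\<And>x y. dist x y < r \<Longrightarrow> \<bar>F x - F y\<bar> \<le> L * dist x y"
    and S: "bounded S" and zero: "\<And>x. x \<notin> S \<Longrightarrow> F x = 0"
    and diff: "AE x in lebesgue. F differentiable (at x)"
  shows "integrable lebesgue (\<lambda>x. frechet_derivative F (at x) b)"
    and "integral\<^sup>L lebesgue (\<lambda>x. frechet_derivative F (at x) b) = 0"
proof -
  obtain R0 where R0: "\<And>x. x \<in> S \<Longrightarrow> norm x \<le> R0" using S by (auto simp: bounded_iff)
  define R where "R = \<bar>R0\<bar> + r"
  \<comment> \<open>Increments \<open>h k *\<^sub>R b\<close> shorter than \<open>r\<close>, so that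
    the local Lipschitz bound applies and the difference quotients vanish outside
    the ball of radius \<open>R\<close>.\<close>
  define h where "h k = r / (2 * (1 + norm b) * (real k + 1))" for k
  have nb: "1 + norm b > 0" by (simp add: add_pos_nonneg)
  have hpos: "h k > 0" for k using r nb by (simp add: h_def)
  have hsmall: "norm (h k *\<^sub>R b) < r" for k
  proof -
    have "2 * norm b < 2 * (1 + norm b) * 1" by simp
    also have "\<dots> \<le> 2 * (1 + norm b) * (real k + 1)" using nb by (intro mult_left_mono) auto
    finally have "r * (2 * norm b) < r * (2 * (1 + norm b) * (real k + 1))" using r by simp
    moreover have "norm (h k *\<^sub>R b) = r * norm b / (2 * (1 + norm b) * (real k + 1))"
      using hpos[of k] by (simp only: norm_scaleR real_norm_def abs_of_pos) (simp add: h_def)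
    ultimately show ?thesis using nb r
      by (simp add: divide_less_eq) (smt (verit) mult_nonneg_nonneg norm_ge_zero)
  qed
  have hlim: "filterlim h (at 0) sequentially"
  proof (rule filterlim_atI)
    have "(\<lambda>k. (r / (2 * (1 + norm b))) * inverse (real (Suc k))) \<longlonglongrightarrow> (r / (2 * (1 + norm b))) * 0"
      by (intro tendsto_mult tendsto_const LIMSEQ_inverse_real_of_nat)
    then show "h \<longlonglongrightarrow> 0" by (simp add: h_def[abs_def] divide_inverse mult.assoc add.commute)
    show "\<forall>\<^sub>F k in sequentially. h k \<noteq> 0" using hpos by (simp add: less_imp_neq[symmetric])
  qed
  have cball_fin: "emeasure lborel (cball (0::'a) R) < \<infinity>"
    by (rule emeasure_bounded_finite) simp
  have contF: "continuous_on UNIV F"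
  proof (clarsimp simp: continuous_on_iff)
    fix x :: 'a and e :: real assume e: "0 < e"
    show "\<exists>d>0. \<forall>x'. dist x' x < d \<longrightarrow> dist (F x') (F x) < e"
    proof (intro exI[of _ "min r (e / (L + 1))"] conjI allI impI)
      show "0 < min r (e / (L + 1))" using r e L0 by simp
      fix x' assume d: "dist x' x < min r (e / (L + 1))"
      have "\<bar>F x' - F x\<bar> \<le> L * dist x' x" using lip d by simp
      also have "\<dots> \<le> (L + 1) * dist x' x" by (simp add: mult_right_mono)
      also have "\<dots> < e" using d L0 by (simp add: field_simps pos_less_divide_eq)
      finally show "dist (F x') (F x) < e" by (simp add: dist_real_def)
    qed
  qed
  then have Fb [measurable]: "F \<in> borel_measurable borel" by (rule borel_measurable_continuous_onI)
  obtain C where C: "\<And>x. x \<in> cball 0 R \<Longrightarrow> \<bar>F x\<bar> \<le> C"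
  proof -
    have "compact (F ` cball 0 R)"
      by (rule compact_continuous_image) (use contF in \<open>auto intro: continuous_on_subset\<close>)
    then have "bounded (F ` cball 0 R)" by (rule compact_imp_bounded)
    then obtain C where "\<forall>x\<in>F ` cball 0 R. norm x \<le> C" unfolding bounded_iff by blast
    then show ?thesis by (intro that[of C]) (force simp del: mem_cball_0)
  qed
  have intF: "integrable lborel F"
  proof (rule Bochner_Integration.integrable_bound)
    show "integrable lborel (\<lambda>x::'a. indicator (cball 0 R) x *\<^sub>R C)"
      by (intro integrable_scaleR_left integrable_real_indicator) (use cball_fin in auto)
    show "AE x in lborel. norm (F x) \<le> norm (indicator (cball 0 R) x *\<^sub>R C)"
    proof (rule AE_I2)
      fix x
      show "norm (F x) \<le> norm (indicator (cball 0 R) x *\<^sub>R C)"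
      proof (cases "x \<in> cball 0 R")
        case True then show ?thesis using C[OF True] by simp
      next
        case False
        then have "x \<notin> S" using R0[of x] r by (auto simp: R_def)
        then show ?thesis by (simp add: zero)
      qed
    qed
  qed simp
  define q where "q k x = (F (x + h k *\<^sub>R b) - F x) / h k" for k x
  have shift: "integrable lborel (\<lambda>x. F (x + a))" "integral\<^sup>L lborel (\<lambda>x. F (x + a)) = integral\<^sup>L lborel F" for a
  proof -
    have d: "distr lborel borel ((+) a) = (lborel :: 'a measure)" by (rule lborel_distr_plus)
    have "integrable (distr lborel borel ((+) a)) F" using intF by (simp add: d)
    then have "integrable lborel (\<lambda>x. F (a + x))" by (subst (asm) integrable_distr_eq) auto
    then show "integrable lborel (\<lambda>x. F (x + a))" by (simp add: add.commute)
    have "integral\<^sup>L (distr lborel borel ((+) a)) F = integral\<^sup>L lborel (\<lambda>x. F (a + x))"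
      by (subst integral_distr) auto
    then show "integral\<^sup>L lborel (\<lambda>x. F (x + a)) = integral\<^sup>L lborel F" by (simp add: d add.commute)
  qed
  have q0: "integral\<^sup>L lebesgue (q k) = 0" for k
  proof -
    have "integral\<^sup>L lebesgue (q k) = integral\<^sup>L lborel (q k)"
      by (rule integral_completion) (simp add: q_def[abs_def])
    also have "\<dots> = (integral\<^sup>L lborel (\<lambda>x. F (x + h k *\<^sub>R b)) - integral\<^sup>L lborel F) / h k"
      unfolding q_def using shift(1) intF by simp
    finally show ?thesis by (simp add: shift(2))
  qed
  have qm: "q k \<in> borel_measurable lebesgue" for k
    by (rule measurable_completion) (simp add: q_def[abs_def])
  have lim: "AE x in lebesgue. (\<lambda>k. q k x) \<longlonglongrightarrow> frechet_derivative F (at x) b"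
    using diff
  proof eventually_elim
    fix x assume "F differentiable (at x)"
    then have "(F has_derivative frechet_derivative F (at x)) (at x)" by (rule frechet_derivative_works[THEN iffD1])
    then have D: "(F has_derivative frechet_derivative F (at x)) (at (x + 0 *\<^sub>R b))" by simp
    have line: "((\<lambda>s. x + s *\<^sub>R b) has_derivative (\<lambda>s. s *\<^sub>R b)) (at (0::real))"
      by (auto intro!: derivative_eq_intros)
    have "((\<lambda>s. F (x + s *\<^sub>R b)) has_derivative (\<lambda>s. frechet_derivative F (at x) (s *\<^sub>R b))) (at 0)"
      by (rule has_derivative_compose[of "\<lambda>s. x + s *\<^sub>R b" "\<lambda>s. s *\<^sub>R b" 0 UNIV F, OF line D])
    moreover have "(\<lambda>s. frechet_derivative F (at x) (s *\<^sub>R b)) = (*) (frechet_derivative F (at x) b)"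
      using linear_frechet_derivative[OF \<open>F differentiable (at x)\<close>] by (auto simp: linear_scale mult.commute)
    ultimately have "((\<lambda>s. F (x + s *\<^sub>R b)) has_field_derivative frechet_derivative F (at x) b) (at 0)"
      by (simp add: has_field_derivative_def)
    then have "((\<lambda>s. (F (x + s *\<^sub>R b) - F x) / s) \<longlongrightarrow> frechet_derivative F (at x) b) (at 0)"
      by (simp add: DERIV_def)
    from filterlim_compose[OF this hlim] show "(\<lambda>k. q k x) \<longlonglongrightarrow> frechet_derivative F (at x) b"
      by (simp add: q_def)
  qed
  have limm: "(\<lambda>x. lim (\<lambda>k. q k x)) \<in> borel_measurable lebesgue"
    by (rule borel_measurable_lim_metric) (rule qm)
  have fm: "(\<lambda>x. frechet_derivative F (at x) b) \<in> borel_measurable lebesgue"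
    by (rule borel_measurable_lebesgue_AE_eq[OF limm]) (use lim in eventually_elim, rule limI)
  have dom: "AE x in lebesgue. norm (q k x) \<le> indicator (cball 0 R) x *\<^sub>R (L * norm b)" for k
  proof (rule AE_I2)
    fix x :: 'a
    have a: "\<bar>q k x\<bar> \<le> L * norm b"
    proof -
      have "\<bar>F (x + h k *\<^sub>R b) - F x\<bar> \<le> L * (h k * norm b)"
        using lip[of "x + h k *\<^sub>R b" x] hsmall[of k] hpos[of k] by (simp add: dist_norm)
      then show ?thesis using hpos[of k] by (simp add: q_def field_simps)
    qed
    show "norm (q k x) \<le> indicator (cball 0 R) x *\<^sub>R (L * norm b)"
    proof (cases "x \<in> cball 0 R")
      case True then show ?thesis using a by simp
    next
      case False
      then have "R < norm x" by simp
      then have "x \<notin> S" using R0[of x] r by (auto simp: R_def)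
      moreover have "x + h k *\<^sub>R b \<notin> S"
        using R0[of "x + h k *\<^sub>R b"] hsmall[of k] \<open>R < norm x\<close> norm_diff_ineq[of x "h k *\<^sub>R b"]
        by (auto simp: R_def)
      ultimately show ?thesis using L0 by (simp add: q_def zero)
    qed
  qed
  have wint: "integrable lebesgue (\<lambda>x::'a. indicator (cball 0 R) x *\<^sub>R (L * norm b))"
  proof -
    have "integrable lborel (\<lambda>x::'a. indicator (cball 0 R) x *\<^sub>R (L * norm b))"
      by (intro integrable_scaleR_left integrable_real_indicator) (use cball_fin in auto)
    then show ?thesis by (subst integrable_completion) auto
  qed
  show "integrable lebesgue (\<lambda>x. frechet_derivative F (at x) b)"
    by (rule integrable_dominated_convergence[OF fm qm wint lim dom])
  have "(\<lambda>k. integral\<^sup>L lebesgue (q k)) \<longlonglongrightarrow> integral\<^sup>L lebesgue (\<lambda>x. frechet_derivative F (at x) b)"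
    by (rule integral_dominated_convergence[OF fm qm wint lim dom])
  then show "integral\<^sup>L lebesgue (\<lambda>x. frechet_derivative F (at x) b) = 0"
    by (simp add: q0 LIMSEQ_const_iff)
qed

lemma Ck_on_imp_continuous_on: "Ck_on k U f \<Longrightarrow> open U \<Longrightarrow> continuous_on U f"
  by (cases k) (auto intro!: continuous_at_imp_continuous_on differentiable_imp_continuous_within)

lemma smooth_on_imp_continuous_on: "smooth_on S f \<Longrightarrow> continuous_on S f"
proof -
  assume sm: "smooth_on S f"
  show ?thesis
  proof (clarsimp simp: continuous_on_eq_continuous_within)
    fix x assume "x \<in> S"
    then obtain U g where U: "open U" "x \<in> U" "\<forall>k. Ck_on k U g" "\<forall>y\<in>S \<inter> U. g y = f y"
      using sm unfolding smooth_on_def by meson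
    have "continuous_on U g" using U(3) by (auto dest: spec[of _ 0])
    then have "continuous (at x within S) g"
      using U by (metis continuous_at_imp_continuous_within continuous_on_eq_continuous_at)
    then show "continuous (at x within S) f"
      by (rule continuous_transform_within_openin[where S = "S \<inter> U"]) (use U \<open>x \<in> S\<close> in \<open>auto intro: openin_open_Int\<close>)
  qed
qed

text \<open>The derivative is continuous in each fixed direction, hence bounded on a compact ball in each of
  the finitely many basis directions, hence bounded in operator norm.\<close>

lemma Ck_on_1_imp_lipschitz_ball:
  fixes f :: "'a::euclidean_space \<Rightarrow> 'b::real_normed_vector"
  assumes C: "Ck_on (Suc k) U f" and U: "open U" and z: "z \<in> U"
  shows "\<exists>r L. 0 < r \<and> 0 \<le> L \<and> ball z r \<subseteq> U \<and>
    (\<forall>x\<in>ball z r. \<forall>y\<in>ball z r. norm (f x - f y) \<le> L * dist x y)"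
proof -
  obtain r where r: "0 < r" "cball z r \<subseteq> U" using U z open_contains_cball_eq by blast
  have cont: "continuous_on (cball z r) (\<lambda>x. frechet_derivative f (at x) w)" for w
    using Ck_on_imp_continuous_on[of k U "\<lambda>x. frechet_derivative f (at x) w"] C U r
    by (auto intro: continuous_on_subset)
  have "\<exists>M. \<forall>x\<in>cball z r. norm (frechet_derivative f (at x) w) \<le> M" for w
    using compact_imp_bounded[OF compact_continuous_image[OF cont[of w] compact_cball]]
    by (auto simp: bounded_iff)
  then obtain M where M: "\<And>w x. x \<in> cball z r \<Longrightarrow> norm (frechet_derivative f (at x) w) \<le> M w" by metis
  define L where "L = (\<Sum>b\<in>Basis. M b)"
  have L0: "0 \<le> L" unfolding L_def
    using M[of z] r by (intro sum_nonneg) (auto intro: order_trans[OF norm_ge_zero])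
  have "norm (f x - f y) \<le> L * dist x y" if x: "x \<in> ball z r" and y: "y \<in> ball z r" for x y
  proof -
    have "norm (f x - f y) \<le> L * norm (x - y)"
    proof (rule differentiable_bound[OF convex_ball])
      fix w assume w: "w \<in> ball z r"
      then have "w \<in> U" using r by auto
      then have dw: "f differentiable (at w)" using C by simp
      then show "(f has_derivative frechet_derivative f (at w)) (at w within ball z r)"
        by (rule has_derivative_at_withinI[OF frechet_derivative_works[THEN iffD1]])
      have lin: "linear (frechet_derivative f (at w))" by (rule linear_frechet_derivative[OF dw])
      show "onorm (frechet_derivative f (at w)) \<le> L"
      proof (rule onorm_bound[OF L0])
        fix v :: 'a
        have "frechet_derivative f (at w) v = (\<Sum>b\<in>Basis. (v \<bullet> b) *\<^sub>R frechet_derivative f (at w) b)"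
        proof -
          have "frechet_derivative f (at w) (\<Sum>b\<in>Basis. (v \<bullet> b) *\<^sub>R b)
              = (\<Sum>b\<in>Basis. (v \<bullet> b) *\<^sub>R frechet_derivative f (at w) b)"
            using lin by (simp add: linear_sum linear_scale)
          then show ?thesis by (simp add: euclidean_representation)
        qed
        also have "norm \<dots> \<le> (\<Sum>b\<in>Basis. norm v * M b)"
          using w by (intro sum_norm_le) (auto intro!: mult_mono M Basis_le_norm)
        finally show "norm (frechet_derivative f (at w) v) \<le> L * norm v"
          by (simp add: L_def sum_distrib_left mult.commute)
      qed
    qed (use x y in auto)
    then show ?thesis by (simp add: dist_norm)
  qed
  with r L0 show ?thesis by (intro exI[of _ r] exI[of _ L]) (use ball_subset_cball in blast)
qed

text \<open>Lebesgue number argument. Only one of the two points has to lie in the compact set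
  \<open>Z\<close>; the restriction to \<open>A\<close> allows one-sided neighbourhoods such as
  those at the ends of a time interval.\<close>

lemma compact_locally_lipschitz_uniform:
  fixes f :: "'a::metric_space \<Rightarrow> 'b::real_normed_vector"
  assumes Z: "compact Z"
    and loc: "\<And>z. z \<in> Z \<Longrightarrow> \<exists>r>0. \<exists>L. \<forall>a\<in>ball z r \<inter> A. \<forall>b\<in>ball z r \<inter> A. norm (f a - f b) \<le> L * dist a b"
  obtains \<eta> L where "0 < \<eta>" "0 \<le> L"
    "\<And>a b. a \<in> Z \<inter> A \<Longrightarrow> b \<in> A \<Longrightarrow> dist a b < \<eta> \<Longrightarrow> norm (f a - f b) \<le> L * dist a b"
proof -
  obtain r L where rL: "\<And>z. z \<in> Z \<Longrightarrow> 0 < r z"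
    "\<And>z a b. z \<in> Z \<Longrightarrow> a \<in> ball z (r z) \<inter> A \<Longrightarrow> b \<in> ball z (r z) \<inter> A \<Longrightarrow> norm (f a - f b) \<le> L z * dist a b"
    using loc by metis
  have "Z \<subseteq> (\<Union>z\<in>Z. ball z (r z / 2))" using rL(1) by force
  then obtain D where D: "D \<subseteq> Z" "finite D" "Z \<subseteq> (\<Union>z\<in>D. ball z (r z / 2))"
    using compactE_image[OF Z, of Z "\<lambda>z. ball z (r z / 2)"] by auto
  define \<eta> where "\<eta> = Min (insert 1 ((\<lambda>z. r z / 2) ` D))"
  define M where "M = (\<Sum>z\<in>D. \<bar>L z\<bar>)"
  have e: "0 < \<eta>" unfolding \<eta>_def using D rL(1) by (subst Min_gr_iff) auto
  have "norm (f a - f b) \<le> M * dist a b" if ab: "a \<in> Z \<inter> A" "b \<in> A" "dist a b < \<eta>" for a b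
  proof -
    obtain z where z: "z \<in> D" "dist z a < r z / 2" using ab D by auto
    have "\<eta> \<le> r z / 2" unfolding \<eta>_def using z D by (intro Min_le) auto
    then have "dist z b < r z" using z ab dist_triangle[of z b a] by simp
    moreover have "dist z a < r z" using z zero_le_dist[of z a] by linarith
    ultimately have "norm (f a - f b) \<le> L z * dist a b" using rL(2)[of z a b] z D ab by auto
    also have "\<dots> \<le> M * dist a b"
    proof (rule mult_right_mono)
      have "\<bar>L z\<bar> \<le> M" unfolding M_def using z D by (intro member_le_sum) auto
      then show "L z \<le> M" by simp
    qed simp
    finally show ?thesis .
  qed
  moreover have "0 \<le> M" unfolding M_def by (simp add: sum_nonneg)
  ultimately show ?thesis using that e by blast
qed

text \<open>Gronwall's inequality for two solutions of an equation whose right-hand side is Lipschitz only for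
  points closer than \<open>\<eta>\<close>. The bound itself prevents the curves from ever being
  \<open>\<eta>\<close> apart.\<close>

lemma curve_divergence_bound:
  fixes y z :: "real \<Rightarrow> 'a::real_inner"
  assumes b: "0 \<le> b" and L: "0 \<le> L"
    and dy: "\<And>s. s \<in> {0..b} \<Longrightarrow> (y has_vector_derivative y' s) (at s)"
    and dz: "\<And>s. s \<in> {0..b} \<Longrightarrow> (z has_vector_derivative z' s) (at s)"
    and lip: "\<And>s. s \<in> {0..b} \<Longrightarrow> norm (y s - z s) < \<eta> \<Longrightarrow> norm (y' s - z' s) \<le> L * norm (y s - z s)"
    and small: "norm (y 0 - z 0) * exp (L * b) < \<eta>"
  shows "norm (y b - z b) \<le> norm (y 0 - z 0) * exp (L * b)"
proof -
  define w where "w s = y s - z s" for s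
  have dw: "(w has_vector_derivative (y' s - z' s)) (at s)" if "s \<in> {0..b}" for s
    unfolding w_def using dy[OF that] dz[OF that] by (rule has_vector_derivative_diff)
  have cw: "continuous_on {0..b} w"
    by (meson continuous_at_imp_continuous_on dw has_vector_derivative_continuous)
  \<comment> \<open>Nonincreasing as long as the curves are closer than \<open>\<eta>\<close>.\<close>
  define g where "g s = exp (- 2 * L * s) * (w s \<bullet> w s)" for s
  have dg: "(g has_real_derivative (exp (- 2 * L * s) * (2 * (w s \<bullet> (y' s - z' s)) - 2 * L * (w s \<bullet> w s)))) (at s)"
    if s: "s \<in> {0..b}" for s
  proof -
    have "((\<lambda>s. w s \<bullet> w s) has_derivative (\<lambda>h. w s \<bullet> (h *\<^sub>R (y' s - z' s)) + (h *\<^sub>R (y' s - z' s)) \<bullet> w s)) (at s)"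
      using dw[OF s] unfolding has_vector_derivative_def by (intro has_derivative_inner) auto
    then have "((\<lambda>s. w s \<bullet> w s) has_real_derivative 2 * (w s \<bullet> (y' s - z' s))) (at s)"
      unfolding has_field_derivative_def
      by (rule has_derivative_eq_rhs) (auto simp: inner_commute algebra_simps)
    then show ?thesis unfolding g_def
      by (auto intro!: derivative_eq_intros simp: algebra_simps)
  qed
  have decr: "norm (w a) \<le> norm (w 0) * exp (L * a)"
    if a: "a \<in> {0..b}" and close: "\<And>s. 0 \<le> s \<Longrightarrow> s < a \<Longrightarrow> norm (w s) < \<eta>" for a
  proof -
    have "g a \<le> g 0"
    proof (cases "a = 0")
      case False
      have nonpos: "exp (- 2 * L * s) * (2 * (w s \<bullet> (y' s - z' s)) - 2 * L * (w s \<bullet> w s)) \<le> 0"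
        if s: "0 \<le> s" "s < a" for s
      proof -
        have "norm (y' s - z' s) \<le> L * norm (w s)"
          using lip[of s] close[OF s] s a by (simp add: w_def)
        then have "w s \<bullet> (y' s - z' s) \<le> norm (w s) * (L * norm (w s))"
          by (meson norm_cauchy_schwarz order_trans mult_left_mono norm_ge_zero)
        then have "w s \<bullet> (y' s - z' s) \<le> L * (w s \<bullet> w s)"
          by (simp add: power2_norm_eq_inner[symmetric] power2_eq_square algebra_simps)
        then show ?thesis by (intro mult_nonneg_nonpos) auto
      qed
      have cg: "continuous_on {0..a} g"
        using cw a unfolding g_def by (intro continuous_intros) (auto intro: continuous_on_subset)
      have a0: "0 < a" using a False by simp
      obtain \<xi> where \<xi>: "0 < \<xi>" "\<xi> < a"
        "g a - g 0 = (a - 0) * (exp (- 2 * L * \<xi>) * (2 * (w \<xi> \<bullet> (y' \<xi> - z' \<xi>)) - 2 * L * (w \<xi> \<bullet> w \<xi>)))"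
      proof -
        have "\<exists>\<xi>. \<xi> > 0 \<and> \<xi> < a \<and> g a - g 0 = (a - 0) * (exp (- 2 * L * \<xi>) * (2 * (w \<xi> \<bullet> (y' \<xi> - z' \<xi>)) - 2 * L * (w \<xi> \<bullet> w \<xi>)))"
          using a0 a by (intro MVT2 dg) auto
        then show ?thesis using that by blast
      qed
      then show ?thesis using nonpos[of \<xi>] a0
        by (smt (verit) mult_nonneg_nonpos)
    qed simp
    then have "(norm (w a))\<^sup>2 \<le> exp (2 * L * a) * (norm (w 0))\<^sup>2"
      by (simp add: g_def power2_norm_eq_inner exp_minus field_simps)
    also have "\<dots> = (norm (w 0) * exp (L * a))\<^sup>2"
      by (simp add: power_mult_distrib exp_double[symmetric] mult.assoc)
    finally show ?thesis by (rule power2_le_imp_le) simp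
  qed
  have "norm (w s) < \<eta>" if "s \<in> {0..b}" for s
  proof (rule ccontr)
    assume bad: "\<not> norm (w s) < \<eta>"
    \<comment> \<open>Its minimum is the first time at which the curves are \<open>\<eta>\<close>
      apart.\<close>
    define B where "B = {s\<in>{0..b}. norm (w s) \<in> {\<eta>..}}"
    have "closed ({0..b} \<inter> (\<lambda>s. norm (w s)) -` {\<eta>..})"
      by (rule continuous_closed_preimage) (auto intro!: continuous_intros cw)
    moreover have "B = {0..b} \<inter> (\<lambda>s. norm (w s)) -` {\<eta>..}" by (auto simp: B_def)
    ultimately have "closed B" by simp
    moreover have "bounded B" by (rule bounded_subset[of "{0..b}"]) (auto simp: B_def)
    ultimately have "compact B" by (simp add: compact_eq_bounded_closed)
    moreover have "B \<noteq> {}" using bad that by (auto simp: B_def)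
    ultimately obtain a where a: "a \<in> B" "\<And>s. s \<in> B \<Longrightarrow> a \<le> s"
      using continuous_attains_inf[of B "\<lambda>s. s"] by auto
    then have ab: "a \<in> {0..b}" by (simp add: B_def)
    have "norm (w a) \<le> norm (w 0) * exp (L * a)"
    proof (rule decr[OF ab])
      fix s assume s: "0 \<le> s" "s < a"
      then show "norm (w s) < \<eta>" using a(2)[of s] ab by (force simp: B_def)
    qed
    also have "\<dots> \<le> norm (w 0) * exp (L * b)" using ab L by (intro mult_left_mono) (auto intro: mult_left_mono)
    also have "\<dots> < \<eta>" using small by (simp add: w_def)
    finally show False using a by (simp add: B_def)
  qed
  then show ?thesis using decr[of b] b by (simp add: w_def)
qed

text \<open>The filter condition excludes isolated points of \<open>S\<close>, where every vector is a
  derivative.\<close>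

lemma has_vector_derivative_norm_le_lipschitz:
  fixes f :: "real \<Rightarrow> 'b::real_normed_vector"
  assumes f: "(f has_vector_derivative D) (at x within S)" and r: "0 < r"
    and nt: "at x within S \<noteq> bot"
    and lip: "\<And>y. y \<in> S \<Longrightarrow> dist y x < r \<Longrightarrow> norm (f y - f x) \<le> B * dist y x"
  shows "norm D \<le> B"
proof (rule field_le_epsilon)
  fix e :: real assume e: "0 < e"
  obtain d where d: "0 < d" "\<And>y. y \<in> S \<Longrightarrow> norm (y - x) < d \<Longrightarrow>
      norm (f y - f x - (y - x) *\<^sub>R D) \<le> e * norm (y - x)"
    using f e unfolding has_vector_derivative_def has_derivative_within_alt by metis
  have "x islimpt S" using nt by (simp add: trivial_limit_within)
  then obtain y where y: "y \<in> S" "y \<noteq> x" "dist y x < min d r"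
    using d r by (metis islimpt_approachable min_less_iff_conj)
  have "norm ((y - x) *\<^sub>R D) \<le> norm (f y - f x) + norm (f y - f x - (y - x) *\<^sub>R D)"
    using norm_triangle_ineq4[of "f y - f x" "f y - f x - (y - x) *\<^sub>R D"] by simp
  also have "\<dots> \<le> B * dist y x + e * norm (y - x)"
    using d(2)[of y] lip[of y] y by (intro add_mono) (auto simp: dist_norm)
  finally have "\<bar>y - x\<bar> * norm D \<le> \<bar>y - x\<bar> * (B + e)"
    unfolding norm_scaleR by (simp add: dist_norm distrib_left distrib_right mult.commute)
  then show "norm D \<le> B + e" using y by simp
qed

lemma has_derivative_norm_le_lipschitz:
  fixes f :: "'a::real_normed_vector \<Rightarrow> 'b::real_normed_vector"
  assumes f: "(f has_derivative f') (at x)" and r: "0 < r"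
    and lip: "\<And>y. dist y x < r \<Longrightarrow> norm (f y - f x) \<le> B * dist y x"
  shows "norm (f' w) \<le> B * norm w"
proof -
  have nw: "0 < 1 + norm w" by (simp add: add_pos_nonneg)
  have line: "((\<lambda>s. x + s *\<^sub>R w) has_derivative (\<lambda>s. s *\<^sub>R w)) (at (0::real))"
    by (auto intro!: derivative_eq_intros)
  have f0: "(f has_derivative f') (at (x + 0 *\<^sub>R w))" using f by simp
  have "((\<lambda>s. f (x + s *\<^sub>R w)) has_derivative (\<lambda>s. f' (s *\<^sub>R w))) (at 0)"
    by (rule has_derivative_compose[of "\<lambda>s. x + s *\<^sub>R w" "\<lambda>s. s *\<^sub>R w" 0 UNIV f, OF line f0])
  then have "((\<lambda>s. f (x + s *\<^sub>R w)) has_vector_derivative f' w) (at 0)"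
    using has_derivative_linear[OF f] by (simp add: has_vector_derivative_def linear_scale)
  then show ?thesis
  proof (rule has_vector_derivative_norm_le_lipschitz)
    show "0 < r / (1 + norm w)" using r nw by simp
    fix s :: real assume s: "dist s 0 < r / (1 + norm w)"
    then have "\<bar>s\<bar> * (1 + norm w) < r" using nw by (simp add: pos_less_divide_eq)
    then have "\<bar>s\<bar> * norm w < r" by (simp add: distrib_left)
    then show "norm (f (x + s *\<^sub>R w) - f (x + 0 *\<^sub>R w)) \<le> B * norm w * dist s 0"
      using lip[of "x + s *\<^sub>R w"] by (simp add: dist_norm mult_ac)
  qed simp
qed

lemma has_derivative_grad:
  assumes "f differentiable (at x)"
  shows "(f has_derivative (\<lambda>w. grad f x \<bullet> w)) (at x)"
proof -
  have lin: "linear (frechet_derivative f (at x))" by (rule linear_frechet_derivative[OF assms])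
  have "frechet_derivative f (at x) w = grad f x \<bullet> w" for w
  proof -
    have "frechet_derivative f (at x) w = frechet_derivative f (at x) (\<Sum>b\<in>Basis. (w \<bullet> b) *\<^sub>R b)"
      by (simp add: euclidean_representation)
    also have "\<dots> = (\<Sum>b\<in>Basis. (w \<bullet> b) * frechet_derivative f (at x) b)"
      using lin by (simp add: linear_sum linear_scale)
    also have "\<dots> = grad f x \<bullet> w"
      unfolding grad_def by (simp add: inner_sum_left inner_commute[of w] mult.commute)
    finally show ?thesis .
  qed
  then show ?thesis using frechet_derivative_works[of f "at x"] assms by (metis (no_types, lifting) ext)
qed

lemma norm_orthogonal_part_le:
  fixes w m :: "'a::real_inner"
  assumes "norm m = 1"
  shows "norm (w - (m \<bullet> w) *\<^sub>R m) \<le> norm w"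
proof (rule power2_le_imp_le)
  have "m \<bullet> m = 1" using assms by (simp add: norm_eq_1)
  then have "(norm (w - (m \<bullet> w) *\<^sub>R m))\<^sup>2 = (norm w)\<^sup>2 - (m \<bullet> w)\<^sup>2"
    unfolding power2_norm_eq_inner
    by (simp add: inner_diff_left inner_diff_right inner_commute[of w m] power2_eq_square)
  then show "(norm (w - (m \<bullet> w) *\<^sub>R m))\<^sup>2 \<le> (norm w)\<^sup>2" by simp
qed simp

text \<open>Continuity argument: the derivative is bounded only while \<open>|g| < d\<close>, but the
  resulting bound on the increments keeps \<open>g\<close> from reaching \<open>d\<close>. It is
  applied to the level function along segments and along time, whose derivatives are controlled
  only inside the strip.\<close>

lemma small_derivative_no_exit:
  fixes g :: "real \<Rightarrow> real"
  assumes cont: "continuous_on {0..1} g" and c: "0 \<le> c" and start: "\<bar>g 0\<bar> + c < d"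
    and der: "\<And>l. 0 < l \<Longrightarrow> l < 1 \<Longrightarrow> \<bar>g l\<bar> < d \<Longrightarrow> \<exists>D. (g has_real_derivative D) (at l) \<and> \<bar>D\<bar> \<le> c"
  shows "\<bar>g 1 - g 0\<bar> \<le> c" and "\<bar>g 1\<bar> < d"
proof -
  have step: "\<bar>g a - g 0\<bar> \<le> c"
    if a: "0 \<le> a" "a \<le> 1" and inside: "\<And>l. 0 < l \<Longrightarrow> l < a \<Longrightarrow> \<bar>g l\<bar> < d" for a
  proof (cases "a = 0")
    case False
    obtain D where D: "\<And>l. 0 < l \<Longrightarrow> l < a \<Longrightarrow> (g has_real_derivative D l) (at l) \<and> \<bar>D l\<bar> \<le> c"
      using der inside a by (metis less_le_trans)
    have "\<exists>l\<in>{0<..<a}. norm (g a - g 0) \<le> norm (D l * (a - 0))"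
    proof (rule mvt_general)
      show "0 < a" using a False by simp
      show "continuous_on {0..a} g" using cont a by (auto intro: continuous_on_subset)
      fix l assume "0 < l" "l < a"
      then show "(g has_derivative (\<lambda>h. D l * h)) (at l)"
        using D[of l] by (simp add: has_field_derivative_def)
    qed
    then obtain l where l: "0 < l" "l < a" "\<bar>g a - g 0\<bar> \<le> \<bar>D l\<bar> * a" using a by (auto simp: abs_mult)
    have "\<bar>D l\<bar> * a \<le> c * 1" using D[of l] l a c by (intro mult_mono) auto
    with l show ?thesis by simp
  qed (use c in simp)
  have all: "\<bar>g l\<bar> < d" if "l \<in> {0..1}" for l
  proof (rule ccontr)
    assume bad: "\<not> \<bar>g l\<bar> < d"
    define B where "B = {0..1} \<inter> (\<lambda>s. \<bar>g s\<bar>) -` {d..}"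
    have "closed B" unfolding B_def
      by (rule continuous_closed_preimage) (auto intro!: continuous_intros cont)
    moreover have "bounded B" by (rule bounded_subset[of "{0..1}"]) (auto simp: B_def)
    ultimately have "compact B" by (simp add: compact_eq_bounded_closed)
    moreover have "B \<noteq> {}" using bad that by (auto simp: B_def)
    ultimately obtain a where a: "a \<in> B" "\<And>s. s \<in> B \<Longrightarrow> a \<le> s"
      using continuous_attains_inf[of B "\<lambda>s. s"] by auto
    then have ab: "a \<in> {0..1}" by (simp add: B_def)
    have "\<bar>g a - g 0\<bar> \<le> c"
    proof (rule step)
      fix l assume l: "0 < l" "l < a"
      show "\<bar>g l\<bar> < d" using a(2)[of l] l ab by (force simp: B_def)
    qed (use ab in auto)
    then have "\<bar>g a\<bar> < d" using start by linarith
    then show False using a by (simp add: B_def)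
  qed
  show "\<bar>g 1 - g 0\<bar> \<le> c" by (rule step) (use all in auto)
  show "\<bar>g 1\<bar> < d" by (rule all) simp
qed

section \<open>The level set function near the surface\<close>

context moving_surface
begin

abbreviation level_grad :: "real \<Rightarrow> 'a \<Rightarrow> 'a" where
  "level_grad t \<equiv> grad (\<lambda>y. \<phi> y t)"

text \<open>Smoothness on \<open>\<Omega> \<times> [0,T]\<close> is expressed by local extensions
  \<open>G\<close> to open sets. Since \<open>\<Omega>\<close> is open, the spatial derivatives of
  \<open>\<phi>\<close> are partial derivatives of \<open>G\<close> also at the end times.\<close>

lemma phi_local:
  assumes x: "x \<in> \<Omega>" and t: "t \<in> {0..T}"
  shows "\<exists>U G. open U \<and> (x, t) \<in> U \<and> (\<forall>k. Ck_on k U G) \<and>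
    (\<forall>y s. (y, s) \<in> U \<longrightarrow> y \<in> \<Omega> \<longrightarrow> s \<in> {0..T} \<longrightarrow>
      \<phi> y s = G (y, s) \<and> (\<lambda>z. \<phi> z s) differentiable (at y) \<and>
      level_grad s y = (\<Sum>b\<in>Basis. frechet_derivative G (at (y, s)) (b, 0) *\<^sub>R b))"
proof -
  have "(x, t) \<in> \<Omega> \<times> {0..T}" using x t by simp
  then obtain U G where U: "open U" "(x, t) \<in> U" "\<And>k. Ck_on k U G"
    "\<And>z. z \<in> (\<Omega> \<times> {0..T}) \<inter> U \<Longrightarrow> G z = (case z of (x, t) \<Rightarrow> \<phi> x t)"
    using phi_smooth unfolding smooth_on_def by meson
  have op: "open \<Omega>" using domain by (simp add: polyhedral_domain_def)
  have G: "\<phi> y s = G (y, s)" if "(y, s) \<in> U" "y \<in> \<Omega>" "s \<in> {0..T}" for y s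
    using U(4)[of "(y, s)"] that by simp
  have der: "((\<lambda>z. \<phi> z s) has_derivative (\<lambda>w. frechet_derivative G (at (y, s)) (w, 0))) (at y)"
    if ys: "(y, s) \<in> U" "y \<in> \<Omega>" "s \<in> {0..T}" for y s
  proof -
    define V where "V = \<Omega> \<inter> (\<lambda>y. (y, s)) -` U"
    have V: "open V" "y \<in> V" unfolding V_def using op U ys
      by (auto intro!: open_Int open_vimage continuous_intros)
    have "G differentiable (at (y, s))" using U(3)[of 1] ys by simp
    then have dG: "(G has_derivative frechet_derivative G (at (y, s))) (at (y, s))"
      by (rule frechet_derivative_works[THEN iffD1])
    have pair: "((\<lambda>y. (y, s)) has_derivative (\<lambda>w. (w, 0))) (at y)"
      by (auto intro!: derivative_eq_intros)
    have "((\<lambda>z. G (z, s)) has_derivative (\<lambda>w. frechet_derivative G (at (y, s)) (w, 0))) (at y)"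
      by (rule has_derivative_compose[of "\<lambda>y. (y, s)" "\<lambda>w. (w, 0)" y UNIV G, OF pair dG])
    then show ?thesis
      by (rule has_derivative_transform_within_open[OF _ V]) (use G ys in \<open>auto simp: V_def\<close>)
  qed
  have dA: "(\<lambda>z. \<phi> z s) differentiable (at y)"
    and dB: "level_grad s y = (\<Sum>b\<in>Basis. frechet_derivative G (at (y, s)) (b, 0) *\<^sub>R b)"
    if ys: "(y, s) \<in> U" "y \<in> \<Omega>" "s \<in> {0..T}" for y s
    using der[OF ys] unfolding grad_def frechet_derivative_at[OF der[OF ys], symmetric]
    by (auto simp: differentiable_def)
  show ?thesis
    by (intro exI[of _ U] exI[of _ G] conjI allI impI U(1-3)) (erule (2) G dA dB)+
qed

lemma phi_differentiable:
  assumes x: "x \<in> \<Omega>" and t: "t \<in> {0..T}"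
  shows "(\<lambda>y. \<phi> y t) differentiable (at x)"
proof -
  obtain U G where U: "open U" "(x, t) \<in> U" "\<forall>k. Ck_on k U G"
    and ext: "\<forall>y s. (y, s) \<in> U \<longrightarrow> y \<in> \<Omega> \<longrightarrow> s \<in> {0..T} \<longrightarrow>
      \<phi> y s = G (y, s) \<and> (\<lambda>z. \<phi> z s) differentiable (at y) \<and>
      level_grad s y = (\<Sum>b\<in>Basis. frechet_derivative G (at (y, s)) (b, 0) *\<^sub>R b)"
    using phi_local[OF x t] by (elim exE conjE) (rule that)
  show ?thesis using ext U x t by simp
qed

lemma phi_has_derivative:
  "x \<in> \<Omega> \<Longrightarrow> t \<in> {0..T} \<Longrightarrow> ((\<lambda>y. \<phi> y t) has_derivative (\<lambda>w. level_grad t x \<bullet> w)) (at x)"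
  by (intro has_derivative_grad phi_differentiable)

lemma open_domain: "open \<Omega>" using domain by (simp add: polyhedral_domain_def)

lemma bounded_domain: "bounded \<Omega>" using domain by (simp add: polyhedral_domain_def)

lemma phi_continuous: "continuous_on (\<Omega> \<times> {0..T}) (\<lambda>(x, t). \<phi> x t)"
  by (rule smooth_on_imp_continuous_on[OF phi_smooth])

lemma phi_continuous_space: "t \<in> {0..T} \<Longrightarrow> continuous_on \<Omega> (\<lambda>x. \<phi> x t)"
  by (intro continuous_at_imp_continuous_on ballI differentiable_imp_continuous_within phi_differentiable)

lemma grad_phi_differentiable:
  assumes x: "x \<in> \<Omega>" and t: "t \<in> {0..T}"
  shows "level_grad t differentiable (at x)"
proof -
  obtain U G where U: "open U" "(x, t) \<in> U" "\<forall>k. Ck_on k U G"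
    and ext: "\<forall>y s. (y, s) \<in> U \<longrightarrow> y \<in> \<Omega> \<longrightarrow> s \<in> {0..T} \<longrightarrow>
      \<phi> y s = G (y, s) \<and> (\<lambda>z. \<phi> z s) differentiable (at y) \<and>
      level_grad s y = (\<Sum>b\<in>Basis. frechet_derivative G (at (y, s)) (b, 0) *\<^sub>R b)"
    using phi_local[OF x t] by (elim exE conjE) (rule that)
  have gr: "level_grad s y = (\<Sum>b\<in>Basis. frechet_derivative G (at (y, s)) (b, 0) *\<^sub>R b)"
    if "(y, s) \<in> U" "y \<in> \<Omega>" "s \<in> {0..T}" for y s
    using ext that by auto
  define V where "V = \<Omega> \<inter> (\<lambda>y. (y, t)) -` U"
  have V: "open V" "x \<in> V" unfolding V_def using open_domain U x
    by (auto intro!: open_Int open_vimage continuous_intros)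
  have d: "(\<lambda>z. frechet_derivative G (at z) (b, 0)) differentiable (at (x, t))" for b
    using U(3)[rule_format, of "Suc 1"] U(2) by simp
  have "(\<lambda>y. \<Sum>b\<in>Basis. frechet_derivative G (at (y, t)) (b, 0) *\<^sub>R b) differentiable (at x)"
  proof (intro differentiable_sum ballI differentiable_scaleR differentiable_const finite_Basis)
    fix b :: 'a assume "b \<in> Basis"
    have "((\<lambda>z. frechet_derivative G (at z) (b, 0)) \<circ> (\<lambda>y. (y, t))) differentiable (at x)"
      by (rule differentiable_chain_at)
        (auto simp: d intro!: derivative_intros differentiable_Pair differentiable_ident)
    then show "(\<lambda>y. frechet_derivative G (at (y, t)) (b, 0)) differentiable (at x)"
      by (simp add: o_def)
  qed
  then obtain D where "((\<lambda>y. \<Sum>b\<in>Basis. frechet_derivative G (at (y, t)) (b, 0) *\<^sub>R b) has_derivative D) (at x)"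
    by (auto simp: differentiable_def)
  then have "(level_grad t has_derivative D) (at x)"
    by (rule has_derivative_transform_within_open[OF _ V]) (use gr t in \<open>auto simp: V_def\<close>)
  then show ?thesis by (auto simp: differentiable_def)
qed

lemma grad_phi_continuous: "t \<in> {0..T} \<Longrightarrow> continuous_on \<Omega> (level_grad t)"
  by (intro continuous_at_imp_continuous_on ballI differentiable_imp_continuous_within grad_phi_differentiable)

lemma grad_phi_locally_lipschitz:
  assumes x: "x \<in> \<Omega>" and t: "t \<in> {0..T}"
  shows "\<exists>r>0. \<exists>L. \<forall>a\<in>ball (x, t) r \<inter> \<Omega> \<times> {0..T}. \<forall>b\<in>ball (x, t) r \<inter> \<Omega> \<times> {0..T}.
    norm ((\<lambda>(y, s). level_grad s y) a - (\<lambda>(y, s). level_grad s y) b) \<le> L * dist a b"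
proof -
  obtain U G where U: "open U" "(x, t) \<in> U" "\<forall>k. Ck_on k U G"
    and ext: "\<forall>y s. (y, s) \<in> U \<longrightarrow> y \<in> \<Omega> \<longrightarrow> s \<in> {0..T} \<longrightarrow>
      \<phi> y s = G (y, s) \<and> (\<lambda>z. \<phi> z s) differentiable (at y) \<and>
      level_grad s y = (\<Sum>b\<in>Basis. frechet_derivative G (at (y, s)) (b, 0) *\<^sub>R b)"
    using phi_local[OF x t] by (elim exE conjE) (rule that)
  have gr: "level_grad s y = (\<Sum>b\<in>Basis. frechet_derivative G (at (y, s)) (b, 0) *\<^sub>R b)"
    if "(y, s) \<in> U" "y \<in> \<Omega>" "s \<in> {0..T}" for y s
    using ext that by auto
  define Q where "Q b r L \<longleftrightarrow> 0 < r \<and> 0 \<le> L \<and> ball (x, t) r \<subseteq> U \<and>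
    (\<forall>p\<in>ball (x, t) r. \<forall>q\<in>ball (x, t) r.
      norm (frechet_derivative G (at p) (b, 0) - frechet_derivative G (at q) (b, 0)) \<le> L * dist p q)"
    for b :: 'a and r L :: real
  have "\<exists>r L. Q b r L" for b
  proof -
    have "Ck_on (Suc 0) U (\<lambda>z. frechet_derivative G (at z) (b, 0))"
      using U(3)[rule_format, of "Suc (Suc 0)"] by simp
    from Ck_on_1_imp_lipschitz_ball[OF this U(1,2)] show ?thesis unfolding Q_def .
  qed
  then obtain r L where "\<And>b. Q b (r b) (L b)" by metis
  then have rL: "\<And>b. 0 < r b" "\<And>b. ball (x, t) (r b) \<subseteq> U"
    "\<And>b p q. p \<in> ball (x, t) (r b) \<Longrightarrow> q \<in> ball (x, t) (r b) \<Longrightarrow>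
      norm (frechet_derivative G (at p) (b, 0) - frechet_derivative G (at q) (b, 0)) \<le> L b * dist p q"
    unfolding Q_def by simp_all
  define R where "R = Min (r ` Basis)"
  have R: "0 < R" unfolding R_def using rL(1) by (subst Min_gr_iff) auto
  have Rb: "R \<le> r b" if "b \<in> Basis" for b unfolding R_def using that by (intro Min_le) auto
  show ?thesis
  proof (rule exI[of _ R], rule conjI, rule R, rule exI[of _ "\<Sum>b\<in>Basis. L b"], intro ballI)
    fix p q assume p: "p \<in> ball (x, t) R \<inter> \<Omega> \<times> {0..T}" and q: "q \<in> ball (x, t) R \<inter> \<Omega> \<times> {0..T}"
    obtain b0 :: 'a where b0: "b0 \<in> Basis" using nonempty_Basis by blast
    have "ball (x, t) R \<subseteq> U" using rL(2)[of b0] Rb[OF b0] by fastforce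
    then have pU: "p \<in> U" "q \<in> U" using p q by auto
    have "(\<lambda>(y, s). level_grad s y) z = (\<Sum>b\<in>Basis. frechet_derivative G (at z) (b, 0) *\<^sub>R b)"
      if "z \<in> U" "z \<in> \<Omega> \<times> {0..T}" for z
      using that gr[of "fst z" "snd z"] by (cases z) simp
    then have "(\<lambda>(y, s). level_grad s y) p - (\<lambda>(y, s). level_grad s y) q
      = (\<Sum>b\<in>Basis. (frechet_derivative G (at p) (b, 0) - frechet_derivative G (at q) (b, 0)) *\<^sub>R b)"
      using p q pU by (simp add: scaleR_diff_left sum_subtractf)
    also have "norm \<dots> \<le> (\<Sum>b\<in>Basis. L b * dist p q)"
    proof (rule sum_norm_le)
      fix b :: 'a assume b: "b \<in> Basis"
      have "p \<in> ball (x, t) (r b)" "q \<in> ball (x, t) (r b)" using p q Rb[OF b] by auto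
      from rL(3)[OF this] show "norm ((frechet_derivative G (at p) (b, 0)
          - frechet_derivative G (at q) (b, 0)) *\<^sub>R b) \<le> L b * dist p q" using b by simp
    qed
    finally show "norm ((\<lambda>(y, s). level_grad s y) p - (\<lambda>(y, s). level_grad s y) q)
        \<le> (\<Sum>b\<in>Basis. L b) * dist p q" by (simp add: sum_distrib_right)
  qed
qed

lemma phi_has_time_derivative:
  assumes x: "x \<in> \<Omega>" and t: "t \<in> {0..T}"
  shows "((\<lambda>s. \<phi> x s) has_vector_derivative time_deriv T \<phi> x t) (at t within {0..T})"
proof -
  obtain U G where U: "open U" "(x, t) \<in> U" "\<forall>k. Ck_on k U G"
    and ext: "\<forall>y s. (y, s) \<in> U \<longrightarrow> y \<in> \<Omega> \<longrightarrow> s \<in> {0..T} \<longrightarrow>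
      \<phi> y s = G (y, s) \<and> (\<lambda>z. \<phi> z s) differentiable (at y) \<and>
      level_grad s y = (\<Sum>b\<in>Basis. frechet_derivative G (at (y, s)) (b, 0) *\<^sub>R b)"
    using phi_local[OF x t] by (elim exE conjE) (rule that)
  have G: "\<phi> y s = G (y, s)" if "(y, s) \<in> U" "y \<in> \<Omega>" "s \<in> {0..T}" for y s
    using ext that by auto
  define V where "V = (\<lambda>s. (x, s)) -` U"
  have V: "open V" "t \<in> V" unfolding V_def using U by (auto intro!: open_vimage continuous_intros)
  have "G differentiable (at (x, t))" using U(3)[rule_format, of 1] U(2) by simp
  then have "(\<lambda>s. G (x, s)) differentiable (at t within {0..T})"
    using differentiable_chain_at[of "\<lambda>s. (x, s)" t G]
    by (auto simp: o_def intro!: differentiable_at_withinI differentiable_Pair differentiable_ident)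
  then obtain D where "((\<lambda>s. G (x, s)) has_derivative D) (at t within {0..T})"
    by (auto simp: differentiable_def)
  then have "((\<lambda>s. \<phi> x s) has_derivative D) (at t within {0..T})"
  proof -
    obtain d where d: "0 < d" "ball t d \<subseteq> V" using V open_contains_ball_eq by blast
    assume "((\<lambda>s. G (x, s)) has_derivative D) (at t within {0..T})"
    then show ?thesis
      by (rule has_derivative_transform_within[where d = d])
        (use d t x G in \<open>auto simp: V_def dist_commute subset_iff\<close>)
  qed
  then have "(\<lambda>s. \<phi> x s) differentiable (at t within {0..T})" by (auto simp: differentiable_def)
  then show ?thesis unfolding time_deriv_def by (simp add: vector_derivative_works)
qed

lemma open_strip: "t \<in> {0..T} \<Longrightarrow> open (strip \<Omega> \<phi> r t)"
proof -
  assume t: "t \<in> {0..T}"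
  have "strip \<Omega> \<phi> r t = \<Omega> \<inter> (\<lambda>x. \<bar>\<phi> x t\<bar>) -` {..<r}" by (auto simp: strip_def)
  then show ?thesis
    using t by (auto intro!: continuous_open_preimage continuous_intros phi_continuous_space open_domain)
qed

text \<open>A segment starting in the strip cannot leave \<open>\<Omega>\<close> before
  \<open>|\<phi>|\<close> reaches \<open>\<delta>0\<close>, since the closure of the strip lies in
  \<open>\<Omega>\<close>; and as long as it stays in the strip, \<open>\<phi>\<close> changes at
  rate at most \<open>c1\<close>.\<close>

lemma near_strip:
  assumes t: "t \<in> {0..T}" and x: "x \<in> \<Omega>" and room: "\<bar>\<phi> x t\<bar> + c1 * dist x y < \<delta>0"
  shows "y \<in> strip \<Omega> \<phi> \<delta>0 t" "\<bar>\<phi> y t - \<phi> x t\<bar> \<le> c1 * dist x y"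
proof -
  define U where "U = strip \<Omega> \<phi> \<delta>0 t"
  have U: "open U" "U \<subseteq> \<Omega>" using open_strip[OF t] by (auto simp: U_def strip_def)
  have c1: "0 \<le> c1" using constants by simp
  define z where "z l = x + l *\<^sub>R (y - x)" for l :: real
  have key: "z a \<in> U \<and> \<bar>\<phi> (z a) t - \<phi> x t\<bar> \<le> c1 * dist x y"
    if a: "0 \<le> a" "a \<le> 1" and inside: "\<And>l. 0 \<le> l \<Longrightarrow> l < a \<Longrightarrow> z l \<in> U" for a
  proof -
    \<comment> \<open>The end point is a limit of points of the strip and therefore still in
      \<open>\<Omega>\<close>.\<close>
    have zc: "z ` closure {0..<a} \<subseteq> closure U"
    proof (rule image_closure_subset)
      show "continuous_on (closure {0..<a}) z" unfolding z_def by (intro continuous_intros)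
      show "z ` {0..<a} \<subseteq> closure U" using inside closure_subset by fastforce
    qed simp
    have za: "z a \<in> \<Omega>"
    proof (cases "a = 0")
      case False
      then have "a \<in> closure {0..<a}" using a by (subst closure_atLeastLessThan) auto
      then have "z a \<in> closure U" using zc by blast
      then show ?thesis using strip_sub[OF t] by (auto simp: U_def)
    qed (simp add: z_def x)
    have zl: "z (l * a) \<in> \<Omega>" if "0 \<le> l" "l \<le> 1" for l
    proof (cases "l * a = a")
      case True then show ?thesis using za by (simp only:)
    next
      case False
      then have "l * a < a" using that a by (metis less_eq_real_def mult_left_le_one_le)
      then show ?thesis using inside[of "l * a"] that a U by auto
    qed
    define g where "g l = \<phi> (z (l * a)) t" for l
    have dg: "(g has_real_derivative (level_grad t (z (l * a)) \<bullet> (a *\<^sub>R (y - x)))) (at l)"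
      if "0 \<le> l" "l \<le> 1" for l
    proof -
      have line: "((\<lambda>l. z (l * a)) has_derivative (\<lambda>h. (h * a) *\<^sub>R (y - x))) (at l)"
        unfolding z_def by (auto intro!: derivative_eq_intros simp: algebra_simps)
      have "((\<lambda>l. \<phi> (z (l * a)) t) has_derivative (\<lambda>h. level_grad t (z (l * a)) \<bullet> ((h * a) *\<^sub>R (y - x)))) (at l)"
        by (rule has_derivative_compose[of "\<lambda>l. z (l * a)" "\<lambda>h. (h * a) *\<^sub>R (y - x)" l UNIV "\<lambda>y. \<phi> y t",
              OF line phi_has_derivative[OF zl[OF that] t]])
      then show ?thesis unfolding g_def has_field_derivative_def
        by (rule has_derivative_eq_rhs) (auto simp: mult_ac)
    qed
    have nb: "\<exists>D. (g has_real_derivative D) (at l) \<and> \<bar>D\<bar> \<le> c1 * dist x y"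
      if l: "0 < l" "l < 1" "\<bar>g l\<bar> < \<delta>0" for l
    proof -
      have "z (l * a) \<in> strip \<Omega> \<phi> \<delta>0 t" using zl[of l] l by (simp add: strip_def g_def)
      then have "norm (level_grad t (z (l * a))) \<le> c1" using phi_bounds[OF t] by blast
      then have "\<bar>level_grad t (z (l * a)) \<bullet> (a *\<^sub>R (y - x))\<bar> \<le> c1 * norm (a *\<^sub>R (y - x))"
        by (meson Cauchy_Schwarz_ineq2 order_trans mult_right_mono norm_ge_zero)
      also have "\<dots> \<le> c1 * dist x y"
        using a c1 by (intro mult_left_mono) (auto simp: dist_norm norm_minus_commute mult_left_le_one_le)
      finally show ?thesis using dg[of l] l by auto
    qed
    have "continuous_on {0..1} g"
      using dg by (meson DERIV_continuous atLeastAtMost_iff continuous_at_imp_continuous_on)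
    note ne = small_derivative_no_exit[OF this _ _ nb]
    have g0: "g 0 = \<phi> x t" by (simp add: g_def z_def)
    have "\<bar>g 1 - g 0\<bar> \<le> c1 * dist x y" "\<bar>g 1\<bar> < \<delta>0"
      by (rule ne; use c1 room g0 in simp)+
    then show ?thesis using za by (simp add: g_def z_def U_def strip_def)
  qed
  have all: "z l \<in> U" if l: "l \<in> {0..1}" for l
  proof (rule ccontr)
    assume bad: "z l \<notin> U"
    define B where "B = {0..1} \<inter> z -` (- U)"
    have "closed B" unfolding B_def
      by (rule continuous_closed_preimage) (use U in \<open>auto intro!: continuous_intros simp: z_def\<close>)
    moreover have "bounded B" by (rule bounded_subset[of "{0..1}"]) (auto simp: B_def)
    ultimately have "compact B" by (simp add: compact_eq_bounded_closed)
    moreover have "B \<noteq> {}" using bad l by (auto simp: B_def)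
    ultimately obtain a where a: "a \<in> B" "\<And>s. s \<in> B \<Longrightarrow> a \<le> s"
      using continuous_attains_inf[of B "\<lambda>s. s"] by auto
    then have ab: "0 \<le> a" "a \<le> 1" by (auto simp: B_def)
    have "z a \<in> U" using key[OF ab] a ab by (force simp: B_def)
    then show False using a by (simp add: B_def)
  qed
  have "z 1 \<in> U \<and> \<bar>\<phi> (z 1) t - \<phi> x t\<bar> \<le> c1 * dist x y" by (rule key) (use all in auto)
  then show "y \<in> strip \<Omega> \<phi> \<delta>0 t" "\<bar>\<phi> y t - \<phi> x t\<bar> \<le> c1 * dist x y"
    by (auto simp: z_def U_def)
qed

lemma grad_phi_lipschitz:
  assumes t: "t \<in> {0..T}" and seg: "closed_segment x y \<subseteq> strip \<Omega> \<phi> \<delta>0 t"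
  shows "norm (level_grad t x - level_grad t y) \<le> c2 * dist x y"
proof -
  have "norm (level_grad t x - level_grad t y) \<le> c2 * norm (x - y)"
  proof (rule differentiable_bound[OF convex_closed_segment])
    fix z assume "z \<in> closed_segment x y"
    then have z: "z \<in> strip \<Omega> \<phi> \<delta>0 t" using seg by blast
    then show "(level_grad t has_derivative hessian (\<lambda>y. \<phi> y t) z) (at z within closed_segment x y)"
      unfolding hessian_def
      using grad_phi_differentiable[OF _ t] frechet_derivative_works
      by (auto simp: strip_def intro: has_derivative_at_withinI)
    show "onorm (hessian (\<lambda>y. \<phi> y t) z) \<le> c2" using phi_bounds[OF t z] by blast
  qed auto
  then show ?thesis by (simp add: dist_norm)
qed

text \<open>The time derivative is bounded only while the point is in the moving strip;
  \<open>small_derivative_no_exit\<close> shows that the strip does not move past the point.\<close>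

lemma phi_time_lipschitz:
  assumes x: "x \<in> \<Omega>" and t: "t \<in> {0..T}" and s: "s \<in> {0..T}"
    and room: "\<bar>\<phi> x t\<bar> + c2 * \<bar>s - t\<bar> < \<delta>0"
  shows "\<bar>\<phi> x s - \<phi> x t\<bar> \<le> c2 * \<bar>s - t\<bar>"
proof -
  define z where "z l = t + l * (s - t)" for l
  have z: "z l \<in> {0..T}" if "l \<in> {0..1}" for l
  proof -
    have "z l \<in> closed_segment t s" using that by (auto simp: z_def in_segment algebra_simps intro!: exI[of _ l])
    moreover have "closed_segment t s \<subseteq> {0..T}" using t s by (intro closed_segment_subset) auto
    ultimately show ?thesis by blast
  qed
  define g where "g l = \<phi> x (z l)" for l
  have dg: "(g has_vector_derivative ((s - t) *\<^sub>R time_deriv T \<phi> x (z l))) (at l within {0..1})"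
    if l: "l \<in> {0..1}" for l
  proof -
    have 1: "(z has_vector_derivative (s - t)) (at l within {0..1})"
      unfolding z_def by (auto intro!: derivative_eq_intros simp: has_vector_derivative_def)
    have 2: "((\<lambda>s. \<phi> x s) has_vector_derivative time_deriv T \<phi> x (z l)) (at (z l) within z ` {0..1})"
      using phi_has_time_derivative[OF x z[OF l]] by (rule has_vector_derivative_within_subset) (use z in auto)
    show ?thesis unfolding g_def using vector_diff_chain_within[OF 1 2] by (simp add: o_def)
  qed
  have cont: "continuous_on {0..1} g"
    using dg by (meson continuous_on_eq_continuous_within has_vector_derivative_continuous)
  have nb: "\<exists>D. (g has_real_derivative D) (at l) \<and> \<bar>D\<bar> \<le> c2 * \<bar>s - t\<bar>"
    if l: "0 < l" "l < 1" "\<bar>g l\<bar> < \<delta>0" for l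
  proof -
    have "x \<in> strip \<Omega> \<phi> \<delta>0 (z l)" using x l by (simp add: strip_def g_def)
    then have "\<bar>time_deriv T \<phi> x (z l)\<bar> \<le> c2" using phi_bounds z l by simp
    moreover have "(g has_real_derivative ((s - t) *\<^sub>R time_deriv T \<phi> x (z l))) (at l)"
      using dg[of l] l by (simp add: at_within_Icc_at has_real_derivative_iff_has_vector_derivative)
    ultimately show ?thesis
      by (intro exI conjI) (auto simp: abs_mult mult.commute[of c2] intro!: mult_left_mono)
  qed
  have "\<bar>g 1 - g 0\<bar> \<le> c2 * \<bar>s - t\<bar>"
    by (rule small_derivative_no_exit[OF cont _ _ nb]) (use constants room in \<open>auto simp: g_def z_def\<close>)
  then show ?thesis by (simp add: g_def z_def)
qed

end

section \<open>The normal flow and the foot point\<close>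

context moving_surface
begin

lemma strip_mono: "r \<le> r' \<Longrightarrow> strip \<Omega> \<phi> r t \<subseteq> strip \<Omega> \<phi> r' t"
  by (auto simp: strip_def)

text \<open>The only issue is closedness, as \<open>\<Omega>\<close> is open.
  If \<open>x\<^sub>k \<rightarrow> x\<close> and \<open>t\<^sub>k \<rightarrow> t\<close>, the bound on the time derivative puts \<open>x\<^sub>k\<close> into the
  \<open>\<delta>0\<close>-strip at the fixed time \<open>t\<close>, whose closure lies in
  \<open>\<Omega>\<close>.\<close>

lemma spacetime_strip_compact:
  "compact {(x, t). x \<in> \<Omega> \<and> t \<in> {0..T} \<and> \<bar>\<phi> x t\<bar> \<le> \<delta>}" (is "compact ?Z")
  unfolding compact_eq_bounded_closed
proof
  show "bounded ?Z"
    by (rule bounded_subset[OF bounded_Times[OF bounded_domain bounded_closed_interval[of 0 T]]]) auto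
  show "closed ?Z"
    unfolding closed_sequential_limits
  proof (intro allI impI, elim conjE)
    fix z l assume z: "\<forall>k. z k \<in> ?Z" and lim: "z \<longlonglongrightarrow> l"
    define xs ts x t where "xs = (\<lambda>k. fst (z k))" and "ts = (\<lambda>k. snd (z k))" and "x = fst l" and "t = snd l"
    have zk: "xs k \<in> \<Omega>" "ts k \<in> {0..T}" "\<bar>\<phi> (xs k) (ts k)\<bar> \<le> \<delta>" for k
      using z[rule_format, of k] by (auto simp: xs_def ts_def split: prod.splits)
    have xl: "xs \<longlonglongrightarrow> x" and tl: "ts \<longlonglongrightarrow> t"
      unfolding xs_def ts_def x_def t_def using lim by (auto intro: tendsto_fst tendsto_snd)
    have t: "t \<in> {0..T}"
      by (rule closed_sequentially[OF _ _ tl]) (use zk in auto)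
    define r where "r = (\<delta>0 - \<delta>) / c2"
    have "0 < r" using delta constants by (simp add: r_def)
    then have "\<forall>\<^sub>F k in sequentially. dist (ts k) t < r" using tl by (rule tendstoD[rotated])
    then have ev: "\<forall>\<^sub>F k in sequentially. xs k \<in> closure (strip \<Omega> \<phi> \<delta>0 t)"
    proof eventually_elim
      fix k assume k: "dist (ts k) t < r"
      then have "c2 * \<bar>t - ts k\<bar> < c2 * r" using constants by (simp add: dist_real_def abs_minus_commute)
      then have lt: "\<bar>\<phi> (xs k) (ts k)\<bar> + c2 * \<bar>t - ts k\<bar> < \<delta>0"
        using zk(3)[of k] constants by (simp add: r_def)
      have "\<bar>\<phi> (xs k) t - \<phi> (xs k) (ts k)\<bar> \<le> c2 * \<bar>t - ts k\<bar>"
        by (rule phi_time_lipschitz[OF zk(1,2) t lt])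
      then have "xs k \<in> strip \<Omega> \<phi> \<delta>0 t" using lt zk(1)[of k] by (simp add: strip_def)
      then show "xs k \<in> closure (strip \<Omega> \<phi> \<delta>0 t)" using closure_subset by blast
    qed
    have "x \<in> closure (strip \<Omega> \<phi> \<delta>0 t)"
      by (rule Lim_in_closed_set[OF closed_closure ev _ xl]) simp
    then have x: "x \<in> \<Omega>" using strip_sub[OF t] by blast
    have "(\<lambda>k. (\<lambda>(x, t). \<phi> x t) (xs k, ts k)) \<longlonglongrightarrow> (\<lambda>(x, t). \<phi> x t) (x, t)"
      by (rule continuous_on_tendsto_compose[OF phi_continuous tendsto_Pair[OF xl tl]])
        (use x t zk in auto)
    then have "(\<lambda>k. \<bar>\<phi> (xs k) (ts k)\<bar>) \<longlonglongrightarrow> \<bar>\<phi> x t\<bar>" by (auto intro: tendsto_rabs)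
    then have "\<bar>\<phi> x t\<bar> \<le> \<delta>" by (rule LIMSEQ_le_const2) (use zk in auto)
    then show "l \<in> ?Z" using x t by (cases l) (simp add: x_def t_def)
  qed
qed

text \<open>The assumptions bound no mixed derivative of \<open>\<phi>\<close> explicitly; a bound comes from
  smoothness and compactness.\<close>

lemma grad_phi_time_lipschitz:
  "\<exists>\<eta>>0. \<exists>L\<ge>0. \<forall>x\<in>\<Omega>. \<forall>t\<in>{0..T}. \<forall>s\<in>{0..T}. \<bar>\<phi> x t\<bar> \<le> \<delta> \<longrightarrow> \<bar>t - s\<bar> < \<eta> \<longrightarrow>
     norm (level_grad t x - level_grad s x) \<le> L * \<bar>t - s\<bar>"
proof -
  let ?Z = "{(x, t). x \<in> \<Omega> \<and> t \<in> {0..T} \<and> \<bar>\<phi> x t\<bar> \<le> \<delta>}"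
  let ?f = "\<lambda>(y, s). level_grad s y"
  obtain \<eta> L where eL: "0 < \<eta>" "0 \<le> L"
    "\<And>a b. a \<in> ?Z \<inter> \<Omega> \<times> {0..T} \<Longrightarrow> b \<in> \<Omega> \<times> {0..T} \<Longrightarrow> dist a b < \<eta> \<Longrightarrow> norm (?f a - ?f b) \<le> L * dist a b"
  proof (rule compact_locally_lipschitz_uniform[OF spacetime_strip_compact, of "\<Omega> \<times> {0..T}" ?f])
    fix z assume "z \<in> ?Z"
    then show "\<exists>r>0. \<exists>L. \<forall>a\<in>ball z r \<inter> \<Omega> \<times> {0..T}. \<forall>b\<in>ball z r \<inter> \<Omega> \<times> {0..T}.
        norm (?f a - ?f b) \<le> L * dist a b"
      using grad_phi_locally_lipschitz[of "fst z" "snd z"] by (cases z) simp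
  qed blast
  show ?thesis
  proof (rule exI[of _ \<eta>], rule conjI, rule eL(1), rule exI[of _ L], rule conjI, rule eL(2), intro ballI impI)
    fix x t s assume "x \<in> \<Omega>" "t \<in> {0..T}" "s \<in> {0..T}" "\<bar>\<phi> x t\<bar> \<le> \<delta>" "\<bar>t - s\<bar> < \<eta>"
    then show "norm (level_grad t x - level_grad s x) \<le> L * \<bar>t - s\<bar>"
      using eL(3)[of "(x, t)" "(x, s)"] by (simp add: dist_Pair_Pair dist_real_def)
  qed
qed

lemma Phi_in_surface: "P \<in> \<Gamma> 0 \<Longrightarrow> t \<in> {0..T} \<Longrightarrow> \<Phi> P t \<in> \<Gamma> t"
  using Phi_diffeo[of t] by (auto simp: diffeomorphism_between_def bij_betw_def)

text \<open>The velocity is the time derivative of \<open>\<Phi>\<close>, which is locally Lipschitz,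
  uniformly on the compact set \<open>\<Gamma>(0) \<times> [0,T]\<close>.\<close>

lemma surface_velocity_bounded:
  "\<exists>V0. \<forall>P\<in>\<Gamma> 0. \<forall>t\<in>{0..T}. norm (v (\<Phi> P t) t) \<le> V0"
proof -
  let ?A = "\<Gamma> 0 \<times> {0..T}"
  let ?f = "\<lambda>(P, t). \<Phi> P t"
  have "compact (\<Gamma> 0)" using surface[of 0] T_pos by simp
  then have comp: "compact ?A" by (intro compact_Times) auto
  obtain \<eta> L where eL: "0 < \<eta>" "0 \<le> L"
    "\<And>a b. a \<in> ?A \<inter> ?A \<Longrightarrow> b \<in> ?A \<Longrightarrow> dist a b < \<eta> \<Longrightarrow> norm (?f a - ?f b) \<le> L * dist a b"
  proof (rule compact_locally_lipschitz_uniform[OF comp, of ?A ?f])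
    fix z assume z: "z \<in> ?A"
    then obtain U g where U: "open U" "z \<in> U" "\<forall>k. Ck_on k U g" "\<forall>y\<in>?A \<inter> U. g y = ?f y"
      using Phi_smooth unfolding smooth_on_def by meson
    obtain r L where r: "0 < r" "ball z r \<subseteq> U"
      "\<forall>x\<in>ball z r. \<forall>y\<in>ball z r. norm (g x - g y) \<le> L * dist x y"
      using Ck_on_1_imp_lipschitz_ball[OF U(3)[rule_format, of "Suc 0"] U(1,2)] by blast
    show "\<exists>r>0. \<exists>L. \<forall>a\<in>ball z r \<inter> ?A. \<forall>b\<in>ball z r \<inter> ?A. norm (?f a - ?f b) \<le> L * dist a b"
    proof (rule exI[of _ r], rule conjI, rule r(1), rule exI[of _ L], intro ballI)
      fix a b assume a: "a \<in> ball z r \<inter> ?A" and b: "b \<in> ball z r \<inter> ?A"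
      have "g a = ?f a" by (rule U(4)[rule_format]) (use r a in blast)
      moreover have "g b = ?f b" by (rule U(4)[rule_format]) (use r b in blast)
      ultimately show "norm (?f a - ?f b) \<le> L * dist a b" using r(3) a b by (metis IntD1)
    qed
  qed blast
  have "norm (v (\<Phi> P t) t) \<le> L" if P: "P \<in> \<Gamma> 0" and t: "t \<in> {0..T}" for P t
  proof (rule has_vector_derivative_norm_le_lipschitz[OF Phi_deriv[OF P t] eL(1)])
    show "at t within {0..T} \<noteq> bot" using t T_pos by (simp add: trivial_limit_within)
    fix s assume "s \<in> {0..T}" "dist s t < \<eta>"
    then show "norm (\<Phi> P s - \<Phi> P t) \<le> L * dist s t"
      using eL(3)[of "(P, s)" "(P, t)"] P t by (simp add: dist_Pair_Pair)
  qed
  then show ?thesis by blast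
qed

definition foot_point :: "'a \<Rightarrow> real \<Rightarrow> 'a" where
  "foot_point x t = \<Phi> (base_point (\<Gamma> 0) \<delta> flow x t) t"

lemma extend_eq: "extend \<Gamma> \<Phi> \<Omega> \<phi> \<delta> flow z x t = (if x \<in> strip \<Omega> \<phi> \<delta> t then z (foot_point x t) t else 0)"
  by (simp add: extend_def foot_point_def)

text \<open>By the choice of the right-hand side, \<open>\<phi>\<close> grows at unit rate along the normal
  flow, and it vanishes at the starting point.\<close>

lemma phi_flow:
  assumes P: "P \<in> \<Gamma> 0" and t: "t \<in> {0..T}" and s: "s \<in> {-\<delta><..<\<delta>}"
  shows "flow P t s \<in> \<Omega>" "\<phi> (flow P t s) t = s"
    "(flow P t has_vector_derivative level_grad t (flow P t s) /\<^sub>R (norm (level_grad t (flow P t s)))\<^sup>2) (at s)"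
    "flow P t s \<in> strip \<Omega> \<phi> \<delta> t" "flow P t 0 = \<Phi> P t"
proof -
  have fl: "flow P t 0 = \<Phi> P t"
    "\<And>s. s \<in> {-\<delta><..<\<delta>} \<Longrightarrow> flow P t s \<in> \<Omega> \<and> level_grad t (flow P t s) \<noteq> 0 \<and>
      (flow P t has_vector_derivative level_grad t (flow P t s) /\<^sub>R (norm (level_grad t (flow P t s)))\<^sup>2) (at s)"
    using flow[OF P t] unfolding gradient_curve_def by auto
  show "flow P t 0 = \<Phi> P t" by (rule fl)
  show om: "flow P t s \<in> \<Omega>" and "(flow P t has_vector_derivative level_grad t (flow P t s) /\<^sub>R (norm (level_grad t (flow P t s)))\<^sup>2) (at s)"
    using fl(2)[OF s] by auto
  have der: "((\<lambda>s. \<phi> (flow P t s) t - s) has_derivative (\<lambda>h. 0)) (at s)" if s: "s \<in> {-\<delta><..<\<delta>}" for s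
  proof -
    let ?g = "level_grad t (flow P t s)"
    have g: "?g \<noteq> 0" and om: "flow P t s \<in> \<Omega>" using fl(2)[OF s] by auto
    have f: "(flow P t has_derivative (\<lambda>h. h *\<^sub>R (?g /\<^sub>R (norm ?g)\<^sup>2))) (at s)"
      using fl(2)[OF s] by (simp add: has_vector_derivative_def)
    have d1: "((\<lambda>s. \<phi> (flow P t s) t) has_derivative (\<lambda>h. ?g \<bullet> (h *\<^sub>R (?g /\<^sub>R (norm ?g)\<^sup>2)))) (at s)"
      by (rule has_derivative_compose[of "flow P t" "\<lambda>h. h *\<^sub>R (?g /\<^sub>R (norm ?g)\<^sup>2)" s UNIV "\<lambda>y. \<phi> y t",
            OF f phi_has_derivative[OF om t]])
    have d2: "?g \<bullet> (h *\<^sub>R (?g /\<^sub>R (norm ?g)\<^sup>2)) = h" for h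
      using g by (simp add: power2_norm_eq_inner)
    have "((\<lambda>s. \<phi> (flow P t s) t) has_derivative (\<lambda>h. h)) (at s)"
      by (rule has_derivative_eq_rhs[OF d1]) (rule ext, rule d2)
    from has_derivative_diff[OF this has_derivative_ident] show ?thesis by simp
  qed
  have "\<exists>c. \<forall>s\<in>{-\<delta><..<\<delta>}. \<phi> (flow P t s) t - s = c"
    by (rule has_derivative_zero_constant) (auto intro: has_derivative_at_withinI[OF der])
  moreover have "0 \<in> {-\<delta><..<\<delta>}" using delta by simp
  ultimately have "\<phi> (flow P t s) t - s = \<phi> (flow P t 0) t - 0" using s by metis
  moreover have "\<phi> (\<Phi> P t) t = 0" using Phi_in_surface[OF P t] surface_eq[OF t] by simp
  ultimately show "\<phi> (flow P t s) t = s" by (simp add: fl(1))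
  then show "flow P t s \<in> strip \<Omega> \<phi> \<delta> t" using om s by (auto simp: strip_def)
qed

lemma base_point:
  assumes t: "t \<in> {0..T}" and x: "x \<in> strip \<Omega> \<phi> \<delta> t"
  shows "base_point (\<Gamma> 0) \<delta> flow x t \<in> \<Gamma> 0" "flow (base_point (\<Gamma> 0) \<delta> flow x t) t (\<phi> x t) = x"
proof -
  let ?S = "\<Gamma> 0 \<times> {-\<delta><..<\<delta>}" and ?F = "\<lambda>(P, s). flow P t s"
  have x': "x \<in> ?F ` ?S" using flow_diffeo[OF t] x by (simp add: diffeomorphism_between_def bij_betw_def)
  obtain P s where Ps: "inv_into ?S ?F x = (P, s)" by (cases "inv_into ?S ?F x")
  have "(P, s) \<in> ?S" using inv_into_into[OF x'] Ps by simp
  moreover have fx: "flow P t s = x" using f_inv_into_f[OF x'] Ps by simp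
  moreover have "base_point (\<Gamma> 0) \<delta> flow x t = P" by (simp add: base_point_def Ps)
  ultimately show "base_point (\<Gamma> 0) \<delta> flow x t \<in> \<Gamma> 0" "flow (base_point (\<Gamma> 0) \<delta> flow x t) t (\<phi> x t) = x"
    using phi_flow(2)[of P t s] t by auto
qed

lemma foot_point_in_surface: "t \<in> {0..T} \<Longrightarrow> x \<in> strip \<Omega> \<phi> \<delta> t \<Longrightarrow> foot_point x t \<in> \<Gamma> t"
  unfolding foot_point_def by (intro Phi_in_surface base_point)

lemma foot_point_continuous:
  assumes t: "t \<in> {0..T}"
  shows "continuous_on (strip \<Omega> \<phi> \<delta> t) (\<lambda>x. foot_point x t)"
proof -
  let ?S = "\<Gamma> 0 \<times> {-\<delta><..<\<delta>}" and ?F = "\<lambda>(P, s). flow P t s"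
  have "smooth_on (strip \<Omega> \<phi> \<delta> t) (inv_into ?S ?F)"
    using flow_diffeo[OF t] by (simp add: diffeomorphism_between_def)
  then have "continuous_on (strip \<Omega> \<phi> \<delta> t) (inv_into ?S ?F)" by (rule smooth_on_imp_continuous_on)
  then have b: "continuous_on (strip \<Omega> \<phi> \<delta> t) (\<lambda>x. base_point (\<Gamma> 0) \<delta> flow x t)"
    unfolding base_point_def by (intro continuous_intros)
  have "continuous_on (\<Gamma> 0) (\<lambda>P. \<Phi> P t)"
    using Phi_diffeo[OF t] by (auto simp: diffeomorphism_between_def intro: smooth_on_imp_continuous_on)
  from continuous_on_compose2[OF this b] show ?thesis
    unfolding foot_point_def using base_point(1)[OF t] by auto
qed

text \<open>Projecting onto the tangent space does not increase the norm, and \<open>|V| = |\<phi>\<^sub>t| /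
  |\<nabla>\<phi>|\<close> is at most \<open>c2 / c0\<close>.\<close>

lemma extended_velocity_bounded:
  "\<exists>A\<ge>0. \<forall>t\<in>{0..T}. \<forall>x\<in>strip \<Omega> \<phi> \<delta> t. norm (extended_velocity T \<Gamma> \<Phi> \<Omega> \<phi> \<delta> flow v x t) \<le> A"
proof -
  obtain V0 where V0: "\<And>P t. P \<in> \<Gamma> 0 \<Longrightarrow> t \<in> {0..T} \<Longrightarrow> norm (v (\<Phi> P t) t) \<le> V0"
    using surface_velocity_bounded by metis
  have "norm (extended_velocity T \<Gamma> \<Phi> \<Omega> \<phi> \<delta> flow v x t) \<le> c2 / c0 + V0"
    if t: "t \<in> {0..T}" and x: "x \<in> strip \<Omega> \<phi> \<delta> t" for t x
  proof -
    have unit: "norm (unit_normal \<phi> y t) = 1" if "level_grad t y \<noteq> 0" for y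
      using that by (simp add: unit_normal_def)
    have x0: "x \<in> strip \<Omega> \<phi> \<delta>0 t" using x delta by (auto simp: strip_def)
    have b: "c0 \<le> norm (level_grad t x)" "\<bar>time_deriv T \<phi> x t\<bar> \<le> c2"
      using phi_bounds[OF t x0] by auto
    then have gx: "level_grad t x \<noteq> 0" using constants by auto
    define y where "y = foot_point x t"
    have y: "y \<in> \<Gamma> t" unfolding y_def by (rule foot_point_in_surface[OF t x])
    have vy: "norm (v y t) \<le> V0" unfolding y_def foot_point_def by (rule V0[OF base_point(1)[OF t x] t])
    define w where "w = tangential_velocity \<phi> v y t"
    have "norm w \<le> norm (v y t)"
      using norm_orthogonal_part_le[OF unit[OF phi_regular[OF t y]], of "v y t"]
      by (simp add: w_def tangential_velocity_def inner_commute)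
    moreover have "norm (w - (unit_normal \<phi> x t \<bullet> w) *\<^sub>R unit_normal \<phi> x t) \<le> norm w"
      by (rule norm_orthogonal_part_le[OF unit[OF gx]])
    moreover have "norm (normal_velocity T \<phi> x t *\<^sub>R unit_normal \<phi> x t) \<le> c2 / c0"
      using b constants by (simp add: normal_velocity_def unit[OF gx] abs_divide frac_le)
    moreover have "extended_velocity T \<Gamma> \<Phi> \<Omega> \<phi> \<delta> flow v x t
      = normal_velocity T \<phi> x t *\<^sub>R unit_normal \<phi> x t + (w - (unit_normal \<phi> x t \<bullet> w) *\<^sub>R unit_normal \<phi> x t)"
      using x by (simp add: extended_velocity_def extend_eq w_def y_def Let_def)
    ultimately show ?thesis using vy norm_triangle_ineq by (smt (verit))
  qed
  then have "norm (extended_velocity T \<Gamma> \<Phi> \<Omega> \<phi> \<delta> flow v x t) \<le> \<bar>c2 / c0 + V0\<bar>"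
    if "t \<in> {0..T}" "x \<in> strip \<Omega> \<phi> \<delta> t" for t x
    using that by (meson abs_ge_self order_trans)
  then show ?thesis by (intro exI[of _ "\<bar>c2 / c0 + V0\<bar>"]) auto
qed

lemma gradient_field_lipschitz:
  assumes t: "t \<in> {0..T}" and seg: "closed_segment x y \<subseteq> strip \<Omega> \<phi> \<delta>0 t"
  shows "norm (level_grad t x /\<^sub>R (norm (level_grad t x))\<^sup>2
      - level_grad t y /\<^sub>R (norm (level_grad t y))\<^sup>2) \<le> c2 / c0\<^sup>2 * dist x y"
    and "norm (level_grad t x /\<^sub>R norm (level_grad t x)
      - level_grad t y /\<^sub>R norm (level_grad t y)) \<le> 2 * c2 / c0 * dist x y"
proof -
  define a b where "a = level_grad t x" and "b = level_grad t y"
  have "x \<in> strip \<Omega> \<phi> \<delta>0 t" "y \<in> strip \<Omega> \<phi> \<delta>0 t" using seg by auto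
  then have ab: "c0 \<le> norm a" "c0 \<le> norm b" unfolding a_def b_def using phi_bounds[OF t] by auto
  then have nz: "a \<noteq> 0" "b \<noteq> 0" using constants by auto
  have d: "norm (a - b) \<le> c2 * dist x y" unfolding a_def b_def by (rule grad_phi_lipschitz[OF t seg])
  have c: "0 < c0" "0 < c2" using constants by auto
  have "norm (a /\<^sub>R (norm a)\<^sup>2 - b /\<^sub>R (norm b)\<^sup>2) = norm (a - b) / (norm a * norm b)"
    by (rule norm_inversion_diff[OF nz])
  also have "\<dots> \<le> c2 * dist x y / (c0 * c0)"
    using d ab c by (intro frac_le mult_mono) auto
  finally show "norm (a /\<^sub>R (norm a)\<^sup>2 - b /\<^sub>R (norm b)\<^sup>2) \<le> c2 / c0\<^sup>2 * dist x y"
    by (simp add: power2_eq_square)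
  have "norm (a /\<^sub>R norm a - b /\<^sub>R norm b) \<le> 2 * norm (a - b) / norm a"
    by (rule norm_normalize_diff[OF nz])
  also have "\<dots> \<le> 2 * (c2 * dist x y) / c0" using d ab c by (intro frac_le mult_mono) auto
  finally show "norm (a /\<^sub>R norm a - b /\<^sub>R norm b) \<le> 2 * c2 / c0 * dist x y" by simp
qed

lemma segment_in_strip:
  assumes t: "t \<in> {0..T}" and x: "x \<in> \<Omega>" and room: "\<bar>\<phi> x t\<bar> + c1 * dist x y < \<delta>0"
  shows "closed_segment x y \<subseteq> strip \<Omega> \<phi> \<delta>0 t"
proof
  fix w assume "w \<in> closed_segment x y"
  then have "dist x w \<le> dist x y" by (metis dist_in_closed_segment dist_commute)
  then have "c1 * dist x w \<le> c1 * dist x y" using constants by (intro mult_left_mono) auto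
  then show "w \<in> strip \<Omega> \<phi> \<delta>0 t" using near_strip(1)[OF t x] room by simp
qed

lemma flow_speed:
  assumes P: "P \<in> \<Gamma> 0" and t: "t \<in> {0..T}" and s: "s \<in> {-\<delta><..<\<delta>}" "s' \<in> {-\<delta><..<\<delta>}"
  shows "norm (flow P t s - flow P t s') \<le> 1 / c0 * \<bar>s - s'\<bar>"
proof -
  let ?g = "\<lambda>s. level_grad t (flow P t s)"
  have aux: "onorm (\<lambda>h. h *\<^sub>R X) \<le> B" if "norm X \<le> B" for X :: 'a and B
  proof (rule onorm_bound)
    show "0 \<le> B" using that norm_ge_zero order_trans by blast
    show "norm (h *\<^sub>R X) \<le> B * norm h" for h :: real
      using mult_left_mono[OF that, of "\<bar>h\<bar>"] by (simp add: mult.commute)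
  qed
  have "norm (flow P t s - flow P t s') \<le> 1 / c0 * norm (s - s')"
  proof (rule differentiable_bound[OF _ _ _ s(1) s(2)])
    show "convex {-\<delta><..<\<delta>}" by simp
    fix r assume r: "r \<in> {-\<delta><..<\<delta>}"
    show "(flow P t has_derivative (\<lambda>h. h *\<^sub>R (?g r /\<^sub>R (norm (?g r))\<^sup>2))) (at r within {-\<delta><..<\<delta>})"
      using phi_flow(3)[OF P t r] by (simp add: has_vector_derivative_def has_derivative_at_withinI)
    have "flow P t r \<in> strip \<Omega> \<phi> \<delta>0 t" using phi_flow(4)[OF P t r] delta by (auto simp: strip_def)
    then have "c0 \<le> norm (?g r)" using phi_bounds[OF t] by blast
    moreover have "norm (?g r /\<^sub>R (norm (?g r))\<^sup>2) = 1 / norm (?g r)"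
    proof -
      have "0 < norm (?g r)" using calculation constants by linarith
      then show ?thesis unfolding norm_scaleR by (simp add: power2_eq_square divide_inverse)
    qed
    ultimately have "norm (?g r /\<^sub>R (norm (?g r))\<^sup>2) \<le> 1 / c0" using constants by (simp add: frac_le)
    then show "onorm (\<lambda>h. h *\<^sub>R (?g r /\<^sub>R (norm (?g r))\<^sup>2)) \<le> 1 / c0"
      by (rule aux)
  qed
  then show ?thesis by simp
qed

text \<open>Two flow lines obey the same equation, whose right-hand side has the Lipschitz constant \<open>c2
  / c0\<^sup>2\<close> along segments within the \<open>\<delta>0\<close>-strip. Points of the
  \<open>\<delta>\<close>-strip closer than \<open>(\<delta>0 - \<delta>) / c1\<close> are joined
  by such a segment.\<close>

lemma flow_separation:
  defines "E \<equiv> exp (c2 / c0\<^sup>2 * \<delta>)"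
  assumes P: "P \<in> \<Gamma> 0" and Q: "Q \<in> \<Gamma> 0" and t: "t \<in> {0..T}" and s: "s \<in> {-\<delta><..<\<delta>}"
    and close: "norm (\<Phi> P t - \<Phi> Q t) * E < (\<delta>0 - \<delta>) / c1"
  shows "norm (flow P t s - flow Q t s) \<le> norm (\<Phi> P t - \<Phi> Q t) * E"
proof -
  let ?L = "c2 / c0\<^sup>2"
  let ?X = "\<lambda>x. level_grad t x /\<^sub>R (norm (level_grad t x))\<^sup>2"
  \<comment> \<open>For negative \<open>s\<close> the flow is followed backwards.\<close>
  define \<sigma> :: real where "\<sigma> = (if 0 \<le> s then 1 else -1)"
  define b where "b = \<bar>s\<bar>"
  have sb: "\<sigma> * b = s" "0 \<le> b" "\<bar>\<sigma>\<bar> = 1" by (auto simp: \<sigma>_def b_def)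
  have c: "0 < c1" "0 \<le> ?L" using constants by auto
  have "?L * b \<le> ?L * \<delta>" using s c(2) by (intro mult_left_mono) (auto simp: b_def)
  then have Eb: "exp (?L * b) \<le> E" unfolding E_def by simp
  have rs: "\<sigma> * r \<in> {-\<delta><..<\<delta>}" if "r \<in> {0..b}" for r
    using that s by (auto simp: \<sigma>_def b_def split: if_splits)
  have der: "((\<lambda>r. flow R t (\<sigma> * r)) has_vector_derivative (\<sigma> *\<^sub>R ?X (flow R t (\<sigma> * r)))) (at r)"
    if R: "R \<in> \<Gamma> 0" and r: "r \<in> {0..b}" for R r
  proof -
    have 1: "((\<lambda>r. \<sigma> * r) has_vector_derivative \<sigma>) (at r)"
      by (auto intro!: derivative_eq_intros simp: has_vector_derivative_def)
    show ?thesis using vector_diff_chain_at[OF 1 phi_flow(3)[OF R t rs[OF r]]] by (simp add: o_def)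
  qed
  have "norm (flow P t (\<sigma> * b) - flow Q t (\<sigma> * b)) \<le> norm (flow P t (\<sigma> * 0) - flow Q t (\<sigma> * 0)) * exp (?L * b)"
  proof (rule curve_divergence_bound[where \<eta> = "(\<delta>0 - \<delta>) / c1", OF sb(2) c(2) der[OF P] der[OF Q]])
    fix r assume r: "r \<in> {0..b}" and near: "norm (flow P t (\<sigma> * r) - flow Q t (\<sigma> * r)) < (\<delta>0 - \<delta>) / c1"
    have "c1 * dist (flow P t (\<sigma> * r)) (flow Q t (\<sigma> * r)) < \<delta>0 - \<delta>"
      using near c by (simp add: dist_norm pos_less_divide_eq mult.commute)
    moreover have "\<bar>\<phi> (flow P t (\<sigma> * r)) t\<bar> < \<delta>" using phi_flow(2)[OF P t rs[OF r]] rs[OF r] by auto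
    ultimately have "closed_segment (flow P t (\<sigma> * r)) (flow Q t (\<sigma> * r)) \<subseteq> strip \<Omega> \<phi> \<delta>0 t"
      by (intro segment_in_strip[OF t phi_flow(1)[OF P t rs[OF r]]]) auto
    from gradient_field_lipschitz(1)[OF t this]
    have "norm (?X (flow P t (\<sigma> * r)) - ?X (flow Q t (\<sigma> * r))) \<le> ?L * norm (flow P t (\<sigma> * r) - flow Q t (\<sigma> * r))"
      by (simp add: dist_norm)
    then show "norm (\<sigma> *\<^sub>R ?X (flow P t (\<sigma> * r)) - \<sigma> *\<^sub>R ?X (flow Q t (\<sigma> * r)))
        \<le> ?L * norm (flow P t (\<sigma> * r) - flow Q t (\<sigma> * r))"
      unfolding scaleR_diff_right[symmetric] norm_scaleR using sb(3) by simp
  next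
    have "norm (\<Phi> P t - \<Phi> Q t) * exp (?L * b) \<le> norm (\<Phi> P t - \<Phi> Q t) * E"
      using Eb by (intro mult_left_mono) auto
    then show "norm (flow P t (\<sigma> * 0) - flow Q t (\<sigma> * 0)) * exp (?L * b) < (\<delta>0 - \<delta>) / c1"
      using close phi_flow(5)[OF P t s] phi_flow(5)[OF Q t s] by simp
  qed
  also have "\<dots> \<le> norm (\<Phi> P t - \<Phi> Q t) * E"
    using Eb phi_flow(5)[OF P t s] phi_flow(5)[OF Q t s] by (simp add: mult_left_mono)
  finally show ?thesis by (simp add: sb(1))
qed

lemma flow_lipschitz:
  "\<exists>\<kappa>>0. \<exists>\<eta>>0. \<forall>t\<in>{0..T}. \<forall>P\<in>\<Gamma> 0. \<forall>Q\<in>\<Gamma> 0. \<forall>s\<in>{-\<delta><..<\<delta>}. \<forall>s'\<in>{-\<delta><..<\<delta>}.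
     norm (\<Phi> P t - \<Phi> Q t) < \<eta> \<longrightarrow>
     norm (flow P t s - flow Q t s') \<le> \<kappa> * (norm (\<Phi> P t - \<Phi> Q t) + \<bar>s - s'\<bar>)"
proof -
  define E where "E = exp (c2 / c0\<^sup>2 * \<delta>)"
  have E: "0 < E" by (simp add: E_def)
  define \<eta> where "\<eta> = (\<delta>0 - \<delta>) / c1 / E"
  define \<kappa> where "\<kappa> = E + 1 / c0"
  have c: "0 < c0" "0 < c1" using constants by auto
  have pos: "0 < \<eta>" "0 < \<kappa>" using c E delta by (auto simp: \<eta>_def \<kappa>_def intro: add_pos_pos)
  show ?thesis
  proof (rule exI[of _ \<kappa>], rule conjI, rule pos(2), rule exI[of _ \<eta>], rule conjI, rule pos(1), intro ballI impI)
    fix t P Q s s' assume a: "t \<in> {0..T}" "P \<in> \<Gamma> 0" "Q \<in> \<Gamma> 0" "s \<in> {-\<delta><..<\<delta>}" "s' \<in> {-\<delta><..<\<delta>}"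
      "norm (\<Phi> P t - \<Phi> Q t) < \<eta>"
    have "norm (\<Phi> P t - \<Phi> Q t) * E < (\<delta>0 - \<delta>) / c1"
      using a(6) by (simp only: \<eta>_def pos_less_divide_eq[OF E])
    then have 1: "norm (flow P t s - flow Q t s) \<le> norm (\<Phi> P t - \<Phi> Q t) * E"
      unfolding E_def using a by (intro flow_separation) auto
    have 2: "norm (flow Q t s - flow Q t s') \<le> 1 / c0 * \<bar>s - s'\<bar>" using a by (intro flow_speed) auto
    have "norm (flow P t s - flow Q t s') \<le> norm (flow P t s - flow Q t s) + norm (flow Q t s - flow Q t s')"
      using norm_triangle_ineq[of "flow P t s - flow Q t s" "flow Q t s - flow Q t s'"] by simp
    also have "\<dots> \<le> E * norm (\<Phi> P t - \<Phi> Q t) + 1 / c0 * \<bar>s - s'\<bar>" using 1 2 by (simp add: mult.commute)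
    also have "\<dots> \<le> \<kappa> * norm (\<Phi> P t - \<Phi> Q t) + \<kappa> * \<bar>s - s'\<bar>"
      using c E by (intro add_mono mult_right_mono) (auto simp: \<kappa>_def)
    finally show "norm (flow P t s - flow Q t s') \<le> \<kappa> * (norm (\<Phi> P t - \<Phi> Q t) + \<bar>s - s'\<bar>)"
      by (simp add: distrib_left)
  qed
qed

end

section \<open>Hausdorff measure of Borel sets\<close>

definition hausdorff_weight :: "nat \<Rightarrow> 'a::metric_space set \<Rightarrow> ennreal" where
  "hausdorff_weight n C = ennreal (unit_ball_vol (real n) * (diameter C / 2) ^ n)"

definition hausdorff_covers :: "real \<Rightarrow> 'a::metric_space set \<Rightarrow> (nat \<Rightarrow> 'a set) set" where
  "hausdorff_covers d A = {C. A \<subseteq> (\<Union>i. C i) \<and> (\<forall>i. bounded (C i) \<and> diameter (C i) \<le> d)}"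

text \<open>The size-\<open>d\<close> approximation, whose supremum over \<open>d\<close> is the Hausdorff
  outer measure.\<close>

definition hausdorff_content :: "nat \<Rightarrow> real \<Rightarrow> 'a::metric_space set \<Rightarrow> ennreal" where
  "hausdorff_content n d A = (INF C\<in>hausdorff_covers d A. \<Sum>i. hausdorff_weight n (C i))"

lemma hausdorff_outer_eq_SUP: "hausdorff_outer n A = (SUP d\<in>{0<..}. hausdorff_content n d A)"
  by (simp add: hausdorff_outer_def hausdorff_content_def hausdorff_covers_def hausdorff_weight_def)

lemma hausdorff_content_le_outer: "0 < d \<Longrightarrow> hausdorff_content n d A \<le> hausdorff_outer n A"
  unfolding hausdorff_outer_eq_SUP by (intro SUP_upper) auto

lemma hausdorff_weight_empty: "1 \<le> n \<Longrightarrow> hausdorff_weight n {} = 0"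
  by (simp add: hausdorff_weight_def power_0_left)

lemma hausdorff_content_mono: "A \<subseteq> B \<Longrightarrow> hausdorff_content n d A \<le> hausdorff_content n d B"
  unfolding hausdorff_content_def by (rule INF_superset_mono) (auto simp: hausdorff_covers_def)

lemma hausdorff_content_antimono: "d \<le> d' \<Longrightarrow> hausdorff_content n d' A \<le> hausdorff_content n d A"
  unfolding hausdorff_content_def
  by (rule INF_superset_mono) (auto simp: hausdorff_covers_def intro: order_trans)

lemma hausdorff_content_empty:
  assumes "1 \<le> n" "0 < d" shows "hausdorff_content n d {} = 0"
proof -
  have "hausdorff_content n d ({} :: 'a set) \<le> (\<Sum>i. hausdorff_weight n ((\<lambda>i::nat. {} :: 'a set) i))"
    unfolding hausdorff_content_def using assms by (intro INF_lower) (auto simp: hausdorff_covers_def)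
  then show ?thesis using assms by (simp add: hausdorff_weight_empty)
qed

lemma hausdorff_content_countably_subadditive:
  fixes A :: "nat \<Rightarrow> 'a::metric_space set"
  shows "hausdorff_content n d (\<Union>i. A i) \<le> (\<Sum>i. hausdorff_content n d (A i))"
proof (rule ennreal_le_epsilon)
  fix e :: real assume e: "0 < e" and fin: "(\<Sum>i. hausdorff_content n d (A i)) < top"
  have fi: "hausdorff_content n d (A i) < top" for i
    using fin by (meson ennreal_suminf_lessD)
  define g where "g i = e * (1 / 2) ^ Suc i" for i
  have g: "0 < g i" for i using e by (simp add: g_def)
  have "\<exists>C\<in>hausdorff_covers d (A i). (\<Sum>j. hausdorff_weight n (C j)) < hausdorff_content n d (A i) + ennreal (g i)" for i
  proof -
    have "hausdorff_content n d (A i) < hausdorff_content n d (A i) + ennreal (g i)"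
      using fi[of i] g[of i] by (cases "hausdorff_content n d (A i)") (auto simp: ennreal_plus[symmetric] ennreal_less_iff simp del: ennreal_plus)
    then show ?thesis by (subst (asm) (1) hausdorff_content_def) (simp add: INF_less_iff)
  qed
  then obtain C where C: "\<And>i. C i \<in> hausdorff_covers d (A i)"
    "\<And>i. (\<Sum>j. hausdorff_weight n (C i j)) < hausdorff_content n d (A i) + ennreal (g i)" by metis
  define D where "D k = C (fst (prod_decode k)) (snd (prod_decode k))" for k
  have "D \<in> hausdorff_covers d (\<Union>i. A i)"
    unfolding hausdorff_covers_def
  proof (intro CollectI conjI subsetI allI)
    fix x assume "x \<in> (\<Union>i. A i)"
    then obtain i where "x \<in> A i" by blast
    then obtain j where "x \<in> C i j" using C(1)[of i] unfolding hausdorff_covers_def by blast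
    then have "x \<in> D (prod_encode (i, j))" by (simp add: D_def)
    then show "x \<in> (\<Union>k. D k)" by blast
  next
    fix k show "bounded (D k)" "diameter (D k) \<le> d"
      using C(1)[of "fst (prod_decode k)"] by (auto simp: D_def hausdorff_covers_def)
  qed
  then have "hausdorff_content n d (\<Union>i. A i) \<le> (\<Sum>k. hausdorff_weight n (D k))"
    unfolding hausdorff_content_def by (rule INF_lower)
  also have "(\<Sum>k. hausdorff_weight n (D k)) = (\<Sum>i. \<Sum>j. hausdorff_weight n (C i j))"
  proof -
    have "(\<Sum>k. (\<lambda>(i, j). hausdorff_weight n (C i j)) (prod_decode k)) = (\<Sum>i. \<Sum>j. hausdorff_weight n (C i j))"
      by (rule suminf_ennreal_2dimen) simp
    then show ?thesis by (simp add: D_def case_prod_beta)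
  qed
  also have "\<dots> \<le> (\<Sum>i. hausdorff_content n d (A i) + ennreal (g i))"
    using C(2) by (intro suminf_le) (auto intro: less_imp_le)
  also have "\<dots> = (\<Sum>i. hausdorff_content n d (A i)) + (\<Sum>i. ennreal (g i))"
    by (intro suminf_add[symmetric]) auto
  also have "(\<Sum>i. ennreal (g i)) = ennreal e"
  proof (rule suminf_ennreal_eq)
    show "g sums e" unfolding g_def using sums_mult[OF power_half_series, of e] by simp
  qed (use g less_imp_le in blast)
  finally show "hausdorff_content n d (\<Union>i. A i) \<le> (\<Sum>i. hausdorff_content n d (A i)) + ennreal e" .
qed

lemma hausdorff_outer_mono: "A \<subseteq> B \<Longrightarrow> hausdorff_outer n A \<le> hausdorff_outer n B"
  unfolding hausdorff_outer_eq_SUP by (intro SUP_mono) (auto intro: hausdorff_content_mono)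

lemma hausdorff_outer_countably_subadditive:
  "hausdorff_outer n (\<Union>i. A i) \<le> (\<Sum>i. hausdorff_outer n (A i))"
proof -
  have "hausdorff_content n d (\<Union>i. A i) \<le> (\<Sum>i. hausdorff_outer n (A i))" if "0 < d" for d
    by (rule order_trans[OF hausdorff_content_countably_subadditive])
      (intro suminf_le hausdorff_content_le_outer that, auto)
  then show ?thesis unfolding hausdorff_outer_eq_SUP[of n "\<Union>i. A i"] by (intro SUP_least) auto
qed

lemma hausdorff_outer_empty: "1 \<le> n \<Longrightarrow> hausdorff_outer n {} = 0"
  unfolding hausdorff_outer_eq_SUP by (simp add: hausdorff_content_empty)

text \<open>A covering by sets of diameter below the distance of \<open>A\<close> and \<open>B\<close> splits
  into a covering of \<open>A\<close> and one of \<open>B\<close>.\<close>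

lemma hausdorff_outer_separated:
  fixes A B :: "'a::metric_space set"
  assumes n: "1 \<le> n" and r: "0 < r" and sep: "\<And>a b. a \<in> A \<Longrightarrow> b \<in> B \<Longrightarrow> r \<le> dist a b"
  shows "hausdorff_outer n A + hausdorff_outer n B \<le> hausdorff_outer n (A \<union> B)"
proof -
  have small: "hausdorff_content n d A + hausdorff_content n d B \<le> hausdorff_content n d (A \<union> B)"
    if d: "0 < d" "d < r" for d
    unfolding hausdorff_content_def[of n d "A \<union> B"]
  proof (rule INF_greatest)
    fix C :: "nat \<Rightarrow> 'a set" assume C: "C \<in> hausdorff_covers d (A \<union> B)"
    define CA where "CA i = (if C i \<inter> A = {} then {} else C i)" for i
    define CB where "CB i = (if C i \<inter> B = {} then {} else C i)" for i
    have "CA \<in> hausdorff_covers d A" "CB \<in> hausdorff_covers d B"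
      using C d by (auto simp: hausdorff_covers_def CA_def CB_def) blast+
    then have "hausdorff_content n d A + hausdorff_content n d B
        \<le> (\<Sum>i. hausdorff_weight n (CA i)) + (\<Sum>i. hausdorff_weight n (CB i))"
      unfolding hausdorff_content_def by (intro add_mono INF_lower)
    also have "\<dots> = (\<Sum>i. hausdorff_weight n (CA i) + hausdorff_weight n (CB i))"
      by (intro suminf_add) auto
    also have "\<dots> \<le> (\<Sum>i. hausdorff_weight n (C i))"
    proof (intro suminf_le)
      fix i
      have "C i \<inter> A = {} \<or> C i \<inter> B = {}"
      proof (rule ccontr)
        assume "\<not> ?thesis"
        then obtain a b where ab: "a \<in> A" "b \<in> B" "a \<in> C i" "b \<in> C i" by blast
        then have "dist a b \<le> diameter (C i)"
          using C by (intro diameter_bounded_bound) (auto simp: hausdorff_covers_def)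
        also have "\<dots> \<le> d" using C by (auto simp: hausdorff_covers_def)
        finally show False using sep[OF ab(1,2)] d by simp
      qed
      then show "hausdorff_weight n (CA i) + hausdorff_weight n (CB i) \<le> hausdorff_weight n (C i)"
        using n by (auto simp: CA_def CB_def hausdorff_weight_empty)
    qed auto
    finally show "hausdorff_content n d A + hausdorff_content n d B \<le> (\<Sum>i. hausdorff_weight n (C i))" .
  qed
  have le: "hausdorff_content n d A + hausdorff_content n d' B \<le> hausdorff_outer n (A \<union> B)"
    if "0 < d" "0 < d'" for d d'
  proof -
    define e where "e = min (r / 2) (min d d')"
    have e: "0 < e" "e < r" "e \<le> d" "e \<le> d'" using r that by (auto simp: e_def)
    have "hausdorff_content n d A + hausdorff_content n d' B \<le> hausdorff_content n e A + hausdorff_content n e B"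
      using e by (intro add_mono hausdorff_content_antimono) auto
    also have "\<dots> \<le> hausdorff_content n e (A \<union> B)" using e by (intro small)
    also have "\<dots> \<le> hausdorff_outer n (A \<union> B)" using e by (intro hausdorff_content_le_outer)
    finally show ?thesis .
  qed
  have "hausdorff_outer n A + hausdorff_outer n B
      = (SUP d\<in>{0<..}. hausdorff_content n d A + hausdorff_outer n B)"
    unfolding hausdorff_outer_eq_SUP[of n A] by (rule ennreal_SUP_add_left[symmetric]) auto
  also have "\<dots> \<le> hausdorff_outer n (A \<union> B)"
  proof (rule SUP_least)
    fix d :: real assume d: "d \<in> {0<..}"
    have "hausdorff_content n d A + hausdorff_outer n B
      = (SUP d'\<in>{0<..}. hausdorff_content n d A + hausdorff_content n d' B)"
      unfolding hausdorff_outer_eq_SUP[of n B] by (rule ennreal_SUP_add_right) auto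
    also have "\<dots> \<le> hausdorff_outer n (A \<union> B)" using d le by (intro SUP_least) auto
    finally show "hausdorff_content n d A + hausdorff_outer n B \<le> hausdorff_outer n (A \<union> B)" .
  qed
  finally show ?thesis .
qed

text \<open>Caratheodory's criterion. The part of \<open>A - F\<close> at distance at least
  \<open>1/(k+1)\<close> from \<open>F\<close> is separated from \<open>A \<inter> F\<close>. The
  rest is a union of annuli; those of equal parity are separated from one another, so the sum of
  the measures of all annuli is at most \<open>2 \<mu>(A)\<close>, and its tail tends to zero.\<close>

lemma closed_caratheodory_measurable:
  fixes \<mu> :: "'a::metric_space set \<Rightarrow> ennreal"
  assumes empty: "\<mu> {} = 0" and mono: "\<And>A B. A \<subseteq> B \<Longrightarrow> \<mu> A \<le> \<mu> B"
    and csub: "\<And>A. \<mu> (\<Union>i::nat. A i) \<le> (\<Sum>i. \<mu> (A i))"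
    and metric: "\<And>A B r. 0 < r \<Longrightarrow> (\<And>a b. a \<in> A \<Longrightarrow> b \<in> B \<Longrightarrow> r \<le> dist a b) \<Longrightarrow> \<mu> A + \<mu> B \<le> \<mu> (A \<union> B)"
    and F: "closed F"
  shows "\<mu> (A \<inter> F) + \<mu> (A - F) = \<mu> A"
proof (rule antisym)
  have sub2: "\<mu> (A \<union> B) \<le> \<mu> A + \<mu> B" for A B
  proof -
    have "(\<Union>i. (\<lambda>i::nat. if i = 0 then A else if i = 1 then B else {}) i) = A \<union> B"
      by (auto split: if_splits)
    then have "\<mu> (A \<union> B) \<le> (\<Sum>i::nat. \<mu> (if i = 0 then A else if i = 1 then B else {}))"
      using csub[of "\<lambda>i. if i = 0 then A else if i = 1 then B else {}"] by simp
    also have "\<dots> = (\<Sum>i\<in>{0, 1::nat}. \<mu> (if i = 0 then A else if i = 1 then B else {}))"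
      by (rule suminf_finite) (auto simp: empty)
    finally show ?thesis by simp
  qed
  have "A = (A \<inter> F) \<union> (A - F)" by blast
  then show "\<mu> A \<le> \<mu> (A \<inter> F) + \<mu> (A - F)" using sub2 by metis
  show "\<mu> (A \<inter> F) + \<mu> (A - F) \<le> \<mu> A"
  proof (cases "F = {} \<or> \<mu> A = \<infinity>")
    case True then show ?thesis by (auto simp: empty)
  next
    case False
    then have Fne: "F \<noteq> {}" and fin: "\<mu> A < top" by (auto simp: less_top)
    define D where "D k = {x \<in> A - F. 1 / real (Suc k) \<le> infdist x F}" for k
    define R where "R k = D (Suc k) - D k" for k
    have DA: "D k \<subseteq> A" for k by (auto simp: D_def)
    have RA: "R k \<subseteq> A" for k using DA by (auto simp: R_def)
    have Rlo: "1 / real (Suc (Suc k)) \<le> infdist x F" and Rhi: "infdist x F < 1 / real (Suc k)"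
      if "x \<in> R k" for x k using that by (auto simp: R_def D_def)
    have Dmono: "D k \<subseteq> D l" if "k \<le> l" for k l
    proof -
      have "1 / real (Suc l) \<le> 1 / real (Suc k)" using that by (simp add: frac_le)
      then show ?thesis by (auto simp: D_def)
    qed
    have inner: "\<mu> (A \<inter> F) + \<mu> (D k) \<le> \<mu> A" for k
    proof -
      have "\<mu> (A \<inter> F) + \<mu> (D k) \<le> \<mu> ((A \<inter> F) \<union> D k)"
      proof (rule metric)
        show "0 < 1 / real (Suc k)" by simp
        fix a b assume "a \<in> A \<inter> F" "b \<in> D k"
        then show "1 / real (Suc k) \<le> dist a b"
          using infdist_le[of a F b] by (auto simp: D_def dist_commute intro: order_trans)
      qed
      also have "\<dots> \<le> \<mu> A" by (rule mono) (auto simp: D_def)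
      finally show ?thesis .
    qed
    have alternate: "(\<Sum>i<N. \<mu> (R (2 * i + m))) \<le> \<mu> (\<Union>i<N. R (2 * i + m))" for N m
    proof (induction N)
      case (Suc N)
      have "(\<Sum>i<Suc N. \<mu> (R (2 * i + m))) \<le> \<mu> (\<Union>i<N. R (2 * i + m)) + \<mu> (R (2 * N + m))"
        using Suc by (simp add: add_right_mono)
      also have "\<dots> \<le> \<mu> ((\<Union>i<N. R (2 * i + m)) \<union> R (2 * N + m))"
      proof (rule metric)
        \<comment> \<open>For \<open>N = 0\<close> the union is empty, and any positive number
          serves as a distance.\<close>
        let ?p = "1 / real (2 * N + m)" and ?q = "1 / real (Suc (2 * N + m))"
        show "0 < (if N = 0 then 1 else ?p - ?q)" by (cases "N = 0") (auto intro!: frac_less2)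
        fix a b assume "a \<in> (\<Union>i<N. R (2 * i + m))" and b: "b \<in> R (2 * N + m)"
        then obtain i where i: "i < N" "a \<in> R (2 * i + m)" by blast
        have "?p \<le> 1 / real (Suc (Suc (2 * i + m)))" using i(1) by (intro frac_le) auto
        also have "\<dots> \<le> infdist a F" by (rule Rlo[OF i(2)])
        also have "\<dots> \<le> infdist b F + dist a b" by (rule infdist_triangle)
        also have "infdist b F \<le> ?q" using Rhi[OF b] by simp
        finally show "(if N = 0 then 1 else ?p - ?q) \<le> dist a b" using i(1) by simp
      qed
      also have "(\<Union>i<N. R (2 * i + m)) \<union> R (2 * N + m) = (\<Union>i<Suc N. R (2 * i + m))"
        by (auto simp: less_Suc_eq)
      finally show ?case .
    qed (simp add: empty)
    have alt: "(\<Sum>i<N. \<mu> (R (2 * i + m))) \<le> \<mu> A" for N m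
      by (rule order_trans[OF alternate mono]) (use RA in blast)
    have dbl: "(\<Sum>i<2 * N. \<mu> (R i)) = (\<Sum>i<N. \<mu> (R (2 * i + 0))) + (\<Sum>i<N. \<mu> (R (2 * i + 1)))" for N
      by (induction N) (simp_all add: ac_simps)
    have "(\<Sum>i. \<mu> (R i)) \<le> 2 * \<mu> A"
      unfolding suminf_eq_SUP
    proof (rule SUP_least)
      fix N
      have "(\<Sum>i<N. \<mu> (R i)) \<le> (\<Sum>i<2 * N. \<mu> (R i))" by (rule sum_mono2) auto
      also have "\<dots> \<le> \<mu> A + \<mu> A" unfolding dbl by (intro add_mono alt)
      finally show "(\<Sum>i<N. \<mu> (R i)) \<le> 2 * \<mu> A" by (simp add: mult_2)
    qed
    also have "\<dots> < top" using fin by (simp add: ennreal_mult_less_top)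
    finally have sumR: "(\<Sum>i. \<mu> (R i)) < top" .
    have Rf: "\<mu> (R i) < top" for i using mono[OF RA] fin by (rule le_less_trans)
    define g where "g i = enn2real (\<mu> (R i))" for i
    have g: "\<mu> (R i) = ennreal (g i)" "0 \<le> g i" for i using Rf[of i] by (auto simp: g_def)
    have sg: "summable g" using sumR unfolding g(1) by (intro summable_suminf_not_top) (auto simp: g)
    show ?thesis
    proof (rule ennreal_le_epsilon)
      fix e :: real assume e: "0 < e"
      obtain k where k: "norm (\<Sum>i. g (i + k)) < e" using suminf_exist_split[OF e sg] by blast
      have "A - F \<subseteq> D k \<union> (\<Union>i. R (i + k))"
      proof
        fix x assume x: "x \<in> A - F"
        then have "infdist x F \<noteq> 0" using F Fne in_closed_iff_infdist_zero by blast
        then have "0 < infdist x F" by (metis infdist_nonneg less_eq_real_def)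
        then obtain l where "inverse (real (Suc l)) < infdist x F" using reals_Archimedean by blast
        then have "x \<in> D l" using x by (simp add: D_def inverse_eq_divide)
        show "x \<in> D k \<union> (\<Union>i. R (i + k))"
        proof (rule ccontr)
          assume not: "x \<notin> D k \<union> (\<Union>i. R (i + k))"
          have "x \<notin> D (k + i)" for i
          proof (induction i)
            case (Suc i)
            have "x \<notin> R (i + k)" using not by blast
            then show ?case using Suc by (auto simp: R_def add.commute)
          qed (use not in simp)
          then have "x \<notin> D (k + l)" .
          then show False using \<open>x \<in> D l\<close> Dmono[of l "k + l"] by auto
        qed
      qed
      then have "\<mu> (A - F) \<le> \<mu> (D k) + \<mu> (\<Union>i. R (i + k))" using mono sub2 order_trans by blast
      also have "\<mu> (\<Union>i. R (i + k)) \<le> (\<Sum>i. \<mu> (R (i + k)))" by (rule csub)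
      also have "\<dots> = ennreal (\<Sum>i. g (i + k))"
        unfolding g(1) by (rule suminf_ennreal2) (auto simp: g summable_ignore_initial_segment sg)
      also have "\<dots> \<le> ennreal e" using k by (intro ennreal_leI) simp
      finally have "\<mu> (A - F) \<le> \<mu> (D k) + ennreal e" by (simp add: add_left_mono)
      then have "\<mu> (A \<inter> F) + \<mu> (A - F) \<le> (\<mu> (A \<inter> F) + \<mu> (D k)) + ennreal e"
        by (simp add: add.assoc add_left_mono)
      also have "\<dots> \<le> \<mu> A + ennreal e" by (rule add_right_mono) (rule inner)
      finally show "\<mu> (A \<inter> F) + \<mu> (A - F) \<le> \<mu> A + ennreal e" .
    qed
  qed
qed

lemma sets_hausdorff_measure [simp, measurable_cong]: "sets (hausdorff_measure n) = sets borel"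
  unfolding hausdorff_measure_def using sets.sets_measure_of_eq[of borel] by simp

text \<open>By Caratheodory's criterion every Borel set is measurable for the outer measure. Hence the
  restriction to the Borel sets is countably additive, which excludes the degenerate case of
  \<^const>\<open>measure_of\<close>.\<close>

lemma emeasure_hausdorff_measure:
  fixes A :: "'a::metric_space set"
  assumes n: "1 \<le> n" and A: "A \<in> sets borel"
  shows "emeasure (hausdorff_measure n) A = hausdorff_outer n A"
proof -
  let ?\<mu> = "hausdorff_outer n :: 'a set \<Rightarrow> ennreal"
  interpret P: sigma_algebra UNIV "Pow UNIV :: 'a set set" by (rule sigma_algebra_Pow)
  have "outer_measure_space (Pow UNIV) ?\<mu>"
    unfolding outer_measure_space_def positive_def increasing_def countably_subadditive_def
    using hausdorff_outer_empty[OF n] hausdorff_outer_mono hausdorff_outer_countably_subadditive by auto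
  then have ms: "measure_space UNIV (lambda_system UNIV (Pow UNIV) ?\<mu>) ?\<mu>" by (rule P.caratheodory_lemma)
  interpret L: sigma_algebra UNIV "lambda_system UNIV (Pow UNIV) ?\<mu>"
    using ms by (simp add: measure_space_def)
  have "F \<in> lambda_system UNIV (Pow UNIV) ?\<mu>" if "closed F" for F
    unfolding lambda_system_def
  proof (intro CollectI conjI ballI)
    fix B
    show "?\<mu> (F \<inter> B) + ?\<mu> ((UNIV - F) \<inter> B) = ?\<mu> B"
      using closed_caratheodory_measurable[of ?\<mu> F B, OF hausdorff_outer_empty[OF n] hausdorff_outer_mono
          hausdorff_outer_countably_subadditive hausdorff_outer_separated[OF n] that]
      by (simp add: Int_commute Diff_eq)
  qed simp
  then have "UNIV - (- U) \<in> lambda_system UNIV (Pow UNIV) ?\<mu>" if "open U" for U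
    by (intro L.compl_sets) (use that in auto)
  then have "{U. open U} \<subseteq> lambda_system UNIV (Pow UNIV) ?\<mu>" by auto
  then have sub: "sets (borel :: 'a measure) \<subseteq> lambda_system UNIV (Pow UNIV) ?\<mu>"
  proof -
    have "sets (borel :: 'a measure) = sigma_sets UNIV {U. open U}"
      unfolding borel_def by (rule sets_measure_of) simp
    then show ?thesis using L.sigma_sets_subset \<open>{U. open U} \<subseteq> _\<close> by metis
  qed
  have "measure_space UNIV (sets borel) ?\<mu>"
    by (rule measure_down[OF ms _ sub]) (use sets.sigma_algebra_axioms[of "borel :: 'a measure"] in simp)
  then show ?thesis unfolding hausdorff_measure_def
    by (intro emeasure_measure_of_sigma) (use A in \<open>auto simp: measure_space_def\<close>)
qed

section \<open>Strip integrals of functions of the foot point\<close>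

lemma ennreal_mult_hausdorff_content_geI:
  fixes A :: "'a::metric_space set"
  assumes c: "0 < c" and le: "\<And>C. C \<in> hausdorff_covers d A \<Longrightarrow> m \<le> ennreal c * (\<Sum>i. hausdorff_weight n (C i))"
  shows "m \<le> ennreal c * hausdorff_content n d A"
proof -
  have "m / ennreal c \<le> hausdorff_content n d A"
    unfolding hausdorff_content_def
  proof (rule INF_greatest)
    fix C assume "C \<in> hausdorff_covers d A"
    then show "m / ennreal c \<le> (\<Sum>i. hausdorff_weight n (C i))"
      using le c by (intro divide_le_posI_ennreal) (auto simp: mult.commute)
  qed
  then have "ennreal c * (m / ennreal c) \<le> ennreal c * hausdorff_content n d A" by (rule mult_left_mono) simp
  then show ?thesis using c by (simp add: ennreal_times_divide ennreal_mult_divide_eq mult.commute[of _ m] ennreal_divide_times)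
qed

context moving_surface
begin

lemma foot_point_extension_measurable:
  assumes t: "t \<in> {0..T}"
  shows "(\<lambda>x. if x \<in> strip \<Omega> \<phi> \<delta> t then foot_point x t else 0) \<in> borel_measurable borel"
  by (rule borel_measurable_continuous_on_if)
    (use open_strip[OF t] foot_point_continuous[OF t] in auto)

lemma foot_point_preimage_borel:
  assumes t: "t \<in> {0..T}" and r: "r \<le> \<delta>" and A: "A \<in> sets borel"
  shows "{x \<in> strip \<Omega> \<phi> r t. foot_point x t \<in> A} \<in> sets borel"
proof -
  let ?f = "\<lambda>x. if x \<in> strip \<Omega> \<phi> \<delta> t then foot_point x t else 0"
  have "strip \<Omega> \<phi> r t \<inter> (?f -` A \<inter> space borel) \<in> sets borel"
    by (intro sets.Int measurable_sets[OF foot_point_extension_measurable[OF t] A] borel_open open_strip t)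
  moreover have "{x \<in> strip \<Omega> \<phi> r t. foot_point x t \<in> A} = strip \<Omega> \<phi> r t \<inter> (?f -` A \<inter> space borel)"
    using subsetD[OF strip_mono[OF r, of t]] by auto
  ultimately show ?thesis by simp
qed

text \<open>The tube over \<open>C\<close> is cut into slabs on which \<open>\<phi>\<close> varies by at most
  \<open>\<zeta>\<close>. As the flow is Lipschitz in foot point and level, each slab has diameter
  at most \<open>2 \<kappa> \<zeta>\<close>; about \<open>2 r / \<zeta>\<close> balls of this
  radius cover the tube.\<close>

lemma tube_volume:
  assumes t: "t \<in> {0..T}" and r: "0 < r" "r \<le> \<delta>" and \<kappa>: "0 < \<kappa>" and \<zeta>: "0 < \<zeta>" "\<zeta> \<le> r" "\<zeta> < \<eta>"
    and lip: "\<And>P Q s s'. P \<in> \<Gamma> 0 \<Longrightarrow> Q \<in> \<Gamma> 0 \<Longrightarrow> s \<in> {-\<delta><..<\<delta>} \<Longrightarrow> s' \<in> {-\<delta><..<\<delta>} \<Longrightarrow>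
      norm (\<Phi> P t - \<Phi> Q t) < \<eta> \<Longrightarrow>
      norm (flow P t s - flow Q t s') \<le> \<kappa> * (norm (\<Phi> P t - \<Phi> Q t) + \<bar>s - s'\<bar>)"
    and C: "bounded C" "diameter C \<le> \<zeta>" "closed C"
  shows "emeasure lborel {x \<in> strip \<Omega> \<phi> r t. foot_point x t \<in> C}
    \<le> ennreal (4 * unit_ball_vol (real (n + 1)) * (2 * \<kappa>) ^ (n + 1) * r * \<zeta> ^ n)"
proof -
  define N where "N = \<lceil>r / \<zeta>\<rceil>"
  define piece where "piece j = {x \<in> strip \<Omega> \<phi> r t. foot_point x t \<in> C \<and> \<lfloor>\<phi> x t / \<zeta>\<rfloor> = j}" for j :: int
  define ctr where "ctr j = (SOME x. x \<in> piece j)" for j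
  define V where "V = unit_ball_vol (real (n + 1)) * (2 * \<kappa> * \<zeta>) ^ (n + 1)"
  have V0: "0 \<le> V" using \<kappa> \<zeta> by (simp add: V_def)
  have close: "dist x y \<le> 2 * \<kappa> * \<zeta>" if x: "x \<in> piece j" and y: "y \<in> piece j" for x y j
  proof -
    have xs: "x \<in> strip \<Omega> \<phi> \<delta> t" "y \<in> strip \<Omega> \<phi> \<delta> t"
      using x y strip_mono[OF r(2)] by (auto simp: piece_def)
    define P Q where "P = base_point (\<Gamma> 0) \<delta> flow x t" and "Q = base_point (\<Gamma> 0) \<delta> flow y t"
    have PQ: "P \<in> \<Gamma> 0" "Q \<in> \<Gamma> 0" "flow P t (\<phi> x t) = x" "flow Q t (\<phi> y t) = y"
      unfolding P_def Q_def using base_point[OF t] xs by auto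
    have sx: "\<phi> x t \<in> {-\<delta><..<\<delta>}" "\<phi> y t \<in> {-\<delta><..<\<delta>}" using xs by (auto simp: strip_def)
    have ft: "\<Phi> P t \<in> C" "\<Phi> Q t \<in> C" using x y by (auto simp: piece_def foot_point_def P_def Q_def)
    have d: "norm (\<Phi> P t - \<Phi> Q t) \<le> \<zeta>"
      using diameter_bounded_bound[OF C(1) ft] C(2) by (simp add: dist_norm)
    have "\<bar>\<phi> x t / \<zeta> - \<phi> y t / \<zeta>\<bar> \<le> 1"
      using x y by (auto simp: piece_def) linarith
    then have e: "\<bar>\<phi> x t - \<phi> y t\<bar> \<le> \<zeta>"
      using \<zeta> by (simp add: diff_divide_distrib[symmetric] abs_divide)
    have "norm (flow P t (\<phi> x t) - flow Q t (\<phi> y t)) \<le> \<kappa> * (norm (\<Phi> P t - \<Phi> Q t) + \<bar>\<phi> x t - \<phi> y t\<bar>)"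
      using d \<zeta> by (intro lip PQ sx) auto
    also have "\<dots> \<le> \<kappa> * (\<zeta> + \<zeta>)" using d e \<kappa> by (intro mult_left_mono) auto
    finally show ?thesis by (simp add: PQ dist_norm algebra_simps)
  qed
  have sub: "{x \<in> strip \<Omega> \<phi> r t. foot_point x t \<in> C} \<subseteq> (\<Union>j\<in>{-N..<N}. cball (ctr j) (2 * \<kappa> * \<zeta>))"
  proof
    fix x assume x: "x \<in> {x \<in> strip \<Omega> \<phi> r t. foot_point x t \<in> C}"
    define j where "j = \<lfloor>\<phi> x t / \<zeta>\<rfloor>"
    have xp: "x \<in> piece j" using x by (simp add: piece_def j_def)
    then have "ctr j \<in> piece j" unfolding ctr_def by (rule someI)
    then have "x \<in> cball (ctr j) (2 * \<kappa> * \<zeta>)" using close xp by simp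
    moreover have "j \<in> {-N..<N}"
    proof -
      have "\<bar>\<phi> x t\<bar> < r" using x by (simp add: strip_def)
      then have "\<bar>\<phi> x t / \<zeta>\<bar> < r / \<zeta>" using \<zeta> by (simp add: abs_divide divide_strict_right_mono)
      moreover have "r / \<zeta> \<le> of_int N" by (simp add: N_def)
      ultimately have "\<bar>\<phi> x t / \<zeta>\<bar> < of_int N" by linarith
      then have "- of_int N < \<phi> x t / \<zeta>" "\<phi> x t / \<zeta> < of_int N" by (simp_all only: abs_less_iff) linarith+
      then show ?thesis unfolding j_def by (simp add: floor_less_iff le_floor_iff)
    qed
    ultimately show "x \<in> (\<Union>j\<in>{-N..<N}. cball (ctr j) (2 * \<kappa> * \<zeta>))" by blast
  qed
  have "emeasure lborel {x \<in> strip \<Omega> \<phi> r t. foot_point x t \<in> C}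
      \<le> emeasure lborel (\<Union>j\<in>{-N..<N}. cball (ctr j) (2 * \<kappa> * \<zeta>))"
    by (intro emeasure_mono sub) auto
  also have "\<dots> \<le> (\<Sum>j\<in>{-N..<N}. emeasure lborel (cball (ctr j) (2 * \<kappa> * \<zeta>)))"
    by (intro emeasure_subadditive_finite) auto
  also have "\<dots> = (\<Sum>j\<in>{-N..<N}. ennreal V)"
    using \<kappa> \<zeta> dim(2) by (intro sum.cong) (auto simp: emeasure_cball V_def)
  also have "\<dots> = ennreal (real (card {-N..<N}) * V)"
    using V0 by (simp add: ennreal_mult ennreal_of_nat_eq_real_of_nat)
  also have "\<dots> \<le> ennreal (4 * r / \<zeta> * V)"
  proof (intro ennreal_leI mult_right_mono V0)
    have "0 < r / \<zeta>" using r \<zeta> by simp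
    then have "- 1 < r / \<zeta>" by linarith
    then have N0: "0 \<le> N" by (simp add: N_def)
    \<comment> \<open>Rounding up is harmless because \<open>\<zeta> \<le> r\<close>.\<close>
    have "real (card {-N..<N}) = 2 * of_int N" using N0 by simp
    also have "of_int N \<le> r / \<zeta> + 1" by (simp add: N_def)
    also have "r / \<zeta> + 1 \<le> 2 * r / \<zeta>" using \<zeta> by (simp add: field_simps)
    finally show "real (card {-N..<N}) \<le> 4 * r / \<zeta>" by simp
  qed
  also have "4 * r / \<zeta> * V = 4 * unit_ball_vol (real (n + 1)) * (2 * \<kappa>) ^ (n + 1) * r * \<zeta> ^ n"
    using \<zeta> by (simp add: V_def power_mult_distrib)
  finally show ?thesis .
qed

text \<open>The upper half of the coarea formula, up to a constant. A covering of \<open>A\<close> by small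
  sets \<open>C\<^sub>i\<close> yields the covering of the tube over \<open>A\<close> by the tubes
  over \<open>C\<^sub>i\<close>, whose volumes are at most a constant times \<open>r (diameter
  C\<^sub>i)\<^sup>n\<close>.\<close>

lemma foot_point_measure_le:
  "\<exists>K>0. \<forall>t\<in>{0..T}. \<forall>r\<in>{0<..\<delta>}. \<forall>A\<in>sets borel.
    emeasure lborel {x \<in> strip \<Omega> \<phi> r t. foot_point x t \<in> A} \<le> ennreal (K * r) * emeasure (hausdorff_measure n) A"
proof -
  obtain \<kappa> \<eta> where k: "0 < \<kappa>" "0 < \<eta>"
    and lip0: "\<forall>t\<in>{0..T}. \<forall>P\<in>\<Gamma> 0. \<forall>Q\<in>\<Gamma> 0. \<forall>s\<in>{-\<delta><..<\<delta>}. \<forall>s'\<in>{-\<delta><..<\<delta>}.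
     norm (\<Phi> P t - \<Phi> Q t) < \<eta> \<longrightarrow>
     norm (flow P t s - flow Q t s') \<le> \<kappa> * (norm (\<Phi> P t - \<Phi> Q t) + \<bar>s - s'\<bar>)"
    using flow_lipschitz by blast
  define K0 where "K0 = 4 * unit_ball_vol (real (n + 1)) * (2 * \<kappa>) ^ (n + 1)"
  define K where "K = K0 * 2 ^ n / unit_ball_vol (real n)"
  have K0: "0 < K0" using k by (simp add: K0_def)
  have K: "0 < K" using K0 by (simp add: K_def)
  have uv: "unit_ball_vol (real n) \<noteq> 0" by (metis less_irrefl of_nat_0_le_iff unit_ball_vol_pos)
  have n1: "1 \<le> n" using dim(1) by auto
  have "emeasure lborel {x \<in> strip \<Omega> \<phi> r t. foot_point x t \<in> A} \<le> ennreal (K * r) * emeasure (hausdorff_measure n) A"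
    if t: "t \<in> {0..T}" and r: "0 < r" "r \<le> \<delta>" and A: "A \<in> sets borel" for t r A
  proof -
    define d0 where "d0 = min r \<eta>"
    have d0: "0 < d0" "d0 \<le> r" "d0 \<le> \<eta>" using r k by (auto simp: d0_def)
    have lip: "norm (flow P t s - flow Q t s') \<le> \<kappa> * (norm (\<Phi> P t - \<Phi> Q t) + \<bar>s - s'\<bar>)"
      if "P \<in> \<Gamma> 0" "Q \<in> \<Gamma> 0" "s \<in> {-\<delta><..<\<delta>}" "s' \<in> {-\<delta><..<\<delta>}" "norm (\<Phi> P t - \<Phi> Q t) < \<eta>" for P Q s s'
      using lip0 t that by blast
    \<comment> \<open>The diameter may be zero, so the tube estimate is applied with
      \<open>\<zeta>\<close> tending to it from above.\<close>
    have one: "emeasure lborel {x \<in> strip \<Omega> \<phi> r t. foot_point x t \<in> C} \<le> ennreal (K0 * r * diameter C ^ n)"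
      if C: "bounded C" "diameter C < d0" "closed C" for C
    proof (rule tendsto_lowerbound)
      let ?D = "diameter C"
      show "((\<lambda>\<zeta>. ennreal (K0 * r * \<zeta> ^ n)) \<longlongrightarrow> ennreal (K0 * r * ?D ^ n)) (at_right ?D)"
        by (intro tendsto_intros)
      show "\<forall>\<^sub>F \<zeta> in at_right ?D. emeasure lborel {x \<in> strip \<Omega> \<phi> r t. foot_point x t \<in> C} \<le> ennreal (K0 * r * \<zeta> ^ n)"
        using eventually_at_right_real[OF C(2)]
      proof eventually_elim
        fix \<zeta> assume z: "\<zeta> \<in> {?D<..<d0}"
        have "0 \<le> ?D" by (rule diameter_ge_0[OF C(1)])
        then show "emeasure lborel {x \<in> strip \<Omega> \<phi> r t. foot_point x t \<in> C} \<le> ennreal (K0 * r * \<zeta> ^ n)"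
          unfolding K0_def using z d0 C by (intro tube_volume[OF t r k(1) _ _ _ lip]) auto
      qed
    qed simp
    have "emeasure lborel {x \<in> strip \<Omega> \<phi> r t. foot_point x t \<in> A} \<le> ennreal (K * r) * hausdorff_content n (d0 / 2) A"
    proof (rule ennreal_mult_hausdorff_content_geI)
      show "0 < K * r" using K r by simp
      fix C assume C: "C \<in> hausdorff_covers (d0 / 2) A"
      \<comment> \<open>The closures have the same diameters, and their preimages are measurable.\<close>
      define B where "B i = {x \<in> strip \<Omega> \<phi> r t. foot_point x t \<in> closure (C i)}" for i
      have Bb: "B i \<in> sets borel" for i unfolding B_def by (rule foot_point_preimage_borel[OF t r(2)]) simp
      have "{x \<in> strip \<Omega> \<phi> r t. foot_point x t \<in> A} \<subseteq> (\<Union>i. B i)"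
      proof
        fix x assume x: "x \<in> {x \<in> strip \<Omega> \<phi> r t. foot_point x t \<in> A}"
        then obtain i where "foot_point x t \<in> C i" using C unfolding hausdorff_covers_def by blast
        then have "foot_point x t \<in> closure (C i)" using closure_subset by blast
        then show "x \<in> (\<Union>i. B i)" using x unfolding B_def by blast
      qed
      then have "emeasure lborel {x \<in> strip \<Omega> \<phi> r t. foot_point x t \<in> A} \<le> emeasure lborel (\<Union>i. B i)"
        using Bb by (intro emeasure_mono) auto
      also have "\<dots> \<le> (\<Sum>i. emeasure lborel (B i))" using Bb by (intro emeasure_subadditive_countably) auto
      also have "\<dots> \<le> (\<Sum>i. ennreal (K * r) * hausdorff_weight n (C i))"
      proof (intro suminf_le)
        fix i
        have b: "bounded (C i)" "diameter (C i) \<le> d0 / 2" using C by (auto simp: hausdorff_covers_def)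
        then have "diameter (closure (C i)) < d0" using d0 by (simp add: diameter_closure)
        then have "emeasure lborel (B i) \<le> ennreal (K0 * r * diameter (closure (C i)) ^ n)"
          unfolding B_def using b by (intro one) auto
        also have "\<dots> = ennreal (K * r * (unit_ball_vol (real n) * (diameter (C i) / 2) ^ n))"
          using b uv by (simp add: K_def diameter_closure power_divide mult.assoc)
        also have "\<dots> = ennreal (K * r) * hausdorff_weight n (C i)"
          unfolding hausdorff_weight_def using K r diameter_ge_0[OF b(1)] by (intro ennreal_mult) auto
        finally show "emeasure lborel (B i) \<le> ennreal (K * r) * hausdorff_weight n (C i)" .
      qed auto
      finally show "emeasure lborel {x \<in> strip \<Omega> \<phi> r t. foot_point x t \<in> A}
          \<le> ennreal (K * r) * (\<Sum>i. hausdorff_weight n (C i))" by simp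
    qed
    also have "\<dots> \<le> ennreal (K * r) * hausdorff_outer n A"
      using d0 by (intro mult_left_mono hausdorff_content_le_outer) auto
    finally show ?thesis by (simp add: emeasure_hausdorff_measure[OF n1 A])
  qed
  then show ?thesis using K by (intro exI[of _ K]) auto
qed

definition extended_square :: "real \<Rightarrow> real \<Rightarrow> ('a \<Rightarrow> real) \<Rightarrow> 'a \<Rightarrow> real" where
  "extended_square r t g x = indicator (strip \<Omega> \<phi> r t) x * (g (foot_point x t))\<^sup>2"

text \<open>The measure inequality for sets says that the image of Lebesgue measure on the strip under the
  foot point map is dominated by a multiple of \<open>r\<close> times the surface measure; this
  passes to integrals.\<close>

lemma extension_square_integral_le:
  "\<exists>K>0. \<forall>t\<in>{0..T}. \<forall>r\<in>{0<..\<delta>}. \<forall>g. square_integrable_on (hausdorff_measure n) (\<Gamma> t) g \<longrightarrow>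
    integrable lebesgue (extended_square r t g) \<and>
    integral\<^sup>L lebesgue (extended_square r t g) \<le> K * r * (LINT x:\<Gamma> t|hausdorff_measure n. (g x)\<^sup>2)"
proof -
  obtain K where K: "0 < K"
    and Kle: "\<forall>t\<in>{0..T}. \<forall>r\<in>{0<..\<delta>}. \<forall>A\<in>sets borel.
    emeasure lborel {x \<in> strip \<Omega> \<phi> r t. foot_point x t \<in> A} \<le> ennreal (K * r) * emeasure (hausdorff_measure n) A"
    using foot_point_measure_le by blast
  have main: "integrable lebesgue (extended_square r t g) \<and>
    integral\<^sup>L lebesgue (extended_square r t g) \<le> K * r * (LINT x:\<Gamma> t|hausdorff_measure n. (g x)\<^sup>2)"
    if t: "t \<in> {0..T}" and r: "0 < r" "r \<le> \<delta>" and g: "square_integrable_on (hausdorff_measure n) (\<Gamma> t) g" for t r g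
  proof -
    let ?H = "hausdorff_measure n :: 'a measure"
    let ?S = "strip \<Omega> \<phi> r t"
    let ?f = "\<lambda>x. if x \<in> strip \<Omega> \<phi> \<delta> t then foot_point x t else 0"
    have sub: "?S \<subseteq> strip \<Omega> \<phi> \<delta> t" by (rule strip_mono[OF r(2)])
    have S: "?S \<in> sets borel" using open_strip[OF t] by simp
    have f: "?f \<in> borel_measurable borel" by (rule foot_point_extension_measurable[OF t])
    define G where "G x = indicator (\<Gamma> t) x * g x" for x
    have Gm: "G \<in> borel_measurable borel"
    proof -
      have "G \<in> borel_measurable ?H" unfolding G_def[abs_def]
        using g by (simp add: square_integrable_on_def set_borel_measurable_def)
      then show ?thesis by (simp add: measurable_cong_sets[OF sets_hausdorff_measure refl])
    qed
    have Gsq: "indicator ?S x * (G (?f x))\<^sup>2 = indicator ?S x * (g (foot_point x t))\<^sup>2" for x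
      using sub foot_point_in_surface[OF t] by (auto simp: G_def split: split_indicator)
    have mb2: "(\<lambda>x. indicator ?S x * (G (?f x))\<^sup>2) \<in> borel_measurable borel"
      by (intro borel_measurable_times borel_measurable_power borel_measurable_indicator S measurable_compose[OF f Gm])
    define \<nu> where "\<nu> = distr (density lborel (indicator ?S)) borel ?f"
    have fm: "?f \<in> measurable (density lborel (indicator ?S)) borel" using f by simp
    have "\<nu> \<le> scale_measure (ennreal (K * r)) ?H"
    proof (subst le_measure)
      show "sets \<nu> = sets (scale_measure (ennreal (K * r)) ?H)" by (simp add: \<nu>_def)
      show "\<forall>A\<in>sets \<nu>. emeasure \<nu> A \<le> emeasure (scale_measure (ennreal (K * r)) ?H) A"
      proof
        fix A assume "A \<in> sets \<nu>"
        then have A: "A \<in> sets borel" by (simp add: \<nu>_def)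
        have fA: "?f -` A \<in> sets borel" using measurable_sets[OF f A] by simp
        have "emeasure \<nu> A = emeasure (density lborel (indicator ?S)) (?f -` A)"
          unfolding \<nu>_def using fm A by (subst emeasure_distr) auto
        also have "\<dots> = (\<integral>\<^sup>+x. indicator ?S x * indicator (?f -` A) x \<partial>lborel)"
          by (rule emeasure_density) (use fA S in auto)
        also have "\<dots> = (\<integral>\<^sup>+x. indicator (?S \<inter> ?f -` A) x \<partial>lborel)"
          by (simp only: indicator_inter_arith)
        also have "\<dots> = emeasure lborel (?S \<inter> ?f -` A)"
          by (rule nn_integral_indicator) (use fA S in auto)
        also have "?S \<inter> ?f -` A = {x \<in> ?S. foot_point x t \<in> A}" using sub by auto
        also have "emeasure lborel \<dots> \<le> ennreal (K * r) * emeasure ?H A" using Kle t r A by auto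
        finally show "emeasure \<nu> A \<le> emeasure (scale_measure (ennreal (K * r)) ?H) A" by simp
      qed
    qed
    then have le: "(\<integral>\<^sup>+x. ennreal ((G x)\<^sup>2) \<partial>\<nu>) \<le> (\<integral>\<^sup>+x. ennreal ((G x)\<^sup>2) \<partial>(scale_measure (ennreal (K * r)) ?H))"
      by (intro nn_integral_mono_measure) (auto simp: \<nu>_def)
    have "(\<integral>\<^sup>+x. ennreal ((G x)\<^sup>2) \<partial>\<nu>) = (\<integral>\<^sup>+x. ennreal ((G (?f x))\<^sup>2) \<partial>(density lborel (indicator ?S)))"
      unfolding \<nu>_def using fm Gm by (subst nn_integral_distr) auto
    also have "\<dots> = (\<integral>\<^sup>+x. indicator ?S x * ennreal ((G (?f x))\<^sup>2) \<partial>lborel)"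
      using S measurable_compose[OF f Gm] by (subst nn_integral_density) auto
    also have "\<dots> = (\<integral>\<^sup>+x. ennreal (indicator ?S x * (G (?f x))\<^sup>2) \<partial>lborel)"
      by (intro nn_integral_cong) (auto split: split_indicator)
    finally have lhs: "(\<integral>\<^sup>+x. ennreal ((G x)\<^sup>2) \<partial>\<nu>) = (\<integral>\<^sup>+x. ennreal (indicator ?S x * (G (?f x))\<^sup>2) \<partial>lborel)" .
    have Gint: "integrable ?H (\<lambda>x. (G x)\<^sup>2)"
    proof -
      have "integrable ?H (\<lambda>x. indicator (\<Gamma> t) x *\<^sub>R (g x)\<^sup>2)"
        using g by (simp add: square_integrable_on_def set_integrable_def)
      moreover have "(\<lambda>x. indicator (\<Gamma> t) x *\<^sub>R (g x)\<^sup>2) = (\<lambda>x. (G x)\<^sup>2)"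
        by (auto simp: G_def fun_eq_iff split: split_indicator)
      ultimately show ?thesis by simp
    qed
    have LI: "(LINT x:\<Gamma> t|?H. (g x)\<^sup>2) = integral\<^sup>L ?H (\<lambda>x. (G x)\<^sup>2)"
      unfolding set_lebesgue_integral_def
      by (intro Bochner_Integration.integral_cong) (auto simp: G_def split: split_indicator)
    have I0: "0 \<le> (LINT x:\<Gamma> t|?H. (g x)\<^sup>2)" unfolding LI by simp
    have "(\<integral>\<^sup>+x. ennreal ((G x)\<^sup>2) \<partial>(scale_measure (ennreal (K * r)) ?H))
        = ennreal (K * r) * (\<integral>\<^sup>+x. ennreal ((G x)\<^sup>2) \<partial>?H)"
      using Gint by (subst nn_integral_scale_measure) auto
    also have "(\<integral>\<^sup>+x. ennreal ((G x)\<^sup>2) \<partial>?H) = ennreal (LINT x:\<Gamma> t|?H. (g x)\<^sup>2)"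
      unfolding LI using Gint by (intro nn_integral_eq_integral) auto
    finally have rhs: "(\<integral>\<^sup>+x. ennreal ((G x)\<^sup>2) \<partial>(scale_measure (ennreal (K * r)) ?H))
        = ennreal (K * r * (LINT x:\<Gamma> t|?H. (g x)\<^sup>2))"
      using K r I0 by (simp add: ennreal_mult)
    have nn: "(\<integral>\<^sup>+x. ennreal (indicator ?S x * (G (?f x))\<^sup>2) \<partial>lborel) \<le> ennreal (K * r * (LINT x:\<Gamma> t|?H. (g x)\<^sup>2))"
      using le unfolding lhs rhs .
    have int: "integrable lborel (\<lambda>x. indicator ?S x * (G (?f x))\<^sup>2)"
    proof (rule integrableI_nonneg)
      show "(\<integral>\<^sup>+x. ennreal (indicator ?S x * (G (?f x))\<^sup>2) \<partial>lborel) < \<infinity>"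
        using nn by (rule le_less_trans) simp
    qed (use mb2 in auto)
    have "integral\<^sup>L lborel (\<lambda>x. indicator ?S x * (G (?f x))\<^sup>2) \<le> K * r * (LINT x:\<Gamma> t|?H. (g x)\<^sup>2)"
    proof -
      have "ennreal (integral\<^sup>L lborel (\<lambda>x. indicator ?S x * (G (?f x))\<^sup>2))
          = (\<integral>\<^sup>+x. ennreal (indicator ?S x * (G (?f x))\<^sup>2) \<partial>lborel)"
        using int by (intro nn_integral_eq_integral[symmetric]) auto
      then have "ennreal (integral\<^sup>L lborel (\<lambda>x. indicator ?S x * (G (?f x))\<^sup>2)) \<le> ennreal (K * r * (LINT x:\<Gamma> t|?H. (g x)\<^sup>2))"
        using nn by simp
      then show ?thesis using K r I0 by (subst (asm) ennreal_le_iff) auto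
    qed
    moreover have "integrable lebesgue (\<lambda>x. indicator ?S x * (G (?f x))\<^sup>2)"
      using int mb2 by (subst integrable_completion) auto
    moreover have "integral\<^sup>L lebesgue (\<lambda>x. indicator ?S x * (G (?f x))\<^sup>2) = integral\<^sup>L lborel (\<lambda>x. indicator ?S x * (G (?f x))\<^sup>2)"
      using mb2 by (intro integral_completion) auto
    ultimately show ?thesis unfolding extended_square_def[abs_def] Gsq[symmetric] by simp
  qed
  show ?thesis
    by (rule exI[of _ K], rule conjI, rule K, intro ballI allI impI, rule main) auto
qed

end

section \<open>Continuous piecewise affine functions\<close>

lemma affine_interpolation_on_simplex:
  fixes C :: "'a::euclidean_space set"
  assumes indep: "\<not> affine_dependent C"
  shows "\<exists>a b. \<forall>x\<in>C. a + b \<bullet> x = (g x :: real)"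
proof (cases "C = {}")
  case False
  then obtain x0 where x0: "x0 \<in> C" by blast
  let ?S = "(\<lambda>x. - x0 + x) ` (C - {x0})"
  have "independent ?S"
    using indep x0 affine_dependent_iff_dependent[of x0 "C - {x0}"] by (simp add: insert_absorb)
  then obtain h where h: "linear h" "\<And>w. w \<in> ?S \<Longrightarrow> h w = g (w + x0) - g x0"
    using linear_independent_extend[of ?S "\<lambda>w. g (w + x0) - g x0"] by blast
  define b where "b = adjoint h 1"
  have hb: "h w = b \<bullet> w" for w using adjoint_works[OF h(1), of w 1] by (simp add: b_def inner_commute)
  have "(g x0 - b \<bullet> x0) + b \<bullet> x = g x" if x: "x \<in> C" for x
  proof (cases "x = x0")
    case False
    then have "h (- x0 + x) = g x - g x0" using h(2)[of "- x0 + x"] x by auto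
    then show ?thesis by (simp add: hb inner_diff_right inner_add_right)
  qed simp
  then show ?thesis by blast
qed simp

lemma simplex_extreme_points:
  fixes K :: "'a::euclidean_space set"
  assumes "m simplex K"
  obtains C where "\<not> affine_dependent C" "K = convex hull C" "finite C"
    "\<And>x. x extreme_point_of K \<longleftrightarrow> x \<in> C"
proof -
  obtain C where C: "\<not> affine_dependent C" "K = convex hull C" using assms by (auto simp: simplex_def)
  show ?thesis
    using that[OF C aff_independent_finite[OF C(1)]] extreme_point_of_convex_hull_affine_independent[OF C(1)] C(2)
    by blast
qed

lemma simplex_compact_convex:
  fixes K :: "'a::euclidean_space set"
  assumes "m simplex K" shows "compact K" "convex K" "closed K"
proof -
  show "compact K" using assms by (auto simp: simplex_def compact_convex_hull finite_imp_compact dest: aff_independent_finite)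
  then show "closed K" by (rule compact_imp_closed)
  show "convex K" using assms by (auto simp: simplex_def)
qed

text \<open>Elements meet in common faces, and the extreme points of a face are extreme points of the element.\<close>

lemma vertices_in_element:
  fixes \<T> :: "'a::euclidean_space set set"
  assumes tri: "triangulation \<T>" and K: "K \<in> \<T>" and x: "x \<in> K" "x \<in> vertices \<T>"
  shows "x extreme_point_of K"
proof -
  obtain K' where K': "K' \<in> \<T>" "x extreme_point_of K'" using x(2) by (auto simp: vertices_def)
  have face: "(K \<inter> K') face_of K" using tri K K'(1) by (auto simp: triangulation_def)
  have "x extreme_point_of (K \<inter> K')" using K'(2) x(1) by (auto simp: extreme_point_of_def)
  then show ?thesis using extreme_point_of_face[OF face] by blast
qed

text \<open>A compact convex set is the convex hull of its extreme points.\<close>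

lemma affine_bound_from_extreme_points:
  fixes F :: "'a::euclidean_space set"
  assumes F: "compact F" "convex F" and x: "x \<in> F" and ext: "\<And>y. y extreme_point_of F \<Longrightarrow> (c::real) \<le> a + b \<bullet> y"
  shows "c \<le> a + b \<bullet> x"
proof -
  have "F = convex hull {y. y extreme_point_of F}" by (rule Krein_Milman_Minkowski[OF F])
  also have "\<dots> \<subseteq> {y. b \<bullet> y \<ge> c - a}"
  proof (rule hull_minimal)
    show "{y. y extreme_point_of F} \<subseteq> {y. b \<bullet> y \<ge> c - a}" using ext by (auto simp: algebra_simps)
  qed (rule convex_halfspace_ge)
  finally show ?thesis using x by auto
qed

lemma affine_eq_from_extreme_points:
  fixes F :: "'a::euclidean_space set"
  assumes F: "compact F" "convex F" and x: "x \<in> F"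
    and ext: "\<And>y. y extreme_point_of F \<Longrightarrow> (a::real) + b \<bullet> y = a' + b' \<bullet> y"
  shows "a + b \<bullet> x = a' + b' \<bullet> x"
proof -
  have "0 \<le> (a - a') + (b - b') \<bullet> x"
    by (rule affine_bound_from_extreme_points[OF F x]) (use ext in \<open>auto simp: inner_diff_left algebra_simps\<close>)
  moreover have "0 \<le> (a' - a) + (b' - b) \<bullet> x"
    by (rule affine_bound_from_extreme_points[OF F x]) (use ext in \<open>auto simp: inner_diff_left algebra_simps\<close>)
  ultimately show ?thesis by (simp add: inner_diff_left)
qed

text \<open>On each simplex the values at the affinely independent vertices determine an affine function. On
  the intersection of two simplices, a common face, the two affine functions agree at the extreme
  points and hence everywhere; so the pieces fit together continuously.\<close>

lemma piecewise_linear_interpolant_ex1: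
  fixes \<T> :: "'a::euclidean_space set set" and g :: "'a \<Rightarrow> real"
  assumes tri: "triangulation \<T>" and M: "M \<subseteq> \<T>"
  shows "\<exists>!w. (continuous_on (\<Union>M) w \<and> (\<forall>K\<in>M. \<exists>a b. \<forall>x\<in>K. w x = a + b \<bullet> x)) \<and>
    (\<forall>x\<in>\<Union>M \<inter> vertices \<T>. w x = g x) \<and> (\<forall>x. x \<notin> \<Union>M \<longrightarrow> w x = 0)"
proof (rule ex_ex1I)
  have simp: "\<exists>m. m simplex K" if "K \<in> M" for K using tri M that by (auto simp: triangulation_def)
  have cc: "compact K" "convex K" "closed K" if "K \<in> M" for K
    using simp[OF that] simplex_compact_convex by blast+
  have finM: "finite M" using tri M by (auto simp: triangulation_def intro: finite_subset)
  have vert: "x \<in> vertices \<T>" if "K \<in> M" "x extreme_point_of K" for x K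
    using that M by (auto simp: vertices_def)
  have "\<exists>p. \<forall>x. x extreme_point_of K \<longrightarrow> fst p + snd p \<bullet> x = g x" if K: "K \<in> M" for K
  proof -
    obtain m where "m simplex K" using simp[OF K] by blast
    then obtain C where C: "\<not> affine_dependent C" "\<And>x. x extreme_point_of K \<longleftrightarrow> x \<in> C"
      by (rule simplex_extreme_points) (rule that; assumption)
    obtain a b where ab: "\<forall>x\<in>C. a + b \<bullet> x = g x" using affine_interpolation_on_simplex[OF C(1), of g] by blast
    then show ?thesis by (intro exI[of _ "(a, b)"]) (simp add: C(2))
  qed
  then have "\<forall>K\<in>M. \<exists>p. \<forall>x. x extreme_point_of K \<longrightarrow> fst p + snd p \<bullet> x = g x" by blast
  from bchoice[OF this] obtain p where
    "\<forall>K\<in>M. \<forall>x. x extreme_point_of K \<longrightarrow> fst (p K) + snd (p K) \<bullet> x = g x" by blast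
  then have p: "fst (p K) + snd (p K) \<bullet> x = g x" if "K \<in> M" "x extreme_point_of K" for K x
    using that by blast
  define w where "w x = (if x \<in> \<Union>M then fst (p (SOME K. K \<in> M \<and> x \<in> K)) + snd (p (SOME K. K \<in> M \<and> x \<in> K)) \<bullet> x else 0)" for x
  have wK: "w x = fst (p K) + snd (p K) \<bullet> x" if K: "K \<in> M" and x: "x \<in> K" for K x
  proof -
    define J where "J = (SOME K. K \<in> M \<and> x \<in> K)"
    have J: "J \<in> M" "x \<in> J" using someI[of "\<lambda>K. K \<in> M \<and> x \<in> K" K] K x by (auto simp: J_def)
    have f1: "(J \<inter> K) face_of J" and f2: "(K \<inter> J) face_of K"
      using tri subsetD[OF M J(1)] subsetD[OF M K] unfolding triangulation_def by blast+
    have "fst (p J) + snd (p J) \<bullet> x = fst (p K) + snd (p K) \<bullet> x"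
    proof (rule affine_eq_from_extreme_points[of "J \<inter> K"])
      show "compact (J \<inter> K)" "convex (J \<inter> K)" using cc J K by (auto intro: convex_Int compact_Int)
      fix y assume y: "y extreme_point_of (J \<inter> K)"
      then have "y extreme_point_of J" "y extreme_point_of K"
        using extreme_point_of_face[OF f1] extreme_point_of_face[OF f2] by (auto simp: Int_commute)
      then show "fst (p J) + snd (p J) \<bullet> y = fst (p K) + snd (p K) \<bullet> y" using p J K by simp
    qed (use J x in auto)
    then show ?thesis using K x by (auto simp: w_def J_def)
  qed
  have "continuous_on (\<Union>M) w"
  proof -
    have "continuous_on (\<Union>K\<in>M. K) w"
    proof (rule continuous_on_closed_Union)
      fix K assume K: "K \<in> M"
      show "closed K" by (rule cc[OF K])
      have "continuous_on K (\<lambda>x. fst (p K) + snd (p K) \<bullet> x)" by (intro continuous_intros)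
      then show "continuous_on K w" by (rule continuous_on_cong[THEN iffD1, rotated -1]) (use wK[OF K] in auto)
    qed (rule finM)
    then show ?thesis by simp
  qed
  moreover have "\<forall>K\<in>M. \<exists>a b. \<forall>x\<in>K. w x = a + b \<bullet> x" using wK by blast
  moreover have "\<forall>x\<in>\<Union>M \<inter> vertices \<T>. w x = g x"
  proof
    fix x assume x: "x \<in> \<Union>M \<inter> vertices \<T>"
    then obtain K where K: "K \<in> M" "x \<in> K" by blast
    then have "x extreme_point_of K" using vertices_in_element[OF tri] M x by blast
    then show "w x = g x" using wK[OF K] p[OF K(1)] by simp
  qed
  moreover have "\<forall>x. x \<notin> \<Union>M \<longrightarrow> w x = 0" by (simp add: w_def)
  ultimately show "\<exists>w. (continuous_on (\<Union>M) w \<and> (\<forall>K\<in>M. \<exists>a b. \<forall>x\<in>K. w x = a + b \<bullet> x)) \<and>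
    (\<forall>x\<in>\<Union>M \<inter> vertices \<T>. w x = g x) \<and> (\<forall>x. x \<notin> \<Union>M \<longrightarrow> w x = 0)" by blast
  fix w1 w2 :: "'a \<Rightarrow> real"
  assume w1: "(continuous_on (\<Union>M) w1 \<and> (\<forall>K\<in>M. \<exists>a b. \<forall>x\<in>K. w1 x = a + b \<bullet> x)) \<and>
    (\<forall>x\<in>\<Union>M \<inter> vertices \<T>. w1 x = g x) \<and> (\<forall>x. x \<notin> \<Union>M \<longrightarrow> w1 x = 0)"
  assume w2: "(continuous_on (\<Union>M) w2 \<and> (\<forall>K\<in>M. \<exists>a b. \<forall>x\<in>K. w2 x = a + b \<bullet> x)) \<and>
    (\<forall>x\<in>\<Union>M \<inter> vertices \<T>. w2 x = g x) \<and> (\<forall>x. x \<notin> \<Union>M \<longrightarrow> w2 x = 0)"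
  show "w1 = w2"
  proof
    fix x
    show "w1 x = w2 x"
    proof (cases "x \<in> \<Union>M")
      case True
      then obtain K where K: "K \<in> M" "x \<in> K" by blast
      obtain a b where 1: "\<forall>x\<in>K. w1 x = a + b \<bullet> x" using w1 K by blast
      obtain a' b' where 2: "\<forall>x\<in>K. w2 x = a' + b' \<bullet> x" using w2 K by blast
      have "a + b \<bullet> x = a' + b' \<bullet> x"
      proof (rule affine_eq_from_extreme_points[OF cc(1,2)[OF K(1)] K(2)])
        fix y assume y: "y extreme_point_of K"
        then have "y \<in> K" by (simp add: extreme_point_of_def)
        then have yv: "y \<in> \<Union>M \<inter> vertices \<T>" using vert[OF K(1) y] K(1) by blast
        have "w1 y = g y" "w2 y = g y" using w1 w2 yv by blast+
        then have "w1 y = w2 y" by simp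
        then show "a + b \<bullet> y = a' + b' \<bullet> y" using 1 2 \<open>y \<in> K\<close> by simp
      qed
      then show ?thesis using 1 2 K(2) by simp
    next
      case False then show ?thesis using w1 w2 by simp
    qed
  qed
qed

text \<open>What integration by parts requires of a finite element function. The Lipschitz condition refers to
  segments in \<open>W\<close> only: \<open>W\<close> is a strip around a surface and not convex,
  and outside \<open>W\<close> the function is arbitrary.\<close>

definition piecewise_regular_on :: "'a::euclidean_space set \<Rightarrow> ('a \<Rightarrow> real) \<Rightarrow> bool" where
  "piecewise_regular_on W u \<longleftrightarrow>
    (\<exists>L\<ge>0. \<forall>x y. closed_segment x y \<subseteq> W \<longrightarrow> \<bar>u x - u y\<bar> \<le> L * dist x y) \<and>
    (\<exists>B\<ge>0. \<forall>x\<in>W. \<bar>u x\<bar> \<le> B) \<and>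
    (AE x in lebesgue. x \<in> W \<longrightarrow> u differentiable (at x))"

text \<open>Along a segment the function is continuous and affine on finitely many closed pieces, so the
  largest slope is a Lipschitz constant. The boundaries of the convex elements are null sets.\<close>

lemma piecewise_affine_regular:
  fixes M :: "'a::euclidean_space set set"
  assumes fin: "finite M" and comp: "\<And>K. K \<in> M \<Longrightarrow> compact K" and conv: "\<And>K. K \<in> M \<Longrightarrow> convex K"
    and cont: "continuous_on (\<Union>M) u" and aff: "\<And>K. K \<in> M \<Longrightarrow> \<exists>a b. \<forall>x\<in>K. u x = a + b \<bullet> x"
    and W: "W \<subseteq> \<Union>M"
  shows "piecewise_regular_on W u"
proof -
  define Q where "Q K p \<longleftrightarrow> (\<forall>x\<in>K. u x = fst p + snd p \<bullet> x)" for K and p :: "real \<times> 'a"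
  have "\<exists>p. Q K p" if "K \<in> M" for K using aff[OF that] by (auto simp: Q_def)
  then obtain p where p: "\<And>K. K \<in> M \<Longrightarrow> Q K (p K)" by metis
  define a b where "a K = fst (p K)" and "b K = snd (p K)" for K
  have ab: "u x = a K + b K \<bullet> x" if "K \<in> M" "x \<in> K" for K x
    using p[OF that(1)] that(2) by (simp add: Q_def a_def b_def)
  define L where "L = (\<Sum>K\<in>M. norm (b K))"
  have L0: "0 \<le> L" by (simp add: L_def sum_nonneg)
  have Lb: "norm (b K) \<le> L" if "K \<in> M" for K unfolding L_def using fin that by (intro member_le_sum) auto
  have lip: "\<bar>u x - u y\<bar> \<le> L * dist x y" if seg: "closed_segment x y \<subseteq> W" for x y
  proof -
    define z where "z s = x + s *\<^sub>R (y - x)" for s :: real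
    have zseg: "z s \<in> closed_segment x y" if "s \<in> {0..1}" for s
      using that by (auto simp: z_def in_segment algebra_simps intro!: exI[of _ s])
    have "lipschitz_on (L * dist x y) {0..1} (\<lambda>s. u (z s))"
    proof (rule lipschitz_on_closed_Union[where I = M and U = "\<lambda>K. {0..1} \<inter> z -` K"])
      fix K assume K: "K \<in> M"
      show "closed ({0..1} \<inter> z -` K)"
        by (rule continuous_closed_preimage)
          (use comp[OF K] in \<open>auto intro!: continuous_intros compact_imp_closed simp: z_def\<close>)
      show "lipschitz_on (L * dist x y) ({0..1} \<inter> z -` K) (\<lambda>s. u (z s))"
      proof (rule lipschitz_onI)
        fix s r assume s: "s \<in> {0..1} \<inter> z -` K" and r: "r \<in> {0..1} \<inter> z -` K"
        have "u (z s) = a K + b K \<bullet> z s" "u (z r) = a K + b K \<bullet> z r" using s r by (auto intro: ab[OF K])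
        then have "u (z s) - u (z r) = b K \<bullet> (z s - z r)" by (simp add: inner_diff_right)
        also have "z s - z r = (s - r) *\<^sub>R (y - x)" by (simp add: z_def scaleR_diff_left)
        finally have "\<bar>u (z s) - u (z r)\<bar> \<le> norm (b K) * norm ((s - r) *\<^sub>R (y - x))"
          by (simp only: Cauchy_Schwarz_ineq2)
        also have "norm (b K) * norm ((s - r) *\<^sub>R (y - x)) \<le> L * norm ((s - r) *\<^sub>R (y - x))" by (intro mult_right_mono Lb K) simp
        finally show "dist (u (z s)) (u (z r)) \<le> L * dist x y * dist s r"
          by (simp add: dist_real_def dist_norm norm_minus_commute mult_ac)
      qed (use L0 in simp)
    next
      show "{0..1} \<subseteq> (\<Union>K\<in>M. {0..1} \<inter> z -` K)"
      proof
        fix s :: real assume s: "s \<in> {0..1}"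
        then have "z s \<in> \<Union>M" using subsetD[OF seg zseg[OF s]] W by blast
        then show "s \<in> (\<Union>K\<in>M. {0..1} \<inter> z -` K)" using s by simp
      qed
    qed (use fin L0 in auto)
    then have "dist (u (z 0)) (u (z 1)) \<le> L * dist x y * dist (0::real) 1"
      by (rule lipschitz_onD) auto
    then show ?thesis by (simp add: z_def dist_real_def)
  qed
  have "compact (\<Union>M)" using fin comp by (rule compact_Union) auto
  then have "bounded (u ` \<Union>M)" by (intro compact_imp_bounded compact_continuous_image cont)
  then obtain B where B: "\<forall>y\<in>u ` \<Union>M. norm y \<le> B" unfolding bounded_iff by blast
  have bd: "\<bar>u x\<bar> \<le> \<bar>B\<bar>" if "x \<in> W" for x
  proof -
    have "norm (u x) \<le> B" using B W that by blast
    then show ?thesis by simp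
  qed
  have "negligible (\<Union>(frontier ` M))"
    using fin conv by (intro negligible_Union) (auto intro: negligible_convex_frontier)
  then have "AE x in lebesgue. x \<notin> \<Union>(frontier ` M)"
    by (intro AE_not_in) (simp add: negligible_iff_null_sets)
  then have ae: "AE x in lebesgue. x \<in> W \<longrightarrow> u differentiable (at x)"
  proof eventually_elim
    fix x assume nf: "x \<notin> \<Union>(frontier ` M)"
    show "x \<in> W \<longrightarrow> u differentiable (at x)"
    proof
      assume "x \<in> W"
      then obtain K where K: "K \<in> M" "x \<in> K" using W by blast
      have "x \<in> closure K" using K(2) closure_subset by blast
      moreover have "x \<notin> frontier K" using nf K(1) by blast
      ultimately have xi: "x \<in> interior K" by (simp add: frontier_def)
      have "((\<lambda>x. a K + b K \<bullet> x) has_derivative (\<lambda>h. b K \<bullet> h)) (at x)"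
        by (auto intro!: derivative_eq_intros)
      then have "(u has_derivative (\<lambda>h. b K \<bullet> h)) (at x)"
        by (rule has_derivative_transform_within_open[OF _ open_interior xi])
          (use ab[OF K(1), symmetric] interior_subset[of K] in blast)
      then show "u differentiable (at x)" by (auto simp: differentiable_def)
    qed
  qed
  show ?thesis unfolding piecewise_regular_on_def
  proof (intro conjI)
    show "\<exists>L\<ge>0. \<forall>x y. closed_segment x y \<subseteq> W \<longrightarrow> \<bar>u x - u y\<bar> \<le> L * dist x y"
      by (rule exI[of _ L]) (use L0 lip in simp)
    show "\<exists>B\<ge>0. \<forall>x\<in>W. \<bar>u x\<bar> \<le> B" by (rule exI[of _ "\<bar>B\<bar>"]) (use bd in simp)
  qed (rule ae)
qed

lemma piecewise_regular_continuous:
  assumes W: "open W" and u: "piecewise_regular_on W u"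
  shows "continuous_on W u"
proof (rule continuous_at_imp_continuous_on, rule ballI)
  fix x assume x: "x \<in> W"
  obtain L where L: "0 \<le> L" "\<And>x y. closed_segment x y \<subseteq> W \<Longrightarrow> \<bar>u x - u y\<bar> \<le> L * dist x y"
    using u unfolding piecewise_regular_on_def by blast
  obtain r where r: "0 < r" "ball x r \<subseteq> W" using W x open_contains_ball by blast
  have "L-lipschitz_on (ball x r) u"
  proof (rule lipschitz_onI[OF _ L(1)])
    fix y z assume yz: "y \<in> ball x r" "z \<in> ball x r"
    then have "closed_segment y z \<subseteq> W" using r closed_segment_subset[OF yz convex_ball] by blast
    then show "dist (u y) (u z) \<le> L * dist y z" using L(2) by (simp add: dist_real_def)
  qed
  then have "continuous_on (ball x r) u" by (rule lipschitz_on_continuous_on)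
  then show "isCont u x" using r by (simp add: continuous_on_eq_continuous_at)
qed

lemma piecewise_regular_grad_bounded:
  assumes W: "open W" and u: "piecewise_regular_on W u"
  shows "\<exists>L\<ge>0. AE x in lebesgue. x \<in> W \<longrightarrow> norm (grad u x) \<le> L"
proof -
  obtain L where L: "0 \<le> L" "\<And>x y. closed_segment x y \<subseteq> W \<Longrightarrow> \<bar>u x - u y\<bar> \<le> L * dist x y"
    using u unfolding piecewise_regular_on_def by blast
  have "AE x in lebesgue. x \<in> W \<longrightarrow> u differentiable (at x)" using u by (simp add: piecewise_regular_on_def)
  then have "AE x in lebesgue. x \<in> W \<longrightarrow> norm (grad u x) \<le> L"
  proof eventually_elim
    fix x assume d: "x \<in> W \<longrightarrow> u differentiable (at x)"
    show "x \<in> W \<longrightarrow> norm (grad u x) \<le> L"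
    proof
      assume x: "x \<in> W"
      then obtain r where r: "0 < r" "ball x r \<subseteq> W" using W open_contains_ball by blast
      have "norm (grad u x \<bullet> grad u x) \<le> L * norm (grad u x)"
      proof (rule has_derivative_norm_le_lipschitz[OF has_derivative_grad r(1)])
        show "u differentiable (at x)" using d x by blast
        fix y assume "dist y x < r"
        then have "y \<in> ball x r" "x \<in> ball x r" using r by (auto simp: dist_commute)
        then have "closed_segment y x \<subseteq> W" using r closed_segment_subset[OF _ _ convex_ball] by blast
        then show "norm (u y - u x) \<le> L * dist y x" using L(2) by simp
      qed
      then have "norm (grad u x) * norm (grad u x) \<le> L * norm (grad u x)"
        by (simp add: power2_norm_eq_inner[symmetric] power2_eq_square)
      then show "norm (grad u x) \<le> L" using L(1) by (cases "grad u x = 0") auto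
    qed
  qed
  then show ?thesis using L(1) by blast
qed

text \<open>The components of the gradient are almost everywhere limits of difference quotients of the
  function continued by zero.\<close>

lemma piecewise_regular_grad_measurable:
  fixes u :: "'a::euclidean_space \<Rightarrow> real"
  assumes W: "open W" and u: "piecewise_regular_on W u"
  shows "(\<lambda>x. indicator W x *\<^sub>R grad u x) \<in> borel_measurable lebesgue"
proof -
  have "(\<lambda>x. (indicator W x *\<^sub>R grad u x) \<bullet> b) \<in> borel_measurable lebesgue" if b: "b \<in> Basis" for b
  proof -
    define U where "U x = (if x \<in> W then u x else 0)" for x
    have Um [measurable]: "U \<in> borel_measurable borel"
      unfolding U_def[abs_def] by (rule borel_measurable_continuous_on_if)
        (use W piecewise_regular_continuous[OF W u] in auto)
    define h where "h k = inverse (real (Suc k))" for k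
    define q where "q k x = (U (x + h k *\<^sub>R b) - U x) / h k" for k x
    have qm: "q k \<in> borel_measurable lebesgue" for k
      by (rule measurable_completion) (simp add: q_def[abs_def])
    have hlim: "filterlim h (at 0) sequentially"
      unfolding h_def[abs_def] by (rule filterlim_atI[OF LIMSEQ_inverse_real_of_nat]) simp
    have "AE x in lebesgue. x \<in> W \<longrightarrow> u differentiable (at x)" using u by (simp add: piecewise_regular_on_def)
    then have "AE x in lebesgue. indicator W x * lim (\<lambda>k. q k x) = (indicator W x *\<^sub>R grad u x) \<bullet> b"
    proof eventually_elim
      fix x assume d: "x \<in> W \<longrightarrow> u differentiable (at x)"
      show "indicator W x * lim (\<lambda>k. q k x) = (indicator W x *\<^sub>R grad u x) \<bullet> b"
      proof (cases "x \<in> W")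
        case True
        have "(u has_derivative (\<lambda>w. grad u x \<bullet> w)) (at x)" using d True by (intro has_derivative_grad) blast
        then have "(U has_derivative (\<lambda>w. grad u x \<bullet> w)) (at x)"
          by (rule has_derivative_transform_within_open[OF _ W True]) (simp add: U_def)
        then have U0: "(U has_derivative (\<lambda>w. grad u x \<bullet> w)) (at (x + 0 *\<^sub>R b))" by simp
        have line: "((\<lambda>s. x + s *\<^sub>R b) has_derivative (\<lambda>s. s *\<^sub>R b)) (at (0::real))"
          by (auto intro!: derivative_eq_intros)
        have "((\<lambda>s. U (x + s *\<^sub>R b)) has_derivative (\<lambda>s. grad u x \<bullet> (s *\<^sub>R b))) (at 0)"
          by (rule has_derivative_compose[of "\<lambda>s. x + s *\<^sub>R b" "\<lambda>s. s *\<^sub>R b" 0 UNIV U, OF line U0])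
        moreover have "(\<lambda>s. grad u x \<bullet> (s *\<^sub>R b)) = (*) (grad u x \<bullet> b)" by (auto simp: mult.commute)
        ultimately have "((\<lambda>s. U (x + s *\<^sub>R b)) has_field_derivative grad u x \<bullet> b) (at 0)"
          by (simp add: has_field_derivative_def)
        then have "((\<lambda>s. (U (x + s *\<^sub>R b) - U x) / s) \<longlongrightarrow> grad u x \<bullet> b) (at 0)" by (simp add: DERIV_def)
        from filterlim_compose[OF this hlim] have "(\<lambda>k. q k x) \<longlonglongrightarrow> grad u x \<bullet> b" by (simp add: q_def)
        then show ?thesis using True by (simp add: limI)
      qed simp
    qed
    moreover have "(\<lambda>x. indicator W x * lim (\<lambda>k. q k x)) \<in> borel_measurable lebesgue"
      using W by (intro borel_measurable_times borel_measurable_indicator borel_measurable_lim_metric qm) auto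
    ultimately show ?thesis by (rule borel_measurable_lebesgue_AE_eq[rotated])
  qed
  then show ?thesis by (subst borel_measurable_euclidean_space) auto
qed

section \<open>The cosine profile and a steep bump function\<close>

lemma DERIV_if_quadratic_remainder:
  fixes f :: "real \<Rightarrow> real"
  assumes d: "0 < d" and rem: "\<And>y. \<bar>y - x\<bar> < d \<Longrightarrow> \<bar>f y - f x - D * (y - x)\<bar> \<le> C * (y - x)\<^sup>2"
  shows "(f has_real_derivative D) (at x)"
  unfolding has_field_derivative_def has_derivative_at_alt
proof (intro conjI allI impI)
  show "bounded_linear ((*) D)" by (rule bounded_linear_mult_right)
  fix e :: real assume e: "0 < e"
  define r where "r = min d (e / (\<bar>C\<bar> + 1))"
  have r: "0 < r" using d e by (simp add: r_def)
  show "\<exists>r>0. \<forall>y. norm (y - x) < r \<longrightarrow> norm (f y - f x - D * (y - x)) \<le> e * norm (y - x)"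
  proof (intro exI[of _ r] conjI r allI impI)
    fix y assume y: "norm (y - x) < r"
    have "\<bar>f y - f x - D * (y - x)\<bar> \<le> C * (y - x)\<^sup>2" using y by (intro rem) (simp add: r_def)
    also have "\<dots> \<le> (\<bar>C\<bar> + 1) * \<bar>y - x\<bar>\<^sup>2" by (simp add: mult_right_mono)
    also have "\<dots> = ((\<bar>C\<bar> + 1) * \<bar>y - x\<bar>) * \<bar>y - x\<bar>" by (simp add: power2_eq_square)
    also have "\<dots> \<le> e * \<bar>y - x\<bar>"
    proof (rule mult_right_mono)
      have "\<bar>y - x\<bar> \<le> e / (\<bar>C\<bar> + 1)" using y by (simp add: r_def)
      then show "(\<bar>C\<bar> + 1) * \<bar>y - x\<bar> \<le> e" by (simp add: field_simps pos_le_divide_eq add_pos_nonneg)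
    qed simp
    finally show "norm (f y - f x - D * (y - x)) \<le> e * norm (y - x)" by simp
  qed
qed

lemma abs_cos_diff_le: "\<bar>cos a - cos b\<bar> \<le> \<bar>a - b\<bar>" for a b :: real
proof -
  have "norm (cos a - cos b) \<le> 1 * norm (a - b)"
    by (rule field_differentiable_bound[of UNIV cos "\<lambda>x. - sin x"])
      (auto intro!: derivative_eq_intros)
  then show ?thesis by simp
qed

lemma abs_sin_diff_le: "\<bar>sin a - sin b\<bar> \<le> \<bar>a - b\<bar>" for a b :: real
proof -
  have "norm (sin a - sin b) \<le> 1 * norm (a - b)"
    by (rule field_differentiable_bound[of UNIV sin cos])
      (auto intro!: derivative_eq_intros)
  then show ?thesis by simp
qed

text \<open>With it the profile is \<open>cos\<^sup>2 \<circ> half_pi_clamp\<close> and its derivative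
  \<open>- sin (2 \<cdot>) \<circ> half_pi_clamp\<close>, without case distinctions, and Lipschitz
  bounds follow from those of sine and cosine.\<close>

definition half_pi_clamp :: "real \<Rightarrow> real" where
  "half_pi_clamp r = max (- (pi / 2)) (min r (pi / 2))"

definition profile_deriv :: "real \<Rightarrow> real" where
  "profile_deriv r = - sin (2 * half_pi_clamp r)"

lemma half_pi_clamp_lipschitz: "\<bar>half_pi_clamp a - half_pi_clamp b\<bar> \<le> \<bar>a - b\<bar>"
  by (auto simp: half_pi_clamp_def max_def min_def)

lemma half_pi_clamp_outside: "pi / 2 \<le> \<bar>r\<bar> \<Longrightarrow> half_pi_clamp r = pi / 2 \<or> half_pi_clamp r = - (pi / 2)"
  using pi_gt_zero by (auto simp: half_pi_clamp_def max_def min_def)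

lemma half_pi_clamp_trig_outside:
  assumes "pi / 2 \<le> \<bar>r\<bar>"
  shows "cos (half_pi_clamp r) = 0" "sin (2 * half_pi_clamp r) = 0"
proof -
  show "cos (half_pi_clamp r) = 0" using half_pi_clamp_outside[OF assms] by (elim disjE) (erule ssubst, simp)+
  show "sin (2 * half_pi_clamp r) = 0" using half_pi_clamp_outside[OF assms] by (elim disjE) (erule ssubst, simp)+
qed

lemma half_pi_clamp_inside: "\<bar>r\<bar> \<le> pi / 2 \<Longrightarrow> half_pi_clamp r = r"
  by (auto simp: half_pi_clamp_def max_def min_def)

lemma profile_eq_cos_clamp: "profile r = (cos (half_pi_clamp r))\<^sup>2"
  using half_pi_clamp_trig_outside[of r] half_pi_clamp_inside[of r] by (auto simp: profile_def)

lemma profile_nonneg: "0 \<le> profile r" by (simp add: profile_eq_cos_clamp)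

lemma profile_le_1: "profile r \<le> 1" by (simp add: profile_eq_cos_clamp abs_square_le_1)

lemma profile_outside: "pi / 2 \<le> \<bar>r\<bar> \<Longrightarrow> profile r = 0"
  by (simp add: profile_eq_cos_clamp half_pi_clamp_trig_outside)

lemma profile_deriv_outside: "pi / 2 \<le> \<bar>r\<bar> \<Longrightarrow> profile_deriv r = 0"
  by (simp add: profile_deriv_def half_pi_clamp_trig_outside)

lemma abs_profile_deriv_le: "\<bar>profile_deriv r\<bar> \<le> 1" by (simp add: profile_deriv_def)

lemma profile_deriv_lipschitz: "\<bar>profile_deriv a - profile_deriv b\<bar> \<le> 2 * \<bar>a - b\<bar>"
proof -
  have "\<bar>profile_deriv a - profile_deriv b\<bar> = \<bar>sin (2 * half_pi_clamp b) - sin (2 * half_pi_clamp a)\<bar>"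
    by (simp add: profile_deriv_def)
  also have "\<dots> \<le> \<bar>2 * half_pi_clamp b - 2 * half_pi_clamp a\<bar>" by (rule abs_sin_diff_le)
  also have "\<dots> = 2 * \<bar>half_pi_clamp a - half_pi_clamp b\<bar>" by (auto simp: abs_if)
  also have "\<dots> \<le> 2 * \<bar>a - b\<bar>" using half_pi_clamp_lipschitz[of a b] by simp
  finally show ?thesis .
qed

lemma profile_has_derivative: "(profile has_real_derivative profile_deriv r) (at r)"
proof (cases "\<bar>r\<bar>" "pi / 2" rule: linorder_cases)
  case less
  have "((\<lambda>r. (cos r)\<^sup>2) has_real_derivative - sin (2 * r)) (at r)"
    by (auto intro!: derivative_eq_intros simp: sin_double)
  moreover have "profile_deriv r = - sin (2 * r)" using less by (simp add: profile_deriv_def half_pi_clamp_inside)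
  ultimately have "((\<lambda>r. (cos r)\<^sup>2) has_real_derivative profile_deriv r) (at r)" by simp
  then show ?thesis
    by (rule has_field_derivative_transform_within_open[where S = "{- (pi / 2)<..<pi / 2}"])
      (use less in \<open>auto simp: profile_def\<close>)
next
  case equal
  show ?thesis
  proof (rule DERIV_if_quadratic_remainder[where d = 1 and C = 1])
    fix y
    have "\<bar>cos (half_pi_clamp y) - cos (half_pi_clamp r)\<bar> \<le> \<bar>y - r\<bar>"
      using abs_cos_diff_le half_pi_clamp_lipschitz order_trans by blast
    moreover have "cos (half_pi_clamp r) = 0" using equal by (intro half_pi_clamp_trig_outside) simp
    ultimately have "\<bar>cos (half_pi_clamp y)\<bar>\<^sup>2 \<le> \<bar>y - r\<bar>\<^sup>2" by (intro power_mono) auto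
    then show "\<bar>profile y - profile r - profile_deriv r * (y - r)\<bar> \<le> 1 * (y - r)\<^sup>2"
      using equal by (simp add: profile_outside profile_deriv_outside) (simp add: profile_eq_cos_clamp)
  qed simp
next
  case greater
  have "((\<lambda>r. 0) has_real_derivative profile_deriv r) (at r)"
    using greater by (simp add: profile_deriv_outside)
  then show ?thesis
  proof (rule has_field_derivative_transform_within_open[where S = "- {- (pi / 2)..pi / 2}"])
    show "open (- {- (pi / 2)..pi / 2})" by (intro open_Compl closed_atLeastAtMost)
    show "r \<in> - {- (pi / 2)..pi / 2}" using greater by auto
    fix y assume "y \<in> - {- (pi / 2)..pi / 2}"
    then show "0 = profile y" by (auto simp: profile_def)
  qed
qed

text \<open>The profile has a Lipschitz derivative, including at \<open>\<plusminus>\<pi>/2\<close>.\<close>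

lemma profile_taylor: "\<bar>profile a - profile b - profile_deriv b * (a - b)\<bar> \<le> 2 * (a - b)\<^sup>2"
proof -
  have "norm ((profile a - profile_deriv b * a) - (profile b - profile_deriv b * b)) \<le> (2 * \<bar>a - b\<bar>) * norm (a - b)"
  proof (rule field_differentiable_bound[of "closed_segment a b" _ "\<lambda>r. profile_deriv r - profile_deriv b"])
    fix r assume r: "r \<in> closed_segment a b"
    show "((\<lambda>a. profile a - profile_deriv b * a) has_field_derivative profile_deriv r - profile_deriv b) (at r within closed_segment a b)"
      by (rule has_field_derivative_at_within)
        (auto intro!: derivative_eq_intros profile_has_derivative)
    have "\<bar>profile_deriv r - profile_deriv b\<bar> \<le> 2 * \<bar>r - b\<bar>" by (rule profile_deriv_lipschitz)
    also have "\<bar>r - b\<bar> \<le> \<bar>a - b\<bar>" using r by (auto simp: closed_segment_eq_real_ivl split: if_splits)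
    finally show "norm (profile_deriv r - profile_deriv b) \<le> 2 * \<bar>a - b\<bar>" by simp
  qed auto
  then show ?thesis by (simp add: algebra_simps power2_eq_square abs_mult_self_eq)
qed

text \<open>The square root of the profile is Lipschitz with constant one. This lets the profile at the old
  level be replaced by that at the new level, up to the factor \<open>2\<close> and a quadratic
  error.\<close>

lemma profile_le_shifted: "profile a \<le> 2 * profile b + 2 * (a - b)\<^sup>2"
proof -
  define x y where "x = cos (half_pi_clamp a)" and "y = cos (half_pi_clamp b)"
  have "\<bar>x - y\<bar> \<le> \<bar>a - b\<bar>" unfolding x_def y_def
    using abs_cos_diff_le half_pi_clamp_lipschitz order_trans by blast
  then have "(x - y)\<^sup>2 \<le> (a - b)\<^sup>2" by (simp add: abs_le_square_iff)
  moreover have "x\<^sup>2 \<le> 2 * y\<^sup>2 + 2 * (x - y)\<^sup>2"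
    using zero_le_power2[of "x - 2 * y"] by (simp add: power2_eq_square algebra_simps)
  ultimately show ?thesis by (simp add: profile_eq_cos_clamp x_def y_def)
qed

lemma profile_ge_quarter: "\<bar>r\<bar> \<le> 1 \<Longrightarrow> 1 / 4 \<le> profile r"
proof -
  assume r: "\<bar>r\<bar> \<le> 1"
  have "cos (pi / 3) \<le> cos \<bar>r\<bar>" using r pi_gt3 by (intro cos_monotone_0_pi_le) auto
  then have "1 / 2 \<le> cos r" by (simp add: cos_60)
  then have "(1 / 2)\<^sup>2 \<le> (cos r)\<^sup>2" by (intro power_mono) auto
  then show ?thesis using r pi_gt3 by (simp add: profile_def power2_eq_square)
qed

text \<open>Test function for the Poincare inequality, positive on \<open>(0,2)\<close>, odd, and zero for
  \<open>|r| \<ge> 2\<close>. The larger \<open>p\<close>, the larger its rate of decay relative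
  to its size for \<open>1 \<le> |r|\<close>.\<close>

definition bump :: "nat \<Rightarrow> real \<Rightarrow> real" where
  "bump p r = r * max 0 (4 - r\<^sup>2) ^ p"

definition bump_deriv :: "nat \<Rightarrow> real \<Rightarrow> real" where
  "bump_deriv p r = max 0 (4 - r\<^sup>2) ^ p - 2 * real p * r\<^sup>2 * max 0 (4 - r\<^sup>2) ^ (p - 1)"

lemma DERIV_positive_part_power:
  assumes p: "2 \<le> p"
  shows "((\<lambda>z::real. max 0 z ^ p) has_real_derivative real p * max 0 z ^ (p - 1)) (at z)"
proof (cases z "0::real" rule: linorder_cases)
  case less
  have "((\<lambda>z. 0) has_real_derivative real p * max 0 z ^ (p - 1)) (at z)" using less p by (simp add: zero_power)
  then show ?thesis
    by (rule has_field_derivative_transform_within_open[where S = "{..<0}"]) (use less p in auto)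
next
  case equal
  show ?thesis
  proof (rule DERIV_if_quadratic_remainder[where d = 1 and C = 1])
    fix y assume y: "\<bar>y - z\<bar> < 1"
    have "max 0 y ^ p \<le> max 0 y ^ 2" using y equal p by (intro power_decreasing) auto
    also have "\<dots> \<le> y\<^sup>2" by (auto simp: max_def)
    finally show "\<bar>max 0 y ^ p - max 0 z ^ p - real p * max 0 z ^ (p - 1) * (y - z)\<bar> \<le> 1 * (y - z)\<^sup>2"
      using equal p by (simp add: zero_power)
  qed simp
next
  case greater
  have "((\<lambda>z. z ^ p) has_real_derivative real p * max 0 z ^ (p - 1)) (at z)"
    using greater by (auto intro!: derivative_eq_intros)
  then show ?thesis
    by (rule has_field_derivative_transform_within_open[where S = "{0<..}"]) (use greater in auto)
qed

lemma bump_has_derivative: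
  assumes p: "2 \<le> p" shows "(bump p has_real_derivative bump_deriv p r) (at r)"
proof -
  have "((\<lambda>r. max 0 (4 - r\<^sup>2) ^ p) has_real_derivative (real p * max 0 (4 - r\<^sup>2) ^ (p - 1)) * (- 2 * r)) (at r)"
    by (rule DERIV_chain2[OF DERIV_positive_part_power[OF p]]) (auto intro!: derivative_eq_intros)
  from DERIV_mult[OF DERIV_ident this] show ?thesis
    unfolding bump_def[abs_def] bump_deriv_def by (simp add: power2_eq_square algebra_simps)
qed

lemma bump_outside: "2 \<le> p \<Longrightarrow> 2 \<le> \<bar>r\<bar> \<Longrightarrow> bump p r = 0" "2 \<le> p \<Longrightarrow> 2 \<le> \<bar>r\<bar> \<Longrightarrow> bump_deriv p r = 0"
proof -
  assume p: "2 \<le> p" and "2 \<le> \<bar>r\<bar>"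
  then have "2\<^sup>2 \<le> \<bar>r\<bar>\<^sup>2" by (intro power_mono) auto
  then have "max 0 (4 - r\<^sup>2) = 0" by simp
  then show "bump p r = 0" "bump_deriv p r = 0" using p by (auto simp: bump_def bump_deriv_def zero_power)
qed

lemma abs_bump_le:
  assumes p: "2 \<le> p" shows "\<bar>bump p r\<bar> \<le> 2 * 4 ^ p"
proof (cases "\<bar>r\<bar> \<le> 2")
  case True
  have "max 0 (4 - r\<^sup>2) ^ p \<le> 4 ^ p" by (intro power_mono) auto
  then show ?thesis unfolding bump_def abs_mult using True by (intro mult_mono) auto
qed (use bump_outside(1)[OF p] in auto)

lemma abs_bump_deriv_le:
  assumes p: "2 \<le> p" shows "\<bar>bump_deriv p r\<bar> \<le> 4 ^ p + 8 * real p * 4 ^ (p - 1)"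
proof (cases "\<bar>r\<bar> \<le> 2")
  case True
  then have r2: "r\<^sup>2 \<le> 4" using abs_le_square_iff[of r 2] by simp
  have "max 0 (4 - r\<^sup>2) ^ p \<le> 4 ^ p" "max 0 (4 - r\<^sup>2) ^ (p - 1) \<le> 4 ^ (p - 1)" by (intro power_mono; auto)+
  moreover from this have "2 * real p * r\<^sup>2 * max 0 (4 - r\<^sup>2) ^ (p - 1) \<le> 2 * real p * 4 * 4 ^ (p - 1)"
    using r2 by (intro mult_mono) auto
  moreover have "0 \<le> max 0 (4 - r\<^sup>2) ^ p" "0 \<le> 2 * real p * r\<^sup>2 * max 0 (4 - r\<^sup>2) ^ (p - 1)" by auto
  ultimately show ?thesis unfolding bump_deriv_def by linarith
qed (use bump_outside(2)[OF p] in auto)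

text \<open>The decay of the bump for \<open>|r| \<ge> 1\<close> pays for the indicator of \<open>|r| \<le>
  17/10\<close> and, if \<open>p\<close> is large, also for \<open>\<beta>\<close> times the bump
  itself; for \<open>|r| < 1\<close> the profile is bounded below and pays for everything. In
  \<open>strip_poincare_inequality\<close>, \<open>\<beta>\<close> stems from the divergence of
  the normal field and is bounded but not small, which is why the exponent has to be adjustable.\<close>

lemma bump_inequality:
  fixes \<beta> :: real
  assumes lam: "0 \<le> \<beta>" and p: "2 \<le> p" "6 * \<beta> + 4 \<le> 2 * real p"
  shows "(if \<bar>r\<bar> \<le> 17 / 10 then 1 else 0) + \<beta> * \<bar>bump p r\<bar>
    \<le> - bump_deriv p r + 4 * (1 + (\<beta> + 1) * 4 ^ p) * profile r"
proof -
  define m where "m = max 0 (4 - r\<^sup>2)"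
  have m: "0 \<le> m" "m \<le> 4" by (auto simp: m_def)
  have mp: "0 \<le> m ^ p" "m ^ p \<le> 4 ^ p" "0 \<le> m ^ (p - 1)" using m by (auto intro: power_mono)
  have K: "0 \<le> 4 * (1 + (\<beta> + 1) * 4 ^ p)" using lam by (intro mult_nonneg_nonneg add_nonneg_nonneg) auto
  \<comment> \<open>In the region \<open>1 \<le> |r| \<le> 2\<close> everything is compared with
    \<open>m ^ (p - 1)\<close>.\<close>
  have pp: "m ^ p = m * m ^ (p - 1)" using p by (metis Suc_diff_1 Suc_le_lessD less_2_cases_iff less_le_trans not_less power_Suc zero_less_Suc pos2)
  consider "\<bar>r\<bar> < 1" | "1 \<le> \<bar>r\<bar>" "\<bar>r\<bar> \<le> 2" | "2 < \<bar>r\<bar>" by linarith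
  then show ?thesis
  proof cases
    case 1
    have "\<bar>bump p r\<bar> \<le> 1 * 4 ^ p" unfolding bump_def abs_mult using 1 mp by (intro mult_mono) (auto simp: m_def)
    then have "\<beta> * \<bar>bump p r\<bar> \<le> \<beta> * 4 ^ p" using lam by (intro mult_left_mono) auto
    moreover have "- bump_deriv p r \<ge> - (4 ^ p)"
    proof -
      have "0 \<le> 2 * real p * r\<^sup>2 * m ^ (p - 1)" using mp by simp
      then show ?thesis using mp unfolding bump_deriv_def m_def[symmetric] by linarith
    qed
    moreover have "4 * (1 + (\<beta> + 1) * 4 ^ p) * (1 / 4) \<le> 4 * (1 + (\<beta> + 1) * 4 ^ p) * profile r"
      using K profile_ge_quarter[of r] 1 by (intro mult_left_mono) auto
    moreover have "4 * (1 + (\<beta> + 1) * 4 ^ p) * (1 / 4) = 1 + \<beta> * 4 ^ p + 4 ^ p" by (simp add: algebra_simps)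
    ultimately show ?thesis using 1 by simp
  next
    case 2
    have r2: "1 \<le> r\<^sup>2" "r\<^sup>2 \<le> 4" using 2 abs_le_square_iff[of 1 r] abs_le_square_iff[of r 2] by auto
    have m3: "m \<le> 3" "m = 4 - r\<^sup>2" using r2 by (auto simp: m_def)
    have "\<bar>bump p r\<bar> = \<bar>r\<bar> * m * m ^ (p - 1)" using mp m by (simp add: bump_def m_def[symmetric] abs_mult pp)
    also have "\<dots> \<le> (2 * 3) * m ^ (p - 1)" using 2 m m3 mp by (intro mult_right_mono mult_mono) auto
    finally have "\<beta> * \<bar>bump p r\<bar> \<le> \<beta> * (6 * m ^ (p - 1))" using lam by (intro mult_left_mono) auto
    moreover have "- bump_deriv p r = (2 * real p * r\<^sup>2 - m) * m ^ (p - 1)"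
      unfolding bump_deriv_def m_def[symmetric] pp by (simp add: algebra_simps)
    moreover have "(2 * real p - 3) * m ^ (p - 1) \<le> (2 * real p * r\<^sup>2 - m) * m ^ (p - 1)"
    proof (rule mult_right_mono)
      have "2 * real p * 1 \<le> 2 * real p * r\<^sup>2" using r2 by (intro mult_left_mono) auto
      then show "2 * real p - 3 \<le> 2 * real p * r\<^sup>2 - m" using m3 by simp
    qed (rule mp)
    moreover have "(6 * \<beta> + 1) * m ^ (p - 1) \<le> (2 * real p - 3) * m ^ (p - 1)"
      using p mp by (intro mult_right_mono) auto
    moreover have "(if \<bar>r\<bar> \<le> 17 / 10 then 1 else 0) \<le> m ^ (p - 1)"
    proof (cases "\<bar>r\<bar> \<le> 17 / 10")
      case True
      then have "r\<^sup>2 \<le> (17 / 10)\<^sup>2" using abs_le_square_iff[of r "17 / 10"] by simp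
      \<comment> \<open>Here \<open>17/10 < \<surd>3\<close> matters.\<close>
      then have "1 \<le> m" using m3 by (simp add: power2_eq_square)
      then show ?thesis by (simp add: one_le_power)
    qed (use mp in auto)
    moreover have "0 \<le> 4 * (1 + (\<beta> + 1) * 4 ^ p) * profile r" using K profile_nonneg by (rule mult_nonneg_nonneg)
    ultimately show ?thesis by (simp add: algebra_simps)
  next
    case 3
    then have "bump p r = 0" "bump_deriv p r = 0" using bump_outside[OF p(1), of r] by auto
    moreover have "0 \<le> 4 * (1 + (\<beta> + 1) * 4 ^ p) * profile r" using K profile_nonneg by (rule mult_nonneg_nonneg)
    ultimately show ?thesis using 3 by simp
  qed
qed

section \<open>Integration by parts across the strip\<close>

lemma product_difference_le:
  fixes p q r p' q' r' :: real
  assumes "\<bar>p - p'\<bar> \<le> a" "\<bar>q - q'\<bar> \<le> b" "\<bar>r - r'\<bar> \<le> c"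
    "\<bar>p'\<bar> \<le> P" "\<bar>q\<bar> \<le> Q" "\<bar>q'\<bar> \<le> Q" "\<bar>r\<bar> \<le> R"
  shows "\<bar>p * q * r - p' * q' * r'\<bar> \<le> a * Q * R + P * b * R + P * Q * c"
proof -
  have "p * q * r - p' * q' * r' = (p - p') * q * r + p' * (q - q') * r + p' * q' * (r - r')"
    by (simp add: algebra_simps)
  also have "\<bar>\<dots>\<bar> \<le> \<bar>p - p'\<bar> * \<bar>q\<bar> * \<bar>r\<bar> + \<bar>p'\<bar> * \<bar>q - q'\<bar> * \<bar>r\<bar> + \<bar>p'\<bar> * \<bar>q'\<bar> * \<bar>r - r'\<bar>"
    by (simp add: abs_mult[symmetric])
  also have "\<dots> \<le> a * Q * R + P * b * R + P * Q * c"
    using assms by (intro add_mono mult_mono mult_nonneg_nonneg) (auto intro: order_trans[OF abs_ge_zero])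
  finally show ?thesis .
qed

context moving_surface
begin

text \<open>The outer strip exceeds the inner one by \<open>\<epsilon>/8\<close> in level, hence by at least
  \<open>\<epsilon> / (8 c1)\<close> in distance. It still lies in the strip of width
  \<open>\<delta>\<close>, since \<open>\<epsilon> < \<delta> / \<pi>\<close>.\<close>

lemma near_inner_strip:
  assumes t: "t \<in> {0..T}" and eps: "0 < \<epsilon>" "\<epsilon> < \<delta> / pi"
    and x: "x \<in> \<Omega>" "\<bar>\<phi> x t\<bar> \<le> 2 * \<epsilon>" and xy: "dist x y < \<epsilon> / (8 * c1)"
  shows "closed_segment x y \<subseteq> strip \<Omega> \<phi> (17 / 8 * \<epsilon>) t" "\<bar>\<phi> y t - \<phi> x t\<bar> \<le> c1 * dist x y"
proof -
  have c: "0 < c1" using constants by simp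
  have "\<epsilon> * 3 \<le> \<epsilon> * pi" using eps pi_gt3 by (intro mult_left_mono) auto
  also have "\<epsilon> * pi < \<delta>" using eps pi_gt_zero by (simp add: pos_less_divide_eq)
  finally have small: "17 / 8 * \<epsilon> < \<delta>0" using eps delta by simp
  have pt: "w \<in> strip \<Omega> \<phi> (17 / 8 * \<epsilon>) t \<and> \<bar>\<phi> w t - \<phi> x t\<bar> \<le> c1 * dist x w"
    if w: "dist x w < \<epsilon> / (8 * c1)" for w
  proof -
    have "c1 * dist x w < \<epsilon> / 8" using w c by (simp add: pos_less_divide_eq mult_ac)
    then have "\<bar>\<phi> x t\<bar> + c1 * dist x w < \<delta>0" "\<bar>\<phi> x t\<bar> + c1 * dist x w < 17 / 8 * \<epsilon>"
      using x(2) small by auto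
    with near_strip[OF t x(1), of w] show ?thesis by (auto simp: strip_def)
  qed
  show "closed_segment x y \<subseteq> strip \<Omega> \<phi> (17 / 8 * \<epsilon>) t"
  proof
    fix w assume "w \<in> closed_segment x y"
    then have "dist x w \<le> dist x y" by (metis dist_in_closed_segment dist_commute)
    then show "w \<in> strip \<Omega> \<phi> (17 / 8 * \<epsilon>) t" using pt[of w] xy by simp
  qed
  show "\<bar>\<phi> y t - \<phi> x t\<bar> \<le> c1 * dist x y" using pt[of y] xy by blast
qed

text \<open>The function \<open>\<Theta>\<close> is the divergence of \<open>u\<^sup>2
  \<psi>(\<phi>/\<epsilon>) Y\<close>, a Lipschitz field supported where \<open>|\<phi>| \<le> 2
  \<epsilon>\<close>, so its integral vanishes. Up to terms that carry the factor
  \<open>\<psi>(\<phi>/\<epsilon>)\<close> it equals \<open>u\<^sup>2 \<psi>'(\<phi>/\<epsilon>)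
  \<nabla>\<phi> \<bullet> Y / \<epsilon>\<close>.

  The conclusion is an almost everywhere pointwise estimate for a function of integral zero, instead
  of an identity between integrals; it can be added to other pointwise inequalities without
  integrability proofs for the single terms of the divergence.\<close>

lemma strip_integration_by_parts:
  fixes u :: "'a \<Rightarrow> real" and Y :: "'a \<Rightarrow> 'a" and \<psi> \<psi>' :: "real \<Rightarrow> real"
  defines "W \<equiv> \<lambda>\<epsilon> t. strip \<Omega> \<phi> (17 / 8 * \<epsilon>) t"
  assumes t: "t \<in> {0..T}" and eps: "0 < \<epsilon>" "\<epsilon> < \<delta> / pi"
    and u: "piecewise_regular_on (W \<epsilon> t) u"
    and psi: "\<And>r. (\<psi> has_real_derivative \<psi>' r) (at r)" "\<And>r. \<bar>\<psi> r\<bar> \<le> M" "\<And>r. \<bar>\<psi>' r\<bar> \<le> M"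
    and supp: "\<And>r. 2 \<le> \<bar>r\<bar> \<Longrightarrow> \<psi> r = 0"
    and Y: "\<And>x. x \<in> W \<epsilon> t \<Longrightarrow> Y differentiable (at x)" "\<And>x. x \<in> W \<epsilon> t \<Longrightarrow> norm (Y x) \<le> A"
      "\<And>x y. closed_segment x y \<subseteq> W \<epsilon> t \<Longrightarrow> norm (Y x - Y y) \<le> B * dist x y"
    and AB: "0 \<le> A" "0 \<le> B"
  shows "\<exists>\<Theta>. integrable lebesgue \<Theta> \<and> integral\<^sup>L lebesgue \<Theta> = 0 \<and>
    (AE x in lebesgue. (x \<notin> W \<epsilon> t \<longrightarrow> \<Theta> x = 0) \<and>
      (x \<in> W \<epsilon> t \<longrightarrow> \<bar>\<Theta> x - (u x)\<^sup>2 * (\<psi>' (\<phi> x t / \<epsilon>) / \<epsilon> * (level_grad t x \<bullet> Y x))\<bar>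
        \<le> \<bar>\<psi> (\<phi> x t / \<epsilon>)\<bar> * (2 * A * (\<bar>u x\<bar> * norm (grad u x)) + real DIM('a) * B * (u x)\<^sup>2)))"
proof -
  define V where "V = W \<epsilon> t"
  have V: "open V" unfolding V_def W_def by (rule open_strip[OF t])
  have VO: "V \<subseteq> \<Omega>" by (auto simp: V_def W_def strip_def)
  have c: "0 < c1" using constants by simp
  have M0: "0 \<le> M" using psi(2)[of 0] by simp
  \<comment> \<open>Points within \<open>r0\<close> of the support \<open>K\<close> are joined to it
    inside \<open>V\<close>, so the Lipschitz bounds on \<open>V\<close> carry over
    to the extension by zero.\<close>
  define r0 where "r0 = \<epsilon> / (8 * c1)"
  have r0: "0 < r0" using eps c by (simp add: r0_def)
  define K where "K = {x \<in> \<Omega>. \<bar>\<phi> x t\<bar> \<le> 2 * \<epsilon>}"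
  have KV: "K \<subseteq> V" using eps by (auto simp: K_def V_def W_def strip_def)
  have near: "closed_segment x y \<subseteq> V" "\<bar>\<phi> y t - \<phi> x t\<bar> \<le> c1 * dist x y" if "x \<in> K" "dist x y < r0" for x y
    using near_inner_strip[OF t eps, of x y] that by (auto simp: K_def V_def W_def r0_def)
  obtain Lu where Lu: "0 \<le> Lu" "\<And>x y. closed_segment x y \<subseteq> V \<Longrightarrow> \<bar>u x - u y\<bar> \<le> Lu * dist x y"
    using u unfolding piecewise_regular_on_def V_def by blast
  obtain Mu where Mu: "0 \<le> Mu" "\<And>x. x \<in> V \<Longrightarrow> \<bar>u x\<bar> \<le> Mu"
    using u unfolding piecewise_regular_on_def V_def by blast
  have udiff: "AE x in lebesgue. x \<in> V \<longrightarrow> u differentiable (at x)"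
    using u by (simp add: piecewise_regular_on_def V_def)
  have psil: "\<bar>\<psi> a - \<psi> b\<bar> \<le> M * \<bar>a - b\<bar>" for a b
  proof -
    have "norm (\<psi> a - \<psi> b) \<le> M * norm (a - b)"
      by (rule field_differentiable_bound[of UNIV \<psi> \<psi>']) (use psi in auto)
    then show ?thesis by simp
  qed
  define F where "F b x = (if x \<in> V then (u x)\<^sup>2 * \<psi> (\<phi> x t / \<epsilon>) * (Y x \<bullet> b) else 0)" for b x
  have Fzero: "F b x = 0" if "x \<notin> K" for b x
  proof (cases "x \<in> V")
    case True
    then have "2 \<le> \<bar>\<phi> x t / \<epsilon>\<bar>" using that VO eps by (auto simp: K_def abs_divide pos_le_divide_eq)
    then show ?thesis by (simp add: F_def supp)
  qed (simp add: F_def)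
  define LF where "LF = 2 * Mu * Lu * M * A + Mu\<^sup>2 * (M * (c1 / \<epsilon>)) * A + Mu\<^sup>2 * M * B"
  have LF0: "0 \<le> LF" unfolding LF_def using Mu Lu M0 AB c eps by (intro add_nonneg_nonneg mult_nonneg_nonneg) auto
  have Flip0: "\<bar>F b x - F b y\<bar> \<le> LF * dist x y" if b: "b \<in> Basis" and x: "x \<in> K" and d: "dist x y < r0" for b x y
  proof -
    have seg: "closed_segment x y \<subseteq> V" by (rule near(1)[OF x d])
    then have xy: "x \<in> V" "y \<in> V" by auto
    have "\<bar>(u x)\<^sup>2 - (u y)\<^sup>2\<bar> = \<bar>u x + u y\<bar> * \<bar>u x - u y\<bar>" by (simp add: abs_mult[symmetric] power2_eq_square algebra_simps)
    also have "\<dots> \<le> (2 * Mu) * (Lu * dist x y)"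
      using Mu(2)[OF xy(1)] Mu(2)[OF xy(2)] Mu(1) Lu(2)[OF seg] by (intro mult_mono) auto
    finally have 1: "\<bar>(u x)\<^sup>2 - (u y)\<^sup>2\<bar> \<le> 2 * Mu * Lu * dist x y" by (simp add: mult.assoc)
    have "\<bar>\<phi> x t / \<epsilon> - \<phi> y t / \<epsilon>\<bar> = \<bar>\<phi> x t - \<phi> y t\<bar> / \<epsilon>"
      using eps by (simp add: diff_divide_distrib[symmetric] abs_divide)
    also have "\<dots> \<le> c1 * dist x y / \<epsilon>" using near(2)[OF x d] eps by (intro divide_right_mono) auto
    finally have "M * \<bar>\<phi> x t / \<epsilon> - \<phi> y t / \<epsilon>\<bar> \<le> M * (c1 * dist x y / \<epsilon>)" using M0 by (rule mult_left_mono)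
    from order_trans[OF psil this]
    have 2: "\<bar>\<psi> (\<phi> x t / \<epsilon>) - \<psi> (\<phi> y t / \<epsilon>)\<bar> \<le> M * (c1 / \<epsilon>) * dist x y" by simp
    have "\<bar>Y x \<bullet> b - Y y \<bullet> b\<bar> \<le> norm (Y x - Y y)" unfolding inner_diff_left[symmetric] by (rule Basis_le_norm[OF b])
    also have "\<dots> \<le> B * dist x y" unfolding W_def using Y(3) seg by (simp add: V_def)
    finally have 3: "\<bar>Y x \<bullet> b - Y y \<bullet> b\<bar> \<le> B * dist x y" .
    have 4: "\<bar>(u y)\<^sup>2\<bar> \<le> Mu\<^sup>2" using Mu(2)[OF xy(2)] by (simp add: abs_le_square_iff[symmetric] Mu(1))
    have 5: "\<bar>Y x \<bullet> b\<bar> \<le> A" using Basis_le_norm[OF b, of "Y x"] Y(2)[of x] xy by (simp add: V_def)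
    have "\<bar>(u x)\<^sup>2 * \<psi> (\<phi> x t / \<epsilon>) * (Y x \<bullet> b) - (u y)\<^sup>2 * \<psi> (\<phi> y t / \<epsilon>) * (Y y \<bullet> b)\<bar>
        \<le> (2 * Mu * Lu * dist x y) * M * A + Mu\<^sup>2 * (M * (c1 / \<epsilon>) * dist x y) * A + Mu\<^sup>2 * M * (B * dist x y)"
      by (rule product_difference_le[OF 1 2 3 4 psi(2) psi(2) 5])
    then show ?thesis using xy by (simp add: F_def LF_def algebra_simps)
  qed
  have Flip: "\<bar>F b x - F b y\<bar> \<le> LF * dist x y" if b: "b \<in> Basis" and d: "dist x y < r0" for b x y
  proof -
    consider "x \<in> K" | "y \<in> K" | "x \<notin> K" "y \<notin> K" by blast
    then show ?thesis
    proof cases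
      case 1 then show ?thesis using Flip0[OF b] d by blast
    next
      case 2
      then have "\<bar>F b y - F b x\<bar> \<le> LF * dist y x" using Flip0[OF b, of y x] d by (simp add: dist_commute)
      then show ?thesis by (simp add: dist_commute abs_minus_commute)
    next
      case 3 then show ?thesis using LF0 by (simp add: Fzero)
    qed
  qed
  have der_in: "(F b has_derivative (\<lambda>h. 2 * u x * (grad u x \<bullet> h) * \<psi> (\<phi> x t / \<epsilon>) * (Y x \<bullet> b)
      + (u x)\<^sup>2 * (\<psi>' (\<phi> x t / \<epsilon>) * ((level_grad t x \<bullet> h) / \<epsilon>)) * (Y x \<bullet> b)
      + (u x)\<^sup>2 * \<psi> (\<phi> x t / \<epsilon>) * (frechet_derivative Y (at x) h \<bullet> b))) (at x)"
    if x: "x \<in> V" and ud: "u differentiable (at x)" for b x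
  proof -
    have du: "(u has_derivative (\<lambda>h. grad u x \<bullet> h)) (at x)" by (rule has_derivative_grad[OF ud])
    have dY: "(Y has_derivative frechet_derivative Y (at x)) (at x)"
      using Y(1)[of x] x frechet_derivative_works by (auto simp: V_def)
    have dp: "((\<lambda>y. \<phi> y t / \<epsilon>) has_derivative (\<lambda>h. (level_grad t x \<bullet> h) / \<epsilon>)) (at x)"
      using phi_has_derivative[of x t] x VO t eps by (auto intro!: derivative_eq_intros)
    have "(\<psi> has_derivative (\<lambda>h. \<psi>' (\<phi> x t / \<epsilon>) * h)) (at (\<phi> x t / \<epsilon>))"
      using psi(1) by (simp add: has_field_derivative_def)
    from has_derivative_compose[of "\<lambda>y. \<phi> y t / \<epsilon>" "\<lambda>h. (level_grad t x \<bullet> h) / \<epsilon>" x UNIV \<psi>, OF dp this]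
    have dpsi: "((\<lambda>y. \<psi> (\<phi> y t / \<epsilon>)) has_derivative (\<lambda>h. \<psi>' (\<phi> x t / \<epsilon>) * ((level_grad t x \<bullet> h) / \<epsilon>))) (at x)" .
    have "((\<lambda>x. (u x * u x) * \<psi> (\<phi> x t / \<epsilon>) * (Y x \<bullet> b)) has_derivative
        (\<lambda>h. (u x * u x) * \<psi> (\<phi> x t / \<epsilon>) * (frechet_derivative Y (at x) h \<bullet> b) +
          ((u x * u x) * (\<psi>' (\<phi> x t / \<epsilon>) * ((level_grad t x \<bullet> h) / \<epsilon>)) +
           (u x * (grad u x \<bullet> h) + (grad u x \<bullet> h) * u x) * \<psi> (\<phi> x t / \<epsilon>)) * (Y x \<bullet> b))) (at x)"
      by (intro has_derivative_mult du dpsi has_derivative_inner_left[OF dY])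
    then have "((\<lambda>x. (u x)\<^sup>2 * \<psi> (\<phi> x t / \<epsilon>) * (Y x \<bullet> b)) has_derivative
        (\<lambda>h. 2 * u x * (grad u x \<bullet> h) * \<psi> (\<phi> x t / \<epsilon>) * (Y x \<bullet> b)
      + (u x)\<^sup>2 * (\<psi>' (\<phi> x t / \<epsilon>) * ((level_grad t x \<bullet> h) / \<epsilon>)) * (Y x \<bullet> b)
      + (u x)\<^sup>2 * \<psi> (\<phi> x t / \<epsilon>) * (frechet_derivative Y (at x) h \<bullet> b))) (at x)"
      unfolding power2_eq_square
      by (rule has_derivative_eq_rhs) (auto simp: fun_eq_iff algebra_simps)
    then show ?thesis
      by (rule has_derivative_transform_within_open[OF _ V x]) (simp add: F_def)
  qed
  have der_out: "(F b has_derivative (\<lambda>h. 0)) (at x)" if x: "x \<notin> V" for b x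
  proof -
    have "F b y = 0" if "y \<in> ball x r0" for y
    proof (rule Fzero, rule notI)
      assume "y \<in> K"
      then have "closed_segment y x \<subseteq> V" using that by (intro near) (auto simp: dist_commute)
      then show False using x by auto
    qed
    then have eq: "\<And>y. y \<in> ball x r0 \<Longrightarrow> (\<lambda>_. 0) y = F b y" by simp
    have xb: "x \<in> ball x r0" using r0 by simp
    show ?thesis by (rule has_derivative_transform_within_open[OF has_derivative_const open_ball xb eq])
  qed
  have Fdiff: "AE x in lebesgue. F b differentiable (at x)" for b
    using udiff
  proof eventually_elim
    fix x assume "x \<in> V \<longrightarrow> u differentiable (at x)"
    then show "F b differentiable (at x)"
      using der_in[of x b] der_out[of x b] by (cases "x \<in> V") (auto simp: differentiable_def)
  qed
  have Kb: "bounded K" using bounded_domain by (rule bounded_subset) (auto simp: K_def)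
  note ibp = integral_frechet_derivative_eq_0[OF r0 LF0 Flip Kb Fzero Fdiff]
  define \<Theta> where "\<Theta> x = (\<Sum>b\<in>Basis. frechet_derivative (F b) (at x) b)" for x
  have int: "integrable lebesgue \<Theta>" unfolding \<Theta>_def by (intro Bochner_Integration.integrable_sum ibp(1))
  have zero: "integral\<^sup>L lebesgue \<Theta> = 0"
  proof -
    have "integral\<^sup>L lebesgue \<Theta> = (\<Sum>b\<in>Basis. integral\<^sup>L lebesgue (\<lambda>x. frechet_derivative (F b) (at x) b))"
      unfolding \<Theta>_def by (intro Bochner_Integration.integral_sum ibp(1))
    also have "\<dots> = 0" by (intro sum.neutral ballI ibp(2))
    finally show ?thesis .
  qed
  have "AE x in lebesgue. (x \<notin> V \<longrightarrow> \<Theta> x = 0) \<and>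
      (x \<in> V \<longrightarrow> \<bar>\<Theta> x - (u x)\<^sup>2 * (\<psi>' (\<phi> x t / \<epsilon>) / \<epsilon> * (level_grad t x \<bullet> Y x))\<bar>
        \<le> \<bar>\<psi> (\<phi> x t / \<epsilon>)\<bar> * (2 * A * (\<bar>u x\<bar> * norm (grad u x)) + real DIM('a) * B * (u x)\<^sup>2))"
    using udiff
  proof eventually_elim
    fix x assume ud: "x \<in> V \<longrightarrow> u differentiable (at x)"
    show "(x \<notin> V \<longrightarrow> \<Theta> x = 0) \<and>
      (x \<in> V \<longrightarrow> \<bar>\<Theta> x - (u x)\<^sup>2 * (\<psi>' (\<phi> x t / \<epsilon>) / \<epsilon> * (level_grad t x \<bullet> Y x))\<bar>
        \<le> \<bar>\<psi> (\<phi> x t / \<epsilon>)\<bar> * (2 * A * (\<bar>u x\<bar> * norm (grad u x)) + real DIM('a) * B * (u x)\<^sup>2))"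
    proof (intro conjI impI)
      assume "x \<notin> V"
      then show "\<Theta> x = 0" unfolding \<Theta>_def using frechet_derivative_at[OF der_out, symmetric] by simp
    next
      assume x: "x \<in> V"
      define s where "s = \<psi> (\<phi> x t / \<epsilon>)"
      define s' where "s' = \<psi>' (\<phi> x t / \<epsilon>)"
      define g where "g = level_grad t x"
      define D where "D = frechet_derivative Y (at x)"
      \<comment> \<open>Product rule; \<open>F b\<close> is the component of the field in direction
        \<open>b\<close>.\<close>
      have fd: "frechet_derivative (F b) (at x) b = 2 * u x * s * ((grad u x \<bullet> b) * (Y x \<bullet> b))
        + (u x)\<^sup>2 * (s' / \<epsilon>) * ((g \<bullet> b) * (Y x \<bullet> b)) + (u x)\<^sup>2 * s * (D b \<bullet> b)" for b
        unfolding frechet_derivative_at[OF der_in, OF x ud[rule_format, OF x], symmetric]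
        by (simp add: s_def s'_def g_def D_def algebra_simps)
      have "\<Theta> x = 2 * u x * s * (grad u x \<bullet> Y x) + (u x)\<^sup>2 * (s' / \<epsilon>) * (g \<bullet> Y x)
          + (u x)\<^sup>2 * s * (\<Sum>b\<in>Basis. D b \<bullet> b)"
        by (simp only: \<Theta>_def fd sum.distrib sum_distrib_left[symmetric] euclidean_inner[symmetric])
      then have "\<Theta> x - (u x)\<^sup>2 * (s' / \<epsilon> * (g \<bullet> Y x))
          = s * (2 * (u x * (grad u x \<bullet> Y x)) + (\<Sum>b\<in>Basis. D b \<bullet> b) * (u x)\<^sup>2)"
        by (simp add: algebra_simps)
      moreover have "\<bar>2 * (u x * (grad u x \<bullet> Y x)) + (\<Sum>b\<in>Basis. D b \<bullet> b) * (u x)\<^sup>2\<bar>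
          \<le> 2 * A * (\<bar>u x\<bar> * norm (grad u x)) + real DIM('a) * B * (u x)\<^sup>2"
      proof -
        have "\<bar>grad u x \<bullet> Y x\<bar> \<le> norm (grad u x) * norm (Y x)" by (rule Cauchy_Schwarz_ineq2)
        also have "\<dots> \<le> norm (grad u x) * A" using Y(2)[of x] x by (intro mult_left_mono) (auto simp: V_def)
        finally have "\<bar>u x\<bar> * \<bar>grad u x \<bullet> Y x\<bar> \<le> \<bar>u x\<bar> * (norm (grad u x) * A)" by (intro mult_left_mono) auto
        then have 1: "\<bar>2 * (u x * (grad u x \<bullet> Y x))\<bar> \<le> 2 * A * (\<bar>u x\<bar> * norm (grad u x))"
          by (simp add: abs_mult mult_ac)
        have "\<bar>\<Sum>b\<in>Basis. D b \<bullet> b\<bar> \<le> (\<Sum>b::'a\<in>Basis. B)"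
        proof (rule order_trans[OF sum_abs], rule sum_mono)
          fix b :: 'a assume b: "b \<in> Basis"
          obtain r where r: "0 < r" "ball x r \<subseteq> V" using V x open_contains_ball by blast
          have "norm (D b) \<le> B * norm b"
          proof (rule has_derivative_norm_le_lipschitz[OF _ r(1)])
            show "(Y has_derivative D) (at x)" unfolding D_def
              using Y(1)[of x] x frechet_derivative_works by (auto simp: V_def)
            fix y assume "dist y x < r"
            then have "y \<in> ball x r" "x \<in> ball x r" using r by (auto simp: dist_commute)
            then have "closed_segment y x \<subseteq> V" using r closed_segment_subset[OF _ _ convex_ball] by blast
            then show "norm (Y y - Y x) \<le> B * dist y x" using Y(3) by (simp add: V_def)
          qed
          then show "\<bar>D b \<bullet> b\<bar> \<le> B" using Basis_le_norm[OF b, of "D b"] b by simp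
        qed
        then have "\<bar>(\<Sum>b\<in>Basis. D b \<bullet> b) * (u x)\<^sup>2\<bar> \<le> real DIM('a) * B * (u x)\<^sup>2"
          by (simp add: abs_mult mult_right_mono)
        with 1 show ?thesis by linarith
      qed
      ultimately show "\<bar>\<Theta> x - (u x)\<^sup>2 * (\<psi>' (\<phi> x t / \<epsilon>) / \<epsilon> * (level_grad t x \<bullet> Y x))\<bar>
        \<le> \<bar>\<psi> (\<phi> x t / \<epsilon>)\<bar> * (2 * A * (\<bar>u x\<bar> * norm (grad u x)) + real DIM('a) * B * (u x)\<^sup>2)"
        by (simp add: s_def[symmetric] s'_def[symmetric] g_def[symmetric] abs_mult mult_left_mono)
    qed
  qed
  then show ?thesis using int zero unfolding V_def by (intro exI[of _ \<Theta>]) simp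
qed

lemma bounded_on_strip_integrable:
  fixes g :: "'a \<Rightarrow> real"
  assumes t: "t \<in> {0..T}" and m: "(\<lambda>x. indicator (strip \<Omega> \<phi> r t) x * g x) \<in> borel_measurable lebesgue"
    and b: "AE x in lebesgue. x \<in> strip \<Omega> \<phi> r t \<longrightarrow> \<bar>g x\<bar> \<le> B"
  shows "integrable lebesgue (\<lambda>x. indicator (strip \<Omega> \<phi> r t) x * g x)"
proof (rule Bochner_Integration.integrable_bound[OF _ m])
  have "bounded (strip \<Omega> \<phi> r t)" using bounded_domain by (rule bounded_subset) (auto simp: strip_def)
  then have "emeasure lborel (strip \<Omega> \<phi> r t) < \<infinity>" by (rule emeasure_bounded_finite)
  then have "integrable lborel (\<lambda>x. indicator (strip \<Omega> \<phi> r t) x *\<^sub>R \<bar>B\<bar>)"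
    using open_strip[OF t] by (intro integrable_scaleR_left integrable_real_indicator) auto
  then show "integrable lebesgue (\<lambda>x. indicator (strip \<Omega> \<phi> r t) x *\<^sub>R \<bar>B\<bar>)"
    using open_strip[OF t] by (subst integrable_completion) auto
  show "AE x in lebesgue. norm (indicator (strip \<Omega> \<phi> r t) x * g x) \<le> norm (indicator (strip \<Omega> \<phi> r t) x *\<^sub>R \<bar>B\<bar>)"
    using b by eventually_elim (auto split: split_indicator)
qed

end

section \<open>Weighted integrals and a Poincare inequality\<close>

context moving_surface
begin

text \<open>The width \<open>17/8 \<epsilon>\<close> leaves \<open>\<epsilon>/8\<close> around the support
  \<open>2 \<epsilon>\<close> of the bump, and is such that a mesh element meeting the strip stays
  within \<open>9/4 \<epsilon>\<close>, where the wider profile is bounded below.\<close>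

definition core_strip :: "real \<Rightarrow> real \<Rightarrow> 'a set" where
  "core_strip \<epsilon> t = strip \<Omega> \<phi> (17 / 8 * \<epsilon>) t"

definition weight :: "real \<Rightarrow> real \<Rightarrow> 'a \<Rightarrow> real" where
  "weight \<epsilon> t x = rho \<Omega> \<phi> \<epsilon> x t * norm (level_grad t x)"

definition mass :: "real \<Rightarrow> real \<Rightarrow> ('a \<Rightarrow> real) \<Rightarrow> real" where
  "mass \<epsilon> t u = (\<integral>x. (u x)\<^sup>2 * weight \<epsilon> t x \<partial>lebesgue)"

definition dissipation :: "real \<Rightarrow> real \<Rightarrow> ('a \<Rightarrow> real) \<Rightarrow> real" where
  "dissipation \<epsilon> t u = (\<integral>x. (norm (grad u x))\<^sup>2 * weight \<epsilon> t x \<partial>lebesgue)"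

definition core_energy :: "real \<Rightarrow> real \<Rightarrow> ('a \<Rightarrow> real) \<Rightarrow> real" where
  "core_energy \<epsilon> t u = (\<integral>x. indicator (core_strip \<epsilon> t) x * (norm (grad u x))\<^sup>2 \<partial>lebesgue)"

text \<open>For a small time step the weights of both time levels vanish where \<open>|\<phi>| > 17/10
  \<epsilon>\<close>, because \<open>\<pi>/2 + 1/8 < 17/10\<close>.\<close>

definition near_square :: "real \<Rightarrow> real \<Rightarrow> ('a \<Rightarrow> real) \<Rightarrow> 'a \<Rightarrow> real" where
  "near_square \<epsilon> t u x =
     indicator (core_strip \<epsilon> t) x * ((u x)\<^sup>2 * (if \<bar>\<phi> x t\<bar> \<le> 17 / 10 * \<epsilon> then 1 else 0))"

definition admissible_width :: "real \<Rightarrow> bool" where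
  "admissible_width \<epsilon> \<longleftrightarrow> 0 < \<epsilon> \<and> \<epsilon> < \<delta> / pi"

lemma admissible_width_bounds:
  assumes "admissible_width \<epsilon>" shows "0 < \<epsilon>" "3 * \<epsilon> < \<delta>" "\<epsilon> * pi < \<delta>"
proof -
  show e: "0 < \<epsilon>" using assms by (simp add: admissible_width_def)
  show p: "\<epsilon> * pi < \<delta>" using assms pi_gt_zero by (simp add: admissible_width_def pos_less_divide_eq)
  have "\<epsilon> * 3 \<le> \<epsilon> * pi" using e pi_gt3 by (intro mult_left_mono) auto
  with p show "3 * \<epsilon> < \<delta>" by simp
qed

lemma core_strip_subset:
  assumes e: "admissible_width \<epsilon>"
  shows "core_strip \<epsilon> t \<subseteq> strip \<Omega> \<phi> \<delta> t" "core_strip \<epsilon> t \<subseteq> strip \<Omega> \<phi> \<delta>0 t" "core_strip \<epsilon> t \<subseteq> \<Omega>"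
  using admissible_width_bounds[OF e] delta unfolding core_strip_def by (auto simp: strip_def)

lemma core_strip_grad_bounds:
  assumes e: "admissible_width \<epsilon>" and t: "t \<in> {0..T}" and x: "x \<in> core_strip \<epsilon> t"
  shows "c0 \<le> norm (level_grad t x)" "norm (level_grad t x) \<le> c1"
  using phi_bounds[OF t subsetD[OF core_strip_subset(2)[OF e] x]] by auto

lemma open_core_strip: "t \<in> {0..T} \<Longrightarrow> open (core_strip \<epsilon> t)"
  unfolding core_strip_def by (rule open_strip)

lemma rho_core: "x \<in> core_strip \<epsilon> t \<Longrightarrow> rho \<Omega> \<phi> \<epsilon> x t = profile (\<phi> x t / \<epsilon>)"
  by (simp add: rho_def core_strip_def strip_def)

lemma rho_nonneg: "0 \<le> rho \<Omega> \<phi> \<epsilon> x t" by (simp add: rho_def profile_nonneg)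

lemma rho_outside:
  assumes e: "0 < \<epsilon>" and x: "\<epsilon> * pi / 2 \<le> \<bar>\<phi> x t\<bar>"
  shows "rho \<Omega> \<phi> \<epsilon> x t = 0"
proof -
  have "pi / 2 \<le> \<bar>\<phi> x t / \<epsilon>\<bar>" using e x by (simp add: abs_divide pos_le_divide_eq mult.commute)
  then show ?thesis by (simp add: rho_def profile_outside)
qed

text \<open>This leaves room for a change of \<open>\<phi>/\<epsilon>\<close> by \<open>1/8\<close>:
  \<open>63/40 + 1/8 = 17/10\<close>.\<close>

lemma half_pi_less: "pi / 2 < 63 / 40" using pi_approx(2) by simp

lemma weight_outside_strip:
  assumes e: "0 < \<epsilon>" and x: "x \<notin> strip \<Omega> \<phi> (\<epsilon> * pi / 2) t"
  shows "weight \<epsilon> t x = 0"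
proof (cases "x \<in> \<Omega>")
  case True
  then have "\<epsilon> * pi / 2 \<le> \<bar>\<phi> x t\<bar>" using x by (simp add: strip_def)
  then show ?thesis using rho_outside[OF e, of x t] by (simp add: weight_def)
qed (simp add: weight_def rho_def)

lemma weight_outside:
  assumes e: "0 < \<epsilon>" and x: "x \<notin> core_strip \<epsilon> t" shows "weight \<epsilon> t x = 0"
proof (rule weight_outside_strip[OF e])
  have "\<epsilon> * (pi / 2) \<le> \<epsilon> * (17 / 8)" using e half_pi_less by (intro mult_left_mono) auto
  then have "strip \<Omega> \<phi> (\<epsilon> * pi / 2) t \<subseteq> core_strip \<epsilon> t"
    unfolding core_strip_def by (intro strip_mono) (simp add: mult.commute)
  then show "x \<notin> strip \<Omega> \<phi> (\<epsilon> * pi / 2) t" using x by blast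
qed

lemma weight_nonneg: "0 \<le> weight \<epsilon> t x"
  by (simp add: weight_def rho_nonneg)

lemma weight_bounds:
  assumes e: "admissible_width \<epsilon>" and t: "t \<in> {0..T}"
  shows "weight \<epsilon> t x \<le> c1"
    and "x \<in> core_strip \<epsilon> t \<Longrightarrow> profile (\<phi> x t / \<epsilon>) \<le> weight \<epsilon> t x / c0"
proof -
  have c: "0 < c0" "0 < c1" using constants by auto
  show "weight \<epsilon> t x \<le> c1"
  proof (cases "x \<in> core_strip \<epsilon> t")
    case True
    have "weight \<epsilon> t x \<le> 1 * c1" unfolding weight_def rho_core[OF True]
      using core_strip_grad_bounds[OF e t True] by (intro mult_mono profile_le_1) auto
    then show ?thesis by simp
  qed (use weight_outside admissible_width_bounds(1)[OF e] c in auto)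
  assume x: "x \<in> core_strip \<epsilon> t"
  have "profile (\<phi> x t / \<epsilon>) * c0 \<le> weight \<epsilon> t x" unfolding weight_def rho_core[OF x]
    using core_strip_grad_bounds[OF e t x] by (intro mult_left_mono profile_nonneg) auto
  then show "profile (\<phi> x t / \<epsilon>) \<le> weight \<epsilon> t x / c0" using c by (simp add: pos_le_divide_eq)
qed

lemma continuous_on_strip_measurable:
  fixes g :: "'a \<Rightarrow> real"
  assumes t: "t \<in> {0..T}" and g: "continuous_on (core_strip \<epsilon> t) g"
  shows "(\<lambda>x. indicator (core_strip \<epsilon> t) x * g x) \<in> borel_measurable lebesgue"
proof -
  have "(\<lambda>x. if x \<in> core_strip \<epsilon> t then g x else 0) \<in> borel_measurable borel"
    by (rule borel_measurable_continuous_on_if) (use open_core_strip[OF t] g in auto)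
  moreover have "(\<lambda>x. if x \<in> core_strip \<epsilon> t then g x else 0) = (\<lambda>x. indicator (core_strip \<epsilon> t) x * g x)"
    by (auto simp: fun_eq_iff)
  ultimately show ?thesis by (simp add: measurable_completion)
qed

lemma continuous_on_comp_phi:
  assumes t: "t \<in> {0..T}" and h: "continuous_on UNIV h" and e: "admissible_width \<epsilon>"
  shows "continuous_on (core_strip \<epsilon> t) (\<lambda>x. h (\<phi> x t / \<epsilon>))"
proof -
  have "continuous_on (core_strip \<epsilon> t) (\<lambda>x. \<phi> x t)"
    using phi_continuous_space[OF t] core_strip_subset(3)[OF e] continuous_on_subset by blast
  then have "continuous_on (core_strip \<epsilon> t) (\<lambda>x. \<phi> x t / \<epsilon>)" by (simp add: divide_inverse continuous_on_mult_right)
  then show ?thesis by (rule continuous_on_compose2[OF h]) auto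
qed

lemma profile_continuous: "continuous_on UNIV profile"
  by (meson DERIV_continuous continuous_at_imp_continuous_on profile_has_derivative)

lemma weight_measurable:
  assumes t: "t \<in> {0..T}" and e: "admissible_width \<epsilon>"
  shows "weight \<epsilon> t \<in> borel_measurable lebesgue"
proof -
  have "continuous_on (core_strip \<epsilon> t) (\<lambda>x. profile (\<phi> x t / \<epsilon>) * norm (level_grad t x))"
    using continuous_on_subset[OF grad_phi_continuous[OF t] core_strip_subset(3)[OF e]]
    by (intro continuous_on_mult continuous_on_norm continuous_on_comp_phi t e profile_continuous)
  from continuous_on_strip_measurable[OF t this]
  have "(\<lambda>x. indicator (core_strip \<epsilon> t) x * (profile (\<phi> x t / \<epsilon>) * norm (level_grad t x))) \<in> borel_measurable lebesgue" .
  moreover have "(\<lambda>x. indicator (core_strip \<epsilon> t) x * (profile (\<phi> x t / \<epsilon>) * norm (level_grad t x))) = weight \<epsilon> t"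
    using weight_outside[OF admissible_width_bounds(1)[OF e]]
    by (auto simp: fun_eq_iff weight_def rho_core split: split_indicator)
  ultimately show ?thesis by simp
qed

text \<open>Boundedness on a bounded strip; stated with an additional bounded factor \<open>q\<close> to cover
  the weights, their shifts in time and indicators.\<close>

lemma regular_square_integrable:
  fixes u q :: "'a \<Rightarrow> real"
  assumes t: "t \<in> {0..T}" and u: "piecewise_regular_on (core_strip \<epsilon> t) u"
    and q: "(\<lambda>x. indicator (core_strip \<epsilon> t) x * q x) \<in> borel_measurable lebesgue"
    and b: "\<And>x. x \<in> core_strip \<epsilon> t \<Longrightarrow> \<bar>q x\<bar> \<le> B"
  shows "integrable lebesgue (\<lambda>x. indicator (core_strip \<epsilon> t) x * ((u x)\<^sup>2 * q x))"
    and "integrable lebesgue (\<lambda>x. indicator (core_strip \<epsilon> t) x * ((norm (grad u x))\<^sup>2 * q x))"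
proof -
  let ?W = "core_strip \<epsilon> t"
  have W: "open ?W" by (rule open_core_strip[OF t])
  obtain Mu where Mu: "0 \<le> Mu" "\<And>x. x \<in> ?W \<Longrightarrow> \<bar>u x\<bar> \<le> Mu"
    using u unfolding piecewise_regular_on_def by blast
  have "continuous_on ?W (\<lambda>x. (u x)\<^sup>2)" by (intro continuous_intros piecewise_regular_continuous[OF W u])
  from borel_measurable_times[OF continuous_on_strip_measurable[OF t this] q]
  have m1: "(\<lambda>x. indicator ?W x * ((u x)\<^sup>2 * q x)) \<in> borel_measurable lebesgue"
    by (rule measurable_cong[THEN iffD1, rotated]) (auto split: split_indicator)
  have "\<bar>(u x)\<^sup>2 * q x\<bar> \<le> Mu\<^sup>2 * \<bar>B\<bar>" if "x \<in> ?W" for x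
  proof -
    have "\<bar>(u x)\<^sup>2\<bar> \<le> Mu\<^sup>2" using Mu(2)[OF that] by (simp add: abs_le_square_iff[symmetric] Mu(1))
    then show ?thesis unfolding abs_mult using b[OF that] by (intro mult_mono) auto
  qed
  then show "integrable lebesgue (\<lambda>x. indicator ?W x * ((u x)\<^sup>2 * q x))"
    using m1 unfolding core_strip_def by (intro bounded_on_strip_integrable[OF t]) auto
  obtain L where L: "AE x in lebesgue. x \<in> ?W \<longrightarrow> norm (grad u x) \<le> L"
    using piecewise_regular_grad_bounded[OF W u] by blast
  have "(\<lambda>x. (norm (indicator ?W x *\<^sub>R grad u x))\<^sup>2) \<in> borel_measurable lebesgue"
    by (rule borel_measurable_power[OF measurable_compose[OF piecewise_regular_grad_measurable[OF W u] borel_measurable_norm]])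
  from borel_measurable_times[OF this q]
  have m2: "(\<lambda>x. indicator ?W x * ((norm (grad u x))\<^sup>2 * q x)) \<in> borel_measurable lebesgue"
    by (rule measurable_cong[THEN iffD1, rotated]) (auto split: split_indicator)
  have "AE x in lebesgue. x \<in> ?W \<longrightarrow> \<bar>(norm (grad u x))\<^sup>2 * q x\<bar> \<le> L\<^sup>2 * \<bar>B\<bar>"
    using L
  proof eventually_elim
    fix x assume "x \<in> ?W \<longrightarrow> norm (grad u x) \<le> L"
    then show "x \<in> ?W \<longrightarrow> \<bar>(norm (grad u x))\<^sup>2 * q x\<bar> \<le> L\<^sup>2 * \<bar>B\<bar>"
      unfolding abs_mult using b[of x] by (auto intro!: mult_mono power_mono)
  qed
  then show "integrable lebesgue (\<lambda>x. indicator ?W x * ((norm (grad u x))\<^sup>2 * q x))"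
    using m2 unfolding core_strip_def by (intro bounded_on_strip_integrable[OF t]) auto
qed

lemma regular_weight_integrable:
  fixes u :: "'a \<Rightarrow> real"
  assumes t: "t \<in> {0..T}" and e: "admissible_width \<epsilon>" and u: "piecewise_regular_on (core_strip \<epsilon> t) u"
  shows "integrable lebesgue (\<lambda>x. (u x)\<^sup>2 * weight \<epsilon> t x)"
    and "integrable lebesgue (\<lambda>x. (norm (grad u x))\<^sup>2 * weight \<epsilon> t x)"
    and "integrable lebesgue (\<lambda>x. indicator (core_strip \<epsilon> t) x * (norm (grad u x))\<^sup>2)"
proof -
  let ?W = "core_strip \<epsilon> t"
  have m: "(\<lambda>x. indicator ?W x * weight \<epsilon> t x) \<in> borel_measurable lebesgue"
    using open_core_strip[OF t] by (intro borel_measurable_times borel_measurable_indicator weight_measurable t e) auto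
  have b: "\<bar>weight \<epsilon> t x\<bar> \<le> c1" for x using weight_bounds(1)[OF e t] weight_nonneg by simp
  note R = regular_square_integrable[OF t u m b]
  have "(\<lambda>x. indicator ?W x * (h x * weight \<epsilon> t x)) = (\<lambda>x. h x * weight \<epsilon> t x)" for h :: "'a \<Rightarrow> real"
    using weight_outside[OF admissible_width_bounds(1)[OF e]] by (auto simp: fun_eq_iff split: split_indicator)
  then show "integrable lebesgue (\<lambda>x. (u x)\<^sup>2 * weight \<epsilon> t x)"
    "integrable lebesgue (\<lambda>x. (norm (grad u x))\<^sup>2 * weight \<epsilon> t x)" using R by simp_all
  have "(\<lambda>x. indicator ?W x * 1 :: real) \<in> borel_measurable lebesgue"
    using continuous_on_strip_measurable[OF t, of \<epsilon> "\<lambda>_. 1"] by simp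
  from regular_square_integrable(2)[OF t u this, of 1]
  show "integrable lebesgue (\<lambda>x. indicator ?W x * (norm (grad u x))\<^sup>2)" by simp
qed

lemma energies_nonneg: "0 \<le> mass \<epsilon> t u" "0 \<le> dissipation \<epsilon> t u" "0 \<le> core_energy \<epsilon> t u"
  unfolding mass_def dissipation_def core_energy_def by (auto intro!: integral_nonneg_AE simp: weight_nonneg)

lemma near_square_integrable:
  assumes t: "t \<in> {0..T}" and e: "admissible_width \<epsilon>" and u: "piecewise_regular_on (core_strip \<epsilon> t) u"
  shows "integrable lebesgue (near_square \<epsilon> t u)"
proof -
  let ?W = "core_strip \<epsilon> t"
  let ?S = "\<lambda>x. if \<bar>\<phi> x t\<bar> \<le> 17 / 10 * \<epsilon> then 1 else 0 :: real"
  have Sm: "(\<lambda>x. indicator ?W x * ?S x) \<in> borel_measurable lebesgue"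
  proof -
    have "continuous_on ?W (\<lambda>x. \<phi> x t)"
      using phi_continuous_space[OF t] core_strip_subset(3)[OF e] continuous_on_subset by blast
    from continuous_on_strip_measurable[OF t this]
    have m: "(\<lambda>x. indicator ?W x * \<phi> x t) \<in> borel_measurable lebesgue" .
    have "{x \<in> space lebesgue. \<bar>indicator ?W x * \<phi> x t\<bar> \<le> 17 / 10 * \<epsilon>} \<in> sets lebesgue"
      using m by measurable
    then have "(\<lambda>x. indicator ?W x * indicator {x \<in> space lebesgue. \<bar>indicator ?W x * \<phi> x t\<bar> \<le> 17 / 10 * \<epsilon>} x :: real)
        \<in> borel_measurable lebesgue"
      using open_core_strip[OF t] by (intro borel_measurable_times borel_measurable_indicator) auto
    then show ?thesis by (rule measurable_cong[THEN iffD1, rotated]) (auto split: split_indicator)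
  qed
  show ?thesis unfolding near_square_def[abs_def]
    by (rule regular_square_integrable(1)[OF t u Sm, of 1]) auto
qed

text \<open>The normal field \<open>Y = \<nabla>\<phi> / |\<nabla>\<phi>|\<^sup>2\<close> satisfies
  \<open>\<nabla>\<phi> \<bullet> Y = 1\<close>, so integration by parts with \<open>\<psi> = bump
  p\<close> produces \<open>\<integral> u\<^sup>2 bump'(\<phi>/\<epsilon>)\<close>. By
  \<open>bump_inequality\<close> this integral controls \<open>u\<^sup>2\<close> on
  \<open>|\<phi>| \<le> 17/10 \<epsilon>\<close> up to the weighted integral. The error consists
  of \<open>\<epsilon> |u| |\<nabla>u|\<close>, split by Young's inequality, and of
  \<open>\<epsilon>\<close> times the divergence of \<open>Y\<close>.\<close>

lemma strip_poincare_inequality: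
  "\<exists>K\<ge>0. \<forall>t\<in>{0..T}. \<forall>\<epsilon> u. admissible_width \<epsilon> \<longrightarrow> piecewise_regular_on (core_strip \<epsilon> t) u \<longrightarrow>
    integral\<^sup>L lebesgue (near_square \<epsilon> t u) \<le> K * (mass \<epsilon> t u + \<epsilon>\<^sup>2 * core_energy \<epsilon> t u)"
proof -
  define A where "A = 1 / c0"
  define B where "B = c2 / c0\<^sup>2"
  define d where "d = real DIM('a)"
  \<comment> \<open>Coefficient of \<open>|bump|\<close> to be absorbed: \<open>1\<close> from
    Young's inequality, the rest from the divergence of \<open>Y\<close> and
    \<open>\<epsilon> < \<delta>\<close>.\<close>
  define l where "l = 1 + \<delta> * (d * B)"
  define p where "p = nat \<lceil>3 * l + 2\<rceil>"
  define K0 where "K0 = 4 * (1 + (l + 1) * 4 ^ p)"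
  define K where "K = K0 / c0 + 2 * 4 ^ p * A\<^sup>2"
  have c: "0 < c0" "0 < c1" "0 < c2" using constants by auto
  have AB: "0 \<le> A" "0 \<le> B" "0 \<le> d" using c by (auto simp: A_def B_def d_def)
  have l0: "0 \<le> l" unfolding l_def using delta AB by (intro add_nonneg_nonneg mult_nonneg_nonneg) auto
  have pl: "3 * l + 2 \<le> real p" by (simp add: p_def) (use l0 in linarith)
  have p2: "2 \<le> p" using pl l0 by linarith
  have pl6: "6 * l + 4 \<le> 2 * real p" using pl by simp
  have K00: "0 \<le> K0" unfolding K0_def using l0 by (intro mult_nonneg_nonneg add_nonneg_nonneg) auto
  have K: "0 \<le> K" "K0 / c0 \<le> K" "2 * 4 ^ p * A\<^sup>2 \<le> K" unfolding K_def using K00 c by auto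
  have main: "integral\<^sup>L lebesgue (near_square \<epsilon> t u) \<le> K * (mass \<epsilon> t u + \<epsilon>\<^sup>2 * core_energy \<epsilon> t u)"
    if t: "t \<in> {0..T}" and e: "admissible_width \<epsilon>" and u: "piecewise_regular_on (core_strip \<epsilon> t) u" for t \<epsilon> u
  proof -
    let ?W = "core_strip \<epsilon> t"
    let ?S = "\<lambda>x. if \<bar>\<phi> x t\<bar> \<le> 17 / 10 * \<epsilon> then 1 else 0 :: real"
    note eb = admissible_width_bounds[OF e]
    have e': "0 < \<epsilon>" "\<epsilon> < \<delta> / pi" using e by (auto simp: admissible_width_def)
    define Y where "Y x = level_grad t x /\<^sub>R (norm (level_grad t x))\<^sup>2" for x
    have gn: "c0 \<le> norm (level_grad t x)" if "x \<in> ?W" for x using core_strip_grad_bounds(1)[OF e t that] .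
    have gnz: "level_grad t x \<noteq> 0" if "x \<in> ?W" for x using gn[OF that] c by auto
    have Yd: "Y differentiable (at x)" if x: "x \<in> ?W" for x
    proof -
      have "level_grad t differentiable (at x)"
        using grad_phi_differentiable[OF subsetD[OF core_strip_subset(3)[OF e] x] t] .
      then show ?thesis unfolding Y_def[abs_def] power2_norm_eq_inner
        using gnz[OF x] by (intro differentiable_scaleR differentiable_inverse differentiable_inner) auto
    qed
    have Yn: "norm (Y x) \<le> A" if "x \<in> ?W" for x
    proof -
      have "norm (Y x) = 1 / norm (level_grad t x)"
        using gnz[OF that] by (simp add: Y_def power2_eq_square divide_inverse)
      then show ?thesis using gn[OF that] c by (simp add: A_def frac_le)
    qed
    have Yl: "norm (Y x - Y y) \<le> B * dist x y" if "closed_segment x y \<subseteq> ?W" for x y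
      unfolding Y_def B_def using that core_strip_subset(2)[OF e] by (intro gradient_field_lipschitz(1)[OF t]) blast
    have Yg: "level_grad t x \<bullet> Y x = 1" if "x \<in> ?W" for x
      using gnz[OF that] by (simp add: Y_def power2_norm_eq_inner)
    define M where "M = 2 * 4 ^ p + (4 ^ p + 8 * real p * 4 ^ (p - 1))"
    have M: "\<bar>bump p r\<bar> \<le> M" "\<bar>bump_deriv p r\<bar> \<le> M" for r
      using abs_bump_le[OF p2, of r] abs_bump_deriv_le[OF p2, of r] by (auto simp: M_def)
    obtain \<Theta> where \<Theta>: "integrable lebesgue \<Theta>" "integral\<^sup>L lebesgue \<Theta> = 0"
      and ae: "AE x in lebesgue. (x \<notin> ?W \<longrightarrow> \<Theta> x = 0) \<and>
      (x \<in> ?W \<longrightarrow> \<bar>\<Theta> x - (u x)\<^sup>2 * (bump_deriv p (\<phi> x t / \<epsilon>) / \<epsilon> * (level_grad t x \<bullet> Y x))\<bar>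
        \<le> \<bar>bump p (\<phi> x t / \<epsilon>)\<bar> * (2 * A * (\<bar>u x\<bar> * norm (grad u x)) + real DIM('a) * B * (u x)\<^sup>2))"
      using strip_integration_by_parts[OF t e' u[unfolded core_strip_def] bump_has_derivative[OF p2] M bump_outside(1)[OF p2]
          Yd[unfolded core_strip_def] Yn[unfolded core_strip_def] Yl[unfolded core_strip_def] AB(1,2)]
      unfolding core_strip_def by blast
    note RW = regular_weight_integrable[OF t e u]
    have "AE x in lebesgue. near_square \<epsilon> t u x
        \<le> - \<epsilon> * \<Theta> x + K0 / c0 * ((u x)\<^sup>2 * weight \<epsilon> t x) + 2 * 4 ^ p * A\<^sup>2 * \<epsilon>\<^sup>2 * (indicator ?W x * (norm (grad u x))\<^sup>2)"
      using ae
    proof eventually_elim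
      fix x
      assume th: "(x \<notin> ?W \<longrightarrow> \<Theta> x = 0) \<and>
      (x \<in> ?W \<longrightarrow> \<bar>\<Theta> x - (u x)\<^sup>2 * (bump_deriv p (\<phi> x t / \<epsilon>) / \<epsilon> * (level_grad t x \<bullet> Y x))\<bar>
        \<le> \<bar>bump p (\<phi> x t / \<epsilon>)\<bar> * (2 * A * (\<bar>u x\<bar> * norm (grad u x)) + real DIM('a) * B * (u x)\<^sup>2))"
      show "near_square \<epsilon> t u x
        \<le> - \<epsilon> * \<Theta> x + K0 / c0 * ((u x)\<^sup>2 * weight \<epsilon> t x) + 2 * 4 ^ p * A\<^sup>2 * \<epsilon>\<^sup>2 * (indicator ?W x * (norm (grad u x))\<^sup>2)"
      proof (cases "x \<in> ?W")
        case False
        then show ?thesis using th weight_outside[OF eb(1) False] by (simp add: near_square_def)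
      next
        case x: True
        define U where "U = (u x)\<^sup>2"
        define G where "G = (norm (grad u x))\<^sup>2"
        define X where "X = \<bar>u x\<bar> * norm (grad u x)"
        define b where "b = \<bar>bump p (\<phi> x t / \<epsilon>)\<bar>"
        define b' where "b' = bump_deriv p (\<phi> x t / \<epsilon>)"
        define w where "w = weight \<epsilon> t x"
        have nn: "0 \<le> U" "0 \<le> G" "0 \<le> b" by (auto simp: U_def G_def b_def)
        have "\<bar>\<Theta> x - U * (b' / \<epsilon>)\<bar> \<le> b * (2 * A * X + d * B * U)"
          using th x Yg[OF x] by (simp add: U_def b'_def b_def X_def d_def)
        then have "\<Theta> x - U * (b' / \<epsilon>) \<le> b * (2 * A * X + d * B * U)" by linarith
        then have "\<epsilon> * (\<Theta> x - U * (b' / \<epsilon>)) \<le> \<epsilon> * (b * (2 * A * X + d * B * U))" using eb(1) by (intro mult_left_mono) auto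
        then have 1: "\<epsilon> * \<Theta> x - U * b' \<le> b * (2 * (\<epsilon> * A) * X + \<epsilon> * (d * B) * U)" using eb(1) by (simp add: algebra_simps)
        have "2 * (\<epsilon> * A) * X \<le> U + \<epsilon>\<^sup>2 * A\<^sup>2 * G"
        proof -
          have "0 \<le> (\<bar>u x\<bar> - \<epsilon> * A * norm (grad u x))\<^sup>2" by simp
          also have "\<dots> = U + \<epsilon>\<^sup>2 * A\<^sup>2 * G - 2 * (\<epsilon> * A) * X"
            by (simp add: U_def G_def X_def power2_diff power_mult_distrib)
          finally show ?thesis by simp
        qed
        moreover have "\<epsilon> * (d * B) * U \<le> \<delta> * (d * B) * U"
          using eb AB nn by (intro mult_right_mono) auto
        ultimately have "2 * (\<epsilon> * A) * X + \<epsilon> * (d * B) * U \<le> l * U + \<epsilon>\<^sup>2 * A\<^sup>2 * G"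
          by (simp add: l_def algebra_simps)
        then have 2: "b * (2 * (\<epsilon> * A) * X + \<epsilon> * (d * B) * U) \<le> b * (l * U + \<epsilon>\<^sup>2 * A\<^sup>2 * G)"
          by (rule mult_left_mono) (rule nn)
        have "b * (\<epsilon>\<^sup>2 * A\<^sup>2 * G) \<le> (2 * 4 ^ p) * (\<epsilon>\<^sup>2 * A\<^sup>2 * G)"
          unfolding b_def using abs_bump_le[OF p2] nn by (intro mult_right_mono) auto
        then have 3: "b * (l * U + \<epsilon>\<^sup>2 * A\<^sup>2 * G) \<le> l * b * U + 2 * 4 ^ p * A\<^sup>2 * \<epsilon>\<^sup>2 * G" by (simp add: algebra_simps)
        have Seq: "(if \<bar>\<phi> x t / \<epsilon>\<bar> \<le> 17 / 10 then 1 else 0) = ?S x"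
          using eb(1) by (simp add: abs_divide pos_divide_le_eq)
        have "?S x + l * b \<le> - b' + K0 * profile (\<phi> x t / \<epsilon>)"
          using bump_inequality[OF l0 p2 pl6, of "\<phi> x t / \<epsilon>"] unfolding Seq b_def b'_def K0_def .
        also have "K0 * profile (\<phi> x t / \<epsilon>) \<le> K0 * (w / c0)"
          unfolding w_def using K00 by (intro mult_left_mono weight_bounds(2)[OF e t x])
        finally have "U * (?S x + l * b) \<le> U * (- b' + K0 * (w / c0))" using nn by (intro mult_left_mono) auto
        then have 4: "U * ?S x + l * b * U \<le> - (U * b') + K0 / c0 * (U * w)" by (simp add: algebra_simps)
        have "U * ?S x \<le> - \<epsilon> * \<Theta> x + K0 / c0 * (U * w) + 2 * 4 ^ p * A\<^sup>2 * \<epsilon>\<^sup>2 * G"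
          using 1 2 3 4 by linarith
        then show ?thesis using x by (simp add: U_def G_def w_def near_square_def)
      qed
    qed
    then have "integral\<^sup>L lebesgue (near_square \<epsilon> t u)
        \<le> (\<integral>x. - \<epsilon> * \<Theta> x + K0 / c0 * ((u x)\<^sup>2 * weight \<epsilon> t x) + 2 * 4 ^ p * A\<^sup>2 * \<epsilon>\<^sup>2 * (indicator ?W x * (norm (grad u x))\<^sup>2) \<partial>lebesgue)"
      using \<Theta>(1) RW
      by (intro integral_mono_AE near_square_integrable t e u Bochner_Integration.integrable_add integrable_mult_right) auto
    also have "\<dots> = K0 / c0 * mass \<epsilon> t u + 2 * 4 ^ p * A\<^sup>2 * (\<epsilon>\<^sup>2 * core_energy \<epsilon> t u)"
      using \<Theta> RW by (simp add: mass_def core_energy_def)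
    also have "\<dots> \<le> K * mass \<epsilon> t u + K * (\<epsilon>\<^sup>2 * core_energy \<epsilon> t u)"
      using K energies_nonneg by (intro add_mono mult_right_mono) auto
    finally show ?thesis by (simp add: distrib_left)
  qed
  show ?thesis by (rule exI[of _ K], rule conjI, rule K(1), intro ballI allI impI, rule main)
qed

end

section \<open>Change of the weight over a time step\<close>

context moving_surface
begin

text \<open>Its product with \<open>\<nabla>\<phi>\<close> is \<open>(\<phi>(x,t) - \<phi>(x,s))
  |\<nabla>\<phi>|\<close>, so that the first order change of the weight has the form required by
  \<open>strip_integration_by_parts\<close>.\<close>

definition level_difference_field :: "real \<Rightarrow> real \<Rightarrow> 'a \<Rightarrow> 'a" where
  "level_difference_field t s x =
     (\<phi> x t - \<phi> x s) *\<^sub>R (level_grad t x /\<^sub>R norm (level_grad t x))"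

text \<open>The field and its Lipschitz constant are both \<open>O(|t - s|)\<close>; for the latter the
  Lipschitz continuity of \<open>\<nabla>\<phi>\<close> in time enters.\<close>

lemma level_difference_field_bounds:
  assumes e: "admissible_width \<epsilon>" and t: "t \<in> {0..T}" and s: "s \<in> {0..T}"
    and step: "c2 * \<bar>t - s\<bar> \<le> \<epsilon> / 8" and L: "0 \<le> L"
    and Lt: "\<forall>x\<in>core_strip \<epsilon> t.
      norm (level_grad t x - level_grad s x) \<le> L * \<bar>t - s\<bar>"
  shows "x \<in> core_strip \<epsilon> t \<Longrightarrow> \<bar>\<phi> x t - \<phi> x s\<bar> \<le> c2 * \<bar>t - s\<bar>"
    and "x \<in> core_strip \<epsilon> t \<Longrightarrow> level_difference_field t s differentiable (at x)"
    and "x \<in> core_strip \<epsilon> t \<Longrightarrow> norm (level_difference_field t s x) \<le> c2 * \<bar>t - s\<bar>"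
    and "closed_segment x y \<subseteq> core_strip \<epsilon> t \<Longrightarrow>
      norm (level_difference_field t s x - level_difference_field t s y)
        \<le> ((L + 2 * c2\<^sup>2 / c0) * \<bar>t - s\<bar>) * dist x y"
proof -
  let ?W = "core_strip \<epsilon> t"
  let ?D = "\<lambda>x. \<phi> x t - \<phi> x s"
  let ?N = "\<lambda>x. level_grad t x /\<^sub>R norm (level_grad t x)"
  note eb = admissible_width_bounds[OF e]
  have c: "0 < c0" "0 < c2" using constants by auto
  have gnz: "level_grad t x \<noteq> 0" if "x \<in> ?W" for x
    using core_strip_grad_bounds(1)[OF e t that] c by auto
  have Db: "\<bar>?D x\<bar> \<le> c2 * \<bar>t - s\<bar>" if x: "x \<in> ?W" for x
  proof -
    have "\<bar>\<phi> x t\<bar> < 17 / 8 * \<epsilon>" "x \<in> \<Omega>" using x by (auto simp: core_strip_def strip_def)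
    then have "\<bar>\<phi> x s - \<phi> x t\<bar> \<le> c2 * \<bar>s - t\<bar>"
      using step eb delta by (intro phi_time_lipschitz t s) (auto simp: abs_minus_commute)
    then show ?thesis by (simp add: abs_minus_commute)
  qed
  show "x \<in> ?W \<Longrightarrow> \<bar>?D x\<bar> \<le> c2 * \<bar>t - s\<bar>" by (rule Db)
  have Nn: "norm (?N x) = 1" if "x \<in> ?W" for x using gnz[OF that] by simp
  show "level_difference_field t s differentiable (at x)" if x: "x \<in> ?W"
  proof -
    have xO: "x \<in> \<Omega>" by (rule subsetD[OF core_strip_subset(3)[OF e] x])
    have g: "level_grad t differentiable (at x)" by (rule grad_phi_differentiable[OF xO t])
    have "(\<lambda>x. norm (level_grad t x)) differentiable (at x)"
      using differentiable_compose[OF differentiable_norm_at[OF gnz[OF x]] g] by simp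
    then show ?thesis unfolding level_difference_field_def[abs_def]
      using gnz[OF x]
      by (intro differentiable_scaleR differentiable_inverse differentiable_diff phi_differentiable xO t s g) auto
  qed
  show "norm (level_difference_field t s x) \<le> c2 * \<bar>t - s\<bar>" if x: "x \<in> ?W"
    using Db[OF x] Nn[OF x] unfolding level_difference_field_def norm_scaleR[of "?D x"] by simp
  assume seg: "closed_segment x y \<subseteq> ?W"
  then have xy: "x \<in> ?W" "y \<in> ?W" by auto
  have "norm (?D x - ?D y) \<le> (L * \<bar>t - s\<bar>) * norm (x - y)"
  proof (rule differentiable_bound[OF convex_closed_segment])
    fix z assume "z \<in> closed_segment x y"
    then have z: "z \<in> ?W" using seg by blast
    then have zO: "z \<in> \<Omega>" using core_strip_subset(3)[OF e] by blast
    have "(?D has_derivative (\<lambda>h. level_grad t z \<bullet> h - level_grad s z \<bullet> h)) (at z)"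
      by (intro has_derivative_diff phi_has_derivative zO t s)
    then show "(?D has_derivative (\<lambda>h. level_grad t z \<bullet> h - level_grad s z \<bullet> h)) (at z within closed_segment x y)"
      by (rule has_derivative_at_withinI)
    show "onorm (\<lambda>h. level_grad t z \<bullet> h - level_grad s z \<bullet> h) \<le> L * \<bar>t - s\<bar>"
    proof (rule onorm_bound)
      show "0 \<le> L * \<bar>t - s\<bar>" using L by simp
      fix h
      have "norm (level_grad t z \<bullet> h - level_grad s z \<bullet> h)
          \<le> norm (level_grad t z - level_grad s z) * norm h"
        unfolding inner_diff_left[symmetric] real_norm_def by (rule Cauchy_Schwarz_ineq2)
      also have "\<dots> \<le> L * \<bar>t - s\<bar> * norm h" by (intro mult_right_mono Lt[rule_format] z) simp
      finally show "norm (level_grad t z \<bullet> h - level_grad s z \<bullet> h) \<le> L * \<bar>t - s\<bar> * norm h" .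
    qed
  qed auto
  then have D: "\<bar>?D x - ?D y\<bar> \<le> L * \<bar>t - s\<bar> * dist x y" by (simp add: dist_norm)
  have N: "norm (?N x - ?N y) \<le> 2 * c2 / c0 * dist x y"
    using seg core_strip_subset(2)[OF e] by (intro gradient_field_lipschitz(2)[OF t]) blast
  have "level_difference_field t s x - level_difference_field t s y
      = (?D x - ?D y) *\<^sub>R ?N x + ?D y *\<^sub>R (?N x - ?N y)"
    unfolding level_difference_field_def by (simp add: algebra_simps)
  also have "norm \<dots> \<le> norm ((?D x - ?D y) *\<^sub>R ?N x) + norm (?D y *\<^sub>R (?N x - ?N y))"
    by (rule norm_triangle_ineq)
  also have "\<dots> = \<bar>?D x - ?D y\<bar> * norm (?N x) + \<bar>?D y\<bar> * norm (?N x - ?N y)"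
    unfolding norm_scaleR[of "?D x - ?D y"] norm_scaleR[of "?D y"] ..
  also have "\<dots> \<le> (L * \<bar>t - s\<bar> * dist x y) * 1 + (c2 * \<bar>t - s\<bar>) * (2 * c2 / c0 * dist x y)"
    using D N Nn[OF xy(1)] Db[OF xy(2)] c L by (intro add_mono mult_mono) auto
  also have "\<dots> = ((L + 2 * c2\<^sup>2 / c0) * \<bar>t - s\<bar>) * dist x y"
    by (simp add: power2_eq_square algebra_simps)
  finally show "norm (level_difference_field t s x - level_difference_field t s y)
        \<le> ((L + 2 * c2\<^sup>2 / c0) * \<bar>t - s\<bar>) * dist x y" .
qed

lemma weight_shift_support:
  assumes e: "admissible_width \<epsilon>" and t: "t \<in> {0..T}" and s: "s \<in> {0..T}"
    and step: "c2 * \<bar>t - s\<bar> \<le> \<epsilon> / 8" and nz: "weight \<epsilon> s x \<noteq> 0"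
  shows "x \<in> core_strip \<epsilon> t" "\<bar>\<phi> x t\<bar> \<le> 17 / 10 * \<epsilon>"
proof -
  note eb = admissible_width_bounds[OF e]
  have "x \<in> strip \<Omega> \<phi> (\<epsilon> * pi / 2) s" using weight_outside_strip[OF eb(1)] nz by blast
  then have x: "x \<in> \<Omega>" "\<bar>\<phi> x s\<bar> < \<epsilon> * (pi / 2)" by (auto simp: strip_def)
  have "\<epsilon> * (pi / 2) \<le> \<epsilon> * (63 / 40)" using eb half_pi_less by (intro mult_left_mono) auto
  from less_le_trans[OF x(2) this] have ps: "\<bar>\<phi> x s\<bar> < 63 / 40 * \<epsilon>" by simp
  then have "\<bar>\<phi> x t - \<phi> x s\<bar> \<le> c2 * \<bar>t - s\<bar>"
    using step eb delta by (intro phi_time_lipschitz x t s) auto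
  then show "\<bar>\<phi> x t\<bar> \<le> 17 / 10 * \<epsilon>" using ps step eb by linarith
  then show "x \<in> core_strip \<epsilon> t" using x(1) eb by (simp add: core_strip_def strip_def)
qed

text \<open>Taylor expansion of the profile in \<open>\<phi>/\<epsilon>\<close>. The first order term is kept
  exactly; replacing \<open>|\<nabla>\<phi>|\<close> at time \<open>s\<close> by that at time
  \<open>t\<close> costs \<open>O(|t - s|)\<close> times the profile at time \<open>s\<close>,
  which \<open>profile_le_shifted\<close> expresses by the profile at time \<open>t\<close>. The
  quadratic errors occur only where \<open>|\<phi>| \<le> 17/10 \<epsilon>\<close>, a strip
  containing the supports of both weights.\<close>

lemma weight_difference_pointwise:
  assumes e: "admissible_width \<epsilon>" and t: "t \<in> {0..T}" and s: "s \<in> {0..T}"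
    and step: "c2 * \<bar>t - s\<bar> \<le> \<epsilon> / 8" and L: "0 \<le> L"
    and Lt: "\<forall>x\<in>core_strip \<epsilon> t.
      norm (level_grad t x - level_grad s x) \<le> L * \<bar>t - s\<bar>"
    and x: "x \<in> core_strip \<epsilon> t"
  shows "weight \<epsilon> s x - weight \<epsilon> t x
    \<le> - (profile_deriv (\<phi> x t / \<epsilon>) / \<epsilon> * (level_grad t x \<bullet> level_difference_field t s x))
      + 2 * L / c0 * \<bar>t - s\<bar> * weight \<epsilon> t x
      + (2 * L * T + 2 * c1) * c2\<^sup>2 * (\<bar>t - s\<bar>\<^sup>2 / \<epsilon>\<^sup>2) * (if \<bar>\<phi> x t\<bar> \<le> 17 / 10 * \<epsilon> then 1 else 0)"
proof -
  note eb = admissible_width_bounds[OF e]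
  note lb = level_difference_field_bounds[OF e t s step L Lt]
  have c: "0 < c0" "0 < c1" "0 < c2" using constants by auto
  define \<tau> where "\<tau> = \<bar>t - s\<bar>"
  have \<tau>: "0 \<le> \<tau>" "\<tau> \<le> T" using t s by (auto simp: \<tau>_def)
  define a b where "a = \<phi> x s / \<epsilon>" and "b = \<phi> x t / \<epsilon>"
  define gt gs where "gt = norm (level_grad t x)" and "gs = norm (level_grad s x)"
  have gtb: "c0 \<le> gt" "gt \<le> c1" using core_strip_grad_bounds[OF e t x] by (auto simp: gt_def)
  have xO: "x \<in> \<Omega>" by (rule subsetD[OF core_strip_subset(3)[OF e] x])
  have ws: "weight \<epsilon> s x = profile a * gs" and wt: "weight \<epsilon> t x = profile b * gt"
    using xO by (auto simp: weight_def rho_def a_def b_def gs_def gt_def)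
  have gi: "level_grad t x \<bullet> level_difference_field t s x = (\<phi> x t - \<phi> x s) * gt"
  proof -
    have "gt \<noteq> 0" using gtb c by simp
    then show ?thesis
      by (simp add: level_difference_field_def gt_def power2_norm_eq_inner[symmetric] power2_eq_square divide_inverse)
  qed
  have Q: "profile_deriv b / \<epsilon> * (level_grad t x \<bullet> level_difference_field t s x) = - (profile_deriv b * (a - b) * gt)"
    unfolding gi a_def b_def using eb(1) by (simp add: field_simps)
  show ?thesis
  proof (cases "\<bar>\<phi> x t\<bar> \<le> 17 / 10 * \<epsilon>")
    case False
    then have "weight \<epsilon> s x = 0" using weight_shift_support(2)[OF e t s step] by blast
    moreover have "profile_deriv b = 0"
    proof (rule profile_deriv_outside)
      have "17 / 10 \<le> \<bar>b\<bar>" using False eb(1) by (simp add: b_def abs_divide pos_le_divide_eq)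
      then show "pi / 2 \<le> \<bar>b\<bar>" using half_pi_less by simp
    qed
    moreover have "0 \<le> weight \<epsilon> t x" by (rule weight_nonneg)
    moreover have "0 \<le> 2 * L / c0 * \<tau> * weight \<epsilon> t x" using L c \<tau> weight_nonneg by simp
    ultimately show ?thesis using False by (simp add: b_def[symmetric] \<tau>_def[symmetric])
  next
    case True
    have ab: "(a - b)\<^sup>2 \<le> c2\<^sup>2 * (\<tau>\<^sup>2 / \<epsilon>\<^sup>2)"
    proof -
      have "\<bar>a - b\<bar> = \<bar>\<phi> x t - \<phi> x s\<bar> / \<epsilon>"
        using eb(1) by (simp add: a_def b_def diff_divide_distrib[symmetric] abs_divide abs_minus_commute)
      also have "\<dots> \<le> c2 * \<tau> / \<epsilon>" unfolding \<tau>_def using lb(1)[OF x] eb(1) by (intro divide_right_mono) auto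
      finally have "\<bar>a - b\<bar>\<^sup>2 \<le> (c2 * \<tau> / \<epsilon>)\<^sup>2" by (intro power_mono) auto
      then show ?thesis by (simp add: power_divide power_mult_distrib)
    qed
    define q where "q = c2\<^sup>2 * (\<tau>\<^sup>2 / \<epsilon>\<^sup>2)"
    have q: "(a - b)\<^sup>2 \<le> q" "0 \<le> q" using ab by (auto simp: q_def)
    have "gs - gt \<le> L * \<tau>"
      using Lt[rule_format, OF x] norm_triangle_ineq3[of "level_grad t x" "level_grad s x"]
      by (simp add: gs_def gt_def \<tau>_def)
    then have 1: "profile a * (gs - gt) \<le> profile a * (L * \<tau>)" by (rule mult_left_mono) (rule profile_nonneg)
    have "profile a \<le> 2 * profile b + 2 * q" using profile_le_shifted[of a b] q by simp
    then have "profile a * (L * \<tau>) \<le> (2 * profile b + 2 * q) * (L * \<tau>)" using L \<tau> by (intro mult_right_mono) auto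
    moreover have "2 * q * (L * \<tau>) \<le> 2 * q * (L * T)" using q L \<tau> by (intro mult_left_mono) auto
    moreover have "profile b * (L * \<tau>) \<le> (weight \<epsilon> t x / c0) * (L * \<tau>)"
      using weight_bounds(2)[OF e t x] L \<tau> by (intro mult_right_mono) (auto simp: b_def)
    moreover have "(2 * profile b + 2 * q) * (L * \<tau>) = 2 * (profile b * (L * \<tau>)) + 2 * q * (L * \<tau>)"
      by (simp add: algebra_simps)
    moreover have "2 * L / c0 * \<tau> * weight \<epsilon> t x = 2 * ((weight \<epsilon> t x / c0) * (L * \<tau>))" by simp
    ultimately have 2: "profile a * (L * \<tau>) \<le> 2 * L / c0 * \<tau> * weight \<epsilon> t x + 2 * q * (L * T)"
      by linarith
    have "profile a - profile b \<le> profile_deriv b * (a - b) + 2 * q"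
      using profile_taylor[of a b] q by linarith
    then have "(profile a - profile b) * gt \<le> (profile_deriv b * (a - b) + 2 * q) * gt"
      using gtb c by (intro mult_right_mono) auto
    also have "\<dots> \<le> profile_deriv b * (a - b) * gt + 2 * q * c1"
      using gtb q by (simp add: distrib_right mult_left_mono)
    finally have 3: "(profile a - profile b) * gt \<le> profile_deriv b * (a - b) * gt + 2 * q * c1" .
    have "weight \<epsilon> s x - weight \<epsilon> t x = profile a * (gs - gt) + (profile a - profile b) * gt"
      unfolding ws wt by (simp add: algebra_simps)
    also have "\<dots> \<le> 2 * L / c0 * \<tau> * weight \<epsilon> t x + 2 * q * (L * T) + (profile_deriv b * (a - b) * gt + 2 * q * c1)"
      using 1 2 3 by linarith
    also have "\<dots> = - (profile_deriv b / \<epsilon> * (level_grad t x \<bullet> level_difference_field t s x))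
        + 2 * L / c0 * \<tau> * weight \<epsilon> t x + (2 * L * T + 2 * c1) * q"
      unfolding Q by (simp add: algebra_simps)
    finally show ?thesis using True by (simp add: q_def b_def \<tau>_def mult.assoc)
  qed
qed

text \<open>The condition involving \<open>c2\<close> bounds the change of \<open>\<phi>/\<epsilon>\<close>
  over the step by \<open>1/8\<close>.\<close>

definition small_step :: "real \<Rightarrow> real \<Rightarrow> real \<Rightarrow> real \<Rightarrow> bool" where
  "small_step \<eta> \<epsilon> t s \<longleftrightarrow> admissible_width \<epsilon> \<and> \<bar>t - s\<bar> < \<eta> \<and> c2 * \<bar>t - s\<bar> \<le> \<epsilon> / 8 \<and> \<bar>t - s\<bar> \<le> \<epsilon>\<^sup>2"

lemma shifted_mass_integrable:
  assumes t: "t \<in> {0..T}" and s: "s \<in> {0..T}" and small: "small_step \<eta> \<epsilon> t s"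
    and u: "piecewise_regular_on (core_strip \<epsilon> t) u"
  shows "integrable lebesgue (\<lambda>x. (u x)\<^sup>2 * weight \<epsilon> s x)"
proof -
  let ?W = "core_strip \<epsilon> t"
  have e: "admissible_width \<epsilon>" and step: "c2 * \<bar>t - s\<bar> \<le> \<epsilon> / 8" using small by (auto simp: small_step_def)
  have m: "(\<lambda>x. indicator ?W x * weight \<epsilon> s x) \<in> borel_measurable lebesgue"
    using open_core_strip[OF t] by (intro borel_measurable_times borel_measurable_indicator weight_measurable s e) auto
  have "\<bar>weight \<epsilon> s x\<bar> \<le> c1" for x using weight_bounds(1)[OF e s] weight_nonneg by simp
  from regular_square_integrable(1)[OF t u m this]
  have "integrable lebesgue (\<lambda>x. indicator ?W x * ((u x)\<^sup>2 * weight \<epsilon> s x))" .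
  moreover have "(\<lambda>x. indicator ?W x * ((u x)\<^sup>2 * weight \<epsilon> s x)) = (\<lambda>x. (u x)\<^sup>2 * weight \<epsilon> s x)"
    using weight_shift_support(1)[OF e t s step] by (fastforce simp: fun_eq_iff split: split_indicator)
  ultimately show ?thesis by simp
qed

text \<open>The pointwise estimate is multiplied by \<open>u\<^sup>2\<close> and the first order term is
  integrated by parts. This leaves the profile at time \<open>t\<close> times \<open>|t - s| (|u|
  |\<nabla>u| + u\<^sup>2)\<close>; Young's inequality is weighted so that exactly half of the
  dissipation is used. The quadratic remainder is \<open>|t - s|\<^sup>2 /
  \<epsilon>\<^sup>2\<close> times \<open>near_square\<close>, to which the Poincare inequality
  applies; \<open>|t - s| \<le> \<epsilon>\<^sup>2\<close> makes the resulting factor \<open>|t -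
  s|\<^sup>2 / \<epsilon>\<^sup>2\<close> of the mass at most \<open>|t - s|\<close>.\<close>

lemma weight_shift_inequality:
  "\<exists>\<eta>>0. \<exists>C\<ge>0. \<forall>t\<in>{0..T}. \<forall>s\<in>{0..T}. \<forall>\<epsilon> u.
    small_step \<eta> \<epsilon> t s \<longrightarrow> piecewise_regular_on (core_strip \<epsilon> t) u \<longrightarrow>
    mass \<epsilon> s u \<le> (1 + C * \<bar>t - s\<bar>) * mass \<epsilon> t u + \<bar>t - s\<bar> / 2 * dissipation \<epsilon> t u
      + C * \<bar>t - s\<bar>\<^sup>2 * core_energy \<epsilon> t u"
proof -
  obtain \<eta> L where \<eta>: "0 < \<eta>" and L: "0 \<le> L"
    and gl: "\<forall>x\<in>\<Omega>. \<forall>t\<in>{0..T}. \<forall>s\<in>{0..T}. \<bar>\<phi> x t\<bar> \<le> \<delta> \<longrightarrow> \<bar>t - s\<bar> < \<eta> \<longrightarrow>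
     norm (level_grad t x - level_grad s x) \<le> L * \<bar>t - s\<bar>"
    using grad_phi_time_lipschitz by blast
  obtain K where K: "0 \<le> K"
    and poincare: "\<forall>t\<in>{0..T}. \<forall>\<epsilon> u. admissible_width \<epsilon> \<longrightarrow> piecewise_regular_on (core_strip \<epsilon> t) u \<longrightarrow>
      integral\<^sup>L lebesgue (near_square \<epsilon> t u) \<le> K * (mass \<epsilon> t u + \<epsilon>\<^sup>2 * core_energy \<epsilon> t u)"
    using strip_poincare_inequality by blast
  have c: "0 < c0" "0 < c1" "0 < c2" using constants by auto
  define d where "d = real DIM('a)"
  define B0 where "B0 = L + 2 * c2\<^sup>2 / c0"
  define a1 where "a1 = 2 * L / c0 + (2 * c2\<^sup>2 / c0 + d * B0) / c0"
  define a2 where "a2 = (2 * L * T + 2 * c1) * c2\<^sup>2"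
  define C where "C = a1 + a2 * K"
  have d0: "0 \<le> d" by (simp add: d_def)
  have B0: "0 \<le> B0" using L c by (simp add: B0_def)
  have a1: "0 \<le> a1" unfolding a1_def using L c d0 B0 by (intro add_nonneg_nonneg divide_nonneg_nonneg mult_nonneg_nonneg) auto
  have a2: "0 \<le> a2" unfolding a2_def using L c T_pos by (intro add_nonneg_nonneg mult_nonneg_nonneg) auto
  have C: "0 \<le> C" unfolding C_def using a1 a2 K by simp
  have main: "mass \<epsilon> s u \<le> (1 + C * \<bar>t - s\<bar>) * mass \<epsilon> t u + \<bar>t - s\<bar> / 2 * dissipation \<epsilon> t u
      + C * \<bar>t - s\<bar>\<^sup>2 * core_energy \<epsilon> t u"
    if t: "t \<in> {0..T}" and s: "s \<in> {0..T}" and small: "small_step \<eta> \<epsilon> t s"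
      and u: "piecewise_regular_on (core_strip \<epsilon> t) u"
    for t s \<epsilon> u
  proof -
    have e: "admissible_width \<epsilon>" and close: "\<bar>t - s\<bar> < \<eta>" and step: "c2 * \<bar>t - s\<bar> \<le> \<epsilon> / 8"
      and quad: "\<bar>t - s\<bar> \<le> \<epsilon>\<^sup>2"
      using small by (auto simp: small_step_def)
    let ?W = "core_strip \<epsilon> t"
    let ?S = "\<lambda>x. if \<bar>\<phi> x t\<bar> \<le> 17 / 10 * \<epsilon> then 1 else 0 :: real"
    let ?Y = "level_difference_field t s"
    note eb = admissible_width_bounds[OF e]
    have e': "0 < \<epsilon>" "\<epsilon> < \<delta> / pi" using e by (auto simp: admissible_width_def)
    define \<tau> where "\<tau> = \<bar>t - s\<bar>"
    have \<tau>: "0 \<le> \<tau>" "\<tau> \<le> \<epsilon>\<^sup>2" using quad by (auto simp: \<tau>_def)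
    have Lt: "\<forall>x\<in>?W. norm (level_grad t x - level_grad s x) \<le> L * \<bar>t - s\<bar>"
    proof
      fix x assume "x \<in> ?W"
      then have "x \<in> strip \<Omega> \<phi> \<delta> t" using core_strip_subset(1)[OF e] by blast
      then show "norm (level_grad t x - level_grad s x) \<le> L * \<bar>t - s\<bar>"
        using gl t s close by (simp add: strip_def)
    qed
    note lb = level_difference_field_bounds[OF e t s step L Lt]
    have A: "0 \<le> c2 * \<tau>" "0 \<le> B0 * \<tau>" using c \<tau> B0 by auto
    obtain \<Theta> where \<Theta>: "integrable lebesgue \<Theta>" "integral\<^sup>L lebesgue \<Theta> = 0"
      and ae: "AE x in lebesgue. (x \<notin> ?W \<longrightarrow> \<Theta> x = 0) \<and>
      (x \<in> ?W \<longrightarrow> \<bar>\<Theta> x - (u x)\<^sup>2 * (profile_deriv (\<phi> x t / \<epsilon>) / \<epsilon> * (level_grad t x \<bullet> ?Y x))\<bar>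
        \<le> \<bar>profile (\<phi> x t / \<epsilon>)\<bar> * (2 * (c2 * \<tau>) * (\<bar>u x\<bar> * norm (grad u x)) + real DIM('a) * (B0 * \<tau>) * (u x)\<^sup>2))"
    proof -
      have p1: "\<bar>profile r\<bar> \<le> 1" for r using profile_nonneg[of r] profile_le_1[of r] by simp
      have p2: "profile r = 0" if "2 \<le> \<bar>r\<bar>" for r using that half_pi_less by (intro profile_outside) simp
      show ?thesis
        using that strip_integration_by_parts[OF t e' u[unfolded core_strip_def] profile_has_derivative p1 abs_profile_deriv_le p2
          lb(2)[unfolded core_strip_def] lb(3)[unfolded core_strip_def] lb(4)[unfolded core_strip_def]]
          A unfolding core_strip_def B0_def[symmetric] \<tau>_def[symmetric] by blast
    qed
    note RW = regular_weight_integrable[OF t e u]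
    note PI = near_square_integrable[OF t e u]
    have PL: "integral\<^sup>L lebesgue (near_square \<epsilon> t u) \<le> K * (mass \<epsilon> t u + \<epsilon>\<^sup>2 * core_energy \<epsilon> t u)"
      using poincare t e u by blast
    note intS = shifted_mass_integrable[OF t s small u]
    define k where "k = a2 * (\<tau>\<^sup>2 / \<epsilon>\<^sup>2)"
    have k: "0 \<le> k" using a2 by (simp add: k_def)
    have "AE x in lebesgue. (u x)\<^sup>2 * weight \<epsilon> s x
        \<le> - \<Theta> x + (1 + a1 * \<tau>) * ((u x)\<^sup>2 * weight \<epsilon> t x) + \<tau> / 2 * ((norm (grad u x))\<^sup>2 * weight \<epsilon> t x)
          + k * near_square \<epsilon> t u x"
      using ae
    proof eventually_elim
      fix x
      assume th: "(x \<notin> ?W \<longrightarrow> \<Theta> x = 0) \<and>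
      (x \<in> ?W \<longrightarrow> \<bar>\<Theta> x - (u x)\<^sup>2 * (profile_deriv (\<phi> x t / \<epsilon>) / \<epsilon> * (level_grad t x \<bullet> ?Y x))\<bar>
        \<le> \<bar>profile (\<phi> x t / \<epsilon>)\<bar> * (2 * (c2 * \<tau>) * (\<bar>u x\<bar> * norm (grad u x)) + real DIM('a) * (B0 * \<tau>) * (u x)\<^sup>2))"
      show "(u x)\<^sup>2 * weight \<epsilon> s x
        \<le> - \<Theta> x + (1 + a1 * \<tau>) * ((u x)\<^sup>2 * weight \<epsilon> t x) + \<tau> / 2 * ((norm (grad u x))\<^sup>2 * weight \<epsilon> t x)
          + k * near_square \<epsilon> t u x"
      proof (cases "x \<in> ?W")
        case False
        then have "weight \<epsilon> s x = 0" using weight_shift_support(1)[OF e t s step] by blast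
        then show ?thesis using False th weight_outside[OF eb(1) False] by (simp add: near_square_def)
      next
        case x: True
        define U where "U = (u x)\<^sup>2"
        define G where "G = (norm (grad u x))\<^sup>2"
        define X where "X = \<bar>u x\<bar> * norm (grad u x)"
        define w where "w = weight \<epsilon> t x"
        define P where "P = profile (\<phi> x t / \<epsilon>)"
        define Q where "Q = profile_deriv (\<phi> x t / \<epsilon>) / \<epsilon> * (level_grad t x \<bullet> ?Y x)"
        have nn: "0 \<le> U" "0 \<le> G" "0 \<le> P" "0 \<le> w" by (auto simp: U_def G_def P_def w_def profile_nonneg weight_nonneg)
        have Pw: "P \<le> w / c0" unfolding P_def w_def by (rule weight_bounds(2)[OF e t x])
        have "weight \<epsilon> s x - w \<le> - Q + 2 * L / c0 * \<tau> * w + k * ?S x"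
          unfolding Q_def w_def k_def a2_def \<tau>_def using weight_difference_pointwise[OF e t s step L Lt x] by (simp add: mult.assoc)
        then have "U * (weight \<epsilon> s x - w) \<le> U * (- Q + 2 * L / c0 * \<tau> * w + k * ?S x)" using nn by (intro mult_left_mono) auto
        then have 1: "U * weight \<epsilon> s x \<le> U * w - U * Q + 2 * L / c0 * \<tau> * (U * w) + k * (U * ?S x)" by (simp add: algebra_simps)
        have "\<bar>\<Theta> x - U * Q\<bar> \<le> P * (2 * (c2 * \<tau>) * X + d * (B0 * \<tau>) * U)"
          using th x nn by (simp add: U_def Q_def P_def X_def d_def)
        then have 2: "- (U * Q) \<le> - \<Theta> x + P * (2 * (c2 * \<tau>) * X + d * (B0 * \<tau>) * U)" by linarith
        \<comment> \<open>The factor \<open>c0 / 2\<close> becomes \<open>1/2\<close> when the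
          profile is estimated by \<open>weight / c0\<close>.\<close>
        have yg: "2 * c2 * X \<le> 2 * c2\<^sup>2 / c0 * U + c0 / 2 * G"
        proof -
          have "0 \<le> (2 * c2 * \<bar>u x\<bar> - c0 * norm (grad u x))\<^sup>2" by simp
          also have "\<dots> = 4 * c2\<^sup>2 * U + c0\<^sup>2 * G - 4 * c0 * c2 * X"
            by (simp add: U_def G_def X_def power2_diff power_mult_distrib)
          finally have "4 * c0 * c2 * X / (2 * c0) \<le> (4 * c2\<^sup>2 * U + c0\<^sup>2 * G) / (2 * c0)" using c by (intro divide_right_mono) auto
          then show ?thesis using c by (simp add: add_divide_distrib power2_eq_square mult_ac)
        qed
        have "2 * (c2 * \<tau>) * X + d * (B0 * \<tau>) * U = \<tau> * (2 * c2 * X + d * B0 * U)" by (simp add: algebra_simps)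
        also have "\<dots> \<le> \<tau> * ((2 * c2\<^sup>2 / c0 + d * B0) * U + c0 / 2 * G)"
          using yg \<tau> by (intro mult_left_mono) (auto simp: algebra_simps)
        finally have "P * (2 * (c2 * \<tau>) * X + d * (B0 * \<tau>) * U) \<le> P * (\<tau> * ((2 * c2\<^sup>2 / c0 + d * B0) * U + c0 / 2 * G))"
          using nn by (intro mult_left_mono) auto
        also have "\<dots> \<le> (w / c0) * (\<tau> * ((2 * c2\<^sup>2 / c0 + d * B0) * U + c0 / 2 * G))"
          using Pw \<tau> c d0 B0 nn by (intro mult_right_mono mult_nonneg_nonneg add_nonneg_nonneg) auto
        also have "\<dots> = (2 * c2\<^sup>2 / c0 + d * B0) / c0 * \<tau> * (U * w) + \<tau> / 2 * (G * w)"
        proof -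
          have "(w / c0) * (\<tau> * (z * U + c0 / 2 * G)) = z / c0 * \<tau> * (U * w) + \<tau> / 2 * (G * w)" for z
            using c by (simp add: field_simps)
          then show ?thesis .
        qed
        finally have 3: "P * (2 * (c2 * \<tau>) * X + d * (B0 * \<tau>) * U)
          \<le> (2 * c2\<^sup>2 / c0 + d * B0) / c0 * \<tau> * (U * w) + \<tau> / 2 * (G * w)" .
        have "a1 * \<tau> * (U * w) = 2 * L / c0 * \<tau> * (U * w) + (2 * c2\<^sup>2 / c0 + d * B0) / c0 * \<tau> * (U * w)"
          unfolding a1_def by (simp only: distrib_right)
        then have "U * weight \<epsilon> s x \<le> - \<Theta> x + (U * w + a1 * \<tau> * (U * w)) + \<tau> / 2 * (G * w) + k * (U * ?S x)"
          using 1 2 3 by linarith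
        then show ?thesis using x by (simp add: U_def G_def w_def near_square_def distrib_right)
      qed
    qed
    then have "mass \<epsilon> s u
        \<le> (\<integral>x. - \<Theta> x + (1 + a1 * \<tau>) * ((u x)\<^sup>2 * weight \<epsilon> t x) + \<tau> / 2 * ((norm (grad u x))\<^sup>2 * weight \<epsilon> t x)
          + k * near_square \<epsilon> t u x \<partial>lebesgue)"
      unfolding mass_def using \<Theta>(1) RW PI
      by (intro integral_mono_AE intS Bochner_Integration.integrable_add integrable_mult_right integrable_minus) auto
    also have "\<dots> = (1 + a1 * \<tau>) * mass \<epsilon> t u + \<tau> / 2 * dissipation \<epsilon> t u
        + k * integral\<^sup>L lebesgue (near_square \<epsilon> t u)"
      using \<Theta> RW PI by (simp add: mass_def dissipation_def)
    also have "k * integral\<^sup>L lebesgue (near_square \<epsilon> t u)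
        \<le> a2 * K * \<tau> * mass \<epsilon> t u + C * \<tau>\<^sup>2 * core_energy \<epsilon> t u"
    proof -
      have "k * integral\<^sup>L lebesgue (near_square \<epsilon> t u) \<le> k * (K * (mass \<epsilon> t u + \<epsilon>\<^sup>2 * core_energy \<epsilon> t u))"
        using PL k by (rule mult_left_mono)
      also have "\<dots> = a2 * K * (\<tau>\<^sup>2 / \<epsilon>\<^sup>2) * mass \<epsilon> t u + a2 * K * \<tau>\<^sup>2 * core_energy \<epsilon> t u"
        using eb(1) by (simp add: k_def field_simps)
      also have "\<dots> \<le> a2 * K * \<tau> * mass \<epsilon> t u + C * \<tau>\<^sup>2 * core_energy \<epsilon> t u"
      proof (rule add_mono)
        have "\<tau>\<^sup>2 / \<epsilon>\<^sup>2 \<le> \<tau>"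
          using \<tau> eb(1) by (simp add: pos_divide_le_eq power2_eq_square[of \<tau>] mult_left_mono)
        then show "a2 * K * (\<tau>\<^sup>2 / \<epsilon>\<^sup>2) * mass \<epsilon> t u \<le> a2 * K * \<tau> * mass \<epsilon> t u"
          using energies_nonneg a2 K by (intro mult_right_mono mult_left_mono) auto
        show "a2 * K * \<tau>\<^sup>2 * core_energy \<epsilon> t u \<le> C * \<tau>\<^sup>2 * core_energy \<epsilon> t u"
          using energies_nonneg a1 by (intro mult_right_mono) (auto simp: C_def)
      qed
      finally show ?thesis .
    qed
    finally show ?thesis unfolding C_def \<tau>_def[symmetric] by (simp add: algebra_simps)
  qed
  show ?thesis
    by (rule exI[of _ \<eta>], rule conjI, rule \<eta>, rule exI[of _ C], rule conjI, rule C, intro ballI allI impI, rule main)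
qed

end

section \<open>Inequalities for the energy argument\<close>

text \<open>Integrability of \<open>g\<close> follows from the bound only if \<open>g\<close> is measurable;
  but the integral of a function that is not integrable is zero by convention, so the inequality
  holds anyway. This spares measurability proofs for the mixed terms of the scheme.\<close>

lemma abs_integral_le:
  fixes g h :: "'a \<Rightarrow> real"
  assumes h: "integrable M h" and le: "AE x in M. \<bar>g x\<bar> \<le> h x"
  shows "\<bar>integral\<^sup>L M g\<bar> \<le> integral\<^sup>L M h"
proof (cases "integrable M g")
  case True
  have "\<bar>integral\<^sup>L M g\<bar> \<le> (\<integral>x. \<bar>g x\<bar> \<partial>M)" by (rule integral_abs_bound)
  also have "\<dots> \<le> integral\<^sup>L M h" using True h le by (intro integral_mono_AE) auto
  finally show ?thesis .
next
  case False
  have "AE x in M. 0 \<le> h x" using le by eventually_elim auto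
  then show ?thesis using False by (simp add: not_integrable_integral_eq integral_nonneg_AE)
qed

lemma abs_mult_le_half_squares: "\<bar>a * b\<bar> \<le> a\<^sup>2 / 2 + b\<^sup>2 / 2" for a b :: real
  using zero_le_power2[of "\<bar>a\<bar> - \<bar>b\<bar>"] by (simp add: power2_diff abs_mult)

text \<open>Moving \<open>b \<tau> a\<close> to the left costs the factor \<open>1 / (1 - b \<tau>)\<close>,
  which is at most \<open>exp (2 b \<tau>)\<close> for \<open>b \<tau> \<le> 1/2\<close>.\<close>

lemma discrete_gronwall:
  fixes a g F \<tau> :: "nat \<Rightarrow> real"
  assumes b: "0 \<le> b" and k: "0 \<le> k"
    and tau: "\<And>m. m \<in> {1..M} \<Longrightarrow> 0 \<le> \<tau> m" "\<And>m. m \<in> {1..M} \<Longrightarrow> b * \<tau> m \<le> 1 / 2"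
    and a0: "\<And>m. 0 \<le> a m" and g0: "\<And>m. 0 \<le> g m" and F0: "\<And>m. 0 \<le> F m"
    and step: "\<And>m. m \<in> {1..M} \<Longrightarrow> a m + \<tau> m * g m \<le> a (m - 1) + b * \<tau> m * a m + k * (\<tau> m * F m)"
  shows "m \<le> M \<Longrightarrow> a m + (\<Sum>j=1..m. \<tau> j * g j)
    \<le> exp (2 * b * (\<Sum>j=1..m. \<tau> j)) * (a 0 + k * (\<Sum>j=1..m. \<tau> j * F j))"
proof (induction m)
  case (Suc m)
  define x where "x = b * \<tau> (Suc m)"
  define S where "S = (\<Sum>j=1..m. \<tau> j * g j)"
  define R where "R = a 0 + k * (\<Sum>j=1..m. \<tau> j * F j)"
  define E where "E = exp (2 * b * (\<Sum>j=1..m. \<tau> j))"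
  define f where "f = k * (\<tau> (Suc m) * F (Suc m))"
  define A where "A = a (Suc m) + (S + \<tau> (Suc m) * g (Suc m))"
  have mem: "Suc m \<in> {1..M}" using Suc.prems by simp
  have x: "0 \<le> x" "x \<le> 1 / 2" using tau[OF mem] b by (auto simp: x_def)
  have S0: "0 \<le> S" unfolding S_def using tau(1) g0 Suc.prems by (intro sum_nonneg mult_nonneg_nonneg) auto
  have tg: "0 \<le> \<tau> (Suc m) * g (Suc m)" using tau(1)[OF mem] g0 by simp
  have f0: "0 \<le> f" using tau(1)[OF mem] F0 k by (simp add: f_def)
  have A0: "0 \<le> A" using a0[of "Suc m"] S0 tg by (simp add: A_def)
  have "0 \<le> 2 * b * (\<Sum>j=1..m. \<tau> j)"
    using b tau(1) Suc.prems by (intro mult_nonneg_nonneg sum_nonneg) auto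
  then have E1: "1 \<le> E" by (simp add: E_def)
  have IH: "a m + S \<le> E * R" using Suc by (simp add: S_def E_def R_def)
  have "a (Suc m) + \<tau> (Suc m) * g (Suc m) \<le> a m + x * a (Suc m) + f"
    using step[OF mem] by (simp add: x_def f_def)
  moreover have "x * a (Suc m) \<le> x * A" using x S0 tg by (intro mult_left_mono) (auto simp: A_def)
  ultimately have "A - x * A \<le> (a m + S) + f" by (simp add: A_def)
  then have 1: "(1 - x) * A \<le> (a m + S) + f" by (simp add: left_diff_distrib)
  have "1 \<le> (1 + 2 * x) * (1 - x)"
    using mult_nonneg_nonneg[of x "1 - 2 * x"] x by (simp add: algebra_simps)
  also have "\<dots> \<le> exp (2 * x) * (1 - x)" using x exp_ge_add_one_self[of "2 * x"] by (intro mult_right_mono) auto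
  finally have "1 * A \<le> (exp (2 * x) * (1 - x)) * A" using A0 by (rule mult_right_mono)
  also have "\<dots> = exp (2 * x) * ((1 - x) * A)" by simp
  also have "\<dots> \<le> exp (2 * x) * ((a m + S) + f)" using 1 by (intro mult_left_mono) auto
  also have "\<dots> \<le> exp (2 * x) * (E * R + E * f)"
    using IH E1 f0 by (intro mult_left_mono add_mono) (auto simp: mult_right_mono[of 1 E f, simplified])
  also have "\<dots> = exp (2 * b * (\<Sum>j=1..Suc m. \<tau> j)) * (R + f)"
    by (simp add: E_def x_def distrib_left exp_add[symmetric] algebra_simps)
  finally show ?case by (simp add: A_def S_def R_def f_def algebra_simps)
qed simp

section \<open>The mesh near the surface\<close>

lemma cos_three_eighths_pi: "0 < cos (3 * pi / 8)" "(cos (3 * pi / 8))\<^sup>2 \<le> 1 / 4"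
proof -
  show p: "0 < cos (3 * pi / 8)" using pi_gt_zero by (intro cos_gt_zero_pi) auto
  have "cos (3 * pi / 8) \<le> cos (pi / 3)" using pi_gt_zero by (intro cos_monotone_0_pi_le) auto
  then have "cos (3 * pi / 8) \<le> 1 / 2" by (simp add: cos_60)
  then have "(cos (3 * pi / 8))\<^sup>2 \<le> (1 / 2)\<^sup>2" using p by (intro power_mono) auto
  then show "(cos (3 * pi / 8))\<^sup>2 \<le> 1 / 4" by (simp add: power2_eq_square)
qed

text \<open>Here \<open>9/8 < 3 \<pi> / 8\<close>.\<close>

lemma profile_ge_cos_three_eighths:
  assumes "\<bar>r\<bar> \<le> 9 / 8" shows "(cos (3 * pi / 8))\<^sup>2 \<le> profile r"
proof -
  have "\<bar>r\<bar> \<le> 3 * pi / 8" using assms pi_gt3 by simp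
  then have "cos (3 * pi / 8) \<le> cos \<bar>r\<bar>" using pi_gt_zero by (intro cos_monotone_0_pi_le) auto
  then have "(cos (3 * pi / 8))\<^sup>2 \<le> (cos r)\<^sup>2" using cos_three_eighths_pi(1) by (intro power_mono) auto
  moreover have "\<bar>r\<bar> \<le> pi / 2" using assms pi_gt3 by simp
  ultimately show ?thesis by (simp add: profile_def)
qed

context moving_surface
begin

lemma diffuse_integral_eq:
  "diffuse_integral \<Omega> \<phi> \<epsilon> t g = (\<integral>x. g x * weight \<epsilon> t x \<partial>lebesgue)"
  unfolding diffuse_integral_def set_lebesgue_integral_def weight_def
  by (intro Bochner_Integration.integral_cong) (auto simp: rho_def split: split_indicator)

text \<open>The last condition says that \<open>\<phi>\<close> changes by at most \<open>\<epsilon>/8\<close>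
  across an element near the surface.\<close>

definition fine_mesh :: "real \<Rightarrow> 'a set set \<Rightarrow> bool" where
  "fine_mesh \<epsilon> \<K> \<longleftrightarrow> triangulation \<K> \<and> (\<forall>K\<in>\<K>. int DIM('a) simplex K) \<and> \<Union>\<K> = closure \<Omega> \<and>
     (\<forall>K\<in>\<K>. c1 * diameter K \<le> \<epsilon> / 8)"

lemma fine_mesh_element:
  assumes "fine_mesh \<epsilon> \<K>" "K \<in> \<K>"
  shows "compact K" "convex K" "x \<in> K \<Longrightarrow> y \<in> K \<Longrightarrow> c1 * dist x y \<le> \<epsilon> / 8"
proof -
  have s: "int DIM('a) simplex K" using assms by (simp add: fine_mesh_def)
  show c: "compact K" "convex K" using simplex_compact_convex[OF s] by auto
  assume "x \<in> K" "y \<in> K"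
  then have "dist x y \<le> diameter K" using compact_imp_bounded[OF c(1)] by (intro diameter_bounded_bound)
  then have "c1 * dist x y \<le> c1 * diameter K" using constants by (intro mult_left_mono) auto
  also have "\<dots> \<le> \<epsilon> / 8" using assms by (simp add: fine_mesh_def)
  finally show "c1 * dist x y \<le> \<epsilon> / 8" .
qed

text \<open>From \<open>|\<phi>| < 17/8 \<epsilon>\<close> at one point of the element follows \<open>|\<phi>|
  \<le> 9/4 \<epsilon>\<close> on all of it, so the argument of the wider profile is at most
  \<open>9/8\<close>.\<close>

lemma element_near_core:
  assumes m: "fine_mesh \<epsilon> \<K>" and e: "admissible_width \<epsilon>" and t: "t \<in> {0..T}"
    and K: "K \<in> \<K>" and x: "x \<in> K" "x \<in> core_strip \<epsilon> t" and y: "y \<in> K"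
  shows "(cos (3 * pi / 8))\<^sup>2 \<le> rho_tilde \<Omega> \<phi> \<epsilon> y t"
proof -
  note eb = admissible_width_bounds[OF e]
  have px: "x \<in> \<Omega>" "\<bar>\<phi> x t\<bar> < 17 / 8 * \<epsilon>" using x(2) by (auto simp: core_strip_def strip_def)
  have d: "c1 * dist x y \<le> \<epsilon> / 8" by (rule fine_mesh_element(3)[OF m K x(1) y])
  have "\<bar>\<phi> x t\<bar> + c1 * dist x y < \<delta>0" using px d eb delta by linarith
  from near_strip[OF t px(1) this] have "y \<in> \<Omega>" "\<bar>\<phi> y t\<bar> \<le> 9 / 4 * \<epsilon>"
    using px d by (auto simp: strip_def)
  moreover have "\<bar>\<phi> y t / (2 * \<epsilon>)\<bar> \<le> 9 / 8" using calculation eb(1) by (simp add: abs_divide pos_divide_le_eq)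
  ultimately show ?thesis by (simp add: rho_tilde_def profile_ge_cos_three_eighths)
qed

lemma element_in_strip_mesh:
  assumes m: "fine_mesh \<epsilon> \<K>" and e: "admissible_width \<epsilon>" and t: "t \<in> {0..T}"
    and K: "K \<in> \<K>" and x: "x \<in> K" "x \<in> core_strip \<epsilon> t"
  shows "K \<in> strip_mesh \<Omega> \<phi> \<K> \<epsilon> t"
proof -
  obtain y where y: "y extreme_point_of K"
    using Krein_Milman_Minkowski[OF fine_mesh_element(1,2)[OF m K]] x(1) by force
  then have yK: "y \<in> K" "y \<in> vertices \<K>" using K by (auto simp: extreme_point_of_def vertices_def)
  have "0 < rho_tilde \<Omega> \<phi> \<epsilon> y t"
    using element_near_core[OF m e t K x yK(1)] zero_less_power[OF cos_three_eighths_pi(1), of 2] by linarith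
  then show ?thesis using K yK by (auto simp: strip_mesh_def)
qed

lemma core_strip_in_strip_domain:
  assumes m: "fine_mesh \<epsilon> \<K>" and e: "admissible_width \<epsilon>" and t: "t \<in> {0..T}"
  shows "core_strip \<epsilon> t \<subseteq> strip_domain \<Omega> \<phi> \<K> \<epsilon> t"
proof
  fix x assume x: "x \<in> core_strip \<epsilon> t"
  then have "x \<in> closure \<Omega>" using core_strip_subset(3)[OF e] closure_subset by blast
  then have "x \<in> \<Union>\<K>" using m by (simp add: fine_mesh_def)
  then obtain K where "K \<in> \<K>" "x \<in> K" by blast
  then show "x \<in> strip_domain \<Omega> \<phi> \<K> \<epsilon> t"
    using element_in_strip_mesh[OF m e t _ _ x] by (auto simp: strip_domain_def)
qed

lemma strip_mesh_finite:
  assumes "fine_mesh \<epsilon> \<K>" shows "strip_mesh \<Omega> \<phi> \<K> \<epsilon> t \<subseteq> \<K>" "finite (strip_mesh \<Omega> \<phi> \<K> \<epsilon> t)"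
proof -
  show s: "strip_mesh \<Omega> \<phi> \<K> \<epsilon> t \<subseteq> \<K>" by (auto simp: strip_mesh_def)
  have "finite \<K>" using assms by (simp add: fine_mesh_def triangulation_def)
  with s show "finite (strip_mesh \<Omega> \<phi> \<K> \<epsilon> t)" by (rule finite_subset)
qed

lemma strip_domain_compact:
  assumes m: "fine_mesh \<epsilon> \<K>" shows "compact (strip_domain \<Omega> \<phi> \<K> \<epsilon> t)"
  unfolding strip_domain_def
  using strip_mesh_finite[OF m] fine_mesh_element(1)[OF m] by (intro compact_Union) auto

lemma fe_space_regular:
  assumes m: "fine_mesh \<epsilon> \<K>" and u: "u \<in> fe_space \<Omega> \<phi> \<K> \<epsilon> t"
    and W: "W \<subseteq> strip_domain \<Omega> \<phi> \<K> \<epsilon> t"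
  shows "piecewise_regular_on W u"
proof (rule piecewise_affine_regular)
  show "finite (strip_mesh \<Omega> \<phi> \<K> \<epsilon> t)" by (rule strip_mesh_finite[OF m])
  show "continuous_on (\<Union>(strip_mesh \<Omega> \<phi> \<K> \<epsilon> t)) u" using u by (simp add: fe_space_def strip_domain_def)
  show "W \<subseteq> \<Union>(strip_mesh \<Omega> \<phi> \<K> \<epsilon> t)" using W by (simp add: strip_domain_def)
  fix K assume K: "K \<in> strip_mesh \<Omega> \<phi> \<K> \<epsilon> t"
  then have "K \<in> \<K>" using strip_mesh_finite(1)[OF m] by blast
  then show "compact K" "convex K" using fine_mesh_element[OF m] by auto
  show "\<exists>a b. \<forall>x\<in>K. u x = a + b \<bullet> x" using u K by (simp add: fe_space_def)
qed

text \<open>On an element the interpolant is affine, so bounds for the vertex values are bounds everywhere.\<close>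

lemma interpolant_properties:
  fixes g :: "'a \<Rightarrow> real" and t :: real
  assumes m: "fine_mesh \<epsilon> \<K>" and g: "\<And>y. 0 \<le> g y" "\<And>y. g y \<le> 1"
  defines "w \<equiv> lagrange_interp \<Omega> \<phi> \<K> \<epsilon> t g"
  shows "w \<in> fe_space \<Omega> \<phi> \<K> \<epsilon> t" "\<And>x. x \<notin> strip_domain \<Omega> \<phi> \<K> \<epsilon> t \<Longrightarrow> w x = 0"
    "\<And>x. 0 \<le> w x" "\<And>x. w x \<le> 1"
    "\<And>K x c. K \<in> strip_mesh \<Omega> \<phi> \<K> \<epsilon> t \<Longrightarrow> x \<in> K \<Longrightarrow> (\<And>y. y \<in> K \<Longrightarrow> c \<le> g y) \<Longrightarrow> c \<le> w x"
proof -
  let ?D = "strip_domain \<Omega> \<phi> \<K> \<epsilon> t" and ?M = "strip_mesh \<Omega> \<phi> \<K> \<epsilon> t"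
  have tri: "triangulation \<K>" using m by (simp add: fine_mesh_def)
  have "\<exists>!w. w \<in> fe_space \<Omega> \<phi> \<K> \<epsilon> t \<and> (\<forall>x\<in>?D \<inter> vertices \<K>. w x = g x) \<and> (\<forall>x. x \<notin> ?D \<longrightarrow> w x = 0)"
    using piecewise_linear_interpolant_ex1[OF tri strip_mesh_finite(1)[OF m], of t g]
    unfolding fe_space_def strip_domain_def mem_Collect_eq .
  from theI'[OF this]
  have w: "w \<in> fe_space \<Omega> \<phi> \<K> \<epsilon> t" "\<And>x. x \<in> ?D \<inter> vertices \<K> \<Longrightarrow> w x = g x" "\<And>x. x \<notin> ?D \<Longrightarrow> w x = 0"
    unfolding w_def lagrange_interp_def by blast+
  show "w \<in> fe_space \<Omega> \<phi> \<K> \<epsilon> t" by (rule w(1))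
  show "w x = 0" if "x \<notin> ?D" for x by (rule w(3)[OF that])
  have vert: "w y = g y \<and> y \<in> K" if "K \<in> ?M" "y extreme_point_of K" for K y
  proof -
    have "K \<in> \<K>" using that(1) strip_mesh_finite(1)[OF m] by blast
    then have "y \<in> ?D \<inter> vertices \<K>" "y \<in> K"
      using that by (auto simp: strip_domain_def vertices_def extreme_point_of_def)
    then show ?thesis using w(2) by blast
  qed
  have cc: "compact K" "convex K" if "K \<in> ?M" for K
    using fine_mesh_element[OF m] strip_mesh_finite(1)[OF m] that by blast+
  have lower: "c \<le> w x" if K: "K \<in> ?M" and x: "x \<in> K" and c: "\<And>y. y \<in> K \<Longrightarrow> c \<le> g y" for K x c
  proof -
    obtain a b where ab: "\<forall>x\<in>K. w x = a + b \<bullet> x" using w(1) K unfolding fe_space_def by blast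
    have "c \<le> a + b \<bullet> x"
    proof (rule affine_bound_from_extreme_points[OF cc[OF K] x])
      fix y assume "y extreme_point_of K"
      then have "w y = g y" "y \<in> K" using vert[OF K] by auto
      then show "c \<le> a + b \<bullet> y" using ab c by metis
    qed
    then show ?thesis using ab x by simp
  qed
  then show "\<And>K x c. K \<in> ?M \<Longrightarrow> x \<in> K \<Longrightarrow> (\<And>y. y \<in> K \<Longrightarrow> c \<le> g y) \<Longrightarrow> c \<le> w x" by blast
  show "0 \<le> w x" for x
  proof (cases "x \<in> ?D")
    case True
    then obtain K where "K \<in> ?M" "x \<in> K" by (auto simp: strip_domain_def)
    then show ?thesis using lower g(1) by blast
  qed (simp add: w(3))
  show "w x \<le> 1" for x
  proof (cases "x \<in> ?D")
    case True
    then obtain K where K: "K \<in> ?M" "x \<in> K" by (auto simp: strip_domain_def)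
    obtain a b where ab: "\<forall>x\<in>K. w x = a + b \<bullet> x" using w(1) K unfolding fe_space_def by blast
    have "-1 \<le> - a + (- b) \<bullet> x"
    proof (rule affine_bound_from_extreme_points[OF cc[OF K(1)] K(2)])
      fix y assume "y extreme_point_of K"
      then have "w y = g y" "y \<in> K" using vert[OF K(1)] by auto
      then have "a + b \<bullet> y \<le> 1" using ab g(2) by metis
      then show "-1 \<le> - a + (- b) \<bullet> y" by simp
    qed
    then show ?thesis using ab K(2) by simp
  qed (simp add: w(3))
qed

lemma rho_tilde_range: "0 \<le> rho_tilde \<Omega> \<phi> \<epsilon> y t" "rho_tilde \<Omega> \<phi> \<epsilon> y t \<le> 1"
  by (auto simp: rho_tilde_def profile_nonneg profile_le_1)

text \<open>Every element meeting the core strip has vertex values of \<open>\<rho>\<close>-tilde bounded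
  below, hence so is the interpolant on the core strip. Outside the mesh strip the interpolant
  vanishes, where the gradient of the finite element function may be anything.\<close>

lemma stabilisation_coercive:
  assumes m: "fine_mesh \<epsilon> \<K>" and e: "admissible_width \<epsilon>" and t: "t \<in> {0..T}"
    and u: "u \<in> fe_space \<Omega> \<phi> \<K> \<epsilon> t"
  shows "(cos (3 * pi / 8))\<^sup>2 * core_energy \<epsilon> t u
    \<le> (LINT x:\<Omega>|lebesgue. lagrange_interp \<Omega> \<phi> \<K> \<epsilon> t (\<lambda>y. rho_tilde \<Omega> \<phi> \<epsilon> y t) x * (grad u x \<bullet> grad u x))"
proof -
  let ?D = "strip_domain \<Omega> \<phi> \<K> \<epsilon> t" and ?M = "strip_mesh \<Omega> \<phi> \<K> \<epsilon> t" and ?W = "core_strip \<epsilon> t"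
  define w where "w = lagrange_interp \<Omega> \<phi> \<K> \<epsilon> t (\<lambda>y. rho_tilde \<Omega> \<phi> \<epsilon> y t)"
  note ip = interpolant_properties[where t = t and g = "\<lambda>y. rho_tilde \<Omega> \<phi> \<epsilon> y t", OF m rho_tilde_range, folded w_def]
  define V where "V = interior ?D"
  have V: "open V" "V \<subseteq> ?D" unfolding V_def by (auto simp: interior_subset)
  have D: "compact ?D" by (rule strip_domain_compact[OF m])
  have uV: "piecewise_regular_on V u" by (rule fe_space_regular[OF m u V(2)])
  obtain L where L: "AE x in lebesgue. x \<in> V \<longrightarrow> norm (grad u x) \<le> L"
    using piecewise_regular_grad_bounded[OF V(1) uV] by blast
  have gm: "(\<lambda>x. indicator V x *\<^sub>R grad u x) \<in> borel_measurable lebesgue"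
    by (rule piecewise_regular_grad_measurable[OF V(1) uV])
  have wm: "w \<in> borel_measurable lebesgue"
  proof -
    have "continuous_on ?D w" using ip(1) by (simp add: fe_space_def)
    then have "(\<lambda>x. if x \<in> ?D then w x else 0) \<in> borel_measurable borel"
      using compact_imp_closed[OF D] by (intro borel_measurable_continuous_on_if) auto
    moreover have "(\<lambda>x. if x \<in> ?D then w x else 0) = w" using ip(2) by auto
    ultimately show ?thesis by (simp add: measurable_completion)
  qed
  \<comment> \<open>The integrand with the gradient cut off to the interior of the mesh strip; the
    two agree except on the boundaries of elements.\<close>
  define f where "f x = indicator \<Omega> x * (w x * (norm (indicator V x *\<^sub>R grad u x))\<^sup>2)" for x
  have fm: "f \<in> borel_measurable lebesgue" unfolding f_def[abs_def]
    using open_domain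
    by (intro borel_measurable_times borel_measurable_indicator wm borel_measurable_power
        measurable_compose[OF gm borel_measurable_norm]) auto
  have fint: "integrable lebesgue f"
  proof (rule Bochner_Integration.integrable_bound[OF _ fm])
    have "emeasure lborel \<Omega> < \<infinity>" by (rule emeasure_bounded_finite[OF bounded_domain])
    then have "integrable lborel (\<lambda>x. indicator \<Omega> x *\<^sub>R L\<^sup>2)"
      using open_domain by (intro integrable_scaleR_left integrable_real_indicator) auto
    then show "integrable lebesgue (\<lambda>x. indicator \<Omega> x *\<^sub>R L\<^sup>2)"
      using open_domain by (subst integrable_completion) auto
    show "AE x in lebesgue. norm (f x) \<le> norm (indicator \<Omega> x *\<^sub>R L\<^sup>2)"
      using L
    proof eventually_elim
      fix x assume "x \<in> V \<longrightarrow> norm (grad u x) \<le> L"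
      then have "(norm (indicator V x *\<^sub>R grad u x))\<^sup>2 \<le> L\<^sup>2"
        by (cases "x \<in> V") (auto intro: power_mono)
      then have "w x * (norm (indicator V x *\<^sub>R grad u x))\<^sup>2 \<le> 1 * L\<^sup>2"
        using ip(3,4) by (intro mult_mono) auto
      then show "norm (f x) \<le> norm (indicator \<Omega> x *\<^sub>R L\<^sup>2)"
        unfolding f_def using ip(3)[of x] by (auto simp: abs_mult split: split_indicator)
    qed
  qed
  have "negligible (\<Union>(frontier ` ?M))"
    using strip_mesh_finite[OF m] fine_mesh_element(2)[OF m]
    by (intro negligible_Union) (auto intro!: negligible_convex_frontier)
  then have "AE x in lebesgue. x \<notin> \<Union>(frontier ` ?M)"
    by (intro AE_not_in) (simp add: negligible_iff_null_sets)
  then have ae: "AE x in lebesgue. f x = indicator \<Omega> x *\<^sub>R (w x * (grad u x \<bullet> grad u x))"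
  proof eventually_elim
    fix x assume nf: "x \<notin> \<Union>(frontier ` ?M)"
    show "f x = indicator \<Omega> x *\<^sub>R (w x * (grad u x \<bullet> grad u x))"
    proof (cases "x \<in> ?D")
      case True
      then obtain K where K: "K \<in> ?M" "x \<in> K" by (auto simp: strip_domain_def)
      have "x \<in> closure K" using K(2) closure_subset by blast
      moreover have "x \<notin> frontier K" using nf K(1) by blast
      ultimately have "x \<in> interior K" by (simp add: frontier_def)
      moreover have "interior K \<subseteq> V" unfolding V_def strip_domain_def by (rule interior_mono) (use K in blast)
      ultimately have "x \<in> V" by blast
      then show ?thesis by (simp add: f_def power2_norm_eq_inner)
    qed (simp add: f_def ip(2))
  qed
  have LI: "(LINT x:\<Omega>|lebesgue. w x * (grad u x \<bullet> grad u x)) = integral\<^sup>L lebesgue f"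
    unfolding set_lebesgue_integral_def
  proof (rule integral_cong_AE)
    show "(\<lambda>x. indicator \<Omega> x *\<^sub>R (w x * (grad u x \<bullet> grad u x))) \<in> borel_measurable lebesgue"
      by (rule borel_measurable_lebesgue_AE_eq[OF fm ae])
    show "AE x in lebesgue. indicator \<Omega> x *\<^sub>R (w x * (grad u x \<bullet> grad u x)) = f x"
      using ae by eventually_elim simp
  qed (rule fm)
  have WV: "?W \<subseteq> V" unfolding V_def
    using core_strip_in_strip_domain[OF m e t] open_core_strip[OF t] by (rule interior_maximal)
  have uW: "piecewise_regular_on ?W u"
    by (rule fe_space_regular[OF m u core_strip_in_strip_domain[OF m e t]])
  have "(cos (3 * pi / 8))\<^sup>2 * core_energy \<epsilon> t u
      = (\<integral>x. (cos (3 * pi / 8))\<^sup>2 * (indicator ?W x * (norm (grad u x))\<^sup>2) \<partial>lebesgue)"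
    by (simp add: core_energy_def)
  also have "\<dots> \<le> integral\<^sup>L lebesgue f"
  proof (rule integral_mono[OF _ fint])
    show "integrable lebesgue (\<lambda>x. (cos (3 * pi / 8))\<^sup>2 * (indicator ?W x * (norm (grad u x))\<^sup>2))"
      by (rule integrable_mult_right[OF regular_weight_integrable(3)[OF t e uW]])
    fix x
    show "(cos (3 * pi / 8))\<^sup>2 * (indicator ?W x * (norm (grad u x))\<^sup>2) \<le> f x"
    proof (cases "x \<in> ?W")
      case True
      then have xs: "x \<in> \<Omega>" "x \<in> V" using core_strip_subset(3)[OF e] WV by auto
      obtain K where K: "K \<in> ?M" "x \<in> K" using xs V(2) by (auto simp: strip_domain_def)
      then have "K \<in> \<K>" using strip_mesh_finite(1)[OF m] by blast
      then have "(cos (3 * pi / 8))\<^sup>2 \<le> w x"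
        using element_near_core[OF m e t _ K(2) True] by (intro ip(5)[OF K]) blast
      then show ?thesis using True xs by (simp add: f_def mult_right_mono)
    next
      case False
      then show ?thesis using ip(3)[of x] by (simp add: f_def)
    qed
  qed
  finally show ?thesis unfolding LI[symmetric] w_def .
qed

section \<open>The energy inequality for one time step\<close>

text \<open>One step of the scheme with its own solution \<open>u\<close> as test function: \<open>w\<close>
  is the previous solution, \<open>z\<close> the extended source and \<open>p\<close> the value of
  the stabilisation term. Keeping \<open>p\<close> abstract separates the energy argument from the
  mesh.\<close>

definition tested_identity ::
    "real \<Rightarrow> real \<Rightarrow> real \<Rightarrow> ('a \<Rightarrow> real) \<Rightarrow> ('a \<Rightarrow> real) \<Rightarrow> ('a \<Rightarrow> real) \<Rightarrow> real \<Rightarrow> bool" where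
  "tested_identity \<epsilon> t s u w z p \<longleftrightarrow>
    (\<integral>x. u x * u x * weight \<epsilon> t x \<partial>lebesgue) - (\<integral>x. w x * u x * weight \<epsilon> s x \<partial>lebesgue)
      + (t - s) * (\<integral>x. grad u x \<bullet> grad u x * weight \<epsilon> t x \<partial>lebesgue)
      - (t - s) * (\<integral>x. u x * (extended_velocity T \<Gamma> \<Phi> \<Omega> \<phi> \<delta> flow v x t \<bullet> grad u x) * weight \<epsilon> t x \<partial>lebesgue)
      + p
    = (t - s) * (\<integral>x. z x * u x * weight \<epsilon> t x \<partial>lebesgue)"

text \<open>Young's inequality gives half of \<open>mass \<epsilon> s w\<close> and half of \<open>mass
  \<epsilon> s u\<close>; the latter is treated by \<open>weight_shift_inequality\<close> and uses
  a quarter of the dissipation and the term \<open>p\<close>. The velocity term uses another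
  quarter. Up to \<open>O(t - s)\<close> times the mass, half of the mass and half of the
  dissipation remain on the left, whence the factor \<open>2\<close> in the final step.\<close>

lemma energy_step:
  "\<exists>\<eta>>0. \<exists>C\<ge>0. \<exists>b\<ge>0. \<forall>t\<in>{0..T}. \<forall>s\<in>{0..T}. \<forall>\<epsilon> u w z p.
    s < t \<longrightarrow> small_step \<eta> \<epsilon> t s \<longrightarrow>
    piecewise_regular_on (core_strip \<epsilon> t) u \<longrightarrow> piecewise_regular_on (core_strip \<epsilon> s) w \<longrightarrow>
    integrable lebesgue (\<lambda>x. (z x)\<^sup>2 * weight \<epsilon> t x) \<longrightarrow>
    C * (t - s)\<^sup>2 * core_energy \<epsilon> t u \<le> p \<longrightarrow> tested_identity \<epsilon> t s u w z p \<longrightarrow>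
    mass \<epsilon> t u + (t - s) * dissipation \<epsilon> t u
      \<le> mass \<epsilon> s w + b * (t - s) * mass \<epsilon> t u + (t - s) * mass \<epsilon> t z"
proof -
  obtain \<eta> C where \<eta>: "0 < \<eta>" and C: "0 \<le> C"
    and shift: "\<forall>t\<in>{0..T}. \<forall>s\<in>{0..T}. \<forall>\<epsilon> u.
    small_step \<eta> \<epsilon> t s \<longrightarrow> piecewise_regular_on (core_strip \<epsilon> t) u \<longrightarrow>
    mass \<epsilon> s u \<le> (1 + C * \<bar>t - s\<bar>) * mass \<epsilon> t u + \<bar>t - s\<bar> / 2 * dissipation \<epsilon> t u
      + C * \<bar>t - s\<bar>\<^sup>2 * core_energy \<epsilon> t u"
    using weight_shift_inequality by blast
  obtain A where A: "0 \<le> A"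
    and vel: "\<forall>t\<in>{0..T}. \<forall>x\<in>strip \<Omega> \<phi> \<delta> t. norm (extended_velocity T \<Gamma> \<Phi> \<Omega> \<phi> \<delta> flow v x t) \<le> A"
    using extended_velocity_bounded by blast
  define b where "b = C + 2 * A\<^sup>2 + 1"
  have b: "0 \<le> b" using C by (simp add: b_def)
  have main: "mass \<epsilon> t u + (t - s) * dissipation \<epsilon> t u
      \<le> mass \<epsilon> s w + b * (t - s) * mass \<epsilon> t u + (t - s) * mass \<epsilon> t z"
    if t: "t \<in> {0..T}" and s: "s \<in> {0..T}" and st: "s < t" and small: "small_step \<eta> \<epsilon> t s"
      and u: "piecewise_regular_on (core_strip \<epsilon> t) u" and w: "piecewise_regular_on (core_strip \<epsilon> s) w"
      and z: "integrable lebesgue (\<lambda>x. (z x)\<^sup>2 * weight \<epsilon> t x)"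
      and stab: "C * (t - s)\<^sup>2 * core_energy \<epsilon> t u \<le> p" and eq: "tested_identity \<epsilon> t s u w z p"
    for t s \<epsilon> u w z p
  proof -
    let ?ve = "extended_velocity T \<Gamma> \<Phi> \<Omega> \<phi> \<delta> flow v"
    have e: "admissible_width \<epsilon>" using small by (simp add: small_step_def)
    define \<tau> where "\<tau> = t - s"
    have \<tau>: "0 < \<tau>" "\<bar>t - s\<bar> = \<tau>" using st by (auto simp: \<tau>_def)
    define I G H J F I' where "I = mass \<epsilon> t u" and "G = dissipation \<epsilon> t u" and "H = core_energy \<epsilon> t u"
      and "J = mass \<epsilon> s w" and "F = mass \<epsilon> t z" and "I' = mass \<epsilon> s u"
    note RW = regular_weight_integrable[OF t e u]
    have Ji: "integrable lebesgue (\<lambda>x. (w x)\<^sup>2 * weight \<epsilon> s x)" by (rule regular_weight_integrable(1)[OF s e w])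
    have sh: "integrable lebesgue (\<lambda>x. (u x)\<^sup>2 * weight \<epsilon> s x)"
      "I' \<le> (1 + C * \<tau>) * I + \<tau> / 2 * G + C * \<tau>\<^sup>2 * H"
      using shifted_mass_integrable[OF t s small u] shift[rule_format, OF t s small u]
      unfolding I_def G_def H_def I'_def \<tau>(2) by auto
    have 1: "\<bar>\<integral>x. w x * u x * weight \<epsilon> s x \<partial>lebesgue\<bar> \<le> J / 2 + I' / 2"
    proof -
      have "\<bar>w x * u x * weight \<epsilon> s x\<bar> \<le> (w x)\<^sup>2 * weight \<epsilon> s x / 2 + (u x)\<^sup>2 * weight \<epsilon> s x / 2" for x
        using mult_right_mono[OF abs_mult_le_half_squares[of "w x" "u x"] weight_nonneg[of \<epsilon> s x]]
        by (simp add: abs_mult abs_of_nonneg[OF weight_nonneg] distrib_right)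
      then have "\<bar>\<integral>x. w x * u x * weight \<epsilon> s x \<partial>lebesgue\<bar>
          \<le> (\<integral>x. (w x)\<^sup>2 * weight \<epsilon> s x / 2 + (u x)\<^sup>2 * weight \<epsilon> s x / 2 \<partial>lebesgue)"
        using Ji sh(1) by (intro abs_integral_le AE_I2 Bochner_Integration.integrable_add integrable_divide_zero) auto
      also have "\<dots> = J / 2 + I' / 2" using Ji sh(1) by (simp add: J_def I'_def mass_def)
      finally show ?thesis .
    qed
    have 2: "\<bar>\<integral>x. z x * u x * weight \<epsilon> t x \<partial>lebesgue\<bar> \<le> F / 2 + I / 2"
    proof -
      have "\<bar>z x * u x * weight \<epsilon> t x\<bar> \<le> (z x)\<^sup>2 * weight \<epsilon> t x / 2 + (u x)\<^sup>2 * weight \<epsilon> t x / 2" for x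
        using mult_right_mono[OF abs_mult_le_half_squares[of "z x" "u x"] weight_nonneg[of \<epsilon> t x]]
        by (simp add: abs_mult abs_of_nonneg[OF weight_nonneg] distrib_right)
      then have "\<bar>\<integral>x. z x * u x * weight \<epsilon> t x \<partial>lebesgue\<bar>
          \<le> (\<integral>x. (z x)\<^sup>2 * weight \<epsilon> t x / 2 + (u x)\<^sup>2 * weight \<epsilon> t x / 2 \<partial>lebesgue)"
        using z RW(1) by (intro abs_integral_le AE_I2 Bochner_Integration.integrable_add integrable_divide_zero) auto
      also have "\<dots> = F / 2 + I / 2" using z RW(1) by (simp add: F_def I_def mass_def)
      finally show ?thesis .
    qed
    have 3: "\<bar>\<integral>x. u x * (?ve x t \<bullet> grad u x) * weight \<epsilon> t x \<partial>lebesgue\<bar> \<le> G / 4 + A\<^sup>2 * I"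
    proof -
      have "\<bar>u x * (?ve x t \<bullet> grad u x) * weight \<epsilon> t x\<bar>
          \<le> (norm (grad u x))\<^sup>2 * weight \<epsilon> t x / 4 + A\<^sup>2 * ((u x)\<^sup>2 * weight \<epsilon> t x)" for x
      proof (cases "x \<in> core_strip \<epsilon> t")
        case False
        then show ?thesis using weight_outside[OF admissible_width_bounds(1)[OF e] False] by simp
      next
        case True
        then have va: "norm (?ve x t) \<le> A" using vel t core_strip_subset(1)[OF e] by blast
        have "\<bar>?ve x t \<bullet> grad u x\<bar> \<le> norm (?ve x t) * norm (grad u x)" by (rule Cauchy_Schwarz_ineq2)
        also have "\<dots> \<le> A * norm (grad u x)" using va by (rule mult_right_mono) simp
        finally have "\<bar>u x\<bar> * \<bar>?ve x t \<bullet> grad u x\<bar> \<le> \<bar>u x\<bar> * (A * norm (grad u x))" by (rule mult_left_mono) simp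
        also have "\<dots> \<le> (norm (grad u x))\<^sup>2 / 4 + A\<^sup>2 * (u x)\<^sup>2"
          using zero_le_power2[of "norm (grad u x) / 2 - A * \<bar>u x\<bar>"]
          by (simp add: power2_diff power_mult_distrib power_divide algebra_simps)
        finally have "\<bar>u x\<bar> * \<bar>?ve x t \<bullet> grad u x\<bar> * weight \<epsilon> t x
            \<le> ((norm (grad u x))\<^sup>2 / 4 + A\<^sup>2 * (u x)\<^sup>2) * weight \<epsilon> t x" by (rule mult_right_mono) (rule weight_nonneg)
        then show ?thesis by (simp add: abs_mult abs_of_nonneg[OF weight_nonneg] distrib_right)
      qed
      then have "\<bar>\<integral>x. u x * (?ve x t \<bullet> grad u x) * weight \<epsilon> t x \<partial>lebesgue\<bar>
          \<le> (\<integral>x. (norm (grad u x))\<^sup>2 * weight \<epsilon> t x / 4 + A\<^sup>2 * ((u x)\<^sup>2 * weight \<epsilon> t x) \<partial>lebesgue)"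
        using RW by (intro abs_integral_le AE_I2 Bochner_Integration.integrable_add integrable_divide_zero integrable_mult_right) auto
      also have "\<dots> = G / 4 + A\<^sup>2 * I" using RW by (simp add: G_def I_def mass_def dissipation_def)
      finally show ?thesis .
    qed
    have eq': "I - (\<integral>x. w x * u x * weight \<epsilon> s x \<partial>lebesgue) + \<tau> * G
      - \<tau> * (\<integral>x. u x * (?ve x t \<bullet> grad u x) * weight \<epsilon> t x \<partial>lebesgue) + p
      = \<tau> * (\<integral>x. z x * u x * weight \<epsilon> t x \<partial>lebesgue)"
      using eq unfolding I_def G_def \<tau>_def mass_def dissipation_def tested_identity_def by (simp add: power2_eq_square[of "u _"] power2_norm_eq_inner)
    have 4: "\<tau> * (\<integral>x. z x * u x * weight \<epsilon> t x \<partial>lebesgue) \<le> \<tau> * (F / 2 + I / 2)"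
      using 2 \<tau> by (intro mult_left_mono) auto
    have 5: "\<tau> * (\<integral>x. u x * (?ve x t \<bullet> grad u x) * weight \<epsilon> t x \<partial>lebesgue) \<le> \<tau> * (G / 4 + A\<^sup>2 * I)"
      using 3 \<tau> by (intro mult_left_mono) auto
    have 6: "C * \<tau>\<^sup>2 * H \<le> p" using stab by (simp add: H_def \<tau>_def)
    have H0: "0 \<le> C * \<tau>\<^sup>2 * H" using C energies_nonneg by (simp add: H_def)
    have "I + \<tau> * G + p \<le> J / 2 + I' / 2 + \<tau> * (G / 4 + A\<^sup>2 * I) + \<tau> * (F / 2 + I / 2)"
      using eq' 1 4 5 by linarith
    also have "I' / 2 \<le> ((1 + C * \<tau>) * I + \<tau> / 2 * G + C * \<tau>\<^sup>2 * H) / 2" using sh(2) by simp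
    finally have sum: "I + \<tau> * G + p \<le> J / 2 + ((1 + C * \<tau>) * I + \<tau> / 2 * G + C * \<tau>\<^sup>2 * H) / 2
        + \<tau> * (G / 4 + A\<^sup>2 * I) + \<tau> * (F / 2 + I / 2)" by simp
    have absorb: "x \<le> y / 2 + k / 2 + r + r'"
      if "q \<le> p" "0 \<le> q" "x + p \<le> y / 2 + (k + q) / 2 + r + r'" for x y k q p r r' :: real
      using that by (simp add: add_divide_distrib)
    have 7: "I + \<tau> * G \<le> J / 2 + ((1 + C * \<tau>) * I + \<tau> / 2 * G) / 2
        + \<tau> * (G / 4 + A\<^sup>2 * I) + \<tau> * (F / 2 + I / 2)" by (rule absorb[OF 6 H0 sum])
    have "2 * (J / 2 + ((1 + C * \<tau>) * I + \<tau> / 2 * G) / 2 + \<tau> * (G / 4 + A\<^sup>2 * I) + \<tau> * (F / 2 + I / 2)) - (I + \<tau> * G)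
        = J + b * \<tau> * I + \<tau> * F"
      by (simp add: b_def algebra_simps)
    moreover have "x \<le> z" if "x \<le> y" "2 * y - x = z" for x y z :: real using that by linarith
    ultimately have "I + \<tau> * G \<le> J + b * \<tau> * I + \<tau> * F" using 7 by blast
    then show ?thesis unfolding I_def G_def J_def F_def \<tau>_def .
  qed
  show ?thesis
    by (rule exI[of _ \<eta>], rule conjI, rule \<eta>, rule exI[of _ C], rule conjI, rule C,
      rule exI[of _ b], rule conjI, rule b, intro ballI allI impI, rule main)
qed

end

section \<open>The stability estimate\<close>

lemma time_partition_range:
  assumes p: "time_partition T M t" and m: "m \<le> M" shows "t m \<in> {0..T}"
proof -
  have mono: "t i \<le> t j" if "i \<le> j" "j \<le> M" for i j
    using that
  proof (induction j)
    case (Suc j)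
    show ?case
    proof (cases "i = Suc j")
      case False
      then have "t i \<le> t j" using Suc by simp
      also have "t j < t (Suc j)" using p Suc.prems by (simp add: time_partition_def)
      finally show ?thesis by simp
    qed simp
  qed simp
  show ?thesis using mono[of 0 m] mono[of m M] m p by (simp add: time_partition_def)
qed

lemma time_step_bounds:
  assumes p: "time_partition T M t" and m: "m \<in> {1..M}"
  shows "0 < time_step t m" "time_step t m \<le> max_time_step M t"
proof -
  obtain k where k: "m = Suc k" "k < M" using m by (cases m) auto
  then have "t k < t (Suc k)" using p by (simp add: time_partition_def)
  then show "0 < time_step t m" by (simp add: time_step_def k)
  show "time_step t m \<le> max_time_step M t" unfolding max_time_step_def using m by (intro Max_ge) auto
qed

lemma sum_time_steps: "(\<Sum>j=1..m. time_step t j) = t m - t 0"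
  by (induction m) (auto simp: time_step_def)

context moving_surface
begin

text \<open>Some vertex of the element has \<open>|\<phi>| < \<pi> \<epsilon> \<le> 63/20 \<epsilon>\<close>,
  and \<open>\<phi>\<close> changes by at most \<open>\<epsilon>/8\<close> across the element.\<close>

lemma strip_domain_subset:
  assumes m: "fine_mesh \<epsilon> \<K>" and e: "admissible_width \<epsilon>" and t: "t \<in> {0..T}"
    and x: "x \<in> strip_domain \<Omega> \<phi> \<K> \<epsilon> t" "x \<in> strip \<Omega> \<phi> \<delta> t"
  shows "x \<in> strip \<Omega> \<phi> (min \<delta> (4 * \<epsilon>)) t"
proof -
  note eb = admissible_width_bounds[OF e]
  obtain K y where K: "K \<in> \<K>" "x \<in> K" "y \<in> K" "0 < rho_tilde \<Omega> \<phi> \<epsilon> y t"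
    using x(1) by (auto simp: strip_domain_def strip_mesh_def)
  have yO: "y \<in> \<Omega>" using K(4) by (auto simp: rho_tilde_def split: if_splits)
  have "\<bar>\<phi> y t / (2 * \<epsilon>)\<bar> < pi / 2"
    using K(4) profile_outside[of "\<phi> y t / (2 * \<epsilon>)"] yO by (force simp: rho_tilde_def)
  then have "\<bar>\<phi> y t\<bar> < pi / 2 * (2 * \<epsilon>)" using eb(1) by (simp add: abs_divide pos_divide_less_eq)
  also have "\<dots> \<le> 63 / 40 * (2 * \<epsilon>)" using half_pi_less eb(1) by (intro mult_right_mono) auto
  finally have py: "\<bar>\<phi> y t\<bar> < 63 / 20 * \<epsilon>" by simp
  have d: "c1 * dist y x \<le> \<epsilon> / 8" by (rule fine_mesh_element(3)[OF m K(1) K(3,2)])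
  have xd: "x \<in> \<Omega>" "\<bar>\<phi> x t\<bar> < \<delta>" using x(2) by (auto simp: strip_def)
  have "\<bar>\<phi> x t\<bar> < 4 * \<epsilon>"
  \<comment> \<open>If the bounds on \<open>\<phi>\<close> are not available along the segment, then
    \<open>\<epsilon>\<close> is so large that \<open>\<delta> < 4
    \<epsilon>\<close>.\<close>
  proof (cases "\<bar>\<phi> y t\<bar> + c1 * dist y x < \<delta>0")
    case True
    from near_strip(2)[OF t yO this] show ?thesis using py d eb by linarith
  next
    case False
    then show ?thesis using py d eb xd delta by linarith
  qed
  then show ?thesis using xd by (simp add: strip_def)
qed

text \<open>Testing the projection with \<open>u\<close> itself shows that it does not increase the
  \<open>L\<^sup>2\<close> norm over the mesh strip; there the extended datum is supported in a
  strip of width at most \<open>4 \<epsilon>\<close>.\<close>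

lemma initial_projection_bound:
  assumes m: "fine_mesh \<epsilon> \<K>" and e: "admissible_width \<epsilon>" and t: "t \<in> {0..T}"
    and u: "u \<in> fe_space \<Omega> \<phi> \<K> \<epsilon> t"
    and gi: "integrable lebesgue (extended_square (min \<delta> (4 * \<epsilon>)) t g)"
    and proj: "(LINT x:strip_domain \<Omega> \<phi> \<K> \<epsilon> t|lebesgue. u x * u x) =
      (LINT x:strip_domain \<Omega> \<phi> \<K> \<epsilon> t|lebesgue. (if x \<in> strip \<Omega> \<phi> \<delta> t then g (foot_point x t) else 0) * u x)"
  shows "mass \<epsilon> t u \<le> c1 * integral\<^sup>L lebesgue (extended_square (min \<delta> (4 * \<epsilon>)) t g)"
proof -
  let ?D = "strip_domain \<Omega> \<phi> \<K> \<epsilon> t" and ?S = "strip \<Omega> \<phi> (min \<delta> (4 * \<epsilon>)) t"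
  let ?R = "extended_square (min \<delta> (4 * \<epsilon>)) t g"
  define z where "z x = (if x \<in> strip \<Omega> \<phi> \<delta> t then g (foot_point x t) else 0)" for x
  define Q where "Q = (\<integral>x. indicator ?D x * (u x)\<^sup>2 \<partial>lebesgue)"
  define R where "R = integral\<^sup>L lebesgue ?R"
  have D: "compact ?D" by (rule strip_domain_compact[OF m])
  have cu: "continuous_on ?D u" using u by (simp add: fe_space_def)
  have Qi: "integrable lebesgue (\<lambda>x. indicator ?D x * (u x)\<^sup>2)"
  proof -
    have "integrable lborel (\<lambda>x. indicator ?D x *\<^sub>R (u x)\<^sup>2)"
      using borel_integrable_compact[OF D, of "\<lambda>x. (u x)\<^sup>2"] cu
      by (simp add: set_integrable_def[symmetric] indicator_scaleR_eq_if continuous_on_power)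
    then show ?thesis by (subst integrable_completion) (auto dest: borel_measurable_integrable)
  qed
  have le: "\<bar>indicator ?D x *\<^sub>R (z x * u x)\<bar> \<le> ?R x / 2 + indicator ?D x * (u x)\<^sup>2 / 2" for x
  proof (cases "x \<in> ?D")
    case True
    show ?thesis
    proof (cases "x \<in> strip \<Omega> \<phi> \<delta> t")
      case xs: True
      then have "x \<in> ?S" using strip_domain_subset[OF m e t True] by blast
      then show ?thesis using True xs abs_mult_le_half_squares[of "g (foot_point x t)" "u x"]
        by (simp add: z_def extended_square_def)
    qed (simp add: z_def extended_square_def)
  qed (simp add: extended_square_def)
  have "Q = (LINT x:?D|lebesgue. u x * u x)"
    by (simp add: Q_def set_lebesgue_integral_def power2_eq_square)
  also have "\<dots> = (LINT x:?D|lebesgue. z x * u x)" using proj by (simp add: z_def)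
  also have "\<dots> \<le> \<bar>\<integral>x. indicator ?D x *\<^sub>R (z x * u x) \<partial>lebesgue\<bar>" by (simp add: set_lebesgue_integral_def)
  also have "\<dots> \<le> (\<integral>x. ?R x / 2 + indicator ?D x * (u x)\<^sup>2 / 2 \<partial>lebesgue)"
    using gi Qi le by (intro abs_integral_le AE_I2 Bochner_Integration.integrable_add integrable_divide_zero) auto
  also have "\<dots> = R / 2 + Q / 2" using gi Qi by (simp add: R_def Q_def)
  finally have QR: "Q \<le> R" by simp
  have "mass \<epsilon> t u \<le> (\<integral>x. c1 * (indicator ?D x * (u x)\<^sup>2) \<partial>lebesgue)"
    unfolding mass_def
  proof (rule integral_mono)
    show "integrable lebesgue (\<lambda>x. (u x)\<^sup>2 * weight \<epsilon> t x)"
      by (rule regular_weight_integrable(1)[OF t e fe_space_regular[OF m u core_strip_in_strip_domain[OF m e t]]])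
    show "integrable lebesgue (\<lambda>x. c1 * (indicator ?D x * (u x)\<^sup>2))" by (rule integrable_mult_right[OF Qi])
    fix x
    show "(u x)\<^sup>2 * weight \<epsilon> t x \<le> c1 * (indicator ?D x * (u x)\<^sup>2)"
    proof (cases "x \<in> core_strip \<epsilon> t")
      case True
      then have "x \<in> ?D" using core_strip_in_strip_domain[OF m e t] by blast
      then show ?thesis using weight_bounds(1)[OF e t, of x] by (simp add: mult.commute[of c1] mult_left_mono)
    next
      case False
      then show ?thesis using weight_outside[OF admissible_width_bounds(1)[OF e] False] constants by simp
    qed
  qed
  also have "\<dots> = c1 * Q" by (simp add: Q_def)
  also have "\<dots> \<le> c1 * R" using QR constants by (intro mult_left_mono) auto
  finally show ?thesis by (simp add: R_def)
qed

lemma source_bound: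
  assumes e: "admissible_width \<epsilon>" and t: "t \<in> {0..T}"
    and gi: "integrable lebesgue (extended_square (\<epsilon> * pi / 2) t g)"
    and z_def: "\<And>x. z x = (if x \<in> strip \<Omega> \<phi> \<delta> t then g (foot_point x t) else 0)"
  shows "integrable lebesgue (\<lambda>x. (z x)\<^sup>2 * weight \<epsilon> t x)"
    and "mass \<epsilon> t z \<le> c1 * integral\<^sup>L lebesgue (extended_square (\<epsilon> * pi / 2) t g)"
proof -
  let ?S = "strip \<Omega> \<phi> (\<epsilon> * pi / 2) t"
  let ?G = "extended_square (\<epsilon> * pi / 2) t g"
  have G0: "0 \<le> ?G x" for x by (simp add: extended_square_def)
  note eb = admissible_width_bounds[OF e]
  have "0 < \<epsilon> * pi" using eb(1) pi_gt_zero by (rule mult_pos_pos)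
  then have sub: "?S \<subseteq> strip \<Omega> \<phi> \<delta> t" using eb(3) by (intro strip_mono) linarith
  have eq: "(z x)\<^sup>2 * weight \<epsilon> t x = ?G x * weight \<epsilon> t x" for x
    using sub weight_outside_strip[OF eb(1), of x t] by (auto simp: z_def extended_square_def split: split_indicator)
  have w: "\<bar>weight \<epsilon> t x\<bar> \<le> c1" for x using weight_bounds(1)[OF e t, of x] weight_nonneg[of \<epsilon> t x] by simp
  have ci: "integrable lebesgue (\<lambda>x. c1 * ?G x)" by (rule integrable_mult_right[OF gi])
  have le: "?G x * weight \<epsilon> t x \<le> c1 * ?G x" for x
    using mult_left_mono[OF weight_bounds(1)[OF e t, of x] G0] by (simp add: mult.commute)
  show i: "integrable lebesgue (\<lambda>x. (z x)\<^sup>2 * weight \<epsilon> t x)"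
    unfolding eq
  proof (rule Bochner_Integration.integrable_bound[OF ci])
    show "(\<lambda>x. ?G x * weight \<epsilon> t x) \<in> borel_measurable lebesgue"
      by (intro borel_measurable_times borel_measurable_integrable[OF gi] weight_measurable t e)
    have "norm (?G x * weight \<epsilon> t x) \<le> norm (c1 * ?G x)" for x
      using le[of x] weight_nonneg[of \<epsilon> t x] G0[of x] constants by (simp add: abs_mult)
    then show "AE x in lebesgue. norm (?G x * weight \<epsilon> t x) \<le> norm (c1 * ?G x)" by simp
  qed
  have "mass \<epsilon> t z \<le> (\<integral>x. c1 * ?G x \<partial>lebesgue)"
    unfolding mass_def by (rule integral_mono[OF i ci]) (simp add: eq le)
  then show "mass \<epsilon> t z \<le> c1 * integral\<^sup>L lebesgue ?G" by simp
qed

end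

theorem theorem4p3:
  fixes n :: nat and T :: real
    and \<Gamma> :: "real \<Rightarrow> 'a::euclidean_space set"
    and v :: "'a \<Rightarrow> real \<Rightarrow> 'a"
    and \<Phi> :: "'a \<Rightarrow> real \<Rightarrow> 'a"
    and \<Omega> :: "'a set"
    and \<phi> :: "'a \<Rightarrow> real \<Rightarrow> real"
    and \<delta>0 c0 c1 c2 \<delta> :: real
    and flow :: "'a \<Rightarrow> real \<Rightarrow> real \<Rightarrow> 'a"
    and h0 \<tau>0 :: real and H :: "real set" and \<T> :: "real \<Rightarrow> 'a set set"
  assumes setting: "moving_surface n T \<Gamma> v \<Phi> \<Omega> \<phi> \<delta>0 c0 c1 c2 \<delta> flow"
    and mesh: "regular_triangulations \<Omega> h0 H \<T>"
    and tau0: "0 < \<tau>0"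
  shows "\<exists>\<gamma>1>0. \<exists>\<tau>1>0. \<tau>1 \<le> \<tau>0 \<and> (\<forall>\<gamma>\<ge>\<gamma>1. \<exists>C.
    \<forall>(\<epsilon>::real) (h::real) (M::nat) (t::nat \<Rightarrow> real)
      (u0::'a \<Rightarrow> real) (f::'a \<Rightarrow> real \<Rightarrow> real) (u::nat \<Rightarrow> 'a \<Rightarrow> real).
      0 < \<epsilon> \<and> \<epsilon> < \<delta> / pi \<and> h \<in> H \<and> time_partition T M t \<and>
      h \<le> (cos (3 * pi / 8))\<^sup>2 / (2 * c1) * \<epsilon> \<and>
      max_time_step M t \<le> (cos (3 * pi / 8))\<^sup>2 / (2 * c2) * \<epsilon> \<and>
      max_time_step M t \<le> min \<tau>1 (\<epsilon>\<^sup>2) \<and>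
      square_integrable_on (hausdorff_measure n) (\<Gamma> 0) u0 \<and>
      (\<forall>s\<in>{0..T}. square_integrable_on (hausdorff_measure n) (\<Gamma> s) (\<lambda>x. f x s)) \<and>
      scheme_solution \<Omega> \<phi> (extended_velocity T \<Gamma> \<Phi> \<Omega> \<phi> \<delta> flow v)
        (\<lambda>x. extend \<Gamma> \<Phi> \<Omega> \<phi> \<delta> flow (\<lambda>y s. u0 y) x 0) (extend \<Gamma> \<Phi> \<Omega> \<phi> \<delta> flow f)
        (\<T> h) \<epsilon> \<gamma> M t u
      \<longrightarrow>
      Max ((\<lambda>m. 2 / (\<epsilon> * pi) * diffuse_integral \<Omega> \<phi> \<epsilon> (t m) (\<lambda>x. (u m x)\<^sup>2)) ` {1..M})
      + (\<Sum>m=1..M. time_step t m *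
           (2 / (\<epsilon> * pi) * diffuse_integral \<Omega> \<phi> \<epsilon> (t m) (\<lambda>x. (norm (grad (u m) x))\<^sup>2)))
      \<le> C * ((LINT x:\<Gamma> 0|hausdorff_measure n. (u0 x)\<^sup>2)
             + (\<Sum>m=1..M. time_step t m * (LINT x:\<Gamma> (t m)|hausdorff_measure n. (f x (t m))\<^sup>2))))"
proof -
  interpret moving_surface n T \<Gamma> v \<Phi> \<Omega> \<phi> \<delta>0 c0 c1 c2 \<delta> flow by (rule setting)
  let ?ve = "extended_velocity T \<Gamma> \<Phi> \<Omega> \<phi> \<delta> flow v"
  let ?c = "(cos (3 * pi / 8))\<^sup>2"
  have cc: "0 < ?c" "?c \<le> 1 / 4" using cos_three_eighths_pi by auto
  have c: "0 < c0" "0 < c1" "0 < c2" using constants by auto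
  obtain \<eta> C b where \<eta>: "0 < \<eta>" and C: "0 \<le> C" and b: "0 \<le> b"
    and step: "\<forall>t\<in>{0..T}. \<forall>s\<in>{0..T}. \<forall>\<epsilon> u w z p.
    s < t \<longrightarrow> small_step \<eta> \<epsilon> t s \<longrightarrow>
    piecewise_regular_on (core_strip \<epsilon> t) u \<longrightarrow> piecewise_regular_on (core_strip \<epsilon> s) w \<longrightarrow>
    integrable lebesgue (\<lambda>x. (z x)\<^sup>2 * weight \<epsilon> t x) \<longrightarrow>
    C * (t - s)\<^sup>2 * core_energy \<epsilon> t u \<le> p \<longrightarrow> tested_identity \<epsilon> t s u w z p \<longrightarrow>
    mass \<epsilon> t u + (t - s) * dissipation \<epsilon> t u
      \<le> mass \<epsilon> s w + b * (t - s) * mass \<epsilon> t u + (t - s) * mass \<epsilon> t z"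
    using energy_step by blast
  obtain K where K: "0 < K"
    and ext: "\<forall>t\<in>{0..T}. \<forall>r\<in>{0<..\<delta>}. \<forall>g. square_integrable_on (hausdorff_measure n) (\<Gamma> t) g \<longrightarrow>
    integrable lebesgue (extended_square r t g) \<and>
    integral\<^sup>L lebesgue (extended_square r t g) \<le> K * r * (LINT x:\<Gamma> t|hausdorff_measure n. (g x)\<^sup>2)"
    using extension_square_integral_le by blast
  \<comment> \<open>By \<open>stabilisation_coercive\<close> the stabilisation term then dominates
    \<open>C \<tau>\<^sup>2\<close> times the core energy.\<close>
  define \<gamma>1 where "\<gamma>1 = C / ?c + 1"
  define \<tau>1 where "\<tau>1 = min \<tau>0 (min (\<eta> / 2) (1 / (2 * (b + 1))))"
  define E where "E = exp (2 * b * T)"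
  \<comment> \<open>These two constants bound the normalised initial mass and source, \<open>2 /
    (\<epsilon> \<pi>)\<close> times \<open>c1 K r\<close>, with \<open>r = 4
    \<epsilon>\<close> and \<open>r = \<epsilon> \<pi> / 2\<close>.\<close>
  define k0 where "k0 = 8 * c1 * K / pi"
  define k1 where "k1 = c1 * K"
  \<comment> \<open>The factor \<open>2\<close> is for bounding the maximum and the sum separately.\<close>
  define C' where "C' = 2 * E * (k0 + k1)"
  have \<gamma>1: "0 < \<gamma>1" "C \<le> \<gamma>1 * ?c" using C cc by (auto simp: \<gamma>1_def distrib_right add_nonneg_pos)
  have \<tau>1: "0 < \<tau>1" "\<tau>1 \<le> \<tau>0" "\<tau>1 < \<eta>" using tau0 \<eta> b by (auto simp: \<tau>1_def)
  have "\<tau>1 \<le> 1 / (2 * (b + 1))" by (simp add: \<tau>1_def)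
  then have "b * \<tau>1 \<le> b * (1 / (2 * (b + 1)))" using b by (rule mult_left_mono)
  also have "\<dots> \<le> 1 / 2" using b by (simp add: field_simps)
  finally have b\<tau>1: "b * \<tau>1 \<le> 1 / 2" .
  have k: "0 < k0" "0 < k1" using K c pi_gt_zero by (auto simp: k0_def k1_def)
  have E: "0 < E" by (simp add: E_def)
  have main: "Max ((\<lambda>m. 2 / (\<epsilon> * pi) * diffuse_integral \<Omega> \<phi> \<epsilon> (t m) (\<lambda>x. (u m x)\<^sup>2)) ` {1..M})
      + (\<Sum>m=1..M. time_step t m *
           (2 / (\<epsilon> * pi) * diffuse_integral \<Omega> \<phi> \<epsilon> (t m) (\<lambda>x. (norm (grad (u m) x))\<^sup>2)))
      \<le> C' * ((LINT x:\<Gamma> 0|hausdorff_measure n. (u0 x)\<^sup>2)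
             + (\<Sum>m=1..M. time_step t m * (LINT x:\<Gamma> (t m)|hausdorff_measure n. (f x (t m))\<^sup>2)))"
    if \<gamma>: "\<gamma>1 \<le> \<gamma>" and eps: "0 < \<epsilon>" "\<epsilon> < \<delta> / pi" and h: "h \<in> H" and part: "time_partition T M t"
      and hs: "h \<le> ?c / (2 * c1) * \<epsilon>" and ts: "max_time_step M t \<le> ?c / (2 * c2) * \<epsilon>"
      and tm: "max_time_step M t \<le> min \<tau>1 (\<epsilon>\<^sup>2)"
      and u0: "square_integrable_on (hausdorff_measure n) (\<Gamma> 0) u0"
      and f: "\<forall>s\<in>{0..T}. square_integrable_on (hausdorff_measure n) (\<Gamma> s) (\<lambda>x. f x s)"
      and sol: "scheme_solution \<Omega> \<phi> ?ve (\<lambda>x. extend \<Gamma> \<Phi> \<Omega> \<phi> \<delta> flow (\<lambda>y s. u0 y) x 0)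
        (extend \<Gamma> \<Phi> \<Omega> \<phi> \<delta> flow f) (\<T> h) \<epsilon> \<gamma> M t u"
    for \<gamma> \<epsilon> h M t u0 f u
  proof -
    have e: "admissible_width \<epsilon>" using eps by (simp add: admissible_width_def)
    note eb = admissible_width_bounds[OF e]
    have fine: "fine_mesh \<epsilon> (\<T> h)"
    proof -
      have tri: "triangulation (\<T> h)" "\<forall>K\<in>\<T> h. int DIM('a) simplex K" "\<Union>(\<T> h) = closure \<Omega>"
        and mx: "Max (diameter ` \<T> h) = h"
        using mesh h unfolding regular_triangulations_def by blast+
      have "c1 * diameter K \<le> \<epsilon> / 8" if "K \<in> \<T> h" for K
      proof -
        have "finite (\<T> h)" using tri(1) by (simp add: triangulation_def)
        then have "diameter K \<le> h" using that mx by (metis Max_ge finite_imageI imageI)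
        then have "c1 * diameter K \<le> c1 * (?c / (2 * c1) * \<epsilon>)" using hs c by (intro mult_left_mono) auto
        also have "\<dots> = ?c * \<epsilon> / 2" using c by simp
        also have "\<dots> \<le> (1 / 4) * \<epsilon> / 2" using cc eps by (intro divide_right_mono mult_right_mono) auto
        finally show ?thesis by simp
      qed
      then show ?thesis using tri by (simp add: fine_mesh_def)
    qed
    have rng: "t m \<in> {0..T}" if "m \<le> M" for m by (rule time_partition_range[OF part that])
    have t0: "t 0 = 0" and tM: "t M = T" using part by (auto simp: time_partition_def)
    have M1: "1 \<le> M" using t0 tM T_pos by (cases M) auto
    have fe: "u m \<in> fe_space \<Omega> \<phi> (\<T> h) \<epsilon> (t m)" if "m \<le> M" for m
      using sol that unfolding scheme_solution_def by blast
    have reg: "piecewise_regular_on (core_strip \<epsilon> (t m)) (u m)" if "m \<le> M" for m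
      using fe_space_regular[OF fine fe[OF that] core_strip_in_strip_domain[OF fine e rng[OF that]]] .
    define a where "a m = 2 / (\<epsilon> * pi) * mass \<epsilon> (t m) (u m)" for m
    define g where "g m = 2 / (\<epsilon> * pi) * dissipation \<epsilon> (t m) (u m)" for m
    define F where "F m = (LINT x:\<Gamma> (t m)|hausdorff_measure n. (f x (t m))\<^sup>2)" for m
    define U where "U = (LINT x:\<Gamma> 0|hausdorff_measure n. (u0 x)\<^sup>2)"
    have ep: "0 < \<epsilon> * pi" using eps pi_gt_zero by simp
    have a0: "0 \<le> a m" and g0: "0 \<le> g m" for m
      unfolding a_def g_def using ep energies_nonneg by (auto intro!: mult_nonneg_nonneg)
    have F0: "0 \<le> F m" for m unfolding F_def set_lebesgue_integral_def by (intro integral_nonneg_AE) auto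
    have U0: "0 \<le> U" unfolding U_def set_lebesgue_integral_def by (intro integral_nonneg_AE) auto
    have init: "a 0 \<le> k0 * U"
    proof -
      define r where "r = min \<delta> (4 * \<epsilon>)"
      have r: "r \<in> {0<..\<delta>}" "r \<le> 4 * \<epsilon>" using eps delta by (auto simp: r_def)
      have z0: "0 \<in> {0..T}" using T_pos by simp
      note x0 = ext[rule_format, OF z0 r(1) u0]
      have "mass \<epsilon> 0 (u 0) \<le> c1 * integral\<^sup>L lebesgue (extended_square r 0 u0)"
        unfolding r_def
      proof (rule initial_projection_bound[OF fine e z0])
        show "u 0 \<in> fe_space \<Omega> \<phi> (\<T> h) \<epsilon> 0" using fe[of 0] t0 by simp
        show "integrable lebesgue (extended_square (min \<delta> (4 * \<epsilon>)) 0 u0)" using x0 unfolding r_def by blast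
        have "\<forall>w\<in>fe_space \<Omega> \<phi> (\<T> h) \<epsilon> (t 0).
          (LINT x:strip_domain \<Omega> \<phi> (\<T> h) \<epsilon> (t 0)|lebesgue. u 0 x * w x) =
          (LINT x:strip_domain \<Omega> \<phi> (\<T> h) \<epsilon> (t 0)|lebesgue. extend \<Gamma> \<Phi> \<Omega> \<phi> \<delta> flow (\<lambda>y s. u0 y) x 0 * w x)"
          using sol unfolding scheme_solution_def by blast
        from bspec[OF this fe[of 0]]
        show "(LINT x:strip_domain \<Omega> \<phi> (\<T> h) \<epsilon> 0|lebesgue. u 0 x * u 0 x) =
          (LINT x:strip_domain \<Omega> \<phi> (\<T> h) \<epsilon> 0|lebesgue. (if x \<in> strip \<Omega> \<phi> \<delta> 0 then u0 (foot_point x 0) else 0) * u 0 x)"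
          unfolding t0 extend_eq by simp
      qed
      also have "\<dots> \<le> c1 * (K * r * U)" using x0 c unfolding U_def by (intro mult_left_mono) auto
      also have "\<dots> \<le> c1 * (K * (4 * \<epsilon>) * U)"
        using r K c U0 by (intro mult_left_mono mult_right_mono) auto
      finally have "a 0 \<le> 2 / (\<epsilon> * pi) * (c1 * (K * (4 * \<epsilon>) * U))"
        unfolding a_def t0 using ep by (intro mult_left_mono) auto
      also have "\<dots> = k0 * U" using eps by (simp add: k0_def)
      finally show ?thesis .
    qed
    have energy: "a m + time_step t m * g m \<le> a (m - 1) + b * time_step t m * a m + k1 * (time_step t m * F m)"
      if m: "m \<in> {1..M}" for m
    proof -
      define s where "s = t (m - 1)"
      define z where "z x = (if x \<in> strip \<Omega> \<phi> \<delta> (t m) then f (foot_point x (t m)) (t m) else 0)" for x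
      define N where "N = (LINT x:\<Omega>|lebesgue.
               lagrange_interp \<Omega> \<phi> (\<T> h) \<epsilon> (t m) (\<lambda>y. rho_tilde \<Omega> \<phi> \<epsilon> y (t m)) x * (grad (u m) x \<bullet> grad (u m) x))"
      define \<tau> where "\<tau> = t m - s"
      have mM: "m \<le> M" "m - 1 \<le> M" using m by auto
      have \<tau>: "time_step t m = \<tau>" by (simp add: time_step_def \<tau>_def s_def)
      have \<tau>p: "0 < \<tau>" "\<tau> \<le> max_time_step M t" using time_step_bounds[OF part m] unfolding \<tau> .
      have "c2 * \<tau> \<le> c2 * (?c / (2 * c2) * \<epsilon>)" using \<tau>p ts c by (intro mult_left_mono) auto
      also have "\<dots> = ?c * \<epsilon> / 2" using c by simp
      also have "\<dots> \<le> (1 / 4) * \<epsilon> / 2" using cc eps by (intro divide_right_mono mult_right_mono) auto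
      finally have c2\<tau>: "c2 * \<tau> \<le> \<epsilon> / 8" by simp
      have \<tau>s: "\<tau> < \<eta>" "\<tau> \<le> \<epsilon>\<^sup>2" using \<tau>p tm \<tau>1 by auto
      have st: "s < t m" using \<tau>p by (simp add: \<tau>_def)
      have r: "\<epsilon> * pi / 2 \<in> {0<..\<delta>}" using ep eb(3) by auto
      have fm: "square_integrable_on (hausdorff_measure n) (\<Gamma> (t m)) (\<lambda>x. f x (t m))" using f rng[OF mM(1)] by blast
      note xf = ext[rule_format, OF rng[OF mM(1)] r fm]
      note src = source_bound[OF e rng[OF mM(1)] conjunct1[OF xf] z_def]
      have stab: "C * (t m - s)\<^sup>2 * core_energy \<epsilon> (t m) (u m) \<le> \<gamma> * (time_step t m)\<^sup>2 * N"
      proof -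
        define G where "G = core_energy \<epsilon> (t m) (u m)"
        have G0: "0 \<le> G" unfolding G_def by (rule energies_nonneg)
        have "C * G \<le> (\<gamma>1 * ?c) * G" using \<gamma>1(2) G0 by (rule mult_right_mono)
        also have "\<dots> \<le> \<gamma> * (?c * G)" using \<gamma> cc G0 by (simp add: mult.assoc mult_right_mono)
        also have "\<dots> \<le> \<gamma> * N"
          using stabilisation_coercive[OF fine e rng[OF mM(1)] fe[OF mM(1)]] \<gamma> \<gamma>1 unfolding G_def N_def
          by (intro mult_left_mono) auto
        finally have "\<tau>\<^sup>2 * (C * G) \<le> \<tau>\<^sup>2 * (\<gamma> * N)" by (rule mult_left_mono) simp
        then show ?thesis unfolding \<tau> G_def \<tau>_def by (simp add: mult_ac)
      qed
      have eqn: "tested_identity \<epsilon> (t m) s (u m) (u (m - 1)) z (\<gamma> * (time_step t m)\<^sup>2 * N)"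
      proof -
        have "\<forall>m\<in>{1..M}. \<forall>w\<in>fe_space \<Omega> \<phi> (\<T> h) \<epsilon> (t m).
          diffuse_integral \<Omega> \<phi> \<epsilon> (t m) (\<lambda>x. u m x * w x)
          - diffuse_integral \<Omega> \<phi> \<epsilon> (t (m - 1)) (\<lambda>x. u (m - 1) x * w x)
          + time_step t m * diffuse_integral \<Omega> \<phi> \<epsilon> (t m) (\<lambda>x. grad (u m) x \<bullet> grad w x)
          - time_step t m * diffuse_integral \<Omega> \<phi> \<epsilon> (t m) (\<lambda>x. u m x * (?ve x (t m) \<bullet> grad w x))
          + \<gamma> * (time_step t m)\<^sup>2 *
            (LINT x:\<Omega>|lebesgue.
               lagrange_interp \<Omega> \<phi> (\<T> h) \<epsilon> (t m) (\<lambda>y. rho_tilde \<Omega> \<phi> \<epsilon> y (t m)) x *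
               (grad (u m) x \<bullet> grad w x))
          = time_step t m * diffuse_integral \<Omega> \<phi> \<epsilon> (t m) (\<lambda>x. extend \<Gamma> \<Phi> \<Omega> \<phi> \<delta> flow f x (t m) * w x)"
          using sol unfolding scheme_solution_def by blast
        from bspec[OF bspec[OF this m] fe[OF mM(1)]] show ?thesis
          unfolding tested_identity_def diffuse_integral_eq \<tau> \<tau>_def s_def[symmetric] N_def[symmetric] extend_eq z_def .
      qed
      have sR: "s \<in> {0..T}" unfolding s_def by (rule rng[OF mM(2)])
      have regs: "piecewise_regular_on (core_strip \<epsilon> s) (u (m - 1))" unfolding s_def by (rule reg[OF mM(2)])
      have small: "small_step \<eta> \<epsilon> (t m) s"
        using e st \<tau>s c2\<tau> unfolding small_step_def \<tau>_def by simp
      define I G J Z where "I = mass \<epsilon> (t m) (u m)" and "G = dissipation \<epsilon> (t m) (u m)"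
        and "J = mass \<epsilon> s (u (m - 1))" and "Z = mass \<epsilon> (t m) z"
      have "I + \<tau> * G \<le> J + b * \<tau> * I + \<tau> * Z"
        unfolding I_def G_def J_def Z_def \<tau>_def
        by (rule step[rule_format, OF rng[OF mM(1)] sR st small reg[OF mM(1)] regs src(1) stab eqn])
      moreover have "Z \<le> c1 * (K * (\<epsilon> * pi / 2) * F m)"
      proof -
        have "Z \<le> c1 * integral\<^sup>L lebesgue (extended_square (\<epsilon> * pi / 2) (t m) (\<lambda>x. f x (t m)))"
          unfolding Z_def by (rule src(2))
        also have "\<dots> \<le> c1 * (K * (\<epsilon> * pi / 2) * F m)"
          using xf c unfolding F_def by (intro mult_left_mono) auto
        finally show ?thesis .
      qed
      then have "\<tau> * Z \<le> \<tau> * (c1 * (K * (\<epsilon> * pi / 2) * F m))" using \<tau>p by (intro mult_left_mono) auto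
      ultimately have "I + \<tau> * G \<le> J + b * \<tau> * I + \<tau> * (c1 * (K * (\<epsilon> * pi / 2) * F m))" by linarith
      then have "2 / (\<epsilon> * pi) * (I + \<tau> * G) \<le> 2 / (\<epsilon> * pi) * (J + b * \<tau> * I + \<tau> * (c1 * (K * (\<epsilon> * pi / 2) * F m)))"
        using ep by (intro mult_left_mono) auto
      also have "\<dots> = 2 / (\<epsilon> * pi) * J + b * \<tau> * (2 / (\<epsilon> * pi) * I) + k1 * (\<tau> * F m)"
        using eps pi_gt_zero by (simp add: k1_def distrib_left)
      finally show ?thesis unfolding \<tau> a_def g_def I_def[symmetric] G_def[symmetric] s_def[symmetric] J_def[symmetric]
        by (simp add: distrib_left mult.left_commute[of \<tau>])
    qed
    have tau_nonneg: "0 \<le> time_step t m" and tau_small: "b * time_step t m \<le> 1 / 2" if m: "m \<in> {1..M}" for m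
    proof -
      show "0 \<le> time_step t m" using time_step_bounds(1)[OF part m] by simp
      have "time_step t m \<le> \<tau>1" using time_step_bounds(2)[OF part m] tm by simp
      then have "b * time_step t m \<le> b * \<tau>1" using b by (rule mult_left_mono)
      then show "b * time_step t m \<le> 1 / 2" using b\<tau>1 by simp
    qed
    define S where "S = (\<Sum>m=1..M. time_step t m * F m)"
    have S0: "0 \<le> S" unfolding S_def using tau_nonneg F0 by (intro sum_nonneg mult_nonneg_nonneg) auto
    have bound: "a m + (\<Sum>j=1..m. time_step t j * g j) \<le> E * ((k0 + k1) * (U + S))" if m: "m \<le> M" for m
    proof -
      have "a m + (\<Sum>j=1..m. time_step t j * g j)
        \<le> exp (2 * b * (\<Sum>j=1..m. time_step t j)) * (a 0 + k1 * (\<Sum>j=1..m. time_step t j * F j))"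
        by (rule discrete_gronwall[where a = a and g = g and F = F and \<tau> = "time_step t" and M = M, OF b less_imp_le[OF k(2)] tau_nonneg tau_small a0 g0 F0 energy m])
      also have "\<dots> \<le> E * ((k0 + k1) * (U + S))"
      proof (rule mult_mono)
        show "exp (2 * b * (\<Sum>j=1..m. time_step t j)) \<le> E"
          unfolding E_def sum_time_steps t0 using rng[OF m] b by (simp add: mult_left_mono)
        have "(\<Sum>j=1..m. time_step t j * F j) \<le> S"
          unfolding S_def using m tau_nonneg F0 by (intro sum_mono2 mult_nonneg_nonneg) auto
        then have "k1 * (\<Sum>j=1..m. time_step t j * F j) \<le> k1 * S" using k by (intro mult_left_mono) auto
        moreover have "0 \<le> k1 * U" "0 \<le> k0 * S" using k U0 S0 by auto
        ultimately show "a 0 + k1 * (\<Sum>j=1..m. time_step t j * F j) \<le> (k0 + k1) * (U + S)"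
          using init by (simp add: distrib_left distrib_right)
        show "0 \<le> a 0 + k1 * (\<Sum>j=1..m. time_step t j * F j)"
          using a0 k tau_nonneg F0 m by (intro add_nonneg_nonneg mult_nonneg_nonneg sum_nonneg) auto
      qed (use E in simp)
      finally show ?thesis .
    qed
    have "Max (a ` {1..M}) \<le> E * ((k0 + k1) * (U + S))"
    proof (subst Max_le_iff)
      show "\<forall>x\<in>a ` {1..M}. x \<le> E * ((k0 + k1) * (U + S))"
      proof
        fix x assume "x \<in> a ` {1..M}"
        then obtain m where m: "m \<in> {1..M}" "x = a m" by blast
        then have "0 \<le> (\<Sum>j=1..m. time_step t j * g j)"
          using tau_nonneg g0 by (intro sum_nonneg mult_nonneg_nonneg) auto
        then show "x \<le> E * ((k0 + k1) * (U + S))" using bound[of m] m by simp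
      qed
    qed (use M1 in auto)
    moreover have "(\<Sum>m=1..M. time_step t m * g m) \<le> E * ((k0 + k1) * (U + S))"
      using bound[of M] a0[of M] by simp
    ultimately have "Max (a ` {1..M}) + (\<Sum>m=1..M. time_step t m * g m) \<le> C' * (U + S)"
      by (simp add: C'_def)
    then show ?thesis unfolding diffuse_integral_eq U_def S_def F_def g_def a_def[abs_def] mass_def dissipation_def .
  qed
  show ?thesis
    by (rule exI[of _ \<gamma>1], rule conjI, rule \<gamma>1(1), rule exI[of _ \<tau>1], rule conjI, rule \<tau>1(1),
      rule conjI, rule \<tau>1(2), intro allI impI, rule exI[of _ C'], intro allI impI, elim conjE, rule main)
qed

end
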